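(* Let $0\le\nu\le1$, $0<\mu\le1$ with $(1-\nu)(1-\mu)\ne0$, let $T>0$, and let $\omega\subset\Omega$ be a non-empty open set. Then the system $$\begin{cases}\mathbb D_t^{\mu,\nu}u+A_Bu=f|_\omega & \text{in }\Omega\times(0,T),\\ (\mathbb I_t^{(1-\nu)(1-\mu)}u)(\cdot,0)=u_0 & \text{in }\Omega\end{cases}$$ is mean approximately controllable in time $T$ if and only if the following unique continuation principle holds for the adjoint system $$\begin{cases}\mathbb D_{t,T}^{\mu,1-\nu}v+A_Bv=0 & \text{in }\Omega\times(0,T),\\ \mathbb I_{t,T}^{\nu(1-\mu)}v(\cdot,T)=v_0 & \text{in }\Omega:\end{cases}$$ for every $v_0\in L^2(\Omega)$, if the weak solution $v$ of the adjoint system satisfies $v=0$ in $\omega\times(0,T)$, then $v_0=0$ in $\Omega$.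
   Context: Setting. $\Omega\subset\mathbb R^N$ ($N\ge1$) is a bounded open set. $A_B$ is a non-negative selfadjoint operator on $L^2(\Omega)$ with domain $D(A_B)$ (graph norm) compactly embedded in $L^2(\Omega)$. It is associated with a symmetric, closed, non-negative bilinear form $\mathcal E_B$ with domain $V_{1/2}:=D(\mathcal E_B)$. Its eigenvalues $(\lambda_n)_{n\in\mathbb N}$ form a non-decreasing sequence tending to $\infty$, and it is assumed that the first eigenvalue satisfies $\lambda_1>0$. $V_{-1/2}$ is the dual of $V_{1/2}$ with respect to the pivot space $L^2(\Omega)$, and $\langle\cdot,\cdot\rangle_{V_{-1/2},V_{1/2}}$ is the duality pairing. Fractional calculus. For $\alpha>0$, $\mathbb I_t^\alpha g(t):=\frac1{\Gamma(\alpha)}\int_0^t(t-\tau)^{\alpha-1}g(\tau)\,d\tau$ and $\mathbb I_{t,T}^\alpha g(t):=\frac1{\Gamma(\alpha)}\int_t^T(\tau-t)^{\alpha-1}g(\tau)\,d\tau$; $\mathbb I_t^0$ and $\mathbb I_{t,T}^0$ are the identity. For $0\le\nu\le1$, $0<\mu\le1$, the left and right Hilfer derivatives are $\mathbb D_t^{\mu,\nu}u(t):=\mathbb I_t^{\nu(1-\mu)}\frac{d}{dt}\big(\mathbb I_t^{(1-\nu)(1-\mu)}u\big)(t)$ and $\mathbb D_{t,T}^{\mu,\nu}u(t):=-\mathbb I_{t,T}^{\nu(1-\mu)}\frac{d}{dt}\big(\mathbb I_{t,T}^{(1-\nu)(1-\mu)}u\big)(t)$. Weak solution of the controlled system. The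 control $f$ is localized in $\omega$, so that $f|_\omega$ is $f$ on $\omega\times(0,T)$ and $0$ on $(\Omega\setminus\omega)\times(0,T)$. A function $u$ is a weak solution of the first system if $u\in C((0,T];V_{1/2})$, $\mathbb I_t^{(1-\nu)(1-\mu)}u\in C([0,T];L^2(\Omega))$, $\mathbb D_t^{\mu,\nu}u\in C((0,T];V_{-1/2})$, $\mathbb I_t^{(1-\nu)(1-\mu)}u(\cdot,0)=u_0$, and for every $\varphi\in V_{1/2}$ and a.e. $t\in(0,T)$, $\langle\mathbb D_t^{\mu,\nu}u(\cdot,t),\varphi\rangle_{V_{-1/2},V_{1/2}}+\mathcal E_B(u(\cdot,t),\varphi)-(f(\cdot,t),\varphi)_{L^2(\Omega)}=0$. Mean approximate controllability in time $T$: for any $u_0,u_1\in L^2(\Omega)$ and $\varepsilon>0$ there exists $f\in L^2(\omega\times(0,T))$ such that the weak solution $u$ satisfies $\|\mathbb I_t^{(1-\nu)(1-\mu)}u(\cdot,T)-u_1\|_{L^2(\Omega)}\le\varepsilon$. Weak solution of the adjoint system: a function $v$ with $v\in C([0,T);V_{1/2})$, $\mathbb I_{t,T}^{\nu(1-\mu)}v\in C([0,T];L^2(\Omega))$, $\mathbb D_{t,T}^{\mu,1-\nu}v\in C([0,T);V_{-1/2})$, $\mathbb I_{t,T}^{\nu(1-\mu)}v(\cdot,T)=v_0$, and, for every $\varphi\in V_{1/2}$ and a.e. $t\in(0,T)$, $\langle\mathbb D_{t,T}^{\mu,1-\nu}v(\cdot,t),\varphi\rangle_{V_{-1/2},V_{1/2}}+\mathcal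 E_B(v(\cdot,t),\varphi)=0$. *)

theory Defs
  imports "HOL-Analysis.Analysis"
begin

section \<open>The Hilbert space of square-integrable functions\<close>

text \<open>
  Every class of Lebesgue-measurable functions modulo null sets has a Borel-measurable
  representative, so Borel functions modulo equality almost everywhere suffice. The space over a
  set \<open>S\<close> is identified, through extension by zero, with the subspace \<open>L2_on S\<close> below. In
  particular restricting a control to a subdomain and extending it by zero needs no separate notation.
\<close>

definition square_integrable :: "('a::euclidean_space \<Rightarrow> real) \<Rightarrow> bool" where
  "square_integrable f \<longleftrightarrow> f \<in> borel_measurable lborel \<and> integrable lborel (\<lambda>x. (f x)\<^sup>2)"

lemma square_integrable_mult:
  assumes "square_integrable f" "square_integrable g"
  shows "integrable lborel (\<lambda>x. f x * g x)"
proof (rule Bochner_Integration.integrable_bound)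
  show "integrable lborel (\<lambda>x. (f x)\<^sup>2 + (g x)\<^sup>2)"
    using assms by (auto simp: square_integrable_def)
  show "(\<lambda>x. f x * g x) \<in> borel_measurable lborel"
    using assms by (auto simp: square_integrable_def)
  have "\<bar>a * b\<bar> \<le> a\<^sup>2 + b\<^sup>2" for a b :: real
  proof -
    have "2 * (\<bar>a\<bar> * \<bar>b\<bar>) \<le> a\<^sup>2 + b\<^sup>2"
      using sum_squares_bound[of "\<bar>a\<bar>" "\<bar>b\<bar>"] by simp
    moreover have "0 \<le> \<bar>a\<bar> * \<bar>b\<bar>" by simp
    ultimately show ?thesis unfolding abs_mult by linarith
  qed
  then show "AE x in lborel. norm (f x * g x) \<le> norm ((f x)\<^sup>2 + (g x)\<^sup>2)"
    by simp
qed

lemma square_integrable_add: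
  assumes "square_integrable f" "square_integrable g"
  shows "square_integrable (\<lambda>x. f x + g x)"
  using assms square_integrable_mult[OF assms]
  by (auto simp: square_integrable_def power2_sum mult.assoc)

lemma square_integrable_cmult: "square_integrable f \<Longrightarrow> square_integrable (\<lambda>x. c * f x)"
  by (auto simp: square_integrable_def power_mult_distrib)

lemma square_integrable_zero: "square_integrable (\<lambda>x. 0)"
  by (simp add: square_integrable_def)

quotient_type (overloaded) 'a L2 = "'a::euclidean_space \<Rightarrow> real" / partial:
  "\<lambda>f g. square_integrable f \<and> square_integrable g \<and> (AE x in lborel. f x = g x)"
  morphisms rep_L2 abs_L2
proof (rule part_equivpI)
  show "\<exists>f::'a \<Rightarrow> real. square_integrable f \<and> square_integrable f \<and> (AE x in lborel. f x = f x)"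
    by (rule exI[of _ "\<lambda>x. 0"]) (simp add: square_integrable_zero)
  show "symp (\<lambda>f g. square_integrable f \<and> square_integrable g \<and> (AE x in lborel. f x = (g x :: real)))"
    by (rule sympI) auto
  show "transp (\<lambda>f g. square_integrable f \<and> square_integrable g \<and> (AE x in lborel. f x = (g x :: real)))"
    by (rule transpI) (auto elim: eventually_elim2)
qed

instantiation L2 :: (euclidean_space) real_vector
begin

lift_definition zero_L2 :: "'a L2" is "\<lambda>x. 0"
  by (simp add: square_integrable_zero)

lift_definition plus_L2 :: "'a L2 \<Rightarrow> 'a L2 \<Rightarrow> 'a L2" is "\<lambda>f g x. f x + g x"
  by (auto simp: square_integrable_add)

lift_definition scaleR_L2 :: "real \<Rightarrow> 'a L2 \<Rightarrow> 'a L2" is "\<lambda>c f x. c * f x"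
  by (auto simp: square_integrable_cmult)

definition uminus_L2 :: "'a L2 \<Rightarrow> 'a L2" where "uminus (f::'a L2) = (- 1) *\<^sub>R f"

definition minus_L2 :: "'a L2 \<Rightarrow> 'a L2 \<Rightarrow> 'a L2" where "(f::'a L2) - g = f + (- g :: 'a L2)"

instance
proof
  fix f g h :: "'a L2" and a b :: real
  show "f + g + h = f + (g + h)" by transfer (auto simp: add.assoc square_integrable_add)
  show "f + g = g + f" by transfer (auto simp: add.commute square_integrable_add)
  show zero: "0 + f = f" by transfer (auto simp: square_integrable_add)
  show "- f + f = 0" unfolding uminus_L2_def
    by transfer (auto simp: square_integrable_zero square_integrable_cmult square_integrable_add)
  show "f - g = f + - g" by (rule minus_L2_def)
  show "a *\<^sub>R (f + g) = a *\<^sub>R f + a *\<^sub>R g"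
    by transfer (auto simp: algebra_simps square_integrable_cmult square_integrable_add)
  show "(a + b) *\<^sub>R f = a *\<^sub>R f + b *\<^sub>R f"
    by transfer (auto simp: algebra_simps square_integrable_cmult square_integrable_add)
  show "a *\<^sub>R b *\<^sub>R f = (a * b) *\<^sub>R f"
    by transfer (auto simp: mult.assoc square_integrable_cmult)
  show "1 *\<^sub>R f = f" by transfer auto
qed

end

instantiation L2 :: (euclidean_space) real_inner
begin

lift_definition inner_L2 :: "'a L2 \<Rightarrow> 'a L2 \<Rightarrow> real" is "\<lambda>f g. LINT x|lborel. f x * g x"
  by (rule integral_cong_AE) (auto simp: square_integrable_def)

definition norm_L2 :: "'a L2 \<Rightarrow> real" where "norm (f::'a L2) = sqrt (f \<bullet> f)"

definition dist_L2 :: "'a L2 \<Rightarrow> 'a L2 \<Rightarrow> real" where "dist (f::'a L2) g = norm (f - g)"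

definition sgn_L2 :: "'a L2 \<Rightarrow> 'a L2" where "sgn (f::'a L2) = f /\<^sub>R norm f"

definition uniformity_L2 :: "('a L2 \<times> 'a L2) filter" where
  "(uniformity :: ('a L2 \<times> 'a L2) filter) = (INF e\<in>{0<..}. principal {(f, g). dist f g < e})"

definition open_L2 :: "'a L2 set \<Rightarrow> bool" where
  "open (U :: 'a L2 set) = (\<forall>f\<in>U. eventually (\<lambda>(f', g). f' = f \<longrightarrow> g \<in> U) uniformity)"

instance
proof
  fix f g h :: "'a L2" and a :: real
  show "dist f g = norm (f - g)" by (rule dist_L2_def)
  show "sgn f = f /\<^sub>R norm f" by (rule sgn_L2_def)
  show "uniformity = (INF e\<in>{0<..}. principal {(x::'a L2, y). dist x y < e})"
    by (rule uniformity_L2_def)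
  show "open U = (\<forall>x\<in>U. \<forall>\<^sub>F (x', y) in uniformity. x' = x \<longrightarrow> y \<in> U)" for U :: "'a L2 set"
    by (rule open_L2_def)
  show "f \<bullet> g = g \<bullet> f" by transfer (simp add: mult.commute)
  show "(f + g) \<bullet> h = f \<bullet> h + g \<bullet> h"
    by transfer (simp add: distrib_right square_integrable_mult)
  show "(a *\<^sub>R f) \<bullet> g = a * (f \<bullet> g)" by transfer (simp add: mult.assoc)
  show "0 \<le> f \<bullet> f" by transfer simp
  have "(LINT x|lborel. u x * u x) = 0 \<longleftrightarrow> (AE x in lborel. u x = 0)"
    if "square_integrable u" for u :: "'a \<Rightarrow> real"
  proof -
    have "(LINT x|lborel. u x * u x) = 0 \<longleftrightarrow> (AE x in lborel. u x * u x = 0)"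
      using square_integrable_mult[OF that that]
      by (intro integral_nonneg_eq_0_iff_AE) auto
    then show ?thesis by simp
  qed
  then show "f \<bullet> f = 0 \<longleftrightarrow> f = 0"
    by transfer (auto simp: square_integrable_zero)
  show "norm f = sqrt (f \<bullet> f)" by (rule norm_L2_def)
qed

end


lemma square_integrable_rep [simp]: "square_integrable (rep_L2 f)"
  using Quotient_rep_reflp[OF Quotient_L2, of f] by simp

lemma abs_rep_L2 [simp]: "abs_L2 (rep_L2 f) = f"
  by (rule Quotient_abs_rep[OF Quotient_L2])

lemma rep_abs_L2: "square_integrable f \<Longrightarrow> AE x in lborel. rep_L2 (abs_L2 f) x = f x"
  using Quotient_rep_abs[OF Quotient_L2, of f] by simp

lemma abs_L2_diff:
  assumes "square_integrable f" "square_integrable g"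
  shows "abs_L2 f - abs_L2 g = abs_L2 (\<lambda>x. f x - g x)"
proof -
  note g = square_integrable_cmult[OF assms(2), of "-1"]
  have "abs_L2 f - abs_L2 g = abs_L2 f + abs_L2 (\<lambda>x. -1 * g x)"
    unfolding minus_L2_def uminus_L2_def by (subst scaleR_L2.abs_eq) (simp_all add: assms)
  also have "\<dots> = abs_L2 (\<lambda>x. f x + -1 * g x)"
    by (rule plus_L2.abs_eq) (use assms(1) g in auto)
  finally show ?thesis by simp
qed

lemma norm_abs_L2:
  assumes "square_integrable f"
  shows "norm (abs_L2 f) = sqrt (LINT x|lborel. (f x)\<^sup>2)"
  unfolding norm_L2_def by (subst inner_L2.abs_eq) (simp_all add: assms power2_eq_square)

lemma square_integrable_diff:
  "square_integrable f \<Longrightarrow> square_integrable g \<Longrightarrow> square_integrable (\<lambda>x. f x - g x)"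
  using square_integrable_add[of f "\<lambda>x. - 1 * g x"] square_integrable_cmult[of g "-1"] by simp

lemma square_integrable_measurable: "square_integrable f \<Longrightarrow> f \<in> borel_measurable lborel"
  by (simp add: square_integrable_def)

lemma rep_measurable [measurable]: "rep_L2 f \<in> borel_measurable borel"
  using square_integrable_measurable[OF square_integrable_rep[of f]] by simp

lemma norm_diff_rep_L2:
  "(\<integral>\<^sup>+x. ennreal ((rep_L2 f x - rep_L2 g x)\<^sup>2) \<partial>lborel) = ennreal ((norm (f - g))\<^sup>2)"
proof -
  note s = square_integrable_diff[OF square_integrable_rep[of f] square_integrable_rep[of g]]
  have "(norm (f - g))\<^sup>2 = (LINT x|lborel. (rep_L2 f x - rep_L2 g x)\<^sup>2)"
    using abs_L2_diff[OF square_integrable_rep[of f] square_integrable_rep[of g]] norm_abs_L2[OF s]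
    by simp
  then show ?thesis
    using s by (subst nn_integral_eq_integral) (auto simp: square_integrable_def)
qed

lemma norm_diff_abs_L2_le:
  assumes "f \<in> borel_measurable borel" "0 \<le> e"
    and le: "(\<integral>\<^sup>+x. ennreal ((rep_L2 F x - f x)\<^sup>2) \<partial>lborel) \<le> ennreal (e\<^sup>2)"
  shows "square_integrable f" "norm (F - abs_L2 f) \<le> e"
proof -
  have d: "square_integrable (\<lambda>x. rep_L2 F x - f x)"
    unfolding square_integrable_def
  proof (intro conjI integrableI_bounded)
    have "(\<integral>\<^sup>+x. ennreal (norm ((rep_L2 F x - f x)\<^sup>2)) \<partial>lborel) \<le> ennreal (e\<^sup>2)"
      using le by simp
    also have "\<dots> < \<infinity>" by simp
    finally show "(\<integral>\<^sup>+x. ennreal (norm ((rep_L2 F x - f x)\<^sup>2)) \<partial>lborel) < \<infinity>" .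
  qed (use assms(1) in measurable)
  show f: "square_integrable f"
    using square_integrable_diff[OF square_integrable_rep[of F] d] by simp
  have "ennreal (LINT x|lborel. (rep_L2 F x - f x)\<^sup>2) \<le> ennreal (e\<^sup>2)"
    using le d by (subst (asm) nn_integral_eq_integral) (auto simp: square_integrable_def)
  then have "(LINT x|lborel. (rep_L2 F x - f x)\<^sup>2) \<le> e\<^sup>2"
    by (simp add: ennreal_le_iff)
  moreover have "norm (F - abs_L2 f) = sqrt (LINT x|lborel. (rep_L2 F x - f x)\<^sup>2)"
    using abs_L2_diff[OF square_integrable_rep[of F] f] norm_abs_L2[OF d] by simp
  ultimately show "norm (F - abs_L2 f) \<le> e"
    using assms(2) by (simp add: real_le_lsqrt real_sqrt_le_iff[of _ "e\<^sup>2", symmetric])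
qed

lemma ennreal_finite_obtain:
  assumes "(a :: ennreal) \<noteq> \<infinity>"
  obtains C where "0 \<le> C" "a = ennreal C"
  using assms by (cases a) auto

instance L2 :: (euclidean_space) complete_space
proof
  fix X :: "nat \<Rightarrow> 'a L2"
  assume X: "Cauchy X"
  have "\<exists>M. \<forall>m\<ge>M. \<forall>n\<ge>M. dist (X m) (X n) < (1/4)^k" for k
    using X unfolding Cauchy_def by (rule allE[of _ "(1/4)^k"]) auto
  then obtain M where M: "\<And>k m n. m \<ge> M k \<Longrightarrow> n \<ge> M k \<Longrightarrow> dist (X m) (X n) < (1/4)^k"
    by metis
  define r where "r k = (\<Sum>i\<le>k. M i) + k" for k
  have r: "strict_mono r"
    by (rule strict_monoI_Suc) (simp add: r_def)
  have rM: "M k \<le> r k" for k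
    unfolding r_def by (rule trans_le_add1) (rule member_le_sum, auto)
  have MS: "M k \<le> r (Suc k)" for k
    using rM[of k] strict_monoD[OF r, of k "Suc k"] by simp
  define F where "F k = rep_L2 (X (r k))" for k
  have F [measurable]: "F k \<in> borel_measurable borel" for k
    unfolding F_def by measurable
  have small: "(\<integral>\<^sup>+x. ennreal (4^k * (F (Suc k) x - F k x)\<^sup>2) \<partial>lborel) \<le> ennreal ((1/4)^k)" for k
  proof -
    have "(\<integral>\<^sup>+x. ennreal (4^k * (F (Suc k) x - F k x)\<^sup>2) \<partial>lborel)
        = ennreal (4^k) * ennreal ((norm (X (r (Suc k)) - X (r k)))\<^sup>2)"
      unfolding norm_diff_rep_L2[symmetric] F_def
      by (subst nn_integral_cmult[symmetric]) (auto simp: ennreal_mult' intro!: nn_integral_cong)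
    also have "\<dots> = ennreal (4^k * (norm (X (r (Suc k)) - X (r k)))\<^sup>2)"
      by (simp add: ennreal_mult')
    also have "\<dots> \<le> ennreal (4^k * ((1/4)^k)\<^sup>2)"
      using M[OF MS[of k] rM[of k]]
      by (intro ennreal_leI mult_left_mono power_mono) (auto simp: dist_norm)
    also have "4^k * ((1/4)^k)\<^sup>2 = ((1/4)^k :: real)"
      by (simp add: power2_eq_square power_divide)
    finally show ?thesis .
  qed
  have "(\<integral>\<^sup>+x. (\<Sum>k. ennreal (4^k * (F (Suc k) x - F k x)\<^sup>2)) \<partial>lborel)
      = (\<Sum>k. \<integral>\<^sup>+x. ennreal (4^k * (F (Suc k) x - F k x)\<^sup>2) \<partial>lborel)"
    by (rule nn_integral_suminf) measurable
  also have "\<dots> \<le> (\<Sum>k. ennreal ((1/4)^k))"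
    by (intro suminf_le small) auto
  also have "\<dots> < \<infinity>"
  proof -
    have "summable (\<lambda>k. (1/4 :: real)^k)"
      by (rule summable_geometric) simp
    then have "(\<Sum>k. ennreal ((1/4)^k)) = ennreal (\<Sum>k. (1/4)^k)"
      by (intro suminf_ennreal2) simp_all
    then show ?thesis by simp
  qed
  finally have fin: "(\<integral>\<^sup>+x. (\<Sum>k. ennreal (4^k * (F (Suc k) x - F k x)\<^sup>2)) \<partial>lborel) \<noteq> \<infinity>"
    by simp
  have "AE x in lborel. (\<Sum>k. ennreal (4^k * (F (Suc k) x - F k x)\<^sup>2)) \<noteq> \<infinity>"
    by (rule nn_integral_noteq_infinite[OF _ fin]) measurable
  then have conv: "AE x in lborel. (\<lambda>k. F k x) \<longlonglongrightarrow> lim (\<lambda>k. F k x)"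
  proof eventually_elim
    fix x
    assume "(\<Sum>k. ennreal (4^k * (F (Suc k) x - F k x)\<^sup>2)) \<noteq> \<infinity>"
    then obtain C where C: "0 \<le> C" "(\<Sum>k. ennreal (4^k * (F (Suc k) x - F k x)\<^sup>2)) = ennreal C"
      by (rule ennreal_finite_obtain)
    have "norm (F (Suc k) x - F k x) \<le> sqrt C * (1/2)^k" for k
    proof -
      have "(\<Sum>i\<in>{k}. ennreal (4^i * (F (Suc i) x - F i x)\<^sup>2)) \<le> ennreal C"
        unfolding C(2)[symmetric] by (intro sum_le_suminf) auto
      then have "4^k * (F (Suc k) x - F k x)\<^sup>2 \<le> C"
        using C(1) by (simp add: ennreal_le_iff)
      then have "sqrt (4^k * (F (Suc k) x - F k x)\<^sup>2) \<le> sqrt C"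
        by (rule real_sqrt_le_mono)
      moreover have "sqrt (4^k) = (2::real)^k"
        by (rule real_sqrt_unique) (simp_all add: power2_eq_square flip: power_mult_distrib)
      ultimately have "2^k * \<bar>F (Suc k) x - F k x\<bar> \<le> sqrt C"
        by (simp add: real_sqrt_mult)
      then show ?thesis
        by (simp add: field_simps power_divide)
    qed
    then have "summable (\<lambda>k. F (Suc k) x - F k x)"
      by (intro summable_comparison_test'[OF summable_mult[OF summable_geometric], of "1/2" 0 _ "sqrt C"])
        simp_all
    then have "convergent (\<lambda>n. \<Sum>k<n. F (Suc k) x - F k x)"
      by (simp add: summable_iff_convergent)
    then have "convergent (\<lambda>n. F n x - F 0 x)"
      using sum_lessThan_telescope[of "\<lambda>k. F k x"] by simp
    then have "convergent (\<lambda>n. F n x)"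
      using convergent_add[OF _ convergent_const, of "\<lambda>n. F n x - F 0 x" "F 0 x"] by simp
    then show "(\<lambda>k. F k x) \<longlonglongrightarrow> lim (\<lambda>k. F k x)"
      by (simp add: convergent_LIMSEQ_iff)
  qed
  define f where "f x = lim (\<lambda>k. F k x)" for x
  have f [measurable]: "f \<in> borel_measurable borel"
    unfolding f_def by measurable
  have le: "square_integrable f" "norm (X (r m) - abs_L2 f) \<le> (1/4)^m" for m
  proof -
    have "(\<integral>\<^sup>+x. ennreal ((F m x - f x)\<^sup>2) \<partial>lborel)
        = (\<integral>\<^sup>+x. liminf (\<lambda>n. ennreal ((F m x - F n x)\<^sup>2)) \<partial>lborel)"
      using conv
    proof (intro nn_integral_cong_AE, eventually_elim)
      fix x assume "(\<lambda>k. F k x) \<longlonglongrightarrow> lim (\<lambda>k. F k x)"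
      then have "(\<lambda>n. ennreal ((F m x - F n x)\<^sup>2)) \<longlonglongrightarrow> ennreal ((F m x - f x)\<^sup>2)"
        unfolding f_def by (intro tendsto_ennrealI tendsto_intros)
      then show "ennreal ((F m x - f x)\<^sup>2) = liminf (\<lambda>n. ennreal ((F m x - F n x)\<^sup>2))"
        by (intro lim_imp_Liminf[symmetric]) auto
    qed
    also have "\<dots> \<le> liminf (\<lambda>n. \<integral>\<^sup>+x. ennreal ((F m x - F n x)\<^sup>2) \<partial>lborel)"
      by (rule nn_integral_liminf) measurable
    also have "\<dots> \<le> ennreal (((1/4)^m)\<^sup>2)"
    proof (rule Liminf_le)
      show "eventually (\<lambda>n. (\<integral>\<^sup>+x. ennreal ((F m x - F n x)\<^sup>2) \<partial>lborel) \<le> ennreal (((1/4)^m)\<^sup>2)) sequentially"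
      proof (rule eventually_sequentiallyI[of m])
        fix n assume "m \<le> n"
        then have "M m \<le> r n"
          using rM[of m] strict_mono_leD[OF r, of m n] by linarith
        then show "(\<integral>\<^sup>+x. ennreal ((F m x - F n x)\<^sup>2) \<partial>lborel) \<le> ennreal (((1/4)^m)\<^sup>2)"
          unfolding F_def norm_diff_rep_L2 using M[OF rM[of m], of "r n"]
          by (intro ennreal_leI power_mono) (auto simp: dist_norm)
      qed
    qed simp
    finally have *: "(\<integral>\<^sup>+x. ennreal ((rep_L2 (X (r m)) x - f x)\<^sup>2) \<partial>lborel) \<le> ennreal (((1/4)^m)\<^sup>2)"
      by (simp add: F_def)
    show "square_integrable f" "norm (X (r m) - abs_L2 f) \<le> (1/4)^m"
      by (rule norm_diff_abs_L2_le[OF f _ *]; simp)+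
  qed
  have "(\<lambda>m. X (r m)) \<longlonglongrightarrow> abs_L2 f"
  proof (rule LIM_zero_cancel, rule Lim_null_comparison)
    show "\<forall>\<^sub>F m in sequentially. norm (X (r m) - abs_L2 f) \<le> (1/4)^m"
      using le(2) by simp
    show "(\<lambda>m. (1/4)^m :: real) \<longlonglongrightarrow> 0"
      by (rule LIMSEQ_power_zero) simp
  qed
  then have "X \<longlonglongrightarrow> abs_L2 f"
    using Cauchy_converges_subseq[OF X r] by (simp add: o_def)
  then show "convergent X"
    by (rule convergentI)
qed

lemma second_countable_if_countable_dense:
  fixes D :: "'a::metric_space set"
  assumes D: "countable D" "closure D = UNIV"
  shows "\<exists>B::'a set set. countable B \<and> open = generate_topology B"
proof (intro exI conjI)
  let ?B = "(\<lambda>(d, n). ball d (1 / real (Suc n))) ` (D \<times> (UNIV :: nat set))"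
  show "countable ?B"
    using D(1) by (intro countable_image countable_SIGMA) auto
  show "open = generate_topology ?B"
  proof (intro topological_basis_imp_subbasis topological_basisI)
    show "open b" if "b \<in> ?B" for b using that by auto
    fix U and x :: 'a
    assume "open U" "x \<in> U"
    then obtain e where e: "0 < e" "ball x e \<subseteq> U"
      by (auto simp: open_contains_ball)
    obtain n where n: "1 / real (Suc n) < e / 2"
      using nat_approx_posE[of "e/2"] e(1) by auto
    have "x \<in> closure D" using D(2) by simp
    then obtain d where d: "d \<in> D" "dist d x < 1 / real (Suc n)"
      unfolding closure_approachable by (meson of_nat_0_less_iff zero_less_Suc zero_less_divide_1_iff)
    have "ball d (1 / real (Suc n)) \<subseteq> ball x e"
    proof
      fix y assume "y \<in> ball d (1 / real (Suc n))"
      then have "dist d y < 1 / real (Suc n)" by simp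
      then show "y \<in> ball x e"
        using dist_triangle[of x y d] d(2) n by (simp add: dist_commute)
    qed
    moreover have "x \<in> ball d (1 / real (Suc n))" using d(2) by simp
    ultimately show "\<exists>b\<in>?B. x \<in> b \<and> b \<subseteq> U"
      using d(1) e(2) by (intro bexI[of _ "ball d (1 / real (Suc n))"]) auto
  qed
qed

lemma countable_dense_in_span:
  fixes X :: "'a::real_normed_vector set"
  assumes "countable X"
  obtains D where "countable D" "span X \<subseteq> closure D"
proof -
  let ?s = "\<lambda>xs :: (real \<times> 'a) list. sum_list (map (\<lambda>(q, x). q *\<^sub>R x) xs)"
  let ?D = "?s ` lists (\<rat> \<times> X)"
  have "countable (\<rat> \<times> X)"
    by (rule countable_SIGMA[OF countable_rat assms])
  then have "countable ?D"
    by (rule countable_image[OF countable_lists])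
  moreover have "span X \<subseteq> closure ?D"
  proof
    fix x assume "x \<in> span X"
    then show "x \<in> closure ?D"
    proof (induction rule: span_induct_alt)
      case base
      have "?s [] \<in> ?D" by (rule imageI) simp
      then show ?case using closure_subset[of ?D] by auto
    next
      case (step c x y)
      show ?case unfolding closure_approachable
      proof (intro allI impI)
        fix e :: real assume e: "0 < e"
        have "\<exists>z\<in>?D. dist z y < e / 2"
          using step(2) half_gt_zero[OF e] unfolding closure_approachable by blast
        then obtain xs where xs: "xs \<in> lists (\<rat> \<times> X)" "dist (?s xs) y < e / 2"
          by (elim bexE imageE) simp
        have "0 < e / (2 * (norm x + 1))"
          using e by (simp add: add_nonneg_pos)
        then obtain q where q: "q \<in> \<rat>" "c < q" "q < c + e / (2 * (norm x + 1))"
          using Rats_dense_in_real[of c "c + e / (2 * (norm x + 1))"] by auto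
        have "norm (q *\<^sub>R x - c *\<^sub>R x) = (q - c) * norm x"
          using q(2) by (simp flip: scaleR_left_diff_distrib)
        also have "\<dots> \<le> (q - c) * (norm x + 1)"
          using q(2) by (intro mult_left_mono) auto
        also have "\<dots> < e / (2 * (norm x + 1)) * (norm x + 1)"
          using q(3) by (intro mult_strict_right_mono) (auto simp: add_nonneg_pos)
        also have "\<dots> = e / 2"
        proof -
          have "norm x + 1 \<noteq> 0" using norm_ge_zero[of x] by linarith
          moreover have "e / (2 * a) * a = e / 2" if "a \<noteq> 0" for a :: real using that by simp
          ultimately show ?thesis by blast
        qed
        finally have "norm (q *\<^sub>R x - c *\<^sub>R x) < e / 2" .
        then have "dist (?s ((q, x) # xs)) (c *\<^sub>R x + y) < e"
          using xs(2) norm_triangle_ineq[of "q *\<^sub>R x - c *\<^sub>R x" "?s xs - y"]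
          by (simp add: dist_norm algebra_simps)
        moreover have "?s ((q, x) # xs) \<in> ?D"
          using q(1) step(1) xs(1) by (intro imageI) auto
        ultimately show "\<exists>z\<in>?D. dist z (c *\<^sub>R x + y) < e" by blast
      qed
    qed
  qed
  ultimately show thesis by (rule that)
qed

lemma tendsto_abs_L2_dominated:
  assumes g: "square_integrable g" and m: "\<And>k. u k \<in> borel_measurable borel"
    and m': "v \<in> borel_measurable borel"
    and le: "\<And>k x. \<bar>u k x\<bar> \<le> g x" and lim: "\<And>x. (\<lambda>k. u k x) \<longlonglongrightarrow> v x"
  shows "\<And>k. square_integrable (u k)" "square_integrable v"
    "(\<lambda>k. abs_L2 (u k)) \<longlonglongrightarrow> abs_L2 v"
proof -
  have dom: "square_integrable w" if "w \<in> borel_measurable borel" "\<And>x. \<bar>w x\<bar> \<le> g x" for w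
  proof -
    have "integrable lborel (\<lambda>x. (w x)\<^sup>2)"
    proof (rule Bochner_Integration.integrable_bound)
      show "integrable lborel (\<lambda>x. (g x)\<^sup>2)" using g by (simp add: square_integrable_def)
      show "(\<lambda>x. (w x)\<^sup>2) \<in> borel_measurable lborel" using that(1) by simp
      have "(w x)\<^sup>2 \<le> (g x)\<^sup>2" for x
        using power_mono[OF that(2)[of x] abs_ge_zero, of 2] by simp
      then show "AE x in lborel. norm ((w x)\<^sup>2) \<le> norm ((g x)\<^sup>2)" by simp
    qed
    then show ?thesis using that(1) by (simp add: square_integrable_def)
  qed
  show u: "square_integrable (u k)" for k by (rule dom[OF m le])
  have v_le: "\<bar>v x\<bar> \<le> g x" for x
    by (rule LIMSEQ_le_const2[OF tendsto_rabs[OF lim]]) (use le in auto)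
  show v: "square_integrable v" by (rule dom[OF m' v_le])
  have "(\<lambda>k. LINT x|lborel. (u k x - v x)\<^sup>2) \<longlonglongrightarrow> (LINT x|(lborel :: 'a measure). 0)"
  proof (rule integral_dominated_convergence[where w = "\<lambda>x. 4 * (g x)\<^sup>2"])
    show "integrable lborel (\<lambda>x. 4 * (g x)\<^sup>2)" using g by (simp add: square_integrable_def)
    have "(\<lambda>k. (u k x - v x)\<^sup>2) \<longlonglongrightarrow> (v x - v x)\<^sup>2" for x
      by (intro tendsto_intros lim)
    then show "AE x in lborel. (\<lambda>k. (u k x - v x)\<^sup>2) \<longlonglongrightarrow> 0" by simp
    fix k
    have "(u k x - v x)\<^sup>2 \<le> 4 * (g x)\<^sup>2" for x
    proof -
      have "\<bar>u k x - v x\<bar> \<le> 2 * g x" using le[of k x] v_le[of x] by linarith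
      then have "\<bar>u k x - v x\<bar>\<^sup>2 \<le> (2 * g x)\<^sup>2" by (rule power_mono) simp
      then show ?thesis by simp
    qed
    then show "AE x in lborel. norm ((u k x - v x)\<^sup>2) \<le> 4 * (g x)\<^sup>2" by simp
  qed (use m m' in \<open>measurable\<close>)
  then have "(\<lambda>k. sqrt (LINT x|lborel. (u k x - v x)\<^sup>2)) \<longlonglongrightarrow> sqrt 0"
    by (intro tendsto_real_sqrt) simp
  then have "(\<lambda>k. norm (abs_L2 (u k) - abs_L2 v)) \<longlonglongrightarrow> 0"
    using u v by (simp add: abs_L2_diff norm_abs_L2 square_integrable_diff)
  then show "(\<lambda>k. abs_L2 (u k)) \<longlonglongrightarrow> abs_L2 v"
    by (rule LIM_zero_cancel[OF tendsto_norm_zero_cancel])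
qed

lemma abs_L2_add:
  "square_integrable f \<Longrightarrow> square_integrable g \<Longrightarrow> abs_L2 f + abs_L2 g = abs_L2 (\<lambda>x. f x + g x)"
  by (rule plus_L2.abs_eq) auto

lemma abs_L2_scaleR: "square_integrable f \<Longrightarrow> c *\<^sub>R abs_L2 f = abs_L2 (\<lambda>x. c * f x)"
  by (rule scaleR_L2.abs_eq) auto

lemma square_integrable_indicator:
  assumes "A \<in> sets borel" "emeasure lborel A < \<infinity>"
  shows "square_integrable (indicat_real A)"
proof -
  have "(\<lambda>x. (indicat_real A x)\<^sup>2) = indicat_real A"
    by (auto simp: indicator_def)
  then show ?thesis
    using assms by (simp add: square_integrable_def)
qed


lemma closure_span_closed:
  fixes X :: "'a::real_normed_vector set"
  shows "0 \<in> closure (span X)"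
    and "x \<in> closure (span X) \<Longrightarrow> c *\<^sub>R x \<in> closure (span X)"
    and "x \<in> closure (span X) \<Longrightarrow> y \<in> closure (span X) \<Longrightarrow> x + y \<in> closure (span X)"
proof -
  show "0 \<in> closure (span X)"
    using closure_subset span_zero by blast
  show "c *\<^sub>R x \<in> closure (span X)" if x: "x \<in> closure (span X)"
  proof -
    obtain u where u: "\<And>n. u n \<in> span X" "u \<longlonglongrightarrow> x"
      using x unfolding closure_sequential by blast
    have "(\<lambda>n. c *\<^sub>R u n) \<longlonglongrightarrow> c *\<^sub>R x" by (intro tendsto_intros u)
    moreover have "c *\<^sub>R u n \<in> span X" for n by (rule span_scale[OF u(1)])
    ultimately show ?thesis
      unfolding closure_sequential by (intro exI[of _ "\<lambda>n. c *\<^sub>R u n"]) simp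
  qed
  show "x + y \<in> closure (span X)" if x: "x \<in> closure (span X)" and y: "y \<in> closure (span X)"
  proof -
    obtain u where u: "\<And>n. u n \<in> span X" "u \<longlonglongrightarrow> x"
      using x unfolding closure_sequential by blast
    obtain v where v: "\<And>n. v n \<in> span X" "v \<longlonglongrightarrow> y"
      using y unfolding closure_sequential by blast
    have "(\<lambda>n. u n + v n) \<longlonglongrightarrow> x + y" by (intro tendsto_intros u v)
    moreover have "u n + v n \<in> span X" for n by (rule span_add[OF u(1) v(1)])
    ultimately show ?thesis
      unfolding closure_sequential by (intro exI[of _ "\<lambda>n. u n + v n"]) simp
  qed
qed

lemma indicator_empty_eq: "indicator {} = (\<lambda>x. 0)"
  by (rule ext) simp

lemma L2_countable_total:
  obtains X :: "'a::euclidean_space L2 set" where "countable X" "closure (span X) = UNIV"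
proof -
  obtain B :: "'a set set" where B: "countable B" "topological_basis B"
    using ex_countable_basis by blast
  define S where "S = (\<lambda>(F, n). \<Union>F \<inter> ball 0 (real n)) ` ({F. finite F \<and> F \<subseteq> B} \<times> (UNIV :: nat set))"
  define X :: "'a L2 set" where "X = (\<lambda>A. abs_L2 (indicat_real A)) ` S"
  have "countable S"
    unfolding S_def using countable_Collect_finite_subset[OF B(1)]
    by (intro countable_image countable_SIGMA) auto
  then have X: "countable X" by (simp add: X_def)
  define M where "M = closure (span X)"
  note M0 = closure_span_closed(1)[of X, folded M_def]
    and Mc = closure_span_closed(2)[of _ X, folded M_def]
    and Ma = closure_span_closed(3)[of _ X, folded M_def]
  have Ml: "x \<in> M" if "\<And>k :: nat. u k \<in> M" "u \<longlonglongrightarrow> x" for u x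
    using closed_sequentially[of M u x] that by (simp add: M_def)
  have ball: "square_integrable (indicat_real (A \<inter> ball (0::'a) (real n)))" if "A \<in> sets borel" for A n
  proof (rule square_integrable_indicator)
    have "emeasure lborel (A \<inter> ball (0::'a) (real n)) \<le> emeasure lborel (ball (0::'a) (real n))"
      by (intro emeasure_mono) auto
    also have "\<dots> < \<infinity>" by (intro emeasure_bounded_finite) simp
    finally show "emeasure lborel (A \<inter> ball (0::'a) (real n)) < \<infinity>" .
  qed (use that in auto)
  have lim: "abs_L2 (indicat_real (\<Union>k. A k)) \<in> M"
    if "\<And>k. abs_L2 (indicat_real (A k)) \<in> M" "incseq A" "\<And>k. A k \<in> sets borel"
      "square_integrable (indicat_real (\<Union>k. A k))" for A :: "nat \<Rightarrow> 'a set"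
  proof (rule Ml)
    show "abs_L2 (indicat_real (A k)) \<in> M" for k by (rule that)
    show "(\<lambda>k. abs_L2 (indicat_real (A k))) \<longlonglongrightarrow> abs_L2 (indicat_real (\<Union>k. A k))"
    proof (rule tendsto_abs_L2_dominated(3)[OF that(4)])
      show "(\<lambda>k. indicat_real (A k) x) \<longlonglongrightarrow> indicat_real (\<Union>k. A k) x" for x
        by (rule LIMSEQ_indicator_incseq[OF that(2)])
    qed (use that(3) in \<open>auto simp: indicator_def\<close>)
  qed
  have open_ball: "abs_L2 (indicat_real (U \<inter> ball 0 (real n))) \<in> M" if "open U" for U :: "'a set" and n
  proof -
    obtain C where C: "C \<subseteq> B" "\<Union>C = U"
      using B(2) \<open>open U\<close> unfolding topological_basis_def by blast
    show ?thesis
    proof (cases "C = {}")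
      case True
      then have "U = {}" using C by simp
      then show ?thesis using M0 by (simp add: zero_L2_def indicator_empty_eq)
    next
      case False
      define c where "c = from_nat_into C"
      have c: "range c = C"
        unfolding c_def using False C(1) B(1) by (intro range_from_nat_into) (auto intro: countable_subset)
      define A where "A k = \<Union>(c ` {..<k}) \<inter> ball 0 (real n)" for k :: nat
      have UN: "(\<Union>k. A k) = U \<inter> ball 0 (real n)"
        unfolding C(2)[symmetric] c[symmetric] A_def by auto
      have "A k \<in> S" for k
        unfolding S_def A_def using c C(1) by (intro image_eqI[of _ _ "(c ` {..<k}, n)"]) auto
      then have "abs_L2 (indicat_real (A k)) \<in> M" for k
        unfolding M_def using closure_subset span_superset by (fastforce simp: X_def)
      moreover have "incseq A" unfolding A_def incseq_def by (blast intro: less_le_trans)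
      moreover have "A k \<in> sets borel" for k
      proof -
        have "open b" if "b \<in> C" for b
          using B(2) C(1) that by (auto intro: topological_basis_open)
        then have "open (A k)"
          unfolding A_def using c by (intro open_Int open_Union) auto
        then show ?thesis by simp
      qed
      moreover have "square_integrable (indicat_real (\<Union>k. A k))"
        unfolding UN using that by (intro ball) auto
      ultimately show ?thesis
        using lim[of A] unfolding UN by blast
    qed
  qed
  have borel_ball: "abs_L2 (indicat_real (A \<inter> ball 0 (real n))) \<in> M" if "A \<in> sets borel" for A :: "'a set" and n
  proof -
    have "Int_stable {S :: 'a set. open S}" by (auto simp: Int_stable_def)
    moreover have "{S :: 'a set. open S} \<subseteq> Pow UNIV" by simp
    moreover have "A \<in> sigma_sets UNIV {S :: 'a set. open S}" using that by (simp add: sets_borel)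
    ultimately show ?thesis
    proof (induction rule: sigma_sets_induct_disjoint)
      case (basic A)
      then show ?case using open_ball by simp
    next
      case empty
      then show ?case using open_ball[of "{}"] by (simp add: indicator_empty_eq)
    next
      case (compl A)
      then have A: "A \<in> sets borel" by (simp add: sets_borel)
      have "abs_L2 (indicat_real (UNIV \<inter> ball 0 (real n))) + (- 1) *\<^sub>R abs_L2 (indicat_real (A \<inter> ball 0 (real n)))
          = abs_L2 (\<lambda>x. indicat_real (UNIV \<inter> ball 0 (real n)) x + - 1 * indicat_real (A \<inter> ball 0 (real n)) x)"
        using ball[OF A, of n] ball[of UNIV n] square_integrable_cmult[OF ball[OF A, of n], of "-1"]
        by (simp only: abs_L2_add abs_L2_scaleR sets.top space_borel[symmetric])
      also have "(\<lambda>x. indicat_real (UNIV \<inter> ball 0 (real n)) x + - 1 * indicat_real (A \<inter> ball 0 (real n)) x)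
          = indicat_real ((UNIV - A) \<inter> ball 0 (real n))"
        by (auto simp: indicator_def)
      finally show ?case
        using Ma[OF open_ball[of UNIV n] Mc[OF compl(2), of "-1"]] by simp
    next
      case (union A)
      then have A: "A k \<in> sets borel" for k by (auto simp: sets_borel)
      define A' where "A' k = (\<Union>i<k. A i) \<inter> ball 0 (real n)" for k :: nat
      have A'm: "A' k \<in> sets borel" for k
        unfolding A'_def using A by auto
      have UN: "(\<Union>k. A' k) = (\<Union>i. A i) \<inter> ball 0 (real n)"
        by (auto simp: A'_def)
      have "abs_L2 (indicat_real (A' k)) \<in> M" for k
      proof (induction k)
        case 0
        then show ?case using open_ball[of "{}" n] by (simp add: A'_def indicator_empty_eq)
      next
        case (Suc k)
        have s: "square_integrable (indicat_real (A' k))"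
          unfolding A'_def using A by (intro ball) auto
        have disjoint: "x \<in> A k \<Longrightarrow> i < k \<Longrightarrow> x \<notin> A i" for i x
          using disjoint_family_onD[OF union(1), of i k] by auto
        have "indicat_real (A' (Suc k)) = (\<lambda>x. indicat_real (A' k) x + indicat_real (A k \<inter> ball 0 (real n)) x)"
          using disjoint
          by (auto simp: A'_def indicator_def lessThan_Suc fun_eq_iff)
        then show ?case
          using Ma[OF Suc union(3)[of k]] abs_L2_add[OF s ball[OF A[of k], of n]] by simp
      qed
      moreover have "incseq A'" unfolding A'_def by (fastforce simp: incseq_def)
      moreover have "square_integrable (indicat_real (\<Union>k. A' k))"
        unfolding UN using A by (intro ball) auto
      ultimately show ?case
        using lim[of A'] A'm unfolding UN by blast
    qed
  qed
  have nonneg: "square_integrable f \<Longrightarrow> abs_L2 f \<in> M"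
    if "f \<in> borel_measurable borel" "\<And>x. 0 \<le> f x" for f :: "'a \<Rightarrow> real"
    using that
  proof (induction rule: borel_measurable_induct_real)
    case (set A)
    have UN: "(\<Union>n. A \<inter> ball 0 (real n)) = A"
      using reals_Archimedean2 by auto
    have "abs_L2 (indicat_real (\<Union>n. A \<inter> ball 0 (real n))) \<in> M"
    proof (rule lim)
      show "square_integrable (indicat_real (\<Union>n. A \<inter> ball 0 (real n)))"
        unfolding UN by (rule set.prems)
    qed (use set borel_ball in \<open>auto simp: incseq_def\<close>)
    then show ?case by (simp only: UN)
  next
    case (mult u c)
    show ?case
    proof (cases "c = 0")
      case True
      then show ?thesis using M0 by (simp add: zero_L2_def)
    next
      case False
      have "square_integrable u"
        using square_integrable_cmult[OF mult.prems, of "inverse c"] False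
        by (simp add: mult.assoc[symmetric])
      then show ?thesis
        using Mc[of "abs_L2 u" c] mult by (simp add: abs_L2_scaleR)
    qed
  next
    case (add u v)
    have "\<bar>u x\<bar> \<le> v x + u x" "\<bar>v x\<bar> \<le> v x + u x" for x
      using add.hyps(2,4)[of x] by simp_all
    then have "square_integrable u" "square_integrable v"
      using tendsto_abs_L2_dominated(2)[OF add.prems, of "\<lambda>_. u" u]
        tendsto_abs_L2_dominated(2)[OF add.prems, of "\<lambda>_. v" v] add.hyps(1,3) by auto
    then show ?case
      using add Ma[of "abs_L2 v" "abs_L2 u"] by (simp add: abs_L2_add)
  next
    case (seq U)
    have le: "\<bar>U k x\<bar> \<le> f x" for k x
      using incseq_le[of "\<lambda>i. U i x" "f x" k] seq.hyps(2-) by (auto simp: incseq_def le_fun_def)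
    have lim: "(\<lambda>k. U k x) \<longlonglongrightarrow> f x" for x
      using seq.hyps by simp
    note t = tendsto_abs_L2_dominated[OF seq.prems seq.hyps(1) that(1) le lim]
    show ?case
      by (rule Ml[OF seq.IH[OF t(1)] t(3)])
  qed
  have "F \<in> M" for F
  proof -
    have m: "square_integrable (\<lambda>x. max 0 (s * rep_L2 F x))" if "\<bar>s\<bar> = 1" for s
    proof -
      have "integrable lborel (\<lambda>x. (max 0 (s * rep_L2 F x))\<^sup>2)"
      proof (rule Bochner_Integration.integrable_bound)
        show "integrable lborel (\<lambda>x. (rep_L2 F x)\<^sup>2)"
          using square_integrable_rep[of F] by (simp add: square_integrable_def)
        have "(max 0 (s * rep_L2 F x))\<^sup>2 \<le> (rep_L2 F x)\<^sup>2" for x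
        proof (rule abs_le_square_iff[THEN iffD1])
          have "\<bar>s * rep_L2 F x\<bar> = \<bar>rep_L2 F x\<bar>"
            using that by (simp add: abs_mult)
          then show "\<bar>max 0 (s * rep_L2 F x)\<bar> \<le> \<bar>rep_L2 F x\<bar>"
            by linarith
        qed
        then show "AE x in lborel. norm ((max 0 (s * rep_L2 F x))\<^sup>2) \<le> norm ((rep_L2 F x)\<^sup>2)"
          by simp
      qed measurable
      then show ?thesis by (simp add: square_integrable_def)
    qed
    let ?p = "\<lambda>x. max 0 (1 * rep_L2 F x)" and ?n = "\<lambda>x. max 0 (- 1 * rep_L2 F x)"
    have "abs_L2 ?p \<in> M" "abs_L2 ?n \<in> M"
      by (rule nonneg; use m[of 1] m[of "-1"] in simp)+
    then have "abs_L2 ?p + (- 1) *\<^sub>R abs_L2 ?n \<in> M"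
      by (intro Ma Mc)
    also have "abs_L2 ?p + (- 1) *\<^sub>R abs_L2 ?n = abs_L2 ?p - abs_L2 ?n" by simp
    also have "\<dots> = abs_L2 (\<lambda>x. ?p x - ?n x)"
      using m[of 1] m[of "-1"] by (intro abs_L2_diff) simp_all
    also have "(\<lambda>x. ?p x - ?n x) = rep_L2 F" by (auto simp: max_def)
    finally show ?thesis by simp
  qed
  then have "closure (span X) = UNIV" by (auto simp: M_def)
  with X show thesis by (rule that)
qed

instance L2 :: (euclidean_space) second_countable_topology
proof
  obtain X :: "'a L2 set" where X: "countable X" "closure (span X) = UNIV"
    by (rule L2_countable_total)
  obtain D where D: "countable D" "span X \<subseteq> closure D"
    by (rule countable_dense_in_span[OF X(1)])
  have "closure D = UNIV"
    using closure_minimal[OF D(2)] X(2) by auto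
  then show "\<exists>B::'a L2 set set. countable B \<and> open = generate_topology B"
    by (rule second_countable_if_countable_dense[OF D(1)])
qed


instance L2 :: (euclidean_space) banach ..

definition L2_on :: "'a::euclidean_space set \<Rightarrow> 'a L2 set" where
  "L2_on S = {f. AE x in lborel. x \<notin> S \<longrightarrow> rep_L2 f x = 0}"


section \<open>Operators and forms on a subspace of a Hilbert space\<close>

definition linear_on_set :: "'a::real_vector set \<Rightarrow> ('a \<Rightarrow> 'b::real_vector) \<Rightarrow> bool" where
  "linear_on_set V h \<longleftrightarrow>
     (\<forall>x\<in>V. \<forall>y\<in>V. h (x + y) = h x + h y) \<and> (\<forall>c. \<forall>x\<in>V. h (c *\<^sub>R x) = c *\<^sub>R h x)"

text \<open>The last conjunct says that the graph of the adjoint equals the graph of \<open>A\<close>.\<close>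

definition selfadjoint_operator :: "'h::real_inner set \<Rightarrow> 'h set \<Rightarrow> ('h \<Rightarrow> 'h) \<Rightarrow> bool" where
  "selfadjoint_operator H D A \<longleftrightarrow>
     subspace D \<and> D \<subseteq> H \<and> H \<subseteq> closure D \<and> A ` D \<subseteq> H \<and> linear_on_set D A \<and>
     (\<forall>x\<in>H. \<forall>y\<in>H. (\<forall>z\<in>D. A z \<bullet> x = z \<bullet> y) \<longleftrightarrow> x \<in> D \<and> A x = y)"

text \<open>Relative compactness in the ambient norm of the unit ball for the graph norm.\<close>

definition domain_compactly_embedded :: "'h::real_inner set \<Rightarrow> ('h \<Rightarrow> 'h) \<Rightarrow> bool" where
  "domain_compactly_embedded D A \<longleftrightarrow>
     compact (closure {x\<in>D. (norm x)\<^sup>2 + (norm (A x))\<^sup>2 \<le> 1})"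

definition closed_nonneg_form :: "'h::real_inner set \<Rightarrow> 'h set \<Rightarrow> ('h \<Rightarrow> 'h \<Rightarrow> real) \<Rightarrow> bool" where
  "closed_nonneg_form H V E \<longleftrightarrow>
     subspace V \<and> V \<subseteq> H \<and> H \<subseteq> closure V \<and>
     (\<forall>x\<in>V. linear_on_set V (E x)) \<and>
     (\<forall>x\<in>V. \<forall>y\<in>V. E x y = E y x) \<and>
     (\<forall>x\<in>V. 0 \<le> E x x) \<and>
     (\<forall>X x. (\<forall>n. X n \<in> V) \<and> X \<longlonglongrightarrow> x \<and>
        (\<forall>e>0. \<exists>N. \<forall>m\<ge>N. \<forall>n\<ge>N. E (X m - X n) (X m - X n) < e) \<longrightarrow>
        x \<in> V \<and> (\<lambda>n. E (X n - x) (X n - x)) \<longlonglongrightarrow> 0)"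

definition associated_with_form ::
    "'h::real_inner set \<Rightarrow> 'h set \<Rightarrow> ('h \<Rightarrow> 'h) \<Rightarrow> 'h set \<Rightarrow> ('h \<Rightarrow> 'h \<Rightarrow> real) \<Rightarrow> bool" where
  "associated_with_form H D A V E \<longleftrightarrow>
     (\<forall>u f. u \<in> D \<and> A u = f \<longleftrightarrow> u \<in> V \<and> f \<in> H \<and> (\<forall>\<phi>\<in>V. E u \<phi> = f \<bullet> \<phi>))"

text \<open>
  Eigenvalues are listed with multiplicity. The eigenspaces occurring below are finite-dimensional,
  so \<open>dim\<close> and \<open>card\<close> never take their default value on an infinite object.
\<close>

definition eigenvalue_sequence :: "'h::real_inner set \<Rightarrow> ('h \<Rightarrow> 'h) \<Rightarrow> (nat \<Rightarrow> real) \<Rightarrow> bool" where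
  "eigenvalue_sequence D A ev \<longleftrightarrow>
     incseq ev \<and> filterlim ev at_top sequentially \<and>
     (\<forall>l. card {n. ev n = l} = dim {u\<in>D. A u = l *\<^sub>R u})"

text \<open>The first eigenvalue has index \<open>0\<close>.\<close>

locale form_operator =
  fixes \<Omega> :: "'a::euclidean_space set" and D :: "'a L2 set" and A :: "'a L2 \<Rightarrow> 'a L2"
    and V :: "'a L2 set" and E :: "'a L2 \<Rightarrow> 'a L2 \<Rightarrow> real" and ev :: "nat \<Rightarrow> real"
  assumes open_domain: "open \<Omega>" and bounded_domain: "bounded \<Omega>"
    and selfadjoint: "selfadjoint_operator (L2_on \<Omega>) D A"
    and nonneg: "\<And>u. u \<in> D \<Longrightarrow> 0 \<le> A u \<bullet> u"
    and compact_embedding: "domain_compactly_embedded D A"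
    and form: "closed_nonneg_form (L2_on \<Omega>) V E"
    and associated: "associated_with_form (L2_on \<Omega>) D A V E"
    and eigenvalues: "eigenvalue_sequence D A ev"
    and first_eigenvalue_pos: "0 < ev 0"


section \<open>The form domain and its dual\<close>

text \<open>
  An element of the dual of the form domain \<open>V\<close> is a functional of which only the values on \<open>V\<close>
  matter. An element \<open>g\<close> of the pivot space is the functional \<open>inner g\<close>, and the duality pairing of
  \<open>l\<close> with \<open>\<phi>\<close> is \<open>l \<phi>\<close>.
\<close>

definition form_norm :: "('h::real_inner \<Rightarrow> 'h \<Rightarrow> real) \<Rightarrow> 'h \<Rightarrow> real" where
  "form_norm E \<phi> = sqrt (E \<phi> \<phi> + \<phi> \<bullet> \<phi>)"

definition dual_space :: "'h::real_inner set \<Rightarrow> ('h \<Rightarrow> 'h \<Rightarrow> real) \<Rightarrow> ('h \<Rightarrow> real) set" where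
  "dual_space V E = {l. linear_on_set V l \<and> (\<exists>C. \<forall>\<phi>\<in>V. \<bar>l \<phi>\<bar> \<le> C * form_norm E \<phi>)}"

definition dual_norm :: "'h::real_inner set \<Rightarrow> ('h \<Rightarrow> 'h \<Rightarrow> real) \<Rightarrow> ('h \<Rightarrow> real) \<Rightarrow> real" where
  "dual_norm V E l = (SUP \<phi>\<in>{\<phi>\<in>V. form_norm E \<phi> \<le> 1}. \<bar>l \<phi>\<bar>)"

definition norm_continuous_on :: "('x::minus \<Rightarrow> real) \<Rightarrow> real set \<Rightarrow> (real \<Rightarrow> 'x) \<Rightarrow> bool" where
  "norm_continuous_on nrm S u \<longleftrightarrow> (\<forall>t\<in>S. ((\<lambda>s. nrm (u s - u t)) \<longlongrightarrow> 0) (at t within S))"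

definition has_dual_derivative ::
    "'h::real_inner set \<Rightarrow> ('h \<Rightarrow> 'h \<Rightarrow> real) \<Rightarrow> (real \<Rightarrow> 'h \<Rightarrow> real) \<Rightarrow> ('h \<Rightarrow> real) \<Rightarrow> real \<Rightarrow> bool" where
  "has_dual_derivative V E G G' t \<longleftrightarrow>
     ((\<lambda>s. dual_norm V E (\<lambda>\<phi>. (G s \<phi> - G t \<phi>) / (s - t) - G' \<phi>)) \<longlongrightarrow> 0) (at t)"

text \<open>
  Bochner integrability in the dual of \<open>V\<close>. That space is separable, so by Pettis' theorem weak and
  strong measurability agree; the Bochner integral is then determined by its values
  \<open>\<phi> \<mapsto> \<integral> F \<tau> \<phi> d\<tau>\<close>, and this is how it is written below.
\<close>

definition dual_integrable ::
    "'h::real_inner set \<Rightarrow> ('h \<Rightarrow> 'h \<Rightarrow> real) \<Rightarrow> real set \<Rightarrow> (real \<Rightarrow> 'h \<Rightarrow> real) \<Rightarrow> bool" where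
  "dual_integrable V E S F \<longleftrightarrow>
     (\<forall>\<phi>\<in>V. set_borel_measurable lborel S (\<lambda>\<tau>. F \<tau> \<phi>)) \<and>
     set_integrable lborel S (\<lambda>\<tau>. dual_norm V E (F \<tau>))"


section \<open>Fractional calculus\<close>

definition frac_int_left ::
    "real \<Rightarrow> (real \<Rightarrow> 'b::{banach, second_countable_topology}) \<Rightarrow> real \<Rightarrow> 'b" where
  "frac_int_left a g t =
     (if a = 0 then g t
      else (1 / Gamma a) *\<^sub>R (LINT \<tau>:{0<..<t}|lborel. (t - \<tau>) powr (a - 1) *\<^sub>R g \<tau>))"

definition frac_int_right ::
    "real \<Rightarrow> real \<Rightarrow> (real \<Rightarrow> 'b::{banach, second_countable_topology}) \<Rightarrow> real \<Rightarrow> 'b" where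
  "frac_int_right T a g t =
     (if a = 0 then g t
      else (1 / Gamma a) *\<^sub>R (LINT \<tau>:{t<..<T}|lborel. (\<tau> - t) powr (a - 1) *\<^sub>R g \<tau>))"

text \<open>
  The library integral of a non-integrable function is \<open>0\<close>, so the existence of a fractional
  integral has to be required explicitly.
\<close>

definition frac_integrable_left ::
    "real \<Rightarrow> (real \<Rightarrow> 'b::{banach, second_countable_topology}) \<Rightarrow> real \<Rightarrow> bool" where
  "frac_integrable_left a g t \<longleftrightarrow>
     a = 0 \<or> set_integrable lborel {0<..<t} (\<lambda>\<tau>. (t - \<tau>) powr (a - 1) *\<^sub>R g \<tau>)"

definition frac_integrable_right ::
    "real \<Rightarrow> real \<Rightarrow> (real \<Rightarrow> 'b::{banach, second_countable_topology}) \<Rightarrow> real \<Rightarrow> bool" where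
  "frac_integrable_right T a g t \<longleftrightarrow>
     a = 0 \<or> set_integrable lborel {t<..<T} (\<lambda>\<tau>. (\<tau> - t) powr (a - 1) *\<^sub>R g \<tau>)"

definition dual_frac_integrable_left ::
    "'h::real_inner set \<Rightarrow> ('h \<Rightarrow> 'h \<Rightarrow> real) \<Rightarrow> real \<Rightarrow> (real \<Rightarrow> 'h \<Rightarrow> real) \<Rightarrow> real \<Rightarrow> bool" where
  "dual_frac_integrable_left V E a F t \<longleftrightarrow>
     a = 0 \<or> dual_integrable V E {0<..<t} (\<lambda>\<tau> \<phi>. (t - \<tau>) powr (a - 1) * F \<tau> \<phi>)"

definition dual_frac_integrable_right ::
    "'h::real_inner set \<Rightarrow> ('h \<Rightarrow> 'h \<Rightarrow> real) \<Rightarrow> real \<Rightarrow> real \<Rightarrow> (real \<Rightarrow> 'h \<Rightarrow> real) \<Rightarrow> real \<Rightarrow> bool" where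
  "dual_frac_integrable_right V E T a F t \<longleftrightarrow>
     a = 0 \<or> dual_integrable V E {t<..<T} (\<lambda>\<tau> \<phi>. (\<tau> - t) powr (a - 1) * F \<tau> \<phi>)"

text \<open>
  \<open>w\<close> is the left Hilfer derivative of type \<open>(\<mu>, \<nu>)\<close> of \<open>u\<close> on \<open>(0, T]\<close>: the inner fractional integral is
  taken in the pivot space, the derivative \<open>F\<close> and the outer fractional integral in the dual of \<open>V\<close>.
  If the order of the outer integral is \<open>0\<close> then \<open>w = F\<close>; the value at \<open>T\<close> is then fixed by the
  continuity of \<open>w\<close> on \<open>(0, T]\<close> that is part of the notion of weak solution.
\<close>

definition has_hilfer_derivative_left ::
    "'h::{real_inner, banach, second_countable_topology} set \<Rightarrow> ('h \<Rightarrow> 'h \<Rightarrow> real) \<Rightarrow> real \<Rightarrow> real \<Rightarrow>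
     real \<Rightarrow> (real \<Rightarrow> 'h) \<Rightarrow> (real \<Rightarrow> 'h \<Rightarrow> real) \<Rightarrow> bool" where
  "has_hilfer_derivative_left V E T \<mu> \<nu> u w \<longleftrightarrow>
     (\<forall>t\<in>{0<..T}. frac_integrable_left ((1 - \<nu>) * (1 - \<mu>)) u t) \<and>
     (\<exists>F. (\<forall>t\<in>{0<..<T}. F t \<in> dual_space V E \<and>
             has_dual_derivative V E (\<lambda>s. inner (frac_int_left ((1 - \<nu>) * (1 - \<mu>)) u s)) (F t) t) \<and>
          (\<forall>t\<in>{0<..T}. dual_frac_integrable_left V E (\<nu> * (1 - \<mu>)) F t \<and>
             (\<forall>\<phi>\<in>V. w t \<phi> = frac_int_left (\<nu> * (1 - \<mu>)) (\<lambda>\<tau>. F \<tau> \<phi>) t)))"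

definition has_hilfer_derivative_right ::
    "'h::{real_inner, banach, second_countable_topology} set \<Rightarrow> ('h \<Rightarrow> 'h \<Rightarrow> real) \<Rightarrow> real \<Rightarrow> real \<Rightarrow>
     real \<Rightarrow> (real \<Rightarrow> 'h) \<Rightarrow> (real \<Rightarrow> 'h \<Rightarrow> real) \<Rightarrow> bool" where
  "has_hilfer_derivative_right V E T \<mu> \<nu> u w \<longleftrightarrow>
     (\<forall>t\<in>{0..<T}. frac_integrable_right T ((1 - \<nu>) * (1 - \<mu>)) u t) \<and>
     (\<exists>F. (\<forall>t\<in>{0<..<T}. F t \<in> dual_space V E \<and>
             has_dual_derivative V E (\<lambda>s. inner (frac_int_right T ((1 - \<nu>) * (1 - \<mu>)) u s)) (F t) t) \<and>
          (\<forall>t\<in>{0..<T}. dual_frac_integrable_right V E T (\<nu> * (1 - \<mu>)) F t \<and>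
             (\<forall>\<phi>\<in>V. w t \<phi> = - frac_int_right T (\<nu> * (1 - \<mu>)) (\<lambda>\<tau>. F \<tau> \<phi>) t)))"


section \<open>Weak solutions, controllability and unique continuation\<close>

text \<open>
  The integral formula gives \<open>0\<close> for the fractional integral of positive order at the initial (resp.
  final) time, so its value there is the limit: \<open>g\<close> is the continuous extension to \<open>[0, T]\<close>.
\<close>

definition weak_solution ::
    "'a::euclidean_space L2 set \<Rightarrow> ('a L2 \<Rightarrow> 'a L2 \<Rightarrow> real) \<Rightarrow> real \<Rightarrow> real \<Rightarrow> real \<Rightarrow>
     ('a \<times> real) L2 \<Rightarrow> 'a L2 \<Rightarrow> (real \<Rightarrow> 'a L2) \<Rightarrow> bool" where
  "weak_solution V E T \<mu> \<nu> f u0 u \<longleftrightarrow>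
     (\<forall>t\<in>{0<..T}. u t \<in> V) \<and> norm_continuous_on (form_norm E) {0<..T} u \<and>
     (\<exists>g. continuous_on {0..T} g \<and> g 0 = u0 \<and>
        (\<forall>t\<in>{0<..T}. frac_integrable_left ((1 - \<nu>) * (1 - \<mu>)) u t \<and>
           g t = frac_int_left ((1 - \<nu>) * (1 - \<mu>)) u t)) \<and>
     (\<exists>w. has_hilfer_derivative_left V E T \<mu> \<nu> u w \<and>
        (\<forall>t\<in>{0<..T}. w t \<in> dual_space V E) \<and> norm_continuous_on (dual_norm V E) {0<..T} w \<and>
        (\<forall>\<phi>\<in>V. AE t in lborel. t \<in> {0<..<T} \<longrightarrow>
           w t \<phi> + E (u t) \<phi> - (LINT x|lborel. rep_L2 f (x, t) * rep_L2 \<phi> x) = 0))"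

definition adjoint_weak_solution ::
    "'a::euclidean_space L2 set \<Rightarrow> ('a L2 \<Rightarrow> 'a L2 \<Rightarrow> real) \<Rightarrow> real \<Rightarrow> real \<Rightarrow> real \<Rightarrow>
     'a L2 \<Rightarrow> (real \<Rightarrow> 'a L2) \<Rightarrow> bool" where
  "adjoint_weak_solution V E T \<mu> \<nu> v0 v \<longleftrightarrow>
     (\<forall>t\<in>{0..<T}. v t \<in> V) \<and> norm_continuous_on (form_norm E) {0..<T} v \<and>
     (\<exists>g. continuous_on {0..T} g \<and> g T = v0 \<and>
        (\<forall>t\<in>{0..<T}. frac_integrable_right T (\<nu> * (1 - \<mu>)) v t \<and>
           g t = frac_int_right T (\<nu> * (1 - \<mu>)) v t)) \<and>
     (\<exists>w. has_hilfer_derivative_right V E T \<mu> (1 - \<nu>) v w \<and>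
        (\<forall>t\<in>{0..<T}. w t \<in> dual_space V E) \<and> norm_continuous_on (dual_norm V E) {0..<T} w \<and>
        (\<forall>\<phi>\<in>V. AE t in lborel. t \<in> {0<..<T} \<longrightarrow> w t \<phi> + E (v t) \<phi> = 0))"

definition mean_approx_controllable ::
    "'a::euclidean_space set \<Rightarrow> 'a set \<Rightarrow> 'a L2 set \<Rightarrow> ('a L2 \<Rightarrow> 'a L2 \<Rightarrow> real) \<Rightarrow>
     real \<Rightarrow> real \<Rightarrow> real \<Rightarrow> bool" where
  "mean_approx_controllable \<Omega> \<omega> V E T \<mu> \<nu> \<longleftrightarrow>
     (\<forall>u0\<in>L2_on \<Omega>. \<forall>u1\<in>L2_on \<Omega>. \<forall>e>0. \<exists>f\<in>L2_on (\<omega> \<times> {0<..<T}). \<exists>u.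
        weak_solution V E T \<mu> \<nu> f u0 u \<and>
        norm (frac_int_left ((1 - \<nu>) * (1 - \<mu>)) u T - u1) \<le> e)"

definition adjoint_unique_continuation ::
    "'a::euclidean_space set \<Rightarrow> 'a set \<Rightarrow> 'a L2 set \<Rightarrow> ('a L2 \<Rightarrow> 'a L2 \<Rightarrow> real) \<Rightarrow>
     real \<Rightarrow> real \<Rightarrow> real \<Rightarrow> bool" where
  "adjoint_unique_continuation \<Omega> \<omega> V E T \<mu> \<nu> \<longleftrightarrow>
     (\<forall>v0\<in>L2_on \<Omega>. \<forall>v. adjoint_weak_solution V E T \<mu> \<nu> v0 v \<and>
        (\<forall>t\<in>{0<..<T}. AE x in lborel. x \<in> \<omega> \<longrightarrow> rep_L2 (v t) x = 0) \<longrightarrow> v0 = 0)"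

end

theory Submission
  imports Defs
begin

text \<open>
  Approximate controllability says that the control-to-state map has dense range, unique continuation
  that its adjoint is injective; the work lies in connecting the two for solutions that are merely weak.
  Put \<open>a = (1 - \<nu>) (1 - \<mu>)\<close> and \<open>b = \<nu> (1 - \<mu>)\<close>, and let \<open>I^c\<close> be the fractional integral of order \<open>c\<close>
  from \<open>0\<close>. The reflection \<open>y s = v (T - s)\<close> turns the adjoint problem into the forward problem with
  \<open>\<nu>\<close> replaced by \<open>1 - \<nu>\<close>, that is with \<open>a\<close> and \<open>b\<close> exchanged (\<open>adjoint_iff_reflected_evolution\<close>).

  Compactness of the embedding of the operator domain yields an orthonormal eigenbasis
  (\<open>eigenvector_expansion\<close>), in which the squared norms of the form domain and of its dual are sums with
  weights \<open>1 + l n\<close> and \<open>1 / (1 + l n)\<close> (\<open>form_norm_eq\<close>, \<open>dual_norm_eq\<close>), and each coordinate of a weak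
  solution satisfies a scalar equation (\<open>evolution_modes\<close>). For a forward solution \<open>u\<close> with datum \<open>0\<close> and
  control \<open>f\<close>, and a reflected adjoint solution \<open>y\<close> with datum \<open>v0\<close>, the scalar equations convolved
  with each other give, mode by mode,
  \<open>(I^a u) t * w0 = (integral over s from 0 to t of f s * y (t - s))\<close>, where \<open>w0\<close> is the coordinate of \<open>v0\<close>
  (\<open>fractional_duality\<close>). The eigenvalue cancels.

  If \<open>v\<close> vanishes on \<open>\<omega>\<close>, then it is orthogonal to every value of a control, and summing the identities
  over the modes shows that \<open>v0\<close> is orthogonal to every reachable state (\<open>evolution_duality\<close>).
  Controllability makes these states dense, hence \<open>v0 = 0\<close>.

  Conversely, suppose that the reachable states are not dense, and let \<open>v0 \<noteq> 0\<close> be orthogonal to them.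
  Among the controls are \<open>t ^ j / fact j\<close> times \<open>\<psi>\<close> with \<open>\<psi>\<close> supported in \<open>\<omega>\<close>. Their
  states, and the adjoint solution with datum \<open>v0\<close>, are given mode by mode by Mittag-Leffler
  functions (\<open>explicit_solution\<close>), and orthogonality becomes the vanishing of all moments of
  \<open>s \<mapsto> \<psi> \<bullet> y s\<close>. So \<open>v\<close> vanishes on \<open>\<omega>\<close> and unique continuation gives \<open>v0 = 0\<close>, a contradiction.
  That the explicit series are weak solutions rests on bounds uniform in the eigenvalue. They all follow from
  the positivity of the resolvent kernel (\<open>ml_kernel_pos\<close>) and its consequence \<open>ml_decay\<close>.
\<close>


section \<open>Power kernels and Mittag-Leffler kernels\<close>

text \<open>
  The kernel of the Riemann-Liouville integral. For \<open>a = 0\<close> it is \<open>0\<close>, because \<open>Gamma 0 = 0\<close>, and not the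
  unit mass at the origin; fractional integrals of order \<open>0\<close> are therefore treated separately.
\<close>

definition rl_kernel :: "real \<Rightarrow> real \<Rightarrow> real" where
  "rl_kernel a t = t powr (a - 1) / Gamma a"

text \<open>
  This is \<open>t powr (b - 1)\<close> times the two-parameter Mittag-Leffler function with parameters \<open>m\<close>, \<open>b\<close> at
  \<open>- l * t powr m\<close>. Written as a series of power kernels, a fractional integral of order \<open>a\<close> replaces
  \<open>b\<close> by \<open>a + b\<close>.
\<close>

definition ml_kernel :: "real \<Rightarrow> real \<Rightarrow> real \<Rightarrow> real \<Rightarrow> real" where
  "ml_kernel m b l t = (\<Sum>k. (- l) ^ k * rl_kernel (b + real k * m) t)"

lemma rl_kernel_zero [simp]: "rl_kernel 0 t = 0"
  by (simp add: rl_kernel_def)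

lemma rl_kernel_nonneg: "0 \<le> a \<Longrightarrow> 0 \<le> rl_kernel a t"
  by (cases "a = 0") (auto simp: rl_kernel_def less_imp_le)

lemma rl_kernel_pos: "0 < a \<Longrightarrow> 0 < t \<Longrightarrow> 0 < rl_kernel a t"
  by (auto simp: rl_kernel_def)

lemma rl_kernel_1 [simp]: "0 < t \<Longrightarrow> rl_kernel 1 t = 1"
  by (simp add: rl_kernel_def)

lemma rl_kernel_Suc: "0 < b \<Longrightarrow> 0 < t \<Longrightarrow> b * rl_kernel (b + 1) t = t * rl_kernel b t"
proof -
  assume b: "0 < b" and t: "0 < t"
  have "Gamma (b + 1) = b * Gamma b"
    using b by (intro Gamma_plus1) auto
  moreover have "t powr b = t * t powr (b - 1)"
    using t by (simp add: powr_diff)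
  ultimately show ?thesis using b by (simp add: rl_kernel_def)
qed

lemma rl_kernel_measurable [measurable]: "rl_kernel a \<in> borel_measurable borel"
  unfolding rl_kernel_def[abs_def] by measurable

lemma continuous_on_pk: "continuous_on {0<..} (rl_kernel a)"
  unfolding rl_kernel_def[abs_def] divide_inverse by (intro continuous_intros) auto

text \<open>
  Log-convexity of the Gamma function at \<open>x - 1\<close>, \<open>x\<close>, \<open>x + m\<close>; it feeds the ratio test for the
  Mittag-Leffler series.
\<close>

lemma Gamma_add_ge:
  fixes x m :: real
  assumes "1 < x" "0 < m"
  shows "Gamma x * (x - 1) powr m \<le> Gamma (x + m)"
proof -
  have g: "Gamma x = (x - 1) * Gamma (x - 1)"
    using Gamma_plus1[of "x - 1"] assms by force
  define u where "u = 1 / (1 + m)"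
  have u: "0 \<le> u" "u \<le> 1" using assms by (auto simp: u_def field_simps)
  have xx: "(1 - u) *\<^sub>R (x - 1) + u *\<^sub>R (x + m) = x"
  proof -
    have "u * (1 + m) = 1" using assms by (simp add: u_def)
    then show ?thesis by (simp add: algebra_simps)
  qed
  have "(ln \<circ> Gamma) ((1 - u) *\<^sub>R (x - 1) + u *\<^sub>R (x + m))
      \<le> (1 - u) * (ln \<circ> Gamma) (x - 1) + u * (ln \<circ> Gamma) (x + m)"
    using assms u by (intro convex_onD[OF log_convex_Gamma_real]) auto
  then have "ln (Gamma x) \<le> (1 - u) * ln (Gamma (x - 1)) + u * ln (Gamma (x + m))"
    unfolding xx by simp
  then have "(1 + m) * ln (Gamma x) \<le> (1 + m) * ((1 - u) * ln (Gamma (x - 1)) + u * ln (Gamma (x + m)))"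
    using assms by (intro mult_left_mono) auto
  also have "\<dots> = m * ln (Gamma (x - 1)) + ln (Gamma (x + m))"
  proof -
    have "(1 + m) * u = 1" using assms by (simp add: u_def)
    then have "(1 + m) * (1 - u) = m" "(1 + m) * u = 1" by (simp_all add: algebra_simps)
    then show ?thesis by (simp only: distrib_left mult.assoc[symmetric] mult_1)
  qed
  also have "ln (Gamma (x - 1)) = ln (Gamma x) - ln (x - 1)"
    unfolding g using assms Gamma_real_pos[of "x - 1"] by (simp add: ln_mult less_imp_neq[symmetric])
  finally have "ln (Gamma x) + m * ln (x - 1) \<le> ln (Gamma (x + m))"
    by (simp add: algebra_simps)
  then have "exp (ln (Gamma x) + m * ln (x - 1)) \<le> exp (ln (Gamma (x + m)))"
    by simp
  then show ?thesis
    using assms by (simp add: exp_add powr_def mult.commute)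
qed

lemma summable_ml_coeff:
  assumes m: "0 < m" and b: "0 \<le> b"
  shows "summable (\<lambda>k. (1 / Gamma (b + real k * m)) * (y::real) ^ k)"
proof (rule summable_ratio_test[where c = "1/2"])
  define M where "M = (2 * \<bar>y\<bar>) powr (1/m) + 2"
  define N where "N = nat \<lceil>M / m\<rceil>"
  show "(1/2::real) < 1" by simp
  fix k assume k: "N \<le> k"
  have "M / m \<le> real k" using k unfolding N_def by linarith
  then have x: "M \<le> b + real k * m" (is "_ \<le> ?x") using m b by (simp add: field_simps)
  have x1: "1 < ?x" using x powr_ge_zero[of "2 * \<bar>y\<bar>" "1/m"] unfolding M_def by linarith
  have "2 * \<bar>y\<bar> = ((2 * \<bar>y\<bar>) powr (1/m)) powr m"
    using m by (simp add: powr_powr)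
  also have "\<dots> \<le> (?x - 1) powr m"
    using x m by (intro powr_mono2) (auto simp: M_def)
  finally have "Gamma ?x * (2 * \<bar>y\<bar>) \<le> Gamma ?x * (?x - 1) powr m"
    using x1 by (intro mult_left_mono) (auto simp: less_imp_le)
  also have "\<dots> \<le> Gamma (?x + m)" by (rule Gamma_add_ge[OF x1 m])
  finally have G: "Gamma ?x * (2 * \<bar>y\<bar>) \<le> Gamma (?x + m)" .
  have e: "b + real (Suc k) * m = ?x + m" by (simp add: algebra_simps)
  have p: "0 < Gamma ?x" "0 < Gamma (?x + m)" using x1 m by auto
  have "\<bar>y\<bar> / Gamma (?x + m) \<le> (1/2) / Gamma ?x"
    using G p by (simp add: field_simps)
  then have "\<bar>y\<bar> / Gamma (?x + m) * \<bar>y\<bar>^k \<le> (1/2) / Gamma ?x * \<bar>y\<bar>^k"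
    by (rule mult_right_mono) simp
  then show "norm (1 / Gamma (b + real (Suc k) * m) * y ^ Suc k) \<le> 1/2 * norm (1 / Gamma (b + real k * m) * y ^ k)"
    unfolding e using p by (simp add: abs_mult power_abs mult_ac)
qed

lemma rl_kernel_add_mult:
  "0 < t \<Longrightarrow> rl_kernel (b + real k * m) t = t powr (b - 1) * ((1 / Gamma (b + real k * m)) * (t powr m) ^ k)"
proof -
  assume t: "0 < t"
  have "t powr (b + real k * m - 1) = t powr (b - 1) * t powr (real k * m)"
    by (simp flip: powr_add) (simp add: algebra_simps)
  also have "t powr (real k * m) = (t powr m) ^ k"
    using t by (simp add: powr_powr mult.commute flip: powr_realpow)
  finally show ?thesis by (simp add: rl_kernel_def)
qed

lemma summable_ml:
  assumes "0 < m" "0 \<le> b" "0 < t"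
  shows "summable (\<lambda>k. l ^ k * rl_kernel (b + real k * m) t)"
proof -
  have "l ^ k * rl_kernel (b + real k * m) t = t powr (b - 1) * ((1 / Gamma (b + real k * m)) * (l * t powr m) ^ k)" for k
    using rl_kernel_add_mult[OF assms(3), of b k m] by (simp add: power_mult_distrib)
  then show ?thesis
    using summable_mult[OF summable_ml_coeff[OF assms(1,2), of "l * t powr m"], of "t powr (b - 1)"] by simp
qed

lemma ml_power_series:
  assumes "0 < m" "0 \<le> b" "0 < t"
  shows "ml_kernel m b l t = t powr (b - 1) * (\<Sum>k. (1 / Gamma (b + real k * m)) * (- l * t powr m) ^ k)"
proof -
  have "(- l) ^ k * rl_kernel (b + real k * m) t = t powr (b - 1) * ((1 / Gamma (b + real k * m)) * (- l * t powr m) ^ k)" for k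
    using rl_kernel_add_mult[OF assms(3), of b k m] unfolding power_mult_distrib by (simp del: power_minus_mult)
  then show ?thesis
    unfolding ml_kernel_def using suminf_mult[OF summable_ml_coeff[OF assms(1,2), of "- l * t powr m"], of "t powr (b - 1)"]
    by simp
qed

lemma continuous_on_ml:
  assumes "0 < m" "0 \<le> b"
  shows "continuous_on {0<..} (ml_kernel m b l)"
proof -
  have "continuous_on {0<..} (\<lambda>t. t powr (b - 1) * (\<Sum>k. (1 / Gamma (b + real k * m)) * (- l * t powr m) ^ k))"
    by (intro continuous_intros continuous_on_compose2[where f = "\<lambda>t. - l * t powr m"
          and g = "\<lambda>x. \<Sum>k. (1 / Gamma (b + real k * m)) * x ^ k" and t = UNIV]
        continuous_at_imp_continuous_on ballI isCont_powser_converges_everywhere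
        summable_ml_coeff assms) auto
  then show ?thesis
    by (rule continuous_on_eq) (use assms in \<open>simp add: ml_power_series\<close>)
qed

lemma ml_rec:
  assumes "0 < m" "0 \<le> b" "0 < t"
  shows "ml_kernel m b l t = rl_kernel b t - l * ml_kernel m (b + m) l t"
proof -
  have "ml_kernel m b l t = (- l) ^ 0 * rl_kernel (b + real 0 * m) t + (\<Sum>k. (- l) ^ Suc k * rl_kernel (b + real (Suc k) * m) t)"
    unfolding ml_kernel_def using suminf_split_initial_segment[OF summable_ml[OF assms, of "-l"], of 1] by simp
  also have "(\<Sum>k. (- l) ^ Suc k * rl_kernel (b + real (Suc k) * m) t) = - l * (\<Sum>k. (- l) ^ k * rl_kernel (b + m + real k * m) t)"
    using assms by (subst suminf_mult[OF summable_ml, symmetric]) (auto simp: algebra_simps)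
  finally show ?thesis by (simp add: ml_kernel_def)
qed

text \<open>
  The semigroup law of fractional integration, which is the evaluation of the Beta integral.
\<close>

lemma rl_kernel_conv:
  assumes a: "0 < a" and b: "0 < b" and t: "0 < t"
  shows "set_integrable lborel {0<..<t} (\<lambda>s. rl_kernel a (t - s) * rl_kernel b s)"
    "(LINT s:{0<..<t}|lborel. rl_kernel a (t - s) * rl_kernel b s) = rl_kernel (a + b) t"
proof -
  define h where "h s = indicat_real {0..1} s *\<^sub>R (s powr (b - 1) * (1 - s) powr (a - 1))" for s :: real
  have hi: "integrable lborel h"
    using integrable_Beta[OF b a] by (simp add: set_integrable_def h_def[abs_def])
  have "(LINT s:{0..1}|lborel. s powr (b - 1) * (1 - s) powr (a - 1)) = Beta b a"
    using set_borel_integral_eq_integral(2)[OF integrable_Beta[OF b a]]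
      integral_unique[OF has_integral_Beta_real[OF b a]] by simp
  then have hI: "integral\<^sup>L lborel h = Beta b a"
    by (simp add: set_lebesgue_integral_def h_def[abs_def])
  define c where "c = t powr (a + b - 2) / (Gamma a * Gamma b)"
  have hs: "indicat_real {0<..<t} s *\<^sub>R (rl_kernel a (t - s) * rl_kernel b s) = c * h (0 + (1/t) * s)" for s
  proof (cases "s \<in> {0<..<t}")
    case True
    have e: "1 - 1 / t * s = (t - s) / t" using t by (simp add: field_simps)
    have p: "t powr (a + b - 2) = t powr (a - 1) * t powr (b - 1)" by (simp flip: powr_add)
    have "(t - s) powr (a - 1) = t powr (a - 1) * (1 - 1 / t * s) powr (a - 1)"
      unfolding e using True t by (simp add: powr_divide)
    moreover have "s powr (b - 1) = t powr (b - 1) * (1 / t * s) powr (b - 1)"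
      using True t by (simp add: powr_divide)
    moreover have "1 / t * s \<in> {0..1}" using True t by auto
    ultimately show ?thesis using True t
      unfolding h_def c_def p rl_kernel_def by (simp add: mult_ac)
  next
    case False
    then have "s \<le> 0 \<or> s \<ge> t" by auto
    then have "h (0 + (1/t) * s) = 0" using t
      by (auto simp: h_def indicator_def zero_le_divide_iff divide_le_eq_1)
    then show ?thesis using False by simp
  qed
  have hi': "integrable lborel (\<lambda>s. h (0 + (1/t) * s))"
    using t by (intro lborel_integrable_real_affine hi) simp
  show "set_integrable lborel {0<..<t} (\<lambda>s. rl_kernel a (t - s) * rl_kernel b s)"
    unfolding set_integrable_def hs using hi' by simp
  have "(LINT s|lborel. h (0 + (1/t) * s)) = t * Beta b a"
    using lborel_integral_real_affine[of "1/t" h 0] t hI by (simp add: field_simps)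
  then have "(LINT s:{0<..<t}|lborel. rl_kernel a (t - s) * rl_kernel b s) = c * (t * Beta b a)"
    unfolding set_lebesgue_integral_def hs by simp
  also have "\<dots> = rl_kernel (a + b) t"
  proof -
    have "t powr (a + b - 1) = t powr (a + b - 2) * t"
      using t powr_add[of t "a+b-2" 1] by simp
    moreover have "Gamma a \<noteq> 0" "Gamma b \<noteq> 0" using Gamma_real_pos[OF a] Gamma_real_pos[OF b] by linarith+
    ultimately show ?thesis
      by (simp add: c_def rl_kernel_def Beta_def add.commute)
  qed
  finally show "(LINT s:{0<..<t}|lborel. rl_kernel a (t - s) * rl_kernel b s) = rl_kernel (a + b) t" .
qed

lemma ml_conv:
  assumes m: "0 < m" and a: "0 < a" and b: "0 < b" and t: "0 < t"
  shows "set_integrable lborel {0<..<t} (\<lambda>s. rl_kernel a (t - s) * ml_kernel m b l s)"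
    "(LINT s:{0<..<t}|lborel. rl_kernel a (t - s) * ml_kernel m b l s) = ml_kernel m (a + b) l t"
proof -
  define f where "f k s = (- l) ^ k * (indicat_real {0<..<t} s *\<^sub>R (rl_kernel a (t - s) * rl_kernel (b + real k * m) s))" for k s
  have bk: "0 < b + real k * m" for k using b m by (simp add: add_pos_nonneg)
  note pc = rl_kernel_conv[OF a bk t, unfolded set_integrable_def set_lebesgue_integral_def]
  have fi: "integrable lborel (f k)" for k
    unfolding f_def[abs_def] by (intro integrable_mult_right pc)
  have fI: "integral\<^sup>L lborel (f k) = (- l) ^ k * rl_kernel (a + b + real k * m) t" for k
    unfolding f_def[abs_def] using pc by (simp add: algebra_simps)
  have nf: "norm (f k s) = \<bar>- l\<bar> ^ k * (indicat_real {0<..<t} s *\<^sub>R (rl_kernel a (t - s) * rl_kernel (b + real k * m) s))" for k s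
    using rl_kernel_nonneg[of a] a rl_kernel_nonneg[OF less_imp_le[OF bk]] by (auto simp: f_def abs_mult power_abs indicator_def)
  have nI: "(LINT s|lborel. norm (f k s)) = \<bar>- l\<bar> ^ k * rl_kernel (a + b + real k * m) t" for k
    unfolding nf using pc by (simp add: algebra_simps)
  have sm: "summable (\<lambda>k. norm (f k s))" for s
  proof (cases "s \<in> {0<..<t}")
    case True
    then have "summable (\<lambda>k. rl_kernel a (t - s) * (\<bar>- l\<bar> ^ k * rl_kernel (b + real k * m) s))"
      using summable_ml[OF m less_imp_le[OF b], of s "\<bar>- l\<bar>"] by (intro summable_mult) auto
    then show ?thesis unfolding nf using True by (simp add: mult_ac)
  next
    case False
    then have "norm (f k s) = 0" for k by (simp add: f_def)
    then show ?thesis by simp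
  qed
  have SI: "summable (\<lambda>k. LINT s|lborel. norm (f k s))"
    unfolding nI using summable_ml[OF m _ t, of "a + b" "\<bar>- l\<bar>"] a b by simp
  have sumf: "(\<Sum>k. f k s) = indicat_real {0<..<t} s *\<^sub>R (rl_kernel a (t - s) * ml_kernel m b l s)" for s
  proof (cases "s \<in> {0<..<t}")
    case True
    then have "(\<Sum>k. rl_kernel a (t - s) * ((- l) ^ k * rl_kernel (b + real k * m) s)) = rl_kernel a (t - s) * ml_kernel m b l s"
      unfolding ml_kernel_def using summable_ml[OF m less_imp_le[OF b], of s "- l"] by (intro suminf_mult) auto
    then show ?thesis using True by (simp add: f_def mult_ac)
  next
    case False
    then have "f k s = 0" for k by (simp add: f_def)
    then show ?thesis using False by simp
  qed
  show "set_integrable lborel {0<..<t} (\<lambda>s. rl_kernel a (t - s) * ml_kernel m b l s)"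
    unfolding set_integrable_def
    using integrable_suminf[OF fi AE_I2[OF sm] SI] by (simp only: sumf)
  have "(LINT s:{0<..<t}|lborel. rl_kernel a (t - s) * ml_kernel m b l s) = (LINT s|lborel. (\<Sum>k. f k s))"
    by (simp add: sumf set_lebesgue_integral_def)
  also have "\<dots> = (\<Sum>k. integral\<^sup>L lborel (f k))"
    by (rule integral_suminf[OF fi _ SI]) (intro AE_I2 sm)
  finally show "(LINT s:{0<..<t}|lborel. rl_kernel a (t - s) * ml_kernel m b l s) = ml_kernel m (a + b) l t"
    by (simp add: fI ml_kernel_def)
qed

text \<open>
  For \<open>m \<le> 1\<close> the kernel \<open>g = rl_kernel m\<close> is log-convex, so \<open>g (t0 - s) / g (t - s)\<close> decreases in \<open>s\<close>
  and is largest at \<open>s = 0\<close>.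
\<close>

lemma rl_kernel_shift_ratio:
  assumes m: "0 < m" "m \<le> 1" and s: "0 < s" "s < t" "t < t0"
  shows "rl_kernel m (t0 - s) \<le> rl_kernel m t0 / rl_kernel m t * rl_kernel m (t - s)"
proof -
  have "((t0 - s) / (t - s)) powr (m - 1) \<le> (t0 / t) powr (m - 1)"
  proof (rule powr_mono2')
    have "s * t \<le> s * t0" using s by simp
    then show "t0 / t \<le> (t0 - s) / (t - s)" using s by (simp add: field_simps)
  qed (use m s in auto)
  then have "(t0 - s) powr (m - 1) \<le> t0 powr (m - 1) / t powr (m - 1) * (t - s) powr (m - 1)"
    using s by (simp add: powr_divide field_simps)
  then have "(t0 - s) powr (m - 1) / Gamma m \<le> t0 powr (m - 1) / t powr (m - 1) * (t - s) powr (m - 1) / Gamma m"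
    using m by (intro divide_right_mono) (auto simp: less_imp_le)
  moreover have "Gamma m \<noteq> 0" using Gamma_real_pos[OF m(1)] by linarith
  ultimately show ?thesis by (simp add: rl_kernel_def)
qed

lemma rl_kernel_integral_shift:
  assumes a: "0 < a" and t: "t < t0"
  shows "set_integrable lborel {t<..<t0} (\<lambda>s. rl_kernel a (t0 - s))"
    "(LINT s:{t<..<t0}|lborel. rl_kernel a (t0 - s)) = rl_kernel (a + 1) (t0 - t)"
proof -
  define h where "h s = indicat_real {0<..<t0 - t} s *\<^sub>R (rl_kernel a (t0 - t - s) * rl_kernel 1 s)" for s
  have e: "indicat_real {t<..<t0} s *\<^sub>R rl_kernel a (t0 - s) = h (- t + 1 * s)" for s
    by (auto simp: h_def indicator_def)
  note c = rl_kernel_conv[OF a zero_less_one, of "t0 - t", unfolded set_integrable_def set_lebesgue_integral_def, folded h_def]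
  show "set_integrable lborel {t<..<t0} (\<lambda>s. rl_kernel a (t0 - s))"
    unfolding set_integrable_def e using c(1) t by (intro lborel_integrable_real_affine) auto
  show "(LINT s:{t<..<t0}|lborel. rl_kernel a (t0 - s)) = rl_kernel (a + 1) (t0 - t)"
    unfolding set_lebesgue_integral_def e using c(2) t lborel_integral_real_affine[of 1 h "- t"] by simp
qed

lemma ml_pos_near_0:
  assumes m: "0 < m"
  shows "eventually (\<lambda>t. 0 < ml_kernel m m l t) (at_right 0)"
proof -
  let ?P = "\<lambda>x::real. \<Sum>k. (1 / Gamma (m + real k * m)) * x ^ k"
  have "isCont ?P 0"
    by (intro isCont_powser_converges_everywhere summable_ml_coeff) (use m in auto)
  then have "((\<lambda>t. ?P (- l * t powr m)) \<longlongrightarrow> ?P 0) (at_right 0)"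
  proof (rule isCont_tendsto_compose)
    have "((\<lambda>t. - l * t powr m) \<longlongrightarrow> - l * 0 powr m) (at_right 0)"
      using m by (intro tendsto_intros tendsto_powr') (auto simp: eventually_at_right_less intro: eventually_mono[OF eventually_at_right_less[of 0]])
    then show "((\<lambda>t. - l * t powr m) \<longlongrightarrow> 0) (at_right 0)" by simp
  qed
  then have lim: "((\<lambda>t. ?P (- l * t powr m)) \<longlongrightarrow> ?P 0) (at_right 0)" .
  have "?P 0 = 1 / Gamma m"
    using powser_zero[of "\<lambda>k. 1 / Gamma (m + real k * m)"] by simp
  then have "0 < ?P 0" using m by simp
  then have "eventually (\<lambda>t. 0 < ?P (- l * t powr m)) (at_right 0)"
    by (rule order_tendstoD(1)[OF lim])
  then show ?thesis
    using eventually_at_right_less[of 0]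
  proof eventually_elim
    case (elim t)
    then show ?case using ml_power_series[OF m less_imp_le[OF m], of t l] by simp
  qed
qed

text \<open>
  The kernel \<open>k = ml_kernel m m l\<close> solves the Volterra equation \<open>k + l * (g conv k) = g\<close> with
  \<open>g = rl_kernel m\<close>, and resolvents of log-convex kernels are positive. Let \<open>t0\<close> be the first zero of
  \<open>k\<close>, \<open>t1 < t0\<close>, and \<open>t\<close> a maximum point of \<open>k\<close> on \<open>[t1, t0]\<close>. The equations at \<open>t\<close> and \<open>t0\<close> are
  compared: for \<open>s < t\<close> by the monotone kernel ratio, for \<open>s > t\<close> by \<open>k s \<le> k t\<close>. After division by
  \<open>k t\<close> this bounds \<open>g t0 / g t\<close> by \<open>l\<close> times the integral of \<open>g\<close> over \<open>(0, t0 - t)\<close>, which is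
  impossible for \<open>t1\<close> near \<open>t0\<close>, where the left side tends to \<open>1\<close> and the right side to \<open>0\<close>.
\<close>

lemma ml_kernel_pos:
  assumes m: "0 < m" "m \<le> 1" and l: "0 \<le> l" and t: "0 < t"
  shows "0 < ml_kernel m m l t"
proof (rule ccontr)
  define k where "k = ml_kernel m m l"
  define g where "g = rl_kernel m"
  define Z where "Z = {t. 0 < t \<and> k t \<le> 0}"
  assume "\<not> 0 < ml_kernel m m l t"
  then have Z: "t \<in> Z" using t by (simp add: Z_def k_def)
  obtain d where d: "0 < d" "\<And>s. 0 < s \<Longrightarrow> s < d \<Longrightarrow> 0 < k s"
    using ml_pos_near_0[OF m(1), of l] unfolding eventually_at_right_field k_def by auto
  have bdd: "bdd_below Z" unfolding Z_def by (rule bdd_belowI[of _ 0]) auto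
  define t0 where "t0 = Inf Z"
  have "d \<le> t0" unfolding t0_def
    by (rule cInf_greatest) (use Z d in \<open>force simp: Z_def\<close>)+
  then have t0: "0 < t0" using d by simp
  have kpos: "0 < k s" if "0 < s" "s < t0" for s
  proof (rule ccontr)
    assume "\<not> 0 < k s"
    then have "s \<in> Z" using that by (simp add: Z_def)
    then have "t0 \<le> s" unfolding t0_def by (rule cInf_lower[OF _ bdd])
    then show False using that by simp
  qed
  have kc: "continuous_on {0<..} k"
    unfolding k_def by (rule continuous_on_ml) (use m in auto)
  have kt0: "k t0 \<le> 0"
  proof -
    have "Z = {d..} \<inter> Z" using d unfolding Z_def by force
    also have "\<dots> = {s\<in>{d..}. k s \<le> 0}" using d by (auto simp: Z_def)
    also have "closed \<dots>"
      using d by (intro continuous_on_closed_Collect_le closed_atLeast continuous_on_const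
          continuous_on_subset[OF kc]) auto
    finally have "Inf Z \<in> Z" by (intro closed_contains_Inf) (use Z bdd in auto)
    then show ?thesis by (simp add: Z_def t0_def)
  qed
  have eq: "k s = g s - l * (LINT r:{0<..<s}|lborel. g (s - r) * k r)"
    "set_integrable lborel {0<..<s} (\<lambda>r. g (s - r) * k r)" if "0 < s" for s
    using ml_rec[OF m(1) _ that, of m l] ml_conv[OF m(1) m(1) m(1) that, of l] m
    by (auto simp: k_def g_def)
  have gpos: "0 < g s" if "0 < s" for s using that m by (simp add: g_def rl_kernel_pos)
  \<comment> \<open>the comparison of the equations at \<open>t\<close> and at \<open>t0\<close>, with the dependence on \<open>t\<close> removed\<close>
  have key: "g t0 / g t1 \<le> l * rl_kernel (m + 1) (t0 - t1)" if t1: "0 < t1" "t1 < t0" for t1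
  proof -
    obtain t where t: "t \<in> {t1..t0}" "\<And>s. s \<in> {t1..t0} \<Longrightarrow> k s \<le> k t"
    proof -
      have "continuous_on {t1..t0} k" by (rule continuous_on_subset[OF kc]) (use t1 in auto)
      then show ?thesis
        using continuous_attains_sup[of "{t1..t0}" k] t1 that by auto
    qed
    have kt: "0 < k t" using t(2)[of t1] kpos[OF t1] t1 by simp
    then have tt: "t1 \<le> t" "t < t0" "0 < t" using t(1) kt0 t1 by (auto simp: order.order_iff_strict)
    define f where "f s = indicat_real {0<..<t0} s *\<^sub>R (g (t0 - s) * k s)" for s
    define p where "p s = indicat_real {0<..<t} s *\<^sub>R (g (t - s) * k s)" for s
    define q where "q s = indicat_real {t<..<t0} s *\<^sub>R g (t0 - s)" for s
    have fi: "integrable lborel f" "k t0 = g t0 - l * integral\<^sup>L lborel f"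
      using eq[OF t0] unfolding set_integrable_def set_lebesgue_integral_def f_def[abs_def] by auto
    have pi: "integrable lborel p" "k t = g t - l * integral\<^sup>L lborel p"
      using eq[OF tt(3)] unfolding set_integrable_def set_lebesgue_integral_def p_def[abs_def] by auto
    have qi: "integrable lborel q" "integral\<^sup>L lborel q = rl_kernel (m + 1) (t0 - t)"
      using rl_kernel_integral_shift[OF m(1) tt(2)]
      unfolding set_integrable_def set_lebesgue_integral_def q_def[abs_def] g_def by auto
    have "f s \<le> g t0 / g t * p s + k t * q s" if st: "s \<noteq> t" for s
    proof -
      consider "s \<le> 0 \<or> t0 \<le> s" | "0 < s" "s < t" | "t < s" "s < t0" using st by linarith
      then show ?thesis
      proof cases
        case 1
        then show ?thesis using tt by (auto simp: f_def p_def q_def)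
      next
        case 2
        have "g (t0 - s) * k s \<le> g t0 / g t * g (t - s) * k s"
          using rl_kernel_shift_ratio[OF m 2 tt(2)] kpos[of s] 2 tt by (intro mult_right_mono) (auto simp: g_def)
        then show ?thesis using 2 tt by (simp add: f_def p_def q_def)
      next
        case 3
        have "g (t0 - s) * k s \<le> g (t0 - s) * k t"
          using 3 t tt gpos[of "t0 - s"] by (intro mult_left_mono) auto
        then show ?thesis using 3 tt by (simp add: f_def p_def q_def mult.commute)
      qed
    qed
    then have ae: "AE s in lborel. f s \<le> g t0 / g t * p s + k t * q s"
      using AE_lborel_singleton[of t] by (auto elim: eventually_mono)
    have ig: "integrable lborel (\<lambda>s. g t0 / g t * p s)" "integrable lborel (\<lambda>s. k t * q s)"
      by (intro integrable_mult_right pi qi)+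
    have "integral\<^sup>L lborel f \<le> (LINT s|lborel. g t0 / g t * p s + k t * q s)"
      by (intro integral_mono_AE fi Bochner_Integration.integrable_add ig ae)
    also have "\<dots> = g t0 / g t * integral\<^sup>L lborel p + k t * rl_kernel (m + 1) (t0 - t)"
      by (subst Bochner_Integration.integral_add[OF ig]) (simp add: qi)
    finally have "l * integral\<^sup>L lborel f \<le> l * (g t0 / g t * integral\<^sup>L lborel p + k t * rl_kernel (m + 1) (t0 - t))"
      using l by (rule mult_left_mono)
    also have "\<dots> = g t0 / g t * (l * integral\<^sup>L lborel p) + l * rl_kernel (m + 1) (t0 - t) * k t"
      by (simp only: distrib_left mult_ac)
    also have "l * integral\<^sup>L lborel p = g t - k t" using pi by simp
    also have "g t0 / g t * (g t - k t) = g t0 - g t0 / g t * k t"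
      using gpos[OF tt(3)] by (simp add: right_diff_distrib)
    finally have "g t0 / g t * k t \<le> l * rl_kernel (m + 1) (t0 - t) * k t"
      using fi kt0 by linarith
    then have 1: "g t0 / g t \<le> l * rl_kernel (m + 1) (t0 - t)"
      using kt by (rule mult_right_le_imp_le)
    have "g t \<le> g t1" unfolding g_def rl_kernel_def using tt t1 m
      by (intro divide_right_mono powr_mono2') (auto simp: less_imp_le)
    then have "g t0 / g t1 \<le> g t0 / g t"
      using gpos[OF tt(3)] gpos[OF t0] by (intro divide_left_mono) auto
    also note 1
    also have "l * rl_kernel (m + 1) (t0 - t) \<le> l * rl_kernel (m + 1) (t0 - t1)"
      unfolding rl_kernel_def using tt t1 m l Gamma_real_pos[of "m + 1"]
      by (intro mult_left_mono divide_right_mono powr_mono2) (auto simp: less_imp_le)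
    finally show ?thesis .
  qed
  have "1 \<le> l * (0 / Gamma (m + 1))"
  proof (rule tendsto_le[of "at_left t0"])
    have "isCont g t0"
      using continuous_on_pk[of m] t0 by (simp add: g_def continuous_on_eq_continuous_at)
    then have gl: "(g \<longlongrightarrow> g t0) (at_left t0)"
      by (simp add: isCont_def filterlim_at_split)
    have "((\<lambda>t1. g t0 / g t1) \<longlongrightarrow> g t0 / g t0) (at_left t0)"
      using gpos[OF t0] gl by (intro tendsto_intros) auto
    then show "((\<lambda>t1. g t0 / g t1) \<longlongrightarrow> 1) (at_left t0)" using gpos[OF t0] by simp
    have "((\<lambda>t1. (t0 - t1) powr m) \<longlongrightarrow> (t0 - t0) powr m) (at_left t0)"
      using m by (intro tendsto_powr' tendsto_intros) (auto simp: eventually_at_filter)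
    then have z: "((\<lambda>t1. (t0 - t1) powr m) \<longlongrightarrow> 0) (at_left t0)" by simp
    show "((\<lambda>t1. l * ((t0 - t1) powr m / Gamma (m + 1))) \<longlongrightarrow> l * (0 / Gamma (m + 1))) (at_left t0)"
    proof -
      have "Gamma (m + 1) \<noteq> 0" using Gamma_real_pos[of "m + 1"] m by linarith
      then show ?thesis using z by (intro tendsto_intros) auto
    qed
    have "eventually (\<lambda>t1. t1 \<in> {0<..<t0}) (at_left t0)"
      using eventually_at_left_real[OF t0] by simp
    then show "eventually (\<lambda>t1. g t0 / g t1 \<le> l * ((t0 - t1) powr m / Gamma (m + 1))) (at_left t0)"
      by eventually_elim (use key in \<open>auto simp: rl_kernel_def\<close>)
  qed simp
  then show False by simp
qed

lemma ml_nonneg: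
  assumes m: "0 < m" "m \<le> 1" and l: "0 \<le> l" and b: "m \<le> b" and t: "0 < t"
  shows "0 \<le> ml_kernel m b l t"
proof (cases "b = m")
  case True
  then show ?thesis using ml_kernel_pos[OF m l t] by simp
next
  case False
  then have a: "0 < b - m" using b by simp
  have "0 \<le> (LINT s:{0<..<t}|lborel. rl_kernel (b - m) (t - s) * ml_kernel m m l s)"
    unfolding set_lebesgue_integral_def
    by (intro Bochner_Integration.integral_nonneg)
      (use a m rl_kernel_nonneg[of "b - m"] ml_kernel_pos[OF m l] in \<open>auto simp: indicator_def less_imp_le\<close>)
  then show ?thesis using ml_conv(2)[OF m(1) a m(1) t, of l] by simp
qed

lemma ml_le_rl_kernel:
  assumes "0 < m" "m \<le> 1" "0 \<le> l" "m \<le> b" "0 < t"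
  shows "ml_kernel m b l t \<le> rl_kernel b t"
  using ml_rec[of m b t l] ml_nonneg[of m l "b + m" t] assms by simp

lemma ml_mult_le_rl_kernel:
  assumes "0 < m" "m \<le> 1" "0 \<le> l" "m \<le> b" "0 < t"
  shows "l * ml_kernel m (b + m) l t \<le> rl_kernel b t"
  using ml_rec[of m b t l] ml_nonneg[of m l "b" t] assms by simp

text \<open>
  Both sides are convolutions with the positive kernel \<open>ml_kernel m m l\<close> up to power kernels, and
  \<open>t * rl_kernel b (t - s) - b * rl_kernel (b + 1) (t - s) = s * rl_kernel b (t - s)\<close> is nonnegative.
  Combined with \<open>ml_mult_le_rl_kernel\<close> this trades a factor \<open>l\<close> for a factor \<open>1 / t\<close>.
\<close>

lemma ml_decay:
  assumes m: "0 < m" "m \<le> 1" and l: "0 \<le> l" and b: "0 < b" and t: "0 < t"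
  shows "t * ml_kernel m b l t \<le> b * ml_kernel m (b + 1) l t"
proof -
  let ?f = "\<lambda>s. rl_kernel b (t - s) * ml_kernel m m l s" and ?g = "\<lambda>s. rl_kernel (b + 1) (t - s) * ml_kernel m m l s"
  have b1: "0 < b + 1" using b by simp
  note f = ml_conv[OF m(1) b m(1) t, of l] and g = ml_conv[OF m(1) b1 m(1) t, of l]
  have "0 \<le> (LINT s:{0<..<t}|lborel. t * ?f s - b * ?g s)"
    unfolding set_lebesgue_integral_def
  proof (intro Bochner_Integration.integral_nonneg)
    fix s
    show "0 \<le> indicat_real {0<..<t} s *\<^sub>R (t * ?f s - b * ?g s)"
    proof (cases "s \<in> {0<..<t}")
      case True
      have "t * ?f s - b * ?g s = s * ?f s"
      proof -
        have "b * ?g s = (b * rl_kernel (b + 1) (t - s)) * ml_kernel m m l s" by simp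
        also have "\<dots> = (t - s) * ?f s" using rl_kernel_Suc[OF b, of "t - s"] True by simp
        finally show ?thesis by (simp add: left_diff_distrib)
      qed
      moreover have "0 \<le> s * ?f s"
        using True rl_kernel_nonneg[of b] b ml_kernel_pos[OF m l, of s] by simp
      ultimately show ?thesis using True by simp
    qed simp
  qed
  also have "\<dots> = t * ml_kernel m (b + m) l t - b * ml_kernel m (b + 1 + m) l t"
    using f g by (simp add: set_integral_diff)
  finally have "l * (b * ml_kernel m (b + 1 + m) l t) \<le> l * (t * ml_kernel m (b + m) l t)"
    using l by (intro mult_left_mono) auto
  moreover have "l * ml_kernel m (b + m) l t = rl_kernel b t - ml_kernel m b l t"
    using ml_rec[of m b t l] m b t by simp
  moreover have "l * ml_kernel m (b + 1 + m) l t = rl_kernel (b + 1) t - ml_kernel m (b + 1) l t"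
    using ml_rec[of m "b + 1" t l] m b t by simp
  ultimately have "b * (rl_kernel (b + 1) t - ml_kernel m (b + 1) l t) \<le> t * (rl_kernel b t - ml_kernel m b l t)"
    by (simp only: mult.left_commute[of l])
  then show ?thesis using rl_kernel_Suc[OF b t] by (simp add: algebra_simps)
qed

lemma ml_mult_le:
  assumes m: "0 < m" "m \<le> 1" and l: "0 \<le> l" and b: "m \<le> b" and t: "0 < t"
  shows "l * ml_kernel m b l t \<le> b / t * rl_kernel (b + 1 - m) t"
proof -
  have "l * (t * ml_kernel m b l t) \<le> l * (b * ml_kernel m (b + 1) l t)"
    using l ml_decay[OF m l _ t, of b] b m by (intro mult_left_mono) auto
  also have "\<dots> = b * (l * ml_kernel m ((b + 1 - m) + m) l t)" by simp
  also have "\<dots> \<le> b * rl_kernel (b + 1 - m) t"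
    using b m by (intro mult_left_mono ml_mult_le_rl_kernel[OF m l _ t]) auto
  finally show ?thesis using t by (simp add: field_simps)
qed

lemma ml_has_derivative:
  assumes m: "0 < m" and b: "0 \<le> b" and t: "0 < t"
  shows "(ml_kernel m (b + 1) l has_real_derivative ml_kernel m b l t) (at t)"
proof -
  have pos: "(ml_kernel m (c + 1) l has_real_derivative ml_kernel m c l t) (at t)" if c: "0 < c" for c
  proof -
    let ?f = "ml_kernel m c l"
    have si: "set_integrable lborel {0<..<x} ?f" "(LINT s:{0<..<x}|lborel. ?f s) = ml_kernel m (c + 1) l x" if "0 < x" for x
    proof -
      have "set_integrable lborel {0<..<x} ?f = set_integrable lborel {0<..<x} (\<lambda>s. rl_kernel 1 (x - s) * ?f s)"
        by (rule set_integrable_cong) auto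
      then show "set_integrable lborel {0<..<x} ?f" using ml_conv(1)[OF m zero_less_one c that, of l] by simp
      have "(LINT s:{0<..<x}|lborel. ?f s) = (LINT s:{0<..<x}|lborel. rl_kernel 1 (x - s) * ?f s)"
        by (rule set_lebesgue_integral_cong) auto
      then show "(LINT s:{0<..<x}|lborel. ?f s) = ml_kernel m (c + 1) l x"
        using ml_conv(2)[OF m zero_less_one c that, of l] by (simp add: add.commute)
    qed
    have hi: "(?f has_integral ml_kernel m (c + 1) l x) {0..x}" if "0 < x" for x
      using set_borel_integral_eq_integral[OF si(1)[OF that]] si(2)[OF that]
      by (intro has_integral_Icc_iff_Ioo[THEN iffD2]) (simp add: has_integral_iff)
    have "((\<lambda>u. integral {0..u} ?f) has_vector_derivative ?f t) (at t within {0..2*t})"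
    proof (rule integral_has_vector_derivative_continuous_at[where S = "{}", simplified])
      show "?f integrable_on {0..2*t}" using hi[of "2*t"] t by (auto simp: has_integral_iff)
      have "continuous (at t) ?f"
        using continuous_on_ml[OF m less_imp_le[OF c], of l] t by (simp add: continuous_on_eq_continuous_at)
      then show "continuous (at t within {0..2*t}) ?f" by (rule continuous_at_imp_continuous_at_within)
    qed (use t in auto)
    then have "((\<lambda>u. integral {0..u} ?f) has_vector_derivative ?f t) (at t within {0<..<2*t})"
      by (rule has_vector_derivative_within_subset) auto
    then have "((\<lambda>u. integral {0..u} ?f) has_vector_derivative ?f t) (at t)"
      using at_within_open[of t "{0<..<2*t}"] t by simp
    then have "(ml_kernel m (c + 1) l has_vector_derivative ?f t) (at t)"
    proof (rule has_vector_derivative_transform_within_open[where S = "{0<..}"])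
      fix x :: real assume "x \<in> {0<..}"
      then show "integral {0..x} ?f = ml_kernel m (c + 1) l x" using hi[of x] by (auto simp: has_integral_iff)
    qed (use t in auto)
    then show ?thesis by (simp add: has_real_derivative_iff_has_vector_derivative)
  qed
  show ?thesis
  proof (cases "b = 0")
    case False
    then show ?thesis using pos[of b] b by simp
  next
    case True
    have "((\<lambda>x. 1 - l * ml_kernel m (m + 1) l x) has_real_derivative (0 - l * ml_kernel m m l t)) (at t)"
      by (intro DERIV_diff DERIV_const DERIV_cmult pos m)
    moreover have "0 - l * ml_kernel m m l t = ml_kernel m 0 l t"
      using ml_rec[of m 0 t l] m t by simp
    ultimately have "((\<lambda>x. 1 - l * ml_kernel m (m + 1) l x) has_real_derivative ml_kernel m 0 l t) (at t)" by simp
    then have "(ml_kernel m 1 l has_real_derivative ml_kernel m 0 l t) (at t)"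
    proof (rule has_field_derivative_transform_within_open[where S = "{0<..}"])
      fix x :: real assume "x \<in> {0<..}"
      then show "1 - l * ml_kernel m (m + 1) l x = ml_kernel m 1 l x"
        using ml_rec[of m 1 x l] m by (simp add: add.commute)
    qed (use t in auto)
    then show ?thesis using True by simp
  qed
qed


section \<open>Eigenvectors of an operator with compact resolvent\<close>

lemma power2_norm_add_scaleR:
  fixes u v :: "'h::real_inner"
  shows "(norm (u + t *\<^sub>R v))\<^sup>2 = (norm u)\<^sup>2 + 2 * t * (v \<bullet> u) + t\<^sup>2 * (norm v)\<^sup>2"
  unfolding power2_norm_eq_inner inner_add_left inner_add_right inner_scaleR_left inner_scaleR_right
  by (simp add: inner_commute power2_eq_square algebra_simps)

text \<open>
  The projection theorem: a minimising sequence for the distance to \<open>M\<close> is Cauchy by the parallelogram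
  identity.
\<close>

lemma closed_subspace_orthogonal_vector:
  fixes M :: "'h::{real_inner,complete_space} set"
  assumes M: "subspace M" "closed M" and x: "x \<notin> M"
  obtains p y where "p \<in> M" "x = p + y" "y \<noteq> 0" "\<And>m. m \<in> M \<Longrightarrow> y \<bullet> m = 0"
proof -
  define d where "d = Inf ((\<lambda>p. (norm (x - p))\<^sup>2) ` M)"
  have ne: "M \<noteq> {}" using subspace_0[OF M(1)] by auto
  have bdd: "bdd_below ((\<lambda>p. (norm (x - p))\<^sup>2) ` M)" by (rule bdd_belowI[of _ 0]) auto
  have d: "d \<le> (norm (x - p))\<^sup>2" if "p \<in> M" for p
    unfolding d_def using that by (intro cInf_lower bdd) auto
  have "\<exists>p\<in>M. (norm (x - p))\<^sup>2 < d + inverse (real (Suc n))" for n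
    using cInf_lessD[of "(\<lambda>p. (norm (x - p))\<^sup>2) ` M" "d + inverse (real (Suc n))"] ne
    by (auto simp: d_def)
  then obtain p where p: "\<And>n. p n \<in> M" "\<And>n. (norm (x - p n))\<^sup>2 < d + inverse (real (Suc n))"
    by metis
  have par: "(norm (p n - p m))\<^sup>2 \<le> 2 * inverse (real (Suc n)) + 2 * inverse (real (Suc m))" for n m
  proof -
    have "(1/2) *\<^sub>R (p n + p m) \<in> M" using p(1) M(1) by (intro subspace_scale subspace_add) auto
    then have "4 * d \<le> 4 * (norm (x - (1/2) *\<^sub>R (p n + p m)))\<^sup>2" using d by simp
    also have "\<dots> = 2 * (norm (x - p n))\<^sup>2 + 2 * (norm (x - p m))\<^sup>2 - (norm (p n - p m))\<^sup>2"
      by (simp add: power2_norm_eq_inner inner_diff inner_add algebra_simps inner_commute)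
    finally show ?thesis using p(2)[of n] p(2)[of m] by simp
  qed
  have "Cauchy p"
  proof (rule metric_CauchyI)
    fix e :: real assume e: "0 < e"
    obtain N where N: "inverse (real (Suc N)) < e\<^sup>2 / 4"
      using reals_Archimedean[of "e\<^sup>2 / 4"] e by auto
    have "dist (p m) (p n) < e" if "N \<le> m" "N \<le> n" for m n
    proof -
      have "inverse (real (Suc m)) \<le> inverse (real (Suc N))" "inverse (real (Suc n)) \<le> inverse (real (Suc N))"
        using that by (auto intro!: le_imp_inverse_le)
      then have "(norm (p m - p n))\<^sup>2 < e\<^sup>2" using par[of m n] N by linarith
      then show ?thesis using e by (simp add: dist_norm power2_less_imp_less)
    qed
    then show "\<exists>N. \<forall>m\<ge>N. \<forall>n\<ge>N. dist (p m) (p n) < e" by blast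
  qed
  then obtain q where q: "p \<longlonglongrightarrow> q" by (auto simp: Cauchy_convergent_iff convergent_def)
  have qM: "q \<in> M" using closed_sequentially[OF M(2)] p(1) q by blast
  have "(norm (x - q))\<^sup>2 \<le> d + 0"
  proof (rule LIMSEQ_le)
    show "(\<lambda>n. (norm (x - p n))\<^sup>2) \<longlonglongrightarrow> (norm (x - q))\<^sup>2" by (intro tendsto_intros q)
    show "(\<lambda>n. d + inverse (real (Suc n))) \<longlonglongrightarrow> d + 0"
      by (intro tendsto_intros LIMSEQ_inverse_real_of_nat)
    show "\<exists>N. \<forall>n\<ge>N. (norm (x - p n))\<^sup>2 \<le> d + inverse (real (Suc n))" using p(2) by (auto intro: less_imp_le)
  qed
  then have qd: "(norm (x - q))\<^sup>2 \<le> d" by simp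
  show thesis
  proof
    show "q \<in> M" by (rule qM)
    show "x = q + (x - q)" by simp
    show "x - q \<noteq> 0" using qM x by auto
    fix m assume m: "m \<in> M"
    have *: "2 * t * ((x - q) \<bullet> m) \<le> t\<^sup>2 * (m \<bullet> m)" for t
    proof -
      have "q + t *\<^sub>R m \<in> M" using qM m M(1) by (intro subspace_add subspace_scale)
      then have "(norm (x - q))\<^sup>2 \<le> (norm (x - (q + t *\<^sub>R m)))\<^sup>2" using d qd by (meson order_trans)
      also have "x - (q + t *\<^sub>R m) = (x - q) - t *\<^sub>R m" by simp
      also have "(norm ((x - q) - t *\<^sub>R m))\<^sup>2 = (norm (x - q))\<^sup>2 - 2 * t * ((x - q) \<bullet> m) + t\<^sup>2 * (m \<bullet> m)"
        using power2_norm_add_scaleR[of "x - q" "- t" m] by (simp add: power2_norm_eq_inner inner_commute)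
      finally show ?thesis by simp
    qed
    show "(x - q) \<bullet> m = 0"
    proof (cases "m = 0")
      case False
      then have mm: "0 < m \<bullet> m" by simp
      let ?a = "(x - q) \<bullet> m"
      have "2 * (?a / (m \<bullet> m)) * ?a \<le> (?a / (m \<bullet> m))\<^sup>2 * (m \<bullet> m)" by (rule *)
      then have "2 * (?a * ?a) / (m \<bullet> m) \<le> (?a * ?a) / (m \<bullet> m)"
        using mm by (simp add: power2_eq_square)
      then have "2 * (?a * ?a) \<le> ?a * ?a" using mm by (simp add: divide_right_mono divide_le_cancel)
      then have "?a * ?a \<le> 0" by simp
      then show ?thesis by (auto simp: mult_le_0_iff)
    qed simp
  qed
qed

lemma quadratic_nonneg_imp_linear_zero:
  fixes a b :: real
  assumes "\<And>t. 0 \<le> 2 * t * a + t\<^sup>2 * b"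
  shows "a = 0"
proof (rule ccontr)
  assume a: "a \<noteq> 0"
  define c where "c = \<bar>b\<bar> + 1"
  have c: "0 < c" "b < c" by (auto simp: c_def)
  have "0 \<le> 2 * (- a / c) * a + (- a / c)\<^sup>2 * b" by (rule assms)
  also have "\<dots> < 2 * (- a / c) * a + (- a / c)\<^sup>2 * c"
    using a c by (intro add_strict_left_mono mult_strict_left_mono) auto
  also have "\<dots> = - (a * a) / c" using c by (simp add: power2_eq_square field_simps)
  also have "\<dots> \<le> 0" using c by (simp add: divide_nonpos_pos)
  finally show False by simp
qed

definition partial_expansion :: "(nat \<Rightarrow> 'h::real_inner) \<Rightarrow> nat \<Rightarrow> 'h \<Rightarrow> 'h" where
  "partial_expansion \<phi> n x = (\<Sum>i<n. (x \<bullet> \<phi> i) *\<^sub>R \<phi> i)"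

text \<open>
  Zero vectors pad the sequence when the space has finite dimension, so that the index set is always
  \<open>nat\<close>.
\<close>

definition orthonormal_or_zero :: "(nat \<Rightarrow> 'h::real_inner) \<Rightarrow> bool" where
  "orthonormal_or_zero \<phi> \<longleftrightarrow> (\<forall>i j. i \<noteq> j \<longrightarrow> \<phi> i \<bullet> \<phi> j = 0) \<and> (\<forall>i. \<phi> i = 0 \<or> norm (\<phi> i) = 1)"

lemma inner_self_orthonormal: "\<phi> i = 0 \<or> norm (\<phi> i) = (1::real) \<Longrightarrow> (x \<bullet> \<phi> i) * (\<phi> i \<bullet> \<phi> i) = x \<bullet> \<phi> i"
  by (auto simp: dot_square_norm)

lemma partial_expansion_inner:
  assumes "\<And>i j. i < n \<Longrightarrow> j < n \<Longrightarrow> i \<noteq> j \<Longrightarrow> \<phi> i \<bullet> \<phi> j = (0::real)" "\<And>i. i < n \<Longrightarrow> \<phi> i = 0 \<or> norm (\<phi> i) = 1" "j < n"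
  shows "partial_expansion \<phi> n x \<bullet> \<phi> j = x \<bullet> \<phi> j"
proof -
  have "partial_expansion \<phi> n x \<bullet> \<phi> j = (\<Sum>i<n. if i = j then x \<bullet> \<phi> j else 0)"
    unfolding partial_expansion_def inner_sum_left
  proof (rule sum.cong[OF refl])
    fix i assume "i \<in> {..<n}"
    then show "(x \<bullet> \<phi> i) *\<^sub>R \<phi> i \<bullet> \<phi> j = (if i = j then x \<bullet> \<phi> j else 0)"
      using assms(1)[of i j] inner_self_orthonormal[of \<phi> j x] assms(2,3) by auto
  qed
  then show ?thesis using assms(3) by simp
qed

lemma partial_expansion_diff: "partial_expansion \<phi> n (x - y) = partial_expansion \<phi> n x - partial_expansion \<phi> n y"
  by (simp add: partial_expansion_def inner_diff_left scaleR_left_diff_distrib sum_subtractf)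

lemma norm_diff_partial_expansion_le:
  assumes "\<And>i j. i < n \<Longrightarrow> j < n \<Longrightarrow> i \<noteq> j \<Longrightarrow> \<phi> i \<bullet> \<phi> j = (0::real)" "\<And>i. i < n \<Longrightarrow> \<phi> i = 0 \<or> norm (\<phi> i) = 1"
  shows "norm (x - partial_expansion \<phi> n x) \<le> norm x"
proof -
  let ?P = "partial_expansion \<phi> n x"
  have "(x - ?P) \<bullet> ?P = 0"
  proof -
    have "(x - ?P) \<bullet> ?P = (\<Sum>i<n. (x \<bullet> \<phi> i) * ((x - ?P) \<bullet> \<phi> i))"
      by (subst (2) partial_expansion_def) (simp add: inner_sum_right)
    also have "\<dots> = 0"
      using partial_expansion_inner[of n \<phi> _ x] assms by (intro sum.neutral) (auto simp: inner_diff_left)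
    finally show ?thesis .
  qed
  then have "(norm x)\<^sup>2 = (norm (x - ?P))\<^sup>2 + (norm ?P)\<^sup>2"
    unfolding power2_norm_eq_inner by (simp add: inner_diff inner_commute)
  then have "(norm (x - ?P))\<^sup>2 \<le> (norm x)\<^sup>2" using zero_le_power2[of "norm ?P"] by linarith
  then show ?thesis by (rule power2_le_imp_le) simp
qed

locale compact_selfadjoint =
  fixes H D :: "'h::{real_inner,complete_space} set" and A :: "'h \<Rightarrow> 'h"
  assumes closedH: "closed H" and sa: "selfadjoint_operator H D A"
    and nonneg: "\<And>u. u \<in> D \<Longrightarrow> 0 \<le> A u \<bullet> u"
    and compact_emb: "domain_compactly_embedded D A"
begin

lemma subspace_D: "subspace D" and D_H: "D \<subseteq> H" and dense: "H \<subseteq> closure D"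
  and A_H: "u \<in> D \<Longrightarrow> A u \<in> H"
  and A_add: "u \<in> D \<Longrightarrow> v \<in> D \<Longrightarrow> A (u + v) = A u + A v"
  and A_scale: "u \<in> D \<Longrightarrow> A (c *\<^sub>R u) = c *\<^sub>R A u"
  and adjoint: "x \<in> H \<Longrightarrow> y \<in> H \<Longrightarrow> (\<And>z. z \<in> D \<Longrightarrow> A z \<bullet> x = z \<bullet> y) \<Longrightarrow> x \<in> D \<and> A x = y"
proof -
  show "subspace D" "D \<subseteq> H" "H \<subseteq> closure D" "u \<in> D \<Longrightarrow> A u \<in> H"
    "u \<in> D \<Longrightarrow> v \<in> D \<Longrightarrow> A (u + v) = A u + A v" "u \<in> D \<Longrightarrow> A (c *\<^sub>R u) = c *\<^sub>R A u"
    using sa by (auto simp: selfadjoint_operator_def linear_on_set_def)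
  show "x \<in> H \<Longrightarrow> y \<in> H \<Longrightarrow> (\<And>z. z \<in> D \<Longrightarrow> A z \<bullet> x = z \<bullet> y) \<Longrightarrow> x \<in> D \<and> A x = y"
    using sa unfolding selfadjoint_operator_def by blast
qed

lemma symmetric: "u \<in> D \<Longrightarrow> v \<in> D \<Longrightarrow> A u \<bullet> v = u \<bullet> A v"
proof -
  assume u: "u \<in> D" and v: "v \<in> D"
  have "\<forall>x\<in>H. \<forall>y\<in>H. (\<forall>z\<in>D. A z \<bullet> x = z \<bullet> y) \<longleftrightarrow> x \<in> D \<and> A x = y"
    using sa unfolding selfadjoint_operator_def by blast
  then have "(\<forall>z\<in>D. A z \<bullet> v = z \<bullet> A v) \<longleftrightarrow> v \<in> D \<and> A v = A v"
    using D_H v A_H[OF v] by blast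
  then show ?thesis using u v by simp
qed

lemma A_diff: "u \<in> D \<Longrightarrow> v \<in> D \<Longrightarrow> A (u - v) = A u - A v"
proof -
  assume u: "u \<in> D" and v: "v \<in> D"
  have "A (u + (-1) *\<^sub>R v) = A u + A ((-1) *\<^sub>R v)"
    by (rule A_add[OF u subspace_scale[OF subspace_D v]])
  then show ?thesis using A_scale[OF v, of "-1"] by simp
qed

lemma A_zero: "A 0 = 0"
  using A_scale[of 0 0] subspace_0[OF subspace_D] by simp

lemma A_sum: "finite I \<Longrightarrow> (\<And>i. i \<in> I \<Longrightarrow> f i \<in> D) \<Longrightarrow> A (\<Sum>i\<in>I. f i) = (\<Sum>i\<in>I. A (f i))"
proof (induction I rule: finite_induct)
  case (insert i I)
  then show ?case by (simp add: A_add subspace_sum[OF subspace_D])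
qed (simp add: A_zero)

lemma closed_operator:
  assumes "\<And>n. X n \<in> D" "X \<longlonglongrightarrow> x" "(\<lambda>n. A (X n)) \<longlonglongrightarrow> y"
  shows "x \<in> D" "A x = y"
proof -
  have "x \<in> H" using closed_sequentially[OF closedH _ assms(2)] assms(1) D_H by blast
  moreover have "y \<in> H" using closed_sequentially[OF closedH _ assms(3)] assms(1) A_H by blast
  moreover have "A z \<bullet> x = z \<bullet> y" if z: "z \<in> D" for z
  proof (rule LIMSEQ_unique)
    show "(\<lambda>n. A z \<bullet> X n) \<longlonglongrightarrow> A z \<bullet> x" by (intro tendsto_intros assms)
    have "(\<lambda>n. z \<bullet> A (X n)) \<longlonglongrightarrow> z \<bullet> y" by (intro tendsto_intros assms)
    then show "(\<lambda>n. A z \<bullet> X n) \<longlonglongrightarrow> z \<bullet> y" using symmetric[OF z assms(1)] by simp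
  qed
  ultimately show "x \<in> D" "A x = y" using adjoint by blast+
qed

lemma bounded_graph_subseq:
  assumes "\<And>n. X n \<in> D" "\<And>n. (norm (X n))\<^sup>2 + (norm (A (X n)))\<^sup>2 \<le> C"
  obtains h x where "strict_mono (h :: nat \<Rightarrow> nat)" "(X \<circ> h) \<longlonglongrightarrow> x"
proof -
  have C: "0 \<le> C" using assms(2)[of 0] by (smt (verit) zero_le_power2)
  define q where "q = 1 / sqrt (C + 1)"
  have q: "0 < q" "q\<^sup>2 * C \<le> 1" using C by (auto simp: q_def power_divide)
  let ?K = "closure {x\<in>D. (norm x)\<^sup>2 + (norm (A x))\<^sup>2 \<le> 1}"
  have "q *\<^sub>R X n \<in> ?K" for n
  proof -
    have "(norm (q *\<^sub>R X n))\<^sup>2 + (norm (A (q *\<^sub>R X n)))\<^sup>2 = q\<^sup>2 * ((norm (X n))\<^sup>2 + (norm (A (X n)))\<^sup>2)"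
      using assms(1) q by (simp add: A_scale power_mult_distrib algebra_simps)
    also have "\<dots> \<le> q\<^sup>2 * C" by (intro mult_left_mono assms) auto
    also note q(2)
    finally have "q *\<^sub>R X n \<in> {x\<in>D. (norm x)\<^sup>2 + (norm (A x))\<^sup>2 \<le> 1}"
      using assms(1) subspace_scale[OF subspace_D] by auto
    then show ?thesis by (rule subsetD[OF closure_subset])
  qed
  then obtain z h where h: "strict_mono (h :: nat \<Rightarrow> nat)" "((\<lambda>n. q *\<^sub>R X n) \<circ> h) \<longlonglongrightarrow> z"
    using compact_emb[unfolded domain_compactly_embedded_def compact_def, rule_format, of "\<lambda>n. q *\<^sub>R X n"] by blast
  have "(\<lambda>n. (1/q) *\<^sub>R ((\<lambda>n. q *\<^sub>R X n) \<circ> h) n) \<longlonglongrightarrow> (1/q) *\<^sub>R z"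
    by (intro tendsto_intros h)
  then have "(X \<circ> h) \<longlonglongrightarrow> (1/q) *\<^sub>R z" using q by (simp add: o_def)
  then show thesis using h(1) that by blast
qed

text \<open>
  Minimise \<open>norm (A x)\<close> over the unit vectors of \<open>D\<close> orthogonal to the eigenvectors found so far. Compactness and
  the parallelogram identity give a minimiser. The first variation says that \<open>A z \<bullet> A x = r * (z \<bullet> x)\<close>, first on
  the orthogonal complement and then for all \<open>z\<close> in \<open>D\<close>; by selfadjointness \<open>A x\<close> lies in \<open>D\<close> and
  \<open>A (A x) = r *\<^sub>R x\<close>. With \<open>c = sqrt r > 0\<close> a nonzero \<open>A x - c *\<^sub>R x\<close> would be an eigenvector for \<open>- c\<close>, which
  nonnegativity excludes.
\<close>

lemma next_eigenvector:
  fixes \<phi> :: "nat \<Rightarrow> 'h"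
  assumes orth: "\<And>i j. i < n \<Longrightarrow> j < n \<Longrightarrow> i \<noteq> j \<Longrightarrow> \<phi> i \<bullet> \<phi> j = 0"
    and unit: "\<And>i. i < n \<Longrightarrow> \<phi> i = 0 \<or> norm (\<phi> i) = 1"
    and eig: "\<And>i. i < n \<Longrightarrow> \<phi> i \<in> D \<and> A (\<phi> i) = l i *\<^sub>R \<phi> i"
    and nontriv: "y0 \<in> D" "\<And>i. i < n \<Longrightarrow> y0 \<bullet> \<phi> i = 0" "y0 \<noteq> 0"
  shows "\<exists>x c. x \<in> D \<and> 0 \<le> c \<and> A x = c *\<^sub>R x \<and> norm x = 1 \<and> (\<forall>i<n. x \<bullet> \<phi> i = 0) \<and>
    (\<forall>y\<in>D. (\<forall>i<n. y \<bullet> \<phi> i = 0) \<longrightarrow> c * norm y \<le> norm (A y))"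
proof -
  define M where "M = {x\<in>D. \<forall>i<n. x \<bullet> \<phi> i = 0}"
  have MD: "x \<in> M \<Longrightarrow> x \<in> D" for x by (simp add: M_def)
  have Ms: "subspace M"
    unfolding M_def subspace_def using subspace_D by (auto simp: subspace_def inner_add_left)
  define R where "R = (\<lambda>x. (norm (A x))\<^sup>2) ` {x\<in>M. norm x = 1}"
  define r where "r = Inf R"
  have "(1 / norm y0) *\<^sub>R y0 \<in> {x\<in>M. norm x = 1}"
    using nontriv subspace_scale[OF Ms, of y0] by (auto simp: M_def)
  then have ne: "R \<noteq> {}" by (auto simp: R_def)
  have bdd: "bdd_below R" by (rule bdd_belowI[of _ 0]) (auto simp: R_def)
  have r0: "0 \<le> r" unfolding r_def by (rule cInf_greatest[OF ne]) (auto simp: R_def)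
  have rM: "r * (norm y)\<^sup>2 \<le> (norm (A y))\<^sup>2" if y: "y \<in> M" for y
  proof (cases "y = 0")
    case False
    then have "(1 / norm y) *\<^sub>R y \<in> {x\<in>M. norm x = 1}" using subspace_scale[OF Ms y] by auto
    then have "r \<le> (norm (A ((1 / norm y) *\<^sub>R y)))\<^sup>2"
      unfolding r_def R_def by (intro cInf_lower imageI bdd[unfolded R_def])
    also have "\<dots> = (norm (A y))\<^sup>2 / (norm y)\<^sup>2" using MD[OF y] by (simp add: A_scale power_divide)
    finally show ?thesis using False by (simp add: field_simps)
  qed simp
  have "\<exists>x\<in>M. norm x = 1 \<and> (norm (A x))\<^sup>2 < r + inverse (real (Suc k))" for k
    using cInf_lessD[OF ne, of "r + inverse (real (Suc k))"] by (auto simp: r_def R_def)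
  then obtain X where X: "\<And>k. X k \<in> M" "\<And>k. norm (X k) = 1"
      "\<And>k. (norm (A (X k)))\<^sup>2 < r + inverse (real (Suc k))"
    by metis
  have "(norm (X k))\<^sup>2 + (norm (A (X k)))\<^sup>2 \<le> 2 + r" for k
    using X(2,3)[of k] le_imp_inverse_le[of 1 "real (Suc k)"] by simp
  then obtain h x where h: "strict_mono h" and lim: "(X \<circ> h) \<longlonglongrightarrow> x"
    using bounded_graph_subseq[of X] X(1) MD by metis
  define Y where "Y = X \<circ> h"
  have Y: "Y k \<in> M" "norm (Y k) = 1" "(norm (A (Y k)))\<^sup>2 < r + inverse (real (Suc k))" for k
  proof -
    show "Y k \<in> M" "norm (Y k) = 1" using X by (auto simp: Y_def)
    have "inverse (real (Suc (h k))) \<le> inverse (real (Suc k))"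
      using seq_suble[OF h, of k] by (intro le_imp_inverse_le) auto
    then show "(norm (A (Y k)))\<^sup>2 < r + inverse (real (Suc k))"
      using X(3)[of "h k"] unfolding Y_def o_def by linarith
  qed
  have Ylim: "Y \<longlonglongrightarrow> x" using lim by (simp add: Y_def)
  have par: "(norm (A (Y k) - A (Y j)))\<^sup>2 \<le> 2 * inverse (real (Suc k)) + 2 * inverse (real (Suc j)) + r * (norm (Y k - Y j))\<^sup>2" for k j
  proof -
    have s: "Y k + Y j \<in> M" using Y(1) Ms by (intro subspace_add)
    have p: "(norm (u - v))\<^sup>2 = 2 * (norm u)\<^sup>2 + 2 * (norm v)\<^sup>2 - (norm (u + v))\<^sup>2" for u v :: 'h
      by (simp add: power2_norm_eq_inner inner_diff inner_add inner_commute)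
    have "(norm (A (Y k) - A (Y j)))\<^sup>2 = 2 * (norm (A (Y k)))\<^sup>2 + 2 * (norm (A (Y j)))\<^sup>2 - (norm (A (Y k + Y j)))\<^sup>2"
      using p[of "A (Y k)" "A (Y j)"] A_add[OF MD[OF Y(1)] MD[OF Y(1)], of k j] by simp
    also have "\<dots> \<le> 2 * (r + inverse (real (Suc k))) + 2 * (r + inverse (real (Suc j))) - r * (norm (Y k + Y j))\<^sup>2"
      using Y(3)[of k] Y(3)[of j] rM[OF s] by simp
    also have "(norm (Y k + Y j))\<^sup>2 = 4 - (norm (Y k - Y j))\<^sup>2"
      using p[of "Y k" "Y j"] Y(2) by simp
    finally show ?thesis by (simp add: algebra_simps)
  qed
  have "Cauchy (\<lambda>k. A (Y k))"
  proof (rule metric_CauchyI)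
    fix e :: real assume e: "0 < e"
    obtain N where N: "inverse (real (Suc N)) < e\<^sup>2 / 8"
      using reals_Archimedean[of "e\<^sup>2 / 8"] e by auto
    define d where "d = e / sqrt (2 * (r + 1))"
    have "s * (e / sqrt (2 * s))\<^sup>2 = e\<^sup>2 / 2" if "0 < s" for s
      using that by (simp add: power_divide)
    then have d: "(r + 1) * d\<^sup>2 = e\<^sup>2 / 2" unfolding d_def using r0 by (metis add_nonneg_pos zero_less_one)
    have d2: "0 < d" using e r0 by (simp add: d_def)
    obtain N2 where N2: "\<And>m n. m \<ge> N2 \<Longrightarrow> n \<ge> N2 \<Longrightarrow> dist (Y m) (Y n) < d"
      using LIMSEQ_imp_Cauchy[OF Ylim] d2 unfolding Cauchy_def by meson
    have "dist (A (Y m)) (A (Y n)) < e" if "max N N2 \<le> m" "max N N2 \<le> n" for m n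
    proof -
      have i: "inverse (real (Suc m)) \<le> inverse (real (Suc N))" "inverse (real (Suc n)) \<le> inverse (real (Suc N))"
        using that by (auto intro!: le_imp_inverse_le)
      have "norm (Y m - Y n) < d" using N2[of m n] that by (simp add: dist_norm)
      then have "(norm (Y m - Y n))\<^sup>2 \<le> d\<^sup>2" by (intro power_mono) auto
      then have "r * (norm (Y m - Y n))\<^sup>2 \<le> r * d\<^sup>2" using r0 by (rule mult_left_mono)
      also have "\<dots> \<le> (r + 1) * d\<^sup>2" by (intro mult_right_mono) auto
      also have "\<dots> = e\<^sup>2 / 2" by (rule d)
      finally have "(norm (A (Y m) - A (Y n)))\<^sup>2 < e\<^sup>2" using par[of m n] N i by linarith
      then show ?thesis using e by (simp add: dist_norm power2_less_imp_less)
    qed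
    then show "\<exists>N. \<forall>m\<ge>N. \<forall>n\<ge>N. dist (A (Y m)) (A (Y n)) < e" by blast
  qed
  then obtain y where y: "(\<lambda>k. A (Y k)) \<longlonglongrightarrow> y" by (auto simp: Cauchy_convergent_iff convergent_def)
  have x: "x \<in> D" "A x = y" by (rule closed_operator[OF MD[OF Y(1)] Ylim y])+
  have nx: "norm x = 1" using LIMSEQ_unique[OF tendsto_norm[OF Ylim]] Y(2) by simp
  have xM: "x \<in> M"
  proof -
    have "x \<bullet> \<phi> i = 0" if "i < n" for i
    proof (rule LIMSEQ_unique)
      show "(\<lambda>k. Y k \<bullet> \<phi> i) \<longlonglongrightarrow> x \<bullet> \<phi> i" by (intro tendsto_intros Ylim)
      show "(\<lambda>k. Y k \<bullet> \<phi> i) \<longlonglongrightarrow> 0" using Y(1) that by (simp add: M_def)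
    qed
    then show ?thesis using x by (simp add: M_def)
  qed
  have "(norm y)\<^sup>2 \<le> r + 0"
  proof (rule LIMSEQ_le)
    show "(\<lambda>n. (norm (A (Y n)))\<^sup>2) \<longlonglongrightarrow> (norm y)\<^sup>2" by (intro tendsto_intros y)
    show "(\<lambda>n. r + inverse (real (Suc n))) \<longlonglongrightarrow> r + 0"
      by (intro tendsto_intros LIMSEQ_inverse_real_of_nat)
    show "\<exists>N. \<forall>n\<ge>N. (norm (A (Y n)))\<^sup>2 \<le> r + inverse (real (Suc n))" using Y(3) by (auto intro: less_imp_le)
  qed
  then have Ax: "(norm (A x))\<^sup>2 = r" using rM[OF xM] nx x by simp
  have EL: "A z \<bullet> A x = r * (z \<bullet> x)" if z: "z \<in> M" for z
  proof -
    have "0 \<le> 2 * t * (A z \<bullet> A x - r * (z \<bullet> x)) + t\<^sup>2 * ((norm (A z))\<^sup>2 - r * (norm z)\<^sup>2)" for t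
    proof -
      have "x + t *\<^sub>R z \<in> M" using xM z Ms by (intro subspace_add subspace_scale)
      from rM[OF this] have "r * (norm (x + t *\<^sub>R z))\<^sup>2 \<le> (norm (A x + t *\<^sub>R A z))\<^sup>2"
        using x(1) MD[OF z] subspace_scale[OF subspace_D] by (simp add: A_add A_scale)
      moreover have "(norm (u + t *\<^sub>R v))\<^sup>2 = (norm u)\<^sup>2 + 2 * t * (v \<bullet> u) + t\<^sup>2 * (norm v)\<^sup>2" for u v :: 'h
        by (rule power2_norm_add_scaleR)
      ultimately show ?thesis using nx Ax by (simp add: algebra_simps)
    qed
    from quadratic_nonneg_imp_linear_zero[OF this] show ?thesis by simp
  qed
  have AAx: "A x \<in> D \<and> A (A x) = r *\<^sub>R x"
  proof (rule adjoint)
    show "A x \<in> H" "r *\<^sub>R x \<in> H" using x(1) A_H D_H subspace_scale[OF subspace_D] by auto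
    fix z assume z: "z \<in> D"
    let ?P = "partial_expansion \<phi> n z"
    have PD: "?P \<in> D" unfolding partial_expansion_def
      using eig by (intro subspace_sum subspace_scale subspace_D) auto
    have zM: "z - ?P \<in> M"
      using partial_expansion_inner[of n \<phi> _ z] orth unit z PD subspace_diff[OF subspace_D]
      by (auto simp: M_def inner_diff_left)
    have "?P \<bullet> x = 0" unfolding partial_expansion_def inner_sum_left
      using xM by (intro sum.neutral) (auto simp: M_def inner_commute)
    have "A ?P = (\<Sum>i<n. (z \<bullet> \<phi> i) *\<^sub>R (l i *\<^sub>R \<phi> i))"
      unfolding partial_expansion_def using eig subspace_scale[OF subspace_D]
      by (subst A_sum) (auto simp: A_scale)
    moreover have "\<phi> i \<bullet> A x = 0" if "i < n" for i
      using symmetric[OF _ x(1), of "\<phi> i"] eig[OF that] xM that by (simp add: M_def inner_commute)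
    ultimately have "A ?P \<bullet> A x = 0" unfolding inner_sum_left
      by (simp add: inner_sum_left)
    have "A z \<bullet> A x = A (z - ?P) \<bullet> A x"
      using A_diff[OF z PD] \<open>A ?P \<bullet> A x = 0\<close> by (simp add: inner_diff_left)
    also have "\<dots> = r * (z \<bullet> x)" using EL[OF zM] \<open>?P \<bullet> x = 0\<close> by (simp add: inner_diff_left)
    finally show "A z \<bullet> A x = z \<bullet> r *\<^sub>R x" by simp
  qed
  define c where "c = sqrt r"
  have c: "0 \<le> c" "c * c = r" using r0 by (auto simp: c_def)
  have "A x = c *\<^sub>R x"
  proof (cases "c = 0")
    case True
    then show ?thesis using Ax c by simp
  next
    case False
    define w where "w = A x - c *\<^sub>R x"
    have wD: "w \<in> D" using AAx x(1) subspace_D by (auto simp: w_def intro: subspace_diff subspace_scale)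
    have "A w = r *\<^sub>R x - c *\<^sub>R A x"
      using A_diff[of "A x" "c *\<^sub>R x"] AAx x(1) subspace_scale[OF subspace_D x(1)] by (simp add: w_def A_scale)
    also have "\<dots> = - c *\<^sub>R w" by (simp add: w_def algebra_simps flip: c(2))
    finally have "0 \<le> - c * (w \<bullet> w)" using nonneg[OF wD] by simp
    then have "w \<bullet> w \<le> 0" using c False by (simp add: mult_le_0_iff)
    then have "w = 0" using inner_gt_zero_iff[of w] by linarith
    then show ?thesis by (simp add: w_def)
  qed
  moreover have "c * norm y \<le> norm (A y)" if "y \<in> M" for y
  proof (rule power2_le_imp_le)
    have "(c * norm y)\<^sup>2 = r * (norm y)\<^sup>2" using c(2) by (simp add: power_mult_distrib power2_eq_square[of c])
    then show "(c * norm y)\<^sup>2 \<le> (norm (A y))\<^sup>2" using rM[OF that] by simp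
  qed simp
  ultimately show ?thesis using x xM nx c(1) unfolding M_def by blast
qed

text \<open>
  The minimality of the eigenvalue \<open>l N\<close> controls the tail: the remainder \<open>z - P n z\<close> is orthogonal to the
  first \<open>N\<close> eigenvectors, so \<open>l N * norm (z - P n z) \<le> norm (A z)\<close> for \<open>n \<ge> N\<close>. The eigenvalues are unbounded,
  since otherwise the eigenvectors would form a sequence bounded in the graph norm without convergent
  subsequence.
\<close>

theorem eigenvector_expansion:
  obtains \<phi> l where "orthonormal_or_zero \<phi>" "\<And>n. \<phi> n \<in> D" "\<And>n. A (\<phi> n) = l n *\<^sub>R \<phi> n" "\<And>n. 0 \<le> (l n :: real)"
    "\<And>x. x \<in> H \<Longrightarrow> (\<lambda>n. (x \<bullet> \<phi> n) *\<^sub>R \<phi> n) sums x"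
proof -
  define P where "P f n r \<longleftrightarrow> fst r \<in> D \<and> 0 \<le> snd r \<and> A (fst r) = snd r *\<^sub>R fst r \<and>
      (fst r = 0 \<or> norm (fst r) = 1) \<and> (\<forall>i<n. fst r \<bullet> fst (f i) = 0) \<and>
      (\<forall>y\<in>D. (\<forall>i<n. y \<bullet> fst (f i) = 0) \<longrightarrow> snd r * norm y \<le> norm (A y) \<and> (fst r = 0 \<longrightarrow> y = 0))"
    for f :: "nat \<Rightarrow> 'h \<times> real" and n r
  have P_orth: "fst r \<bullet> fst (f i) = 0" if "P f n r" "i < n" for f n r i
    using that unfolding P_def by blast
  have P_sym: "fst (f i) \<bullet> fst (f j) = 0" if "P f i (f i)" "P f j (f j)" "i \<noteq> j" for f i j
  proof (cases "i < j")
    case True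
    then show ?thesis using P_orth[OF that(2) True] by (simp add: inner_commute)
  next
    case False
    then show ?thesis using P_orth[OF that(1), of j] that(3) by simp
  qed
  have P_eig: "fst r \<in> D" "0 \<le> snd r" "A (fst r) = snd r *\<^sub>R fst r" "fst r = 0 \<or> norm (fst r) = 1" if "P f n r" for f n r
    using that unfolding P_def by blast+
  have P_min: "snd r * norm y \<le> norm (A y) \<and> (fst r = 0 \<longrightarrow> y = 0)"
    if "P f n r" "y \<in> D" "\<And>i. i < n \<Longrightarrow> y \<bullet> fst (f i) = 0" for f n r y
    using that unfolding P_def by blast
  have "\<exists>f. \<forall>n. P f n (f n)"
  proof (rule dependent_wf_choice[where R = less_than])
    show "P f n r = P g n r" if "\<And>z. (z, n) \<in> less_than \<Longrightarrow> f z = g z" for f g n r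
      using that by (auto simp: P_def)
    fix n and f :: "nat \<Rightarrow> 'h \<times> real"
    assume IH: "\<And>y. (y, n) \<in> less_than \<Longrightarrow> P f y (f y)"
    then have IH: "P f i (f i)" if "i < n" for i using that by auto
    show "\<exists>r. P f n r"
    proof (cases "\<exists>y\<in>D. (\<forall>i<n. y \<bullet> fst (f i) = 0) \<and> y \<noteq> 0")
      case False
      \<comment> \<open>the eigenvectors found so far exhaust the space: pad with zero\<close>
      then have "P f n (0, 0)" by (auto simp: P_def subspace_0[OF subspace_D] A_zero)
      then show ?thesis by blast
    next
      case True
      then obtain y0 where y0: "y0 \<in> D" "\<And>i. i < n \<Longrightarrow> y0 \<bullet> fst (f i) = 0" "y0 \<noteq> 0" by auto
      have orth: "fst (f i) \<bullet> fst (f j) = 0" if "i < n" "j < n" "i \<noteq> j" for i j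
        using P_sym IH that by blast
      have "\<exists>x c. x \<in> D \<and> 0 \<le> c \<and> A x = c *\<^sub>R x \<and> norm x = 1 \<and> (\<forall>i<n. x \<bullet> fst (f i) = 0) \<and>
          (\<forall>y\<in>D. (\<forall>i<n. y \<bullet> fst (f i) = 0) \<longrightarrow> c * norm y \<le> norm (A y))"
        using P_eig[OF IH] by (intro next_eigenvector[where l = "\<lambda>i. snd (f i)", OF orth _ _ y0]) auto
      then obtain x c where "x \<in> D \<and> 0 \<le> c \<and> A x = c *\<^sub>R x \<and> norm x = 1 \<and> (\<forall>i<n. x \<bullet> fst (f i) = 0) \<and>
          (\<forall>y\<in>D. (\<forall>i<n. y \<bullet> fst (f i) = 0) \<longrightarrow> c * norm y \<le> norm (A y))" by blast
      then have "P f n (x, c)" unfolding P_def by auto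
      then show ?thesis by blast
    qed
  qed simp
  then obtain f where f: "\<And>n. P f n (f n)" by blast
  define \<phi> l where "\<phi> n = fst (f n)" and "l n = snd (f n)" for n
  have D: "\<phi> n \<in> D" and l0: "0 \<le> l n" and eig: "A (\<phi> n) = l n *\<^sub>R \<phi> n" and unit: "\<phi> n = 0 \<or> norm (\<phi> n) = 1"
    and min: "\<And>y. y \<in> D \<Longrightarrow> (\<And>i. i < n \<Longrightarrow> y \<bullet> \<phi> i = 0) \<Longrightarrow> l n * norm y \<le> norm (A y)"
    and triv: "\<And>y. y \<in> D \<Longrightarrow> (\<And>i. i < n \<Longrightarrow> y \<bullet> \<phi> i = 0) \<Longrightarrow> \<phi> n = 0 \<Longrightarrow> y = 0" for n
    unfolding \<phi>_def l_def using P_eig[OF f] P_min[OF f] by blast+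
  have orth: "\<phi> i \<bullet> \<phi> j = 0" if "i \<noteq> j" for i j
    unfolding \<phi>_def using P_sym f that by blast
  have on: "orthonormal_or_zero \<phi>" using orth unit by (auto simp: orthonormal_or_zero_def)
  let ?P = "partial_expansion \<phi>"
  have PD: "?P n z \<in> D" for n z
    unfolding partial_expansion_def using D by (intro subspace_sum subspace_scale subspace_D) auto
  have Pperp: "(z - ?P n z) \<bullet> \<phi> i = 0" if "i < n" for n z i
    using partial_expansion_inner[of n \<phi> i z] orth unit that by (simp add: inner_diff_left)
  have contr: "norm (z - ?P n z) \<le> norm z" for n z
    by (rule norm_diff_partial_expansion_le) (use orth unit in auto)
  have AP: "A (z - ?P n z) = A z - ?P n (A z)" if z: "z \<in> D" for n z
  proof -
    have "A (?P n z) = (\<Sum>i<n. (z \<bullet> \<phi> i) *\<^sub>R (l i *\<^sub>R \<phi> i))"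
      unfolding partial_expansion_def using D eig subspace_scale[OF subspace_D]
      by (subst A_sum) (auto simp: A_scale)
    also have "\<dots> = ?P n (A z)" unfolding partial_expansion_def
      using symmetric[OF z D] eig by (intro sum.cong) (auto simp: mult.commute)
    finally show ?thesis using A_diff[OF z PD] by simp
  qed
  have conv_D: "(\<lambda>n. ?P n z) \<longlonglongrightarrow> z" if z: "z \<in> D" for z
  proof (cases "\<exists>N. \<phi> N = 0")
    case True
    then obtain N where N: "\<phi> N = 0" by blast
    have "?P n z = z" if "N \<le> n" for n
      using triv[of "z - ?P n z" N] Pperp[of _ n z] N that z PD subspace_diff[OF subspace_D] by auto
    then show ?thesis by (intro tendsto_eventually eventually_sequentiallyI[of N])
  next
    case False
    then have u: "norm (\<phi> n) = 1" for n using unit by blast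
    have mono: "l n \<le> l m" if "n \<le> m" for n m
      using min[OF D[of m], of n] u[of m] eig[of m] l0[of m] orth[of m] that by (cases "n = m") auto
    have unbdd: "\<exists>N. C < l N" for C
    proof (rule ccontr)
      assume "\<not> ?thesis"
      then have C: "l n \<le> C" for n by (simp add: not_less)
      have "(norm (\<phi> n))\<^sup>2 + (norm (A (\<phi> n)))\<^sup>2 \<le> 1 + C\<^sup>2" for n
        using u[of n] eig[of n] l0[of n] C[of n] by (simp add: power_mono)
      then obtain h x where h: "strict_mono h" "(\<phi> \<circ> h) \<longlonglongrightarrow> x"
        using bounded_graph_subseq[of \<phi>] D by metis
      obtain N where N: "\<And>m n. m \<ge> N \<Longrightarrow> n \<ge> N \<Longrightarrow> dist ((\<phi> \<circ> h) m) ((\<phi> \<circ> h) n) < 1"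
        using LIMSEQ_imp_Cauchy[OF h(2)] unfolding Cauchy_def by (meson zero_less_one)
      have hN: "h N \<noteq> h (Suc N)" using strict_monoD[OF h(1), of N "Suc N"] by simp
      have "(dist ((\<phi> \<circ> h) N) ((\<phi> \<circ> h) (Suc N)))\<^sup>2 = (norm (\<phi> (h N)))\<^sup>2 + (norm (\<phi> (h (Suc N))))\<^sup>2"
        using orth[OF hN] by (simp add: dist_norm power2_norm_eq_inner inner_diff inner_commute)
      then have "(dist ((\<phi> \<circ> h) N) ((\<phi> \<circ> h) (Suc N)))\<^sup>2 = 2" using u by simp
      moreover have "(dist ((\<phi> \<circ> h) N) ((\<phi> \<circ> h) (Suc N)))\<^sup>2 \<le> 1\<^sup>2"
        using N[of N "Suc N"] by (intro power_mono) auto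
      ultimately show False by simp
    qed
    show ?thesis
    proof (rule metric_LIMSEQ_I)
      fix e :: real assume e: "0 < e"
      obtain N where N: "(norm (A z) + 1) / e < l N" using unbdd by blast
      have "dist (?P n z) z < e" if n: "N \<le> n" for n
      proof -
        have lN: "0 < l N" using N e by (smt (verit) divide_pos_pos norm_ge_zero)
        have "l N * norm (z - ?P n z) \<le> norm (A (z - ?P n z))"
          using min[of "z - ?P n z" N] Pperp[of _ n z] n z PD subspace_diff[OF subspace_D] by auto
        also have "\<dots> \<le> norm (A z)" unfolding AP[OF z] by (rule contr)
        also have "\<dots> < l N * e" using N e by (simp add: field_simps)
        finally show ?thesis using lN by (simp add: dist_norm norm_minus_commute)
      qed
      then show "\<exists>N. \<forall>n\<ge>N. dist (?P n z) z < e" by blast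
    qed
  qed
  have "(\<lambda>n. ?P n x) \<longlonglongrightarrow> x" if x: "x \<in> H" for x
  proof (rule metric_LIMSEQ_I)
    fix e :: real assume e: "0 < e"
    then obtain z where z: "z \<in> D" "dist z x < e / 2"
      using dense x unfolding subset_iff closure_approachable by (meson half_gt_zero)
    obtain N where N: "\<And>n. n \<ge> N \<Longrightarrow> dist (?P n z) z < e / 2"
      using metric_LIMSEQ_D[OF conv_D[OF z(1)], of "e/2"] e by auto
    have "dist (?P n x) x < e" if "N \<le> n" for n
    proof -
      have "norm (x - ?P n x) = norm (((x - z) - ?P n (x - z)) + (z - ?P n z))"
        by (simp add: partial_expansion_diff)
      also have "\<dots> \<le> norm (x - z) + norm (z - ?P n z)"
        by (intro norm_triangle_le add_mono contr order_refl)
      also have "\<dots> < e" using z(2) N[OF that] by (simp add: dist_norm norm_minus_commute)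
      finally show ?thesis by (simp add: dist_norm norm_minus_commute)
    qed
    then show "\<exists>N. \<forall>n\<ge>N. dist (?P n x) x < e" by blast
  qed
  then have "(\<lambda>n. (x \<bullet> \<phi> n) *\<^sub>R \<phi> n) sums x" if "x \<in> H" for x
    using that by (simp add: sums_def partial_expansion_def)
  then show thesis using that on D eig l0 by blast
qed

end


section \<open>The form domain and its dual in coordinates\<close>

lemma Cauchy_Schwarz_suminf:
  fixes a b :: "nat \<Rightarrow> real"
  assumes a: "summable (\<lambda>n. (a n)\<^sup>2)" and b: "summable (\<lambda>n. (b n)\<^sup>2)"
  shows "summable (\<lambda>n. \<bar>a n * b n\<bar>)" "(\<Sum>n. \<bar>a n * b n\<bar>) \<le> sqrt (\<Sum>n. (a n)\<^sup>2) * sqrt (\<Sum>n. (b n)\<^sup>2)"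
proof -
  have le: "(\<Sum>i<n. \<bar>a i * b i\<bar>) \<le> sqrt (\<Sum>n. (a n)\<^sup>2) * sqrt (\<Sum>n. (b n)\<^sup>2)" for n
  proof -
    have "(\<Sum>i<n. \<bar>a i * b i\<bar>) \<le> L2_set a {..<n} * L2_set b {..<n}"
      by (simp add: abs_mult L2_set_mult_ineq)
    also have "\<dots> \<le> sqrt (\<Sum>n. (a n)\<^sup>2) * sqrt (\<Sum>n. (b n)\<^sup>2)"
      unfolding L2_set_def by (intro mult_mono real_sqrt_le_mono sum_le_suminf a b suminf_nonneg real_sqrt_ge_zero sum_nonneg) auto
    finally show ?thesis .
  qed
  show "summable (\<lambda>n. \<bar>a n * b n\<bar>)"
    by (rule summableI_nonneg_bounded[OF _ le]) simp
  then show "(\<Sum>n. \<bar>a n * b n\<bar>) \<le> sqrt (\<Sum>n. (a n)\<^sup>2) * sqrt (\<Sum>n. (b n)\<^sup>2)"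
    by (rule suminf_le_const) (rule le)
qed

text \<open>
  A closed form together with an eigenbasis. The weight \<open>w n = 1 + l n\<close> is the squared form norm of
  \<open>\<phi> n\<close> unless \<open>\<phi> n = 0\<close>.
\<close>

locale diagonal_form =
  fixes H V :: "'h::{real_inner,banach} set" and E :: "'h \<Rightarrow> 'h \<Rightarrow> real"
    and \<phi> :: "nat \<Rightarrow> 'h" and l :: "nat \<Rightarrow> real"
  assumes form: "closed_nonneg_form H V E" and closedH: "closed H" and subspaceH: "subspace H"
    and on: "orthonormal_or_zero \<phi>" and basis_V: "\<phi> n \<in> V" and l_nonneg: "0 \<le> l n"
    and E_basis: "\<psi> \<in> V \<Longrightarrow> E (\<phi> n) \<psi> = l n * (\<phi> n \<bullet> \<psi>)"
    and expansion: "x \<in> H \<Longrightarrow> (\<lambda>n. (x \<bullet> \<phi> n) *\<^sub>R \<phi> n) sums x"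
begin

abbreviation "w n \<equiv> 1 + l n"
abbreviation "P \<equiv> partial_expansion \<phi>"

lemma w_pos: "0 < w n" using l_nonneg[of n] by simp

lemma subspace_V: "subspace V" and V_H: "V \<subseteq> H"
  and E_sym: "x \<in> V \<Longrightarrow> y \<in> V \<Longrightarrow> E x y = E y x" and E_nonneg: "x \<in> V \<Longrightarrow> 0 \<le> E x x"
  and E_closed: "(\<And>n. X n \<in> V) \<Longrightarrow> X \<longlonglongrightarrow> x \<Longrightarrow>
        (\<And>e. 0 < e \<Longrightarrow> \<exists>N. \<forall>m\<ge>N. \<forall>n\<ge>N. E (X m - X n) (X m - X n) < e) \<Longrightarrow>
        x \<in> V \<and> (\<lambda>n. E (X n - x) (X n - x)) \<longlonglongrightarrow> 0"
  and E_add_right: "x \<in> V \<Longrightarrow> y \<in> V \<Longrightarrow> z \<in> V \<Longrightarrow> E x (y + z) = E x y + E x z"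
  and E_scale_right: "x \<in> V \<Longrightarrow> y \<in> V \<Longrightarrow> E x (c *\<^sub>R y) = c * E x y"
proof -
  show "subspace V" "V \<subseteq> H" "x \<in> V \<Longrightarrow> y \<in> V \<Longrightarrow> E x y = E y x" "x \<in> V \<Longrightarrow> 0 \<le> E x x"
    "x \<in> V \<Longrightarrow> y \<in> V \<Longrightarrow> z \<in> V \<Longrightarrow> E x (y + z) = E x y + E x z"
    "x \<in> V \<Longrightarrow> y \<in> V \<Longrightarrow> E x (c *\<^sub>R y) = c * E x y"
    using form unfolding closed_nonneg_form_def linear_on_set_def real_scaleR_def by blast+
  show "(\<And>n. X n \<in> V) \<Longrightarrow> X \<longlonglongrightarrow> x \<Longrightarrow>
        (\<And>e. 0 < e \<Longrightarrow> \<exists>N. \<forall>m\<ge>N. \<forall>n\<ge>N. E (X m - X n) (X m - X n) < e) \<Longrightarrow>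
        x \<in> V \<and> (\<lambda>n. E (X n - x) (X n - x)) \<longlonglongrightarrow> 0"
    using form unfolding closed_nonneg_form_def by blast
qed

lemma V_add: "x \<in> V \<Longrightarrow> y \<in> V \<Longrightarrow> x + y \<in> V" and V_scale: "x \<in> V \<Longrightarrow> c *\<^sub>R x \<in> V"
  and V_diff: "x \<in> V \<Longrightarrow> y \<in> V \<Longrightarrow> x - y \<in> V" and V_0: "0 \<in> V"
  using subspace_V by (auto intro: subspace_add subspace_scale subspace_diff subspace_0)

lemma E_add_left: "x \<in> V \<Longrightarrow> y \<in> V \<Longrightarrow> z \<in> V \<Longrightarrow> E (x + y) z = E x z + E y z"
  and E_scale_left: "x \<in> V \<Longrightarrow> y \<in> V \<Longrightarrow> E (c *\<^sub>R x) y = c * E x y"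
proof -
  show "E (x + y) z = E x z + E y z" if "x \<in> V" "y \<in> V" "z \<in> V"
    unfolding E_sym[OF V_add[OF that(1,2)] that(3)] E_sym[OF that(1,3)] E_sym[OF that(2,3)]
    by (rule E_add_right[OF that(3,1,2)])
  show "E (c *\<^sub>R x) y = c * E x y" if "x \<in> V" "y \<in> V"
    unfolding E_sym[OF V_scale[OF that(1)] that(2)] E_sym[OF that] by (rule E_scale_right[OF that(2,1)])
qed

lemma E_diff_self: "x \<in> V \<Longrightarrow> y \<in> V \<Longrightarrow> E (x - y) (x - y) = E x x - 2 * E y x + E y y"
proof -
  assume x: "x \<in> V" and y: "y \<in> V"
  have m: "(-1) *\<^sub>R y \<in> V" by (rule V_scale[OF y])
  have "E (x + (-1) *\<^sub>R y) (x + (-1) *\<^sub>R y) = E x x + E x ((-1) *\<^sub>R y) + (E ((-1) *\<^sub>R y) x + E ((-1) *\<^sub>R y) ((-1) *\<^sub>R y))"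
    using x m by (simp only: E_add_left E_add_right V_add)
  also have "\<dots> = E x x - 2 * E y x + E y y"
    using x y m by (simp only: E_scale_left E_scale_right E_sym[of x y])
  finally show ?thesis by simp
qed

lemma orth: "i \<noteq> j \<Longrightarrow> \<phi> i \<bullet> \<phi> j = 0" and unit: "\<phi> i = 0 \<or> norm (\<phi> i) = 1"
  using on by (auto simp: orthonormal_or_zero_def)

lemma P_inner: "i < n \<Longrightarrow> P n x \<bullet> \<phi> i = x \<bullet> \<phi> i"
  by (rule partial_expansion_inner) (use orth unit in auto)

lemma sum_V: "(\<Sum>i<n. c i *\<^sub>R \<phi> i) \<in> V" for n :: nat
  by (intro subspace_sum subspace_V V_scale basis_V)

lemma P_V: "P n x \<in> V"
  unfolding partial_expansion_def by (rule sum_V)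

lemma E_sum: "\<psi> \<in> V \<Longrightarrow> E (\<Sum>i<n. c i *\<^sub>R \<phi> i) \<psi> = (\<Sum>i<n. c i * l i * (\<phi> i \<bullet> \<psi>))" for n :: nat
proof (induction n)
  case 0
  then show ?case using E_scale_left[of 0 \<psi> 0] V_0 by simp
next
  case (Suc n)
  then show ?case using V_scale[OF basis_V] sum_V by (simp add: E_add_left E_scale_left basis_V E_basis)
qed

lemma P_tendsto: "x \<in> H \<Longrightarrow> (\<lambda>n. P n x) \<longlonglongrightarrow> x"
  using expansion[of x] by (simp add: sums_def partial_expansion_def)

lemma parseval: "x \<in> H \<Longrightarrow> (\<lambda>n. (x \<bullet> \<phi> n) * (y \<bullet> \<phi> n)) sums (x \<bullet> y)"
proof -
  assume x: "x \<in> H"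
  have "(\<lambda>n. ((x \<bullet> \<phi> n) *\<^sub>R \<phi> n) \<bullet> y) sums (x \<bullet> y)"
    by (rule bounded_linear.sums[OF bounded_linear_inner_left expansion[OF x]])
  then show ?thesis by (simp add: inner_commute)
qed

lemma parseval_norm: "x \<in> H \<Longrightarrow> (\<lambda>n. (x \<bullet> \<phi> n)\<^sup>2) sums (norm x)\<^sup>2"
  using parseval[of x x] unfolding power2_norm_eq_inner by (simp add: power2_eq_square)

lemma inner_sum_basis: "(\<Sum>i\<in>I. c i *\<^sub>R \<phi> i) \<bullet> \<phi> j = (if j \<in> I then c j * (\<phi> j \<bullet> \<phi> j) else 0)" if "finite I"
proof -
  have "(\<Sum>i\<in>I. c i *\<^sub>R \<phi> i) \<bullet> \<phi> j = (\<Sum>i\<in>I. if i = j then c j * (\<phi> j \<bullet> \<phi> j) else 0)"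
    unfolding inner_sum_left by (rule sum.cong) (auto simp: orth)
  then show ?thesis using that by simp
qed

lemma basis_self: "(\<phi> i = 0 \<Longrightarrow> c = 0) \<Longrightarrow> c * (\<phi> i \<bullet> \<phi> i) = (c :: real)"
  using unit[of i] by (auto simp: dot_square_norm)

lemma norm_sum_basis:
  assumes "\<And>n. \<phi> n = 0 \<Longrightarrow> c n = 0" "finite I"
  shows "(norm (\<Sum>i\<in>I. c i *\<^sub>R \<phi> i))\<^sup>2 = (\<Sum>i\<in>I. (c i)\<^sup>2)"
proof -
  have "(norm (\<Sum>i\<in>I. c i *\<^sub>R \<phi> i))\<^sup>2 = (\<Sum>i\<in>I. c i * ((\<Sum>i\<in>I. c i *\<^sub>R \<phi> i) \<bullet> \<phi> i))"
    unfolding power2_norm_eq_inner by (simp only: inner_sum_right inner_scaleR_right)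
  also have "\<dots> = (\<Sum>i\<in>I. (c i)\<^sup>2)"
    by (rule sum.cong) (use assms in \<open>simp_all add: inner_sum_basis basis_self power2_eq_square\<close>)
  finally show ?thesis .
qed

lemma synthesis:
  assumes c0: "\<And>n. \<phi> n = 0 \<Longrightarrow> c n = 0" and c: "summable (\<lambda>n. (c n)\<^sup>2)"
  shows "summable (\<lambda>n. c n *\<^sub>R \<phi> n)" "(\<Sum>n. c n *\<^sub>R \<phi> n) \<in> H" "(\<Sum>n. c n *\<^sub>R \<phi> n) \<bullet> \<phi> n = c n"
proof -
  show s: "summable (\<lambda>n. c n *\<^sub>R \<phi> n)"
    unfolding summable_Cauchy
  proof (intro allI impI)
    fix e :: real assume e: "0 < e"
    then obtain N where N: "\<And>m n. m \<ge> N \<Longrightarrow> norm (\<Sum>i\<in>{m..<n}. (c i)\<^sup>2) < e\<^sup>2"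
      using c unfolding summable_Cauchy by (meson zero_less_power)
    have "norm (\<Sum>i\<in>{m..<n}. c i *\<^sub>R \<phi> i) < e" if "m \<ge> N" for m n
    proof -
      have "(norm (\<Sum>i\<in>{m..<n}. c i *\<^sub>R \<phi> i))\<^sup>2 < e\<^sup>2"
        using N[OF that, of n] by (simp add: norm_sum_basis[OF c0])
      then show ?thesis using e by (simp add: power2_less_imp_less)
    qed
    then show "\<exists>N. \<forall>m\<ge>N. \<forall>n. norm (\<Sum>i\<in>{m..<n}. c i *\<^sub>R \<phi> i) < e" by blast
  qed
  have lim: "(\<lambda>n. \<Sum>i<n. c i *\<^sub>R \<phi> i) \<longlonglongrightarrow> (\<Sum>n. c n *\<^sub>R \<phi> n)"
    using s by (simp add: summable_LIMSEQ)
  show "(\<Sum>n. c n *\<^sub>R \<phi> n) \<in> H"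
    using closed_sequentially[OF closedH _ lim] sum_V V_H by blast
  have "(\<lambda>k. (\<Sum>i<k. c i *\<^sub>R \<phi> i) \<bullet> \<phi> n) \<longlonglongrightarrow> (\<Sum>n. c n *\<^sub>R \<phi> n) \<bullet> \<phi> n"
    by (intro tendsto_intros lim)
  moreover have "(\<lambda>k. (\<Sum>i<k. c i *\<^sub>R \<phi> i) \<bullet> \<phi> n) \<longlonglongrightarrow> c n"
    by (intro tendsto_eventually eventually_sequentiallyI[of "Suc n"]) (simp add: inner_sum_basis basis_self c0)
  ultimately show "(\<Sum>n. c n *\<^sub>R \<phi> n) \<bullet> \<phi> n = c n" by (rule LIMSEQ_unique)
qed

lemma H_eqI: "x \<in> H \<Longrightarrow> y \<in> H \<Longrightarrow> (\<And>n. x \<bullet> \<phi> n = y \<bullet> \<phi> n) \<Longrightarrow> x = y"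
proof -
  assume "x \<in> H" "y \<in> H" and eq: "\<And>n. x \<bullet> \<phi> n = y \<bullet> \<phi> n"
  from expansion[OF this(1)] expansion[OF this(2)] show "x = y" unfolding eq by (rule sums_unique2)
qed

lemma E_sum_self:
  fixes m n :: nat
  assumes c0: "\<And>n. \<phi> n = 0 \<Longrightarrow> c n = 0"
  shows "E ((\<Sum>i<m. c i *\<^sub>R \<phi> i) - (\<Sum>i<n. c i *\<^sub>R \<phi> i)) ((\<Sum>i<m. c i *\<^sub>R \<phi> i) - (\<Sum>i<n. c i *\<^sub>R \<phi> i))
    = \<bar>(\<Sum>i<m. l i * (c i)\<^sup>2) - (\<Sum>i<n. l i * (c i)\<^sup>2)\<bar>"
proof -
  have e: "E (\<Sum>i<k. c i *\<^sub>R \<phi> i) (\<Sum>i<j. c i *\<^sub>R \<phi> i) = (\<Sum>i<min k j. l i * (c i)\<^sup>2)" for k j :: nat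
  proof -
    have "E (\<Sum>i<k. c i *\<^sub>R \<phi> i) (\<Sum>i<j. c i *\<^sub>R \<phi> i) = (\<Sum>i<k. c i * l i * ((\<Sum>i<j. c i *\<^sub>R \<phi> i) \<bullet> \<phi> i))"
      by (simp add: E_sum[OF sum_V] inner_commute)
    also have "\<dots> = (\<Sum>i<k. if i < j then l i * (c i)\<^sup>2 else 0)"
      by (rule sum.cong) (auto simp: inner_sum_basis basis_self c0 power2_eq_square)
    also have "\<dots> = (\<Sum>i<min k j. l i * (c i)\<^sup>2)"
      by (rule sum.mono_neutral_cong_right) auto
    finally show ?thesis .
  qed
  have "(\<Sum>i<min m n. l i * (c i)\<^sup>2) \<le> (\<Sum>i<m. l i * (c i)\<^sup>2)" "(\<Sum>i<min m n. l i * (c i)\<^sup>2) \<le> (\<Sum>i<n. l i * (c i)\<^sup>2)"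
    using l_nonneg by (auto intro!: sum_mono2)
  then show ?thesis
    unfolding E_diff_self[OF sum_V sum_V] e by (cases "m \<le> n") (auto simp: min_def)
qed

text \<open>
  The partial sums are Cauchy for the form, so closedness of the form puts the sum into \<open>V\<close>.
\<close>

lemma synthesis_V:
  assumes c0: "\<And>n. \<phi> n = 0 \<Longrightarrow> c n = 0" and c: "summable (\<lambda>n. w n * (c n)\<^sup>2)"
  shows "summable (\<lambda>n. (c n)\<^sup>2)" "(\<Sum>n. c n *\<^sub>R \<phi> n) \<in> V"
proof -
  show c1: "summable (\<lambda>n. (c n)\<^sup>2)"
  proof (rule summable_comparison_test'[OF c])
    show "norm ((c n)\<^sup>2) \<le> w n * (c n)\<^sup>2" for n
      using mult_right_mono[of 1 "w n" "(c n)\<^sup>2"] l_nonneg[of n] by simp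
  qed
  have c2: "summable (\<lambda>n. l n * (c n)\<^sup>2)"
  proof (rule summable_comparison_test'[OF c])
    show "norm (l n * (c n)\<^sup>2) \<le> w n * (c n)\<^sup>2" for n
      using l_nonneg[of n] by (simp add: distrib_right)
  qed
  have lim: "(\<lambda>n. \<Sum>i<n. c i *\<^sub>R \<phi> i) \<longlonglongrightarrow> (\<Sum>n. c n *\<^sub>R \<phi> n)"
    by (rule summable_LIMSEQ) (rule synthesis(1)[OF c0 c1])
  have Cau: "Cauchy (\<lambda>n. \<Sum>i<n. l i * (c i)\<^sup>2)"
    using summable_LIMSEQ[OF c2] by (rule LIMSEQ_imp_Cauchy)
  have "\<exists>N. \<forall>m\<ge>N. \<forall>n\<ge>N. E ((\<Sum>i<m. c i *\<^sub>R \<phi> i) - (\<Sum>i<n. c i *\<^sub>R \<phi> i)) ((\<Sum>i<m. c i *\<^sub>R \<phi> i) - (\<Sum>i<n. c i *\<^sub>R \<phi> i)) < e"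
    if "0 < e" for e
    using metric_CauchyD[OF Cau that] by (simp add: E_sum_self c0 dist_real_def)
  then show "(\<Sum>n. c n *\<^sub>R \<phi> n) \<in> V"
    using E_closed[OF sum_V lim] by blast
qed

text \<open>
  The partial sums \<open>P n u\<close> are Cauchy for the form because \<open>E (P n u) (P n u)\<close> is increasing and bounded by
  \<open>E u u\<close> (Bessel). By closedness they converge to \<open>u\<close> in the form norm as well, not only in the pivot space.
\<close>

lemma E_self_sums:
  assumes u: "u \<in> V"
  shows "(\<lambda>n. l n * (u \<bullet> \<phi> n)\<^sup>2) sums E u u" "(\<lambda>n. E (P n u - u) (P n u - u)) \<longlonglongrightarrow> 0"
proof -
  let ?c = "\<lambda>n. u \<bullet> \<phi> n"
  have c0: "\<phi> n = 0 \<Longrightarrow> ?c n = 0" for n by simp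
  have P: "P n u = (\<Sum>i<n. ?c i *\<^sub>R \<phi> i)" for n by (simp add: partial_expansion_def)
  have e: "E (u - P n u) (u - P n u) = E u u - (\<Sum>i<n. l i * (?c i)\<^sup>2)" for n
  proof -
    have "E (P n u) u = (\<Sum>i<n. l i * (?c i)\<^sup>2)"
      unfolding P E_sum[OF u] by (rule sum.cong) (auto simp: power2_eq_square inner_commute)
    moreover have "E (P n u) (P n u) = (\<Sum>i<n. l i * (?c i)\<^sup>2)"
    proof -
      have "E (P n u) (P n u) = (\<Sum>i<n. ?c i * l i * (\<phi> i \<bullet> P n u))"
        by (subst (1) P) (rule E_sum[OF P_V])
      also have "\<dots> = (\<Sum>i<n. l i * (?c i)\<^sup>2)"
        using P_inner[of _ n u] by (intro sum.cong) (auto simp: power2_eq_square inner_commute)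
      finally show ?thesis .
    qed
    ultimately show ?thesis using E_diff_self[OF u P_V] by simp
  qed
  have s: "summable (\<lambda>n. l n * (?c n)\<^sup>2)"
  proof (rule summableI_nonneg_bounded)
    show "(\<Sum>i<n. l i * (?c i)\<^sup>2) \<le> E u u" for n
      using E_nonneg[OF V_diff[OF u P_V], of n u] e[of n] by simp
  qed (use l_nonneg in auto)
  have Cau: "Cauchy (\<lambda>n. \<Sum>i<n. l i * (?c i)\<^sup>2)"
    using summable_LIMSEQ[OF s] by (rule LIMSEQ_imp_Cauchy)
  have "\<exists>N. \<forall>m\<ge>N. \<forall>n\<ge>N. E (P m u - P n u) (P m u - P n u) < e" if "0 < e" for e
    using metric_CauchyD[OF Cau that] unfolding P by (simp add: E_sum_self[where c = ?c] dist_real_def)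
  then have lim: "(\<lambda>n. E (P n u - u) (P n u - u)) \<longlonglongrightarrow> 0"
    using E_closed[of "\<lambda>n. P n u", OF P_V P_tendsto] u V_H by blast
  then show "(\<lambda>n. E (P n u - u) (P n u - u)) \<longlonglongrightarrow> 0" .
  have "E (P n u - u) (P n u - u) = E u u - (\<Sum>i<n. l i * (?c i)\<^sup>2)" for n
    using E_diff_self[OF P_V u] E_diff_self[OF u P_V] E_sym[OF u P_V] e[of n] by simp
  then have "(\<lambda>n. E u u - (\<Sum>i<n. l i * (?c i)\<^sup>2)) \<longlonglongrightarrow> 0" using lim by simp
  then have "(\<lambda>n. E u u - (E u u - (\<Sum>i<n. l i * (?c i)\<^sup>2))) \<longlonglongrightarrow> E u u - 0"
    by (intro tendsto_intros)
  then show "(\<lambda>n. l n * (u \<bullet> \<phi> n)\<^sup>2) sums E u u" by (simp add: sums_def)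
qed

lemma E_sums:
  assumes u: "u \<in> V" and v: "v \<in> V"
  shows "(\<lambda>n. l n * ((u \<bullet> \<phi> n) * (v \<bullet> \<phi> n))) sums E u v"
proof -
  have "E (u + v) (u + v) = E u u + 2 * E u v + E v v"
    using u v V_add[OF u v] by (simp add: E_add_left E_add_right E_sym[of v u])
  then have "(\<lambda>n. (l n * ((u + v) \<bullet> \<phi> n)\<^sup>2 - l n * (u \<bullet> \<phi> n)\<^sup>2 - l n * (v \<bullet> \<phi> n)\<^sup>2) / 2) sums ((E u u + 2 * E u v + E v v - E u u - E v v) / 2)"
    using E_self_sums(1)[OF V_add[OF u v]] by (intro sums_divide sums_diff E_self_sums(1) u v) simp
  then show ?thesis by (simp add: inner_add_left power2_sum algebra_simps)
qed

lemma form_norm_sums: "u \<in> V \<Longrightarrow> (\<lambda>n. w n * (u \<bullet> \<phi> n)\<^sup>2) sums (form_norm E u)\<^sup>2"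
proof -
  assume u: "u \<in> V"
  have "(\<lambda>n. l n * (u \<bullet> \<phi> n)\<^sup>2 + (u \<bullet> \<phi> n)\<^sup>2) sums (E u u + (norm u)\<^sup>2)"
    using u V_H by (intro sums_add E_self_sums parseval_norm) auto
  moreover have "(form_norm E u)\<^sup>2 = E u u + (norm u)\<^sup>2"
    using E_nonneg[OF u] by (simp add: form_norm_def power2_norm_eq_inner)
  ultimately show ?thesis by (simp add: algebra_simps)
qed

lemma form_norm_nonneg: "u \<in> V \<Longrightarrow> 0 \<le> form_norm E u"
  using E_nonneg[of u] by (simp add: form_norm_def)

lemma form_norm_eq: "u \<in> V \<Longrightarrow> form_norm E u = sqrt (\<Sum>n. w n * (u \<bullet> \<phi> n)\<^sup>2)"
  unfolding sums_unique[OF form_norm_sums, symmetric] by (simp add: form_norm_nonneg)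

lemma norm_le_form_norm: "u \<in> V \<Longrightarrow> norm u \<le> form_norm E u"
  unfolding form_norm_def norm_eq_sqrt_inner using E_nonneg[of u] by (intro real_sqrt_le_mono) simp

lemma form_norm_P_tendsto: "u \<in> V \<Longrightarrow> (\<lambda>n. form_norm E (P n u - u)) \<longlonglongrightarrow> 0"
proof -
  assume u: "u \<in> V"
  have "(\<lambda>n. sqrt (E (P n u - u) (P n u - u) + (P n u - u) \<bullet> (P n u - u))) \<longlonglongrightarrow> sqrt (0 + (u - u) \<bullet> (u - u))"
    using u V_H by (intro tendsto_intros E_self_sums P_tendsto) auto
  then show ?thesis by (simp add: form_norm_def)
qed

lemma form_norm_scale: "u \<in> V \<Longrightarrow> form_norm E (c *\<^sub>R u) = \<bar>c\<bar> * form_norm E u"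
proof -
  assume u: "u \<in> V"
  have "E (c *\<^sub>R u) (c *\<^sub>R u) + (c *\<^sub>R u) \<bullet> (c *\<^sub>R u) = c\<^sup>2 * (E u u + u \<bullet> u)"
    using u V_scale[OF u] by (simp add: E_scale_left E_scale_right power2_eq_square algebra_simps)
  then show ?thesis by (simp add: form_norm_def real_sqrt_mult)
qed

abbreviation "V' \<equiv> dual_space V E"

lemma dual_add: "f \<in> V' \<Longrightarrow> x \<in> V \<Longrightarrow> y \<in> V \<Longrightarrow> f (x + y) = f x + f y"
  and dual_scale: "f \<in> V' \<Longrightarrow> x \<in> V \<Longrightarrow> f (c *\<^sub>R x) = c * f x"
  by (auto simp: dual_space_def linear_on_set_def)

lemma dual_zero: "f \<in> V' \<Longrightarrow> f 0 = 0"
  using dual_scale[OF _ V_0, of f 0] by simp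

lemma dual_sum: "f \<in> V' \<Longrightarrow> f (\<Sum>i<n. c i *\<^sub>R \<phi> i) = (\<Sum>i<n. c i * f (\<phi> i))" for n :: nat
proof (induction n)
  case (Suc n)
  then show ?case using V_scale[OF basis_V] sum_V basis_V by (simp add: dual_add dual_scale)
qed (simp add: dual_zero)

lemma dual_bdd: "f \<in> V' \<Longrightarrow> bdd_above ((\<lambda>\<psi>. \<bar>f \<psi>\<bar>) ` {\<psi>\<in>V. form_norm E \<psi> \<le> 1})"
proof -
  assume "f \<in> V'"
  then obtain C where C: "\<And>\<psi>. \<psi> \<in> V \<Longrightarrow> \<bar>f \<psi>\<bar> \<le> C * form_norm E \<psi>"
    by (auto simp: dual_space_def)
  have "\<bar>f \<psi>\<bar> \<le> \<bar>C\<bar>" if "\<psi> \<in> V" "form_norm E \<psi> \<le> 1" for \<psi>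
  proof -
    have "C * form_norm E \<psi> \<le> \<bar>C\<bar> * form_norm E \<psi>"
      using form_norm_nonneg[OF that(1)] by (intro mult_right_mono) auto
    also have "\<dots> \<le> \<bar>C\<bar> * 1" using that by (intro mult_left_mono) auto
    finally show ?thesis using C[OF that(1)] by simp
  qed
  then show ?thesis by (intro bdd_aboveI2) auto
qed

lemma dual_norm_ge: "f \<in> V' \<Longrightarrow> \<psi> \<in> V \<Longrightarrow> form_norm E \<psi> \<le> 1 \<Longrightarrow> \<bar>f \<psi>\<bar> \<le> dual_norm V E f"
  unfolding dual_norm_def by (rule cSUP_upper[OF _ dual_bdd]) auto

lemma dual_norm_partial_sum:
  fixes n :: nat
  assumes f: "f \<in> V'"
  shows "(\<Sum>i<n. (f (\<phi> i))\<^sup>2 / w i) \<le> (dual_norm V E f)\<^sup>2"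
proof -
  define S where "S = (\<Sum>i<n. (f (\<phi> i))\<^sup>2 / w i)"
  define c where "c i = f (\<phi> i) / w i" for i
  have c0: "c i = 0" if "\<phi> i = 0" for i using that dual_zero[OF f] by (simp add: c_def)
  define \<psi> where "\<psi> = (\<Sum>i<n. c i *\<^sub>R \<phi> i)"
  have wn: "w i \<noteq> 0" for i using w_pos[of i] by simp
  have V: "\<psi> \<in> V" by (simp add: \<psi>_def sum_V)
  have f\<psi>: "f \<psi> = S"
    by (simp add: \<psi>_def dual_sum[OF f] S_def c_def power2_eq_square)
  have S0: "0 \<le> S" unfolding S_def by (intro sum_nonneg divide_nonneg_pos w_pos) auto
  have "E \<psi> \<psi> = (\<Sum>i<n. l i * (c i)\<^sup>2)"
    using E_sum_self[where c = c and m = n and n = 0, OF c0] l_nonneg by (simp add: \<psi>_def abs_of_nonneg sum_nonneg)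
  moreover have "\<psi> \<bullet> \<psi> = (\<Sum>i<n. (c i)\<^sup>2)"
    using norm_sum_basis[OF c0, where I = "{..<n}"] by (simp add: \<psi>_def power2_norm_eq_inner)
  ultimately have "E \<psi> \<psi> + \<psi> \<bullet> \<psi> = (\<Sum>i<n. w i * (c i)\<^sup>2)"
    by (simp add: sum.distrib distrib_right)
  also have "\<dots> = S" unfolding S_def c_def
    by (rule sum.cong) (use wn in \<open>auto simp: power2_eq_square\<close>)
  finally have fn: "form_norm E \<psi> = sqrt S" by (simp add: form_norm_def)
  show ?thesis
  proof (cases "S = 0")
    case False
    then have S: "0 < S" using S0 by simp
    have "\<bar>f ((1 / sqrt S) *\<^sub>R \<psi>)\<bar> \<le> dual_norm V E f"
      using S by (intro dual_norm_ge f V_scale V) (simp add: form_norm_scale[OF V] fn)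
    then have "sqrt S \<le> dual_norm V E f"
      using S by (simp add: dual_scale[OF f V] f\<psi> real_div_sqrt)
    then have "(sqrt S)\<^sup>2 \<le> (dual_norm V E f)\<^sup>2" using S0 by (intro power_mono) auto
    then show ?thesis using S0 by (simp add: S_def)
  qed (simp add: S_def)
qed

lemma dual_norm_nonneg: "f \<in> V' \<Longrightarrow> 0 \<le> dual_norm V E f"
proof -
  assume f: "f \<in> V'"
  have "form_norm E 0 = 0" using E_scale_left[OF V_0 V_0, of 0] by (simp add: form_norm_def)
  then have "\<bar>f 0\<bar> \<le> dual_norm V E f" by (intro dual_norm_ge[OF f V_0]) simp
  then show ?thesis by simp
qed

lemma dual_summable: "f \<in> V' \<Longrightarrow> summable (\<lambda>n. (f (\<phi> n))\<^sup>2 / w n)"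
  by (rule summableI_nonneg_bounded[OF _ dual_norm_partial_sum])
    (auto intro!: divide_nonneg_pos w_pos)

lemma weighted_Cauchy_Schwarz:
  assumes d: "summable (\<lambda>n. (d n)\<^sup>2 / w n)" and \<psi>: "\<psi> \<in> V"
  shows "summable (\<lambda>n. \<bar>(\<psi> \<bullet> \<phi> n) * d n\<bar>)" "(\<Sum>n. \<bar>(\<psi> \<bullet> \<phi> n) * d n\<bar>) \<le> form_norm E \<psi> * sqrt (\<Sum>n. (d n)\<^sup>2 / w n)"
proof -
  define a where "a n = sqrt (w n) * (\<psi> \<bullet> \<phi> n)" for n
  define b where "b n = d n / sqrt (w n)" for n
  have sw: "sqrt (w n) \<noteq> 0" "(sqrt (w n))\<^sup>2 = w n" for n using w_pos[of n] by auto
  have ab: "(\<psi> \<bullet> \<phi> n) * d n = a n * b n" for n using sw[of n] by (simp add: a_def b_def)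
  have a2: "(a n)\<^sup>2 = w n * (\<psi> \<bullet> \<phi> n)\<^sup>2" "(b n)\<^sup>2 = (d n)\<^sup>2 / w n" for n
    unfolding a_def b_def power_mult_distrib power_divide sw(2) by simp_all
  have s: "summable (\<lambda>n. (a n)\<^sup>2)" "summable (\<lambda>n. (b n)\<^sup>2)"
    unfolding a2 using form_norm_sums[OF \<psi>] d by (auto simp: sums_iff)
  show "summable (\<lambda>n. \<bar>(\<psi> \<bullet> \<phi> n) * d n\<bar>)" unfolding ab by (rule Cauchy_Schwarz_suminf(1)[OF s])
  show "(\<Sum>n. \<bar>(\<psi> \<bullet> \<phi> n) * d n\<bar>) \<le> form_norm E \<psi> * sqrt (\<Sum>n. (d n)\<^sup>2 / w n)"
    using Cauchy_Schwarz_suminf(2)[OF s] unfolding ab a2 form_norm_eq[OF \<psi>] .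
qed

lemma dual_expansion: "f \<in> V' \<Longrightarrow> \<psi> \<in> V \<Longrightarrow> (\<lambda>n. (\<psi> \<bullet> \<phi> n) * f (\<phi> n)) sums f \<psi>"
proof -
  assume f: "f \<in> V'" and \<psi>: "\<psi> \<in> V"
  obtain C where C: "\<And>\<psi>. \<psi> \<in> V \<Longrightarrow> \<bar>f \<psi>\<bar> \<le> C * form_norm E \<psi>"
    using f by (auto simp: dual_space_def)
  have "(\<lambda>n. f (P n \<psi>) - f \<psi>) \<longlonglongrightarrow> 0"
  proof (rule Lim_null_comparison)
    have "f (P n \<psi>) - f \<psi> = f (P n \<psi> - \<psi>)" for n
      using dual_add[OF f V_diff[OF P_V \<psi>] \<psi>, of n \<psi>] by simp
    then show "\<forall>\<^sub>F n in sequentially. norm (f (P n \<psi>) - f \<psi>) \<le> C * form_norm E (P n \<psi> - \<psi>)"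
      using C[OF V_diff[OF P_V \<psi>]] by simp
    show "(\<lambda>n. C * form_norm E (P n \<psi> - \<psi>)) \<longlonglongrightarrow> 0"
      using tendsto_mult_left[OF form_norm_P_tendsto[OF \<psi>], of C] by simp
  qed
  then have "(\<lambda>n. f (P n \<psi>)) \<longlonglongrightarrow> f \<psi>" by (rule LIM_zero_cancel)
  then show ?thesis by (simp add: sums_def partial_expansion_def dual_sum[OF f])
qed

text \<open>
  The partial sums of the right-hand side are values of \<open>f\<close> at test vectors, and Cauchy-Schwarz gives the
  other inequality. As a countable sum over coordinates the dual norm of a measurable family of
  functionals is measurable, and limits in the dual space become instances of dominated convergence.
\<close>

theorem dual_norm_eq:
  assumes f: "f \<in> V'"
  shows "dual_norm V E f = sqrt (\<Sum>n. (f (\<phi> n))\<^sup>2 / w n)"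
proof (rule antisym)
  show "sqrt (\<Sum>n. (f (\<phi> n))\<^sup>2 / w n) \<le> dual_norm V E f"
    using dual_norm_nonneg[OF f] dual_norm_partial_sum[OF f]
    by (intro real_le_lsqrt suminf_le_const dual_summable f suminf_nonneg divide_nonneg_pos w_pos) auto
  show "dual_norm V E f \<le> sqrt (\<Sum>n. (f (\<phi> n))\<^sup>2 / w n)"
    unfolding dual_norm_def
  proof (rule cSUP_least)
    have "form_norm E 0 = 0" using E_scale_left[OF V_0 V_0, of 0] by (simp add: form_norm_def)
    then show "{\<psi> \<in> V. form_norm E \<psi> \<le> 1} \<noteq> {}" using V_0 by force
    fix \<psi> assume "\<psi> \<in> {\<psi> \<in> V. form_norm E \<psi> \<le> 1}"
    then have \<psi>: "\<psi> \<in> V" "form_norm E \<psi> \<le> 1" by auto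
    note cs = weighted_Cauchy_Schwarz[OF dual_summable[OF f] \<psi>(1)]
    have "\<bar>f \<psi>\<bar> \<le> (\<Sum>n. \<bar>(\<psi> \<bullet> \<phi> n) * f (\<phi> n)\<bar>)"
      using summable_rabs[OF cs(1)] dual_expansion[OF f \<psi>(1)] by (simp add: sums_iff)
    also note cs(2)
    also have "form_norm E \<psi> * sqrt (\<Sum>n. (f (\<phi> n))\<^sup>2 / w n) \<le> 1 * sqrt (\<Sum>n. (f (\<phi> n))\<^sup>2 / w n)"
      using \<psi>(2) by (intro mult_right_mono real_sqrt_ge_zero suminf_nonneg dual_summable f divide_nonneg_pos w_pos) auto
    finally show "\<bar>f \<psi>\<bar> \<le> sqrt (\<Sum>n. (f (\<phi> n))\<^sup>2 / w n)" by simp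
  qed
qed

lemma dual_synthesis:
  assumes d0: "\<And>n. \<phi> n = 0 \<Longrightarrow> d n = 0" and d: "summable (\<lambda>n. (d n)\<^sup>2 / w n)"
  shows "(\<lambda>\<psi>. \<Sum>n. (\<psi> \<bullet> \<phi> n) * d n) \<in> V'" "(\<Sum>k. (\<phi> n \<bullet> \<phi> k) * d k) = d n"
    "\<psi> \<in> V \<Longrightarrow> summable (\<lambda>n. (\<psi> \<bullet> \<phi> n) * d n)"
proof -
  note cs = weighted_Cauchy_Schwarz[OF d]
  have s: "summable (\<lambda>n. (\<psi> \<bullet> \<phi> n) * d n)" if "\<psi> \<in> V" for \<psi>
    using cs(1)[OF that] by (rule summable_rabs_cancel)
  then show "\<psi> \<in> V \<Longrightarrow> summable (\<lambda>n. (\<psi> \<bullet> \<phi> n) * d n)" .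
  show "(\<lambda>\<psi>. \<Sum>n. (\<psi> \<bullet> \<phi> n) * d n) \<in> V'"
    unfolding dual_space_def linear_on_set_def mem_Collect_eq
  proof (intro conjI ballI allI exI)
    fix x y assume "x \<in> V" "y \<in> V"
    then show "(\<Sum>n. ((x + y) \<bullet> \<phi> n) * d n) = (\<Sum>n. (x \<bullet> \<phi> n) * d n) + (\<Sum>n. (y \<bullet> \<phi> n) * d n)"
      by (subst suminf_add[OF s s]) (auto simp: inner_add_left distrib_right)
  next
    fix c x assume "x \<in> V"
    then show "(\<Sum>n. ((c *\<^sub>R x) \<bullet> \<phi> n) * d n) = c *\<^sub>R (\<Sum>n. (x \<bullet> \<phi> n) * d n)"
      using suminf_mult[OF s, of x c] by (simp add: mult.assoc)
  next
    fix \<psi> assume \<psi>: "\<psi> \<in> V"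
    have "\<bar>\<Sum>n. (\<psi> \<bullet> \<phi> n) * d n\<bar> \<le> (\<Sum>n. \<bar>(\<psi> \<bullet> \<phi> n) * d n\<bar>)"
      by (rule summable_rabs[OF cs(1)[OF \<psi>]])
    also note cs(2)[OF \<psi>]
    finally show "\<bar>\<Sum>n. (\<psi> \<bullet> \<phi> n) * d n\<bar> \<le> sqrt (\<Sum>n. (d n)\<^sup>2 / w n) * form_norm E \<psi>"
      by (simp add: mult.commute)
  qed
  have "(\<lambda>k. (\<phi> n \<bullet> \<phi> k) * d k) = (\<lambda>k. if k = n then d k else 0)"
    using orth[of n] basis_self[of n "d n"] d0[of n] by (auto simp: fun_eq_iff mult.commute)
  then show "(\<Sum>k. (\<phi> n \<bullet> \<phi> k) * d k) = d n" using sums_unique[OF sums_single[of n d]] by simp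
qed

lemma inner_dual: "inner z \<in> V'"
proof -
  have "\<bar>z \<bullet> \<psi>\<bar> \<le> norm z * form_norm E \<psi>" if "\<psi> \<in> V" for \<psi>
  proof -
    have "\<bar>z \<bullet> \<psi>\<bar> \<le> norm z * norm \<psi>" by (rule Cauchy_Schwarz_ineq2)
    also have "\<dots> \<le> norm z * form_norm E \<psi>" using norm_le_form_norm[OF that] by (intro mult_left_mono) auto
    finally show ?thesis .
  qed
  then show ?thesis by (auto simp: dual_space_def linear_on_set_def inner_add_right)
qed

lemma dual_space_lincomb:
  assumes f: "f \<in> V'" and g: "g \<in> V'"
  shows "(\<lambda>\<psi>. a * f \<psi> + b * g \<psi>) \<in> V'"
proof -
  obtain C where C: "\<And>\<psi>. \<psi> \<in> V \<Longrightarrow> \<bar>f \<psi>\<bar> \<le> C * form_norm E \<psi>" using f by (auto simp: dual_space_def)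
  obtain D where D: "\<And>\<psi>. \<psi> \<in> V \<Longrightarrow> \<bar>g \<psi>\<bar> \<le> D * form_norm E \<psi>" using g by (auto simp: dual_space_def)
  have "\<bar>a * f \<psi> + b * g \<psi>\<bar> \<le> (\<bar>a\<bar> * C + \<bar>b\<bar> * D) * form_norm E \<psi>" if "\<psi> \<in> V" for \<psi>
  proof -
    have "\<bar>a * f \<psi> + b * g \<psi>\<bar> \<le> \<bar>a\<bar> * \<bar>f \<psi>\<bar> + \<bar>b\<bar> * \<bar>g \<psi>\<bar>"
      using abs_triangle_ineq[of "a * f \<psi>" "b * g \<psi>"] by (simp add: abs_mult)
    also have "\<dots> \<le> \<bar>a\<bar> * (C * form_norm E \<psi>) + \<bar>b\<bar> * (D * form_norm E \<psi>)"
      using C[OF that] D[OF that] by (intro add_mono mult_left_mono) auto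
    finally show ?thesis by (simp add: algebra_simps)
  qed
  moreover have "linear_on_set V (\<lambda>\<psi>. a * f \<psi> + b * g \<psi>)"
    unfolding linear_on_set_def using f g by (auto simp: dual_add dual_scale algebra_simps)
  ultimately show ?thesis by (auto simp: dual_space_def)
qed

lemma dual_norm_coeff_le: "f \<in> V' \<Longrightarrow> \<bar>f (\<phi> n)\<bar> \<le> sqrt (w n) * dual_norm V E f"
proof -
  assume f: "f \<in> V'"
  have "(f (\<phi> n))\<^sup>2 / w n \<le> (\<Sum>i<Suc n. (f (\<phi> i))\<^sup>2 / w i)"
    using w_pos by (intro member_le_sum) (auto intro: divide_nonneg_pos)
  also note dual_norm_partial_sum[OF f]
  finally have "(f (\<phi> n))\<^sup>2 \<le> w n * (dual_norm V E f)\<^sup>2" using w_pos[of n] by (simp add: field_simps)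
  also have "\<dots> = (sqrt (w n) * dual_norm V E f)\<^sup>2" using w_pos[of n] by (simp add: power_mult_distrib)
  finally have "\<bar>f (\<phi> n)\<bar> \<le> \<bar>sqrt (w n) * dual_norm V E f\<bar>" by (simp only: abs_le_square_iff)
  then show ?thesis using dual_norm_nonneg[OF f] w_pos[of n] by (simp add: abs_mult)
qed

end


section \<open>Explicit solutions\<close>

text \<open>
  Weak solutions with a time-dependent functional \<open>q\<close> as right-hand side. The control problem and the
  reflected adjoint problem are both of this kind.
\<close>

definition evolution_solution ::
    "'h::{real_inner, banach, second_countable_topology} set \<Rightarrow> ('h \<Rightarrow> 'h \<Rightarrow> real) \<Rightarrow> real \<Rightarrow> real \<Rightarrow> real \<Rightarrow>
     (real \<Rightarrow> 'h \<Rightarrow> real) \<Rightarrow> 'h \<Rightarrow> (real \<Rightarrow> 'h) \<Rightarrow> bool" where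
  "evolution_solution V E T \<mu> \<nu> q u0 u \<longleftrightarrow>
     (\<forall>t\<in>{0<..T}. u t \<in> V) \<and> norm_continuous_on (form_norm E) {0<..T} u \<and>
     (\<exists>g. continuous_on {0..T} g \<and> g 0 = u0 \<and>
        (\<forall>t\<in>{0<..T}. frac_integrable_left ((1 - \<nu>) * (1 - \<mu>)) u t \<and>
           g t = frac_int_left ((1 - \<nu>) * (1 - \<mu>)) u t)) \<and>
     (\<exists>w. has_hilfer_derivative_left V E T \<mu> \<nu> u w \<and>
        (\<forall>t\<in>{0<..T}. w t \<in> dual_space V E) \<and> norm_continuous_on (dual_norm V E) {0<..T} w \<and>
        (\<forall>\<phi>\<in>V. AE t in lborel. t \<in> {0<..<T} \<longrightarrow> w t \<phi> + E (u t) \<phi> - q t \<phi> = 0))"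

text \<open>
  One factor \<open>l\<close> is absorbed by \<open>ml_mult_le\<close>, so that the bound does not involve \<open>l\<close>.
\<close>

lemma ml_form_bound:
  assumes m: "0 < m" "m \<le> 1" and l: "0 \<le> l" and b: "m \<le> b" and t: "0 < t"
  shows "(1 + l) * (ml_kernel m b l t)\<^sup>2 \<le> (rl_kernel b t)\<^sup>2 + rl_kernel b t * (b / t * rl_kernel (b + 1 - m) t)"
proof -
  let ?e = "ml_kernel m b l t"
  have e: "0 \<le> ?e" "?e \<le> rl_kernel b t" "l * ?e \<le> b / t * rl_kernel (b + 1 - m) t"
    using ml_nonneg ml_le_rl_kernel ml_mult_le assms by auto
  have "(1 + l) * ?e\<^sup>2 = ?e * ?e + ?e * (l * ?e)" by (simp add: power2_eq_square algebra_simps)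
  also have "\<dots> \<le> rl_kernel b t * rl_kernel b t + rl_kernel b t * (b / t * rl_kernel (b + 1 - m) t)"
  proof (rule add_mono)
    show "?e * ?e \<le> rl_kernel b t * rl_kernel b t" using e by (intro mult_mono) auto
    have "0 \<le> l * ?e" using e l by simp
    then show "?e * (l * ?e) \<le> rl_kernel b t * (b / t * rl_kernel (b + 1 - m) t)"
      using e by (intro mult_mono[of ?e "rl_kernel b t" "l * ?e" "b / t * rl_kernel (b + 1 - m) t"]) auto
  qed
  finally show ?thesis by (simp add: power2_eq_square)
qed

lemma ml_zero: "0 < m \<Longrightarrow> 0 < t \<Longrightarrow> ml_kernel m 0 l t = - l * ml_kernel m m l t"
  using ml_rec[of m 0 t l] by simp

text \<open>
  For \<open>d = 0\<close> the kernel is \<open>- l * k\<close> with \<open>k = ml_kernel m m l\<close>. The two bounds \<open>k \<le> rl_kernel m t\<close> and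
  \<open>l * k \<le> m / t\<close> are interpolated: \<open>(l * k)^2 \<le> l * rl_kernel m t * (m / t)\<close> costs only \<open>sqrt l\<close>, which the
  dual norm absorbs, and leaves the integrable singularity \<open>t powr (m / 2 - 1)\<close>.
\<close>

lemma ml_dual_bound:
  assumes m: "0 < m" "m \<le> 1" and d: "d = 0 \<or> m \<le> d"
  shows "\<exists>C \<sigma>. 0 \<le> C \<and> 0 < \<sigma> \<and> (\<forall>l\<ge>0. \<forall>t>0. \<bar>ml_kernel m d l t\<bar> \<le> sqrt (1 + l) * (C * rl_kernel \<sigma> t))"
proof (cases "d = 0")
  case False
  show ?thesis
  proof (intro exI conjI allI impI)
    show "0 < d" using d m False by auto
    fix l t :: real assume lt: "0 \<le> l" "0 < t"
    have "\<bar>ml_kernel m d l t\<bar> \<le> 1 * (1 * rl_kernel d t)"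
      using ml_nonneg[OF m lt(1) _ lt(2), of d] ml_le_rl_kernel[OF m lt(1) _ lt(2), of d] d False by auto
    also have "\<dots> \<le> sqrt (1 + l) * (1 * rl_kernel d t)"
      using lt d m False by (intro mult_right_mono) (auto intro!: rl_kernel_nonneg)
    finally show "\<bar>ml_kernel m d l t\<bar> \<le> sqrt (1 + l) * (1 * rl_kernel d t)" .
  qed simp
next
  case True
  have G: "0 < Gamma m" "0 < Gamma (m / 2)" using m by auto
  define C where "C = sqrt (m / Gamma m) * Gamma (m / 2)"
  show ?thesis
  proof (intro exI conjI allI impI)
    show "0 \<le> C" "0 < m / 2" using m G by (auto simp: C_def)
    fix l t :: real assume lt: "0 \<le> l" "0 < t"
    let ?e = "ml_kernel m m l t"
    have e: "0 \<le> ?e" "?e \<le> rl_kernel m t" "l * ?e \<le> m / t"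
      using ml_nonneg[OF m lt(1) _ lt(2)] ml_le_rl_kernel[OF m lt(1) _ lt(2)] ml_mult_le[OF m lt(1) _ lt(2), of m] lt by auto
    have "(l * ?e)\<^sup>2 = l * (?e * (l * ?e))" by (simp add: power2_eq_square)
    also have "\<dots> \<le> (1 + l) * (rl_kernel m t * (m / t))"
      using e lt by (intro mult_mono) auto
    also have "\<dots> = (sqrt (1 + l) * (C * rl_kernel (m / 2) t))\<^sup>2"
    proof -
      have "t powr (m / 2 - 1) * t powr (m / 2 - 1) = t powr (m - 1) / t"
        using lt by (simp add: powr_diff flip: powr_add)
      then have pp: "(t powr (m / 2 - 1))\<^sup>2 = t powr (m - 1) / t" by (simp add: power2_eq_square)
      have "C * rl_kernel (m / 2) t = sqrt (m / Gamma m) * t powr (m / 2 - 1)"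
        using less_imp_neq[OF G(2)] by (simp add: C_def rl_kernel_def)
      then have "(C * rl_kernel (m / 2) t)\<^sup>2 = m / Gamma m * (t powr (m - 1) / t)"
        using m G(1) by (simp add: power_mult_distrib pp)
      then have "rl_kernel m t * (m / t) = (C * rl_kernel (m / 2) t)\<^sup>2"
        by (simp add: rl_kernel_def)
      then show ?thesis using lt by (simp add: power_mult_distrib)
    qed
    finally have "\<bar>l * ?e\<bar> \<le> \<bar>sqrt (1 + l) * (C * rl_kernel (m / 2) t)\<bar>" by (simp only: abs_le_square_iff)
    then show "\<bar>ml_kernel m d l t\<bar> \<le> sqrt (1 + l) * (C * rl_kernel (m / 2) t)"
      using ml_zero[OF m(1) lt(2), of l] True lt e G m rl_kernel_nonneg[of "m/2" t]
      by (simp add: abs_mult C_def)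
  qed
qed

text \<open>
  Tannery's theorem in the form in which every continuity statement about a series over the modes is obtained: the
  multipliers \<open>h n\<close> converge for each mode and are bounded uniformly in the mode.
\<close>

lemma weighted_sqrt_suminf_tendsto_0:
  fixes c :: "nat \<Rightarrow> real" and h :: "nat \<Rightarrow> 'x \<Rightarrow> real"
  assumes c: "summable (\<lambda>n. (c n)\<^sup>2)" and lim: "\<And>n. ((h n) \<longlongrightarrow> 0) F"
    and bound: "eventually (\<lambda>t. \<forall>n. (h n t)\<^sup>2 \<le> M) F"
  shows "((\<lambda>t. sqrt (\<Sum>n. (c n * h n t)\<^sup>2)) \<longlongrightarrow> 0) F"
proof (cases "F = bot")
  case False
  have "eventually (\<lambda>(n, t). norm ((c n * h n t)\<^sup>2) \<le> M * (c n)\<^sup>2) (at_top \<times>\<^sub>F F)"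
    unfolding eventually_prod_filter
  proof (intro exI conjI allI impI)
    show "eventually (\<lambda>_. True) (at_top :: nat filter)" by simp
    show "\<forall>\<^sub>F y in F. \<forall>n. (h n y)\<^sup>2 \<le> M" by (rule bound)
    fix n :: nat and t assume "\<forall>n. (h n t)\<^sup>2 \<le> M"
    then show "case (n, t) of (n, t) \<Rightarrow> norm ((c n * h n t)\<^sup>2) \<le> M * (c n)\<^sup>2"
      using mult_right_mono[of "(h n t)\<^sup>2" M "(c n)\<^sup>2"] by (simp add: power_mult_distrib mult.commute)
  qed
  then have "((\<lambda>t. \<Sum>n. (c n * h n t)\<^sup>2) \<longlongrightarrow> (\<Sum>n. (0::real))) F"
    using tannerys_theorem[of "\<lambda>n t. (c n * h n t)\<^sup>2" "\<lambda>_. 0" F "\<lambda>n. M * (c n)\<^sup>2"] summable_mult[OF c, of M] False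
      tendsto_power[OF tendsto_mult[OF tendsto_const lim], of _ _ 2] by simp
  then show ?thesis using tendsto_real_sqrt[of "\<lambda>t. \<Sum>n. (c n * h n t)\<^sup>2" 0 F] by simp
qed simp

text \<open>
  Here \<open>a\<close> and \<open>b\<close> are the orders of the inner and the outer fractional integral of the derivative. They
  play symmetric roles, so that the reflected adjoint problem is the instance with \<open>a\<close> and \<open>b\<close> exchanged.
\<close>

locale fractional_form = diagonal_form H V E \<phi> l
  for H V :: "'h::{real_inner,banach,second_countable_topology} set" and E :: "'h \<Rightarrow> 'h \<Rightarrow> real"
    and \<phi> :: "nat \<Rightarrow> 'h" and l :: "nat \<Rightarrow> real" +
  fixes m a b :: real
  assumes m: "0 < m" "m \<le> 1" and ab: "0 \<le> a" "0 \<le> b" "a + b + m = 1"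
begin

abbreviation "mode \<equiv> \<lambda>\<beta> n. ml_kernel m \<beta> (l n)"

text \<open>
  A state has \<open>\<beta> = b + d + m\<close>; its fractional integral of order \<open>a\<close> has \<open>\<beta> = 1 + d\<close>.
\<close>

definition sol :: "real \<Rightarrow> 'h \<Rightarrow> real \<Rightarrow> 'h" where
  "sol \<beta> x t = (\<Sum>n. (x \<bullet> \<phi> n * mode \<beta> n t) *\<^sub>R \<phi> n)"

lemma mode_bounds: "m \<le> \<beta> \<Longrightarrow> 0 < t \<Longrightarrow> 0 \<le> mode \<beta> n t" "m \<le> \<beta> \<Longrightarrow> 0 < t \<Longrightarrow> mode \<beta> n t \<le> rl_kernel \<beta> t"
  using ml_nonneg ml_le_rl_kernel m l_nonneg by auto

lemma mode_isCont: "0 \<le> \<beta> \<Longrightarrow> 0 < t \<Longrightarrow> isCont (mode \<beta> n) t"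
  using continuous_on_ml[OF m(1), of \<beta> "l n"] by (simp add: continuous_on_eq_continuous_at)

definition form_bound :: "real \<Rightarrow> real \<Rightarrow> real" where
  "form_bound \<beta> t = (rl_kernel \<beta> t)\<^sup>2 + rl_kernel \<beta> t * (\<beta> / t * rl_kernel (\<beta> + 1 - m) t)"

lemma mode_form_bound: "m \<le> \<beta> \<Longrightarrow> 0 < t \<Longrightarrow> w n * (mode \<beta> n t)\<^sup>2 \<le> form_bound \<beta> t"
  unfolding form_bound_def using ml_form_bound m l_nonneg by auto

lemma rl_kernel_isCont: "0 < t \<Longrightarrow> isCont (rl_kernel \<beta>) t"
  using continuous_on_pk[of \<beta>] by (simp add: continuous_on_eq_continuous_at)

lemma form_bound_isCont: "0 < t \<Longrightarrow> isCont (form_bound \<beta>) t"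
  unfolding form_bound_def[abs_def] by (intro continuous_intros rl_kernel_isCont) auto

lemma eventually_form_bound:
  assumes "0 < t0" shows "eventually (\<lambda>t. 0 < t \<and> form_bound \<beta> t \<le> form_bound \<beta> t0 + 1) (at t0 within S)"
proof -
  have "(form_bound \<beta> \<longlongrightarrow> form_bound \<beta> t0) (at t0 within S)"
    using form_bound_isCont[OF assms] by (simp add: isCont_def tendsto_within_subset[OF _ subset_UNIV])
  then have "eventually (\<lambda>t. form_bound \<beta> t < form_bound \<beta> t0 + 1) (at t0 within S)"
    by (rule order_tendstoD) simp
  moreover have "eventually (\<lambda>t. 0 < t) (at t0 within S)"
    using order_tendstoD(1)[OF tendsto_ident_at assms] .
  ultimately show ?thesis by eventually_elim simp
qed

lemma coeff_summable: "x \<in> H \<Longrightarrow> summable (\<lambda>n. (x \<bullet> \<phi> n)\<^sup>2)" "x \<in> H \<Longrightarrow> (\<Sum>n. (x \<bullet> \<phi> n)\<^sup>2) = (norm x)\<^sup>2"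
  using parseval_norm by (auto simp: sums_iff)

lemma sol_summable:
  assumes "x \<in> H" "m \<le> \<beta>" "0 < t"
  shows "summable (\<lambda>n. w n * (x \<bullet> \<phi> n * mode \<beta> n t)\<^sup>2)"
proof (rule summable_comparison_test'[OF summable_mult[OF coeff_summable(1)[OF assms(1)]]])
  fix n
  have "(w n * (mode \<beta> n t)\<^sup>2) * (x \<bullet> \<phi> n)\<^sup>2 \<le> form_bound \<beta> t * (x \<bullet> \<phi> n)\<^sup>2"
    using mode_form_bound[OF assms(2,3)] by (intro mult_right_mono) auto
  then show "norm (w n * (x \<bullet> \<phi> n * mode \<beta> n t)\<^sup>2) \<le> form_bound \<beta> t * (x \<bullet> \<phi> n)\<^sup>2"
    using w_pos[of n] by (simp add: power_mult_distrib mult_ac abs_mult)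
qed

lemma sol_V: "x \<in> H \<Longrightarrow> m \<le> \<beta> \<Longrightarrow> 0 < t \<Longrightarrow> sol \<beta> x t \<in> V"
  unfolding sol_def by (rule synthesis_V(2)[OF _ sol_summable]) auto

lemma sol_coeff: "x \<in> H \<Longrightarrow> m \<le> \<beta> \<Longrightarrow> 0 < t \<Longrightarrow> sol \<beta> x t \<bullet> \<phi> n = x \<bullet> \<phi> n * mode \<beta> n t"
  unfolding sol_def by (rule synthesis(3)[OF _ synthesis_V(1)[OF _ sol_summable]]) auto

lemma sol_H: "x \<in> H \<Longrightarrow> m \<le> \<beta> \<Longrightarrow> 0 < t \<Longrightarrow> sol \<beta> x t \<in> H"
  using sol_V V_H by blast

lemma sol_norm_le:
  assumes "x \<in> H" "m \<le> \<beta>" "0 < t"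
  shows "norm (sol \<beta> x t) \<le> rl_kernel \<beta> t * norm x"
proof (rule power2_le_imp_le)
  have s: "(\<lambda>n. (x \<bullet> \<phi> n * mode \<beta> n t)\<^sup>2) sums (norm (sol \<beta> x t))\<^sup>2"
    using parseval_norm[OF sol_H[OF assms]] by (simp add: sol_coeff assms)
  have "(norm (sol \<beta> x t))\<^sup>2 \<le> (rl_kernel \<beta> t)\<^sup>2 * (norm x)\<^sup>2"
  proof (rule sums_le[OF _ s sums_mult[OF parseval_norm[OF assms(1)]]])
    fix n
    have "(mode \<beta> n t)\<^sup>2 \<le> (rl_kernel \<beta> t)\<^sup>2" using mode_bounds[OF assms(2,3), of n] by (intro power_mono)
    then show "(x \<bullet> \<phi> n * mode \<beta> n t)\<^sup>2 \<le> (rl_kernel \<beta> t)\<^sup>2 * (x \<bullet> \<phi> n)\<^sup>2"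
      using mult_right_mono[of "(mode \<beta> n t)\<^sup>2" _ "(x \<bullet> \<phi> n)\<^sup>2"] by (simp add: power_mult_distrib mult.commute)
  qed
  then show "(norm (sol \<beta> x t))\<^sup>2 \<le> (rl_kernel \<beta> t * norm x)\<^sup>2" by (simp add: power_mult_distrib)
  show "0 \<le> rl_kernel \<beta> t * norm x" using assms m by (intro mult_nonneg_nonneg rl_kernel_nonneg) auto
qed

lemma bounded_diff_square:
  fixes p q M :: real
  assumes "W * p\<^sup>2 \<le> M" "W * q\<^sup>2 \<le> M" "0 \<le> W"
  shows "(sqrt W * (p - q))\<^sup>2 \<le> 4 * M"
proof -
  have "(p - q)\<^sup>2 \<le> 2 * p\<^sup>2 + 2 * q\<^sup>2"
    using zero_le_power2[of "p + q"] by (simp add: power2_sum power2_diff)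
  then have "W * (p - q)\<^sup>2 \<le> W * (2 * p\<^sup>2 + 2 * q\<^sup>2)" using assms(3) by (rule mult_left_mono)
  also have "\<dots> \<le> 4 * M" using assms by (simp add: distrib_left)
  finally show ?thesis using assms(3) by (simp add: power_mult_distrib)
qed

lemma sol_continuous:
  assumes x: "x \<in> H" and \<beta>: "m \<le> \<beta>" and S: "S \<subseteq> {0<..}"
  shows "norm_continuous_on (form_norm E) S (sol \<beta> x)" "continuous_on S (sol \<beta> x)"
proof -
  have *: "((\<lambda>s. form_norm E (sol \<beta> x s - sol \<beta> x t)) \<longlongrightarrow> 0) (at t within S)" if t: "t \<in> S" for t
  proof -
    have t0: "0 < t" using t S by auto
    have "((\<lambda>s. sqrt (\<Sum>n. (x \<bullet> \<phi> n * (sqrt (w n) * (mode \<beta> n s - mode \<beta> n t)))\<^sup>2)) \<longlongrightarrow> 0) (at t within S)"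
    proof (rule weighted_sqrt_suminf_tendsto_0[OF coeff_summable(1)[OF x]])
      fix n
      have "((\<lambda>s. mode \<beta> n s) \<longlongrightarrow> mode \<beta> n t) (at t within S)"
        using mode_isCont[of \<beta> t n] \<beta> m t0 by (simp add: isCont_def tendsto_within_subset[OF _ subset_UNIV])
      from tendsto_mult_left[OF LIM_zero[OF this], of "sqrt (w n)"]
      show "((\<lambda>s. sqrt (w n) * (mode \<beta> n s - mode \<beta> n t)) \<longlongrightarrow> 0) (at t within S)" by simp
    next
      show "eventually (\<lambda>s. \<forall>n. (sqrt (w n) * (mode \<beta> n s - mode \<beta> n t))\<^sup>2 \<le> 4 * (form_bound \<beta> t + 1)) (at t within S)"
        using eventually_form_bound[OF t0, of \<beta> S]
      proof eventually_elim
        case (elim s)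
        show ?case
        proof
          fix n show "(sqrt (w n) * (mode \<beta> n s - mode \<beta> n t))\<^sup>2 \<le> 4 * (form_bound \<beta> t + 1)"
            using mode_form_bound[OF \<beta>, of s n] mode_form_bound[OF \<beta> t0, of n] elim w_pos[of n]
            by (intro bounded_diff_square) auto
        qed
      qed
    qed
    then show ?thesis
    proof (rule Lim_transform_eventually)
      have "eventually (\<lambda>s. s \<in> S) (at t within S)" by (simp add: eventually_at_filter)
      then show "eventually (\<lambda>s. sqrt (\<Sum>n. (x \<bullet> \<phi> n * (sqrt (w n) * (mode \<beta> n s - mode \<beta> n t)))\<^sup>2) = form_norm E (sol \<beta> x s - sol \<beta> x t)) (at t within S)"
      proof eventually_elim
        case (elim s)
        then have s0: "0 < s" using S by auto
        have "(x \<bullet> \<phi> n * (sqrt (w n) * (mode \<beta> n s - mode \<beta> n t)))\<^sup>2 = w n * ((sol \<beta> x s - sol \<beta> x t) \<bullet> \<phi> n)\<^sup>2" for n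
          using w_pos[of n] by (simp add: inner_diff_left sol_coeff x \<beta> s0 t0 power_mult_distrib flip: right_diff_distrib)
        then show ?case by (simp add: form_norm_eq V_diff sol_V x \<beta> s0 t0)
      qed
    qed
  qed
  then show "norm_continuous_on (form_norm E) S (sol \<beta> x)" by (simp add: norm_continuous_on_def)
  show "continuous_on S (sol \<beta> x)"
    unfolding continuous_on_def
  proof
    fix t assume t: "t \<in> S"
    show "(sol \<beta> x \<longlongrightarrow> sol \<beta> x t) (at t within S)"
    proof (rule LIM_zero_cancel, rule Lim_null_comparison[OF _ *[OF t]])
      have "eventually (\<lambda>s. s \<in> S) (at t within S)" by (simp add: eventually_at_filter)
      then show "eventually (\<lambda>s. norm (sol \<beta> x s - sol \<beta> x t) \<le> form_norm E (sol \<beta> x s - sol \<beta> x t)) (at t within S)"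
        by eventually_elim (use t S in \<open>auto intro!: norm_le_form_norm V_diff sol_V x \<beta>\<close>)
    qed
  qed
qed

lemma integral_in_H:
  assumes "integrable M f" "\<And>x. f x \<in> H"
  shows "integral\<^sup>L M f \<in> H"
proof (rule ccontr)
  assume "integral\<^sup>L M f \<notin> H"
  then obtain p y where p: "p \<in> H" "integral\<^sup>L M f = p + y" "y \<noteq> 0" "\<And>z. z \<in> H \<Longrightarrow> y \<bullet> z = 0"
    using closed_subspace_orthogonal_vector[OF subspaceH closedH] by blast
  have "integral\<^sup>L M f \<bullet> y = (LINT x|M. f x \<bullet> y)"
    using integral_inner_left[of y M f] assms(1) by simp
  also have "\<dots> = 0" using p(4)[OF assms(2)] by (simp add: inner_commute)
  finally have "p \<bullet> y + y \<bullet> y = 0" unfolding p(2) inner_add_left .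
  then have "y \<bullet> y = 0" using p(4)[OF p(1)] by (simp add: inner_commute)
  then show False using p(3) by simp
qed

lemma set_integral_in_H:
  assumes "set_integrable M S f" "\<And>x. x \<in> S \<Longrightarrow> f x \<in> H"
  shows "set_lebesgue_integral M S f \<in> H"
  unfolding set_lebesgue_integral_def
  by (rule integral_in_H) (use assms subspace_0[OF subspaceH] in \<open>auto simp: set_integrable_def indicator_def\<close>)

text \<open>
  Fractional integration acts on each mode by \<open>ml_conv\<close>, and the Bochner integral stays in the closed
  subspace \<open>H\<close>, where coordinates determine a vector.
\<close>

lemma sol_frac:
  assumes x: "x \<in> H" and \<beta>: "m \<le> \<beta>" and c: "0 < c" and t: "0 < t"
  shows "set_integrable lborel {0<..<t} (\<lambda>\<tau>. (t - \<tau>) powr (c - 1) *\<^sub>R sol \<beta> x \<tau>)"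
    and "frac_int_left c (sol \<beta> x) t = sol (c + \<beta>) x t"
proof -
  have \<beta>0: "0 < \<beta>" using \<beta> m by simp
  have G: "Gamma c > 0" using c by simp
  have con: "continuous_on {0<..<t} (\<lambda>\<tau>. (t - \<tau>) powr (c - 1) *\<^sub>R sol \<beta> x \<tau>)"
    by (intro continuous_intros sol_continuous(2)[OF x \<beta>]) auto
  have pc: "set_integrable lborel {0<..<t} (\<lambda>\<tau>. (Gamma c * norm x) * (rl_kernel c (t - \<tau>) * rl_kernel \<beta> \<tau>))"
    using rl_kernel_conv(1)[OF c \<beta>0 t] by simp
  show si: "set_integrable lborel {0<..<t} (\<lambda>\<tau>. (t - \<tau>) powr (c - 1) *\<^sub>R sol \<beta> x \<tau>)"
  proof (rule set_integrable_bound[OF pc])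
    show "set_borel_measurable lborel {0<..<t} (\<lambda>\<tau>. (t - \<tau>) powr (c - 1) *\<^sub>R sol \<beta> x \<tau>)"
      unfolding set_borel_measurable_def using borel_measurable_continuous_on_indicator[OF _ con] by simp
    show "AE \<tau> in lborel. \<tau> \<in> {0<..<t} \<longrightarrow> norm ((t - \<tau>) powr (c - 1) *\<^sub>R sol \<beta> x \<tau>) \<le> norm ((Gamma c * norm x) * (rl_kernel c (t - \<tau>) * rl_kernel \<beta> \<tau>))"
    proof (intro AE_I2 impI)
      fix \<tau> assume "\<tau> \<in> {0<..<t}"
      then have \<tau>: "0 < \<tau>" "\<tau> < t" by auto
      have "norm ((t - \<tau>) powr (c - 1) *\<^sub>R sol \<beta> x \<tau>) \<le> (t - \<tau>) powr (c - 1) * (rl_kernel \<beta> \<tau> * norm x)"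
        using sol_norm_le[OF x \<beta> \<tau>(1)] by (simp add: mult_left_mono)
      also have "\<dots> = (Gamma c * norm x) * (rl_kernel c (t - \<tau>) * rl_kernel \<beta> \<tau>)"
        using G by (simp add: rl_kernel_def)
      finally show "norm ((t - \<tau>) powr (c - 1) *\<^sub>R sol \<beta> x \<tau>) \<le> norm ((Gamma c * norm x) * (rl_kernel c (t - \<tau>) * rl_kernel \<beta> \<tau>))"
        by simp
    qed
  qed
  have cb: "m \<le> c + \<beta>" using c \<beta> by simp
  show "frac_int_left c (sol \<beta> x) t = sol (c + \<beta>) x t"
  proof (rule H_eqI)
    have "(LINT \<tau>:{0<..<t}|lborel. (t - \<tau>) powr (c - 1) *\<^sub>R sol \<beta> x \<tau>) \<in> H"
      by (rule set_integral_in_H[OF si]) (auto intro!: subspace_scale subspaceH sol_H x \<beta>)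
    then show "frac_int_left c (sol \<beta> x) t \<in> H"
      using c by (simp add: frac_int_left_def subspace_scale subspaceH)
    show "sol (c + \<beta>) x t \<in> H" by (rule sol_H[OF x cb t])
    fix n
    have "(LINT \<tau>:{0<..<t}|lborel. (t - \<tau>) powr (c - 1) *\<^sub>R sol \<beta> x \<tau>) \<bullet> \<phi> n
        = (LINT \<tau>|lborel. (indicat_real {0<..<t} \<tau> *\<^sub>R (t - \<tau>) powr (c - 1) *\<^sub>R sol \<beta> x \<tau>) \<bullet> \<phi> n)"
      unfolding set_lebesgue_integral_def
      using integral_inner_left[of "\<phi> n" lborel "\<lambda>\<tau>. indicat_real {0<..<t} \<tau> *\<^sub>R (t - \<tau>) powr (c - 1) *\<^sub>R sol \<beta> x \<tau>"] si
      by (simp add: set_integrable_def)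
    also have "\<dots> = (LINT \<tau>:{0<..<t}|lborel. (Gamma c * (x \<bullet> \<phi> n)) * (rl_kernel c (t - \<tau>) * mode \<beta> n \<tau>))"
      unfolding set_lebesgue_integral_def
    proof (rule Bochner_Integration.integral_cong[OF refl])
      fix \<tau>
      show "(indicat_real {0<..<t} \<tau> *\<^sub>R (t - \<tau>) powr (c - 1) *\<^sub>R sol \<beta> x \<tau>) \<bullet> \<phi> n =
        indicat_real {0<..<t} \<tau> *\<^sub>R (Gamma c * (x \<bullet> \<phi> n) * (rl_kernel c (t - \<tau>) * mode \<beta> n \<tau>))"
        using G by (cases "\<tau> \<in> {0<..<t}") (auto simp: sol_coeff x \<beta> rl_kernel_def)
    qed
    also have "\<dots> = Gamma c * (x \<bullet> \<phi> n) * mode (c + \<beta>) n t"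
      using ml_conv(2)[OF m(1) c \<beta>0 t, of "l n"] by simp
    finally show "frac_int_left c (sol \<beta> x) t \<bullet> \<phi> n = sol (c + \<beta>) x t \<bullet> \<phi> n"
      using c less_imp_neq[OF G] by (simp add: frac_int_left_def sol_coeff x cb t)
  qed
qed

end

lemma rl_kernel_tendsto_0:
  assumes "1 < c"
  shows "((\<lambda>t. rl_kernel c t) \<longlongrightarrow> 0) (at 0 within {0..T})"
proof -
  have "eventually (\<lambda>t. t \<in> {0..T}) (at 0 within {0..T})" by (simp add: eventually_at_filter)
  then have "((\<lambda>t. t powr (c - 1)) \<longlongrightarrow> 0 powr (c - 1)) (at 0 within {0..T})"
    using assms by (intro tendsto_powr' tendsto_intros) (auto elim: eventually_mono)
  then have "((\<lambda>t. t powr (c - 1) * inverse (Gamma c)) \<longlongrightarrow> 0 * inverse (Gamma c)) (at 0 within {0..T})"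
    using assms by (intro tendsto_mult tendsto_const) simp
  then show ?thesis by (simp add: rl_kernel_def divide_inverse)
qed

context fractional_form
begin

lemma sol_norm_diff:
  assumes x: "x \<in> H" and \<beta>: "m \<le> \<beta>" and t: "0 < t"
  shows "norm (sol \<beta> x t - x) = sqrt (\<Sum>n. (x \<bullet> \<phi> n * (mode \<beta> n t - 1))\<^sup>2)"
proof -
  have d: "sol \<beta> x t - x \<in> H" using sol_H[OF assms] x subspaceH by (intro subspace_diff)
  have "(\<lambda>n. (x \<bullet> \<phi> n * (mode \<beta> n t - 1))\<^sup>2) sums (norm (sol \<beta> x t - x))\<^sup>2"
    using parseval_norm[OF d] by (simp add: inner_diff_left sol_coeff assms right_diff_distrib)
  then show ?thesis by (simp add: sums_iff)
qed

text \<open>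
  For \<open>d = 0\<close> each mode tends to \<open>1\<close> at time \<open>0\<close>, but not uniformly in the mode, so the limit holds only for
  the norm of the pivot space.
\<close>

lemma sol_initial:
  assumes x: "x \<in> H" and d: "d = 0 \<or> m \<le> d"
  shows "continuous_on {0..T} (\<lambda>t. if t = 0 then (if d = 0 then x else 0) else sol (1 + d) x t)" (is "continuous_on _ ?g")
  unfolding continuous_on_def
proof
  fix t assume t: "t \<in> {0..T}"
  have d1: "m \<le> 1 + d" using d m by auto
  show "(?g \<longlongrightarrow> ?g t) (at t within {0..T})"
  proof (cases "t = 0")
    case False
    then have t0: "0 < t" using t by simp
    have "continuous_on {0<..} (sol (1 + d) x)" by (rule sol_continuous(2)[OF x d1]) simp
    then have "isCont (sol (1 + d) x) t" using t0 by (simp add: continuous_on_eq_continuous_at)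
    then have lim: "(sol (1 + d) x \<longlongrightarrow> ?g t) (at t within {0..T})"
      using t0 by (simp add: isCont_def tendsto_within_subset[OF _ subset_UNIV])
    have "eventually (\<lambda>s. 0 < s) (at t within {0..T})"
      by (rule order_tendstoD(1)[OF tendsto_ident_at t0])
    then have "eventually (\<lambda>s. sol (1 + d) x s = ?g s) (at t within {0..T})"
      by eventually_elim auto
    then show ?thesis by (rule Lim_transform_eventually[OF lim])
  next
    case True
    have ev: "eventually (\<lambda>s. 0 < s) (at 0 within {0..T})"
      by (auto simp: eventually_at_filter)
    show ?thesis
    proof (cases "d = 0")
      case d0: False
      then have dm: "1 < 1 + d" using d m by auto
      have "(?g \<longlongrightarrow> 0) (at 0 within {0..T})"
      proof (rule Lim_null_comparison)
        show "eventually (\<lambda>s. norm (?g s) \<le> rl_kernel (1 + d) s * norm x) (at 0 within {0..T})"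
          using ev by eventually_elim (use sol_norm_le[OF x d1] in auto)
        show "((\<lambda>s. rl_kernel (1 + d) s * norm x) \<longlongrightarrow> 0) (at 0 within {0..T})"
          using tendsto_mult_right[OF rl_kernel_tendsto_0[OF dm], of "norm x"] by simp
      qed
      then show ?thesis using True d0 by simp
    next
      case d0: True
      have "((\<lambda>s. sqrt (\<Sum>n. (x \<bullet> \<phi> n * (mode 1 n s - 1))\<^sup>2)) \<longlongrightarrow> 0) (at 0 within {0..T})"
      proof (rule weighted_sqrt_suminf_tendsto_0[OF coeff_summable(1)[OF x]])
        have b: "0 \<le> mode 1 n s" "mode 1 n s \<le> 1" "1 - mode 1 n s = l n * mode (1 + m) n s" if "0 < s" for n s
          using that mode_bounds[of 1 s n] m ml_rec[OF m(1) _ that, of 1 "l n"] by auto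
        show "eventually (\<lambda>s. \<forall>n. (mode 1 n s - 1)\<^sup>2 \<le> 1) (at 0 within {0..T})"
          using ev
        proof eventually_elim
          case (elim s)
          have "\<bar>mode 1 n s - 1\<bar> \<le> \<bar>1\<bar>" for n using b[OF elim, of n] by simp
          then show ?case by (simp only: abs_le_square_iff) simp
        qed
        fix n
        show "((\<lambda>s. mode 1 n s - 1) \<longlongrightarrow> 0) (at 0 within {0..T})"
        proof (rule Lim_null_comparison)
          show "eventually (\<lambda>s. norm (mode 1 n s - 1) \<le> l n * rl_kernel (1 + m) s) (at 0 within {0..T})"
            using ev
          proof eventually_elim
            case (elim s)
            have "norm (mode 1 n s - 1) = l n * mode (1 + m) n s" using b[OF elim, of n] by simp
            also have "\<dots> \<le> l n * rl_kernel (1 + m) s"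
              using mode_bounds(2)[of "1 + m" s n] elim l_nonneg[of n] by (intro mult_left_mono) auto
            finally show ?case .
          qed
          show "((\<lambda>s. l n * rl_kernel (1 + m) s) \<longlongrightarrow> 0) (at 0 within {0..T})"
            using tendsto_mult_left[OF rl_kernel_tendsto_0[of "1 + m" T], of "l n"] m by simp
        qed
      qed
      then have "((\<lambda>s. ?g s - x) \<longlongrightarrow> 0) (at 0 within {0..T})"
      proof (rule Lim_null_comparison[rotated])
        show "eventually (\<lambda>s. norm (?g s - x) \<le> sqrt (\<Sum>n. (x \<bullet> \<phi> n * (mode 1 n s - 1))\<^sup>2)) (at 0 within {0..T})"
          using ev by eventually_elim (use sol_norm_diff[OF x, of 1] d0 m in auto)
      qed
      then show ?thesis using True d0 by (simp add: LIM_zero_cancel)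
    qed
  qed
qed

text \<open>
  The time derivative of \<open>sol (1 + d) x\<close>. For \<open>d = 0\<close> its modes grow with \<open>l n\<close>, and the series converges
  only in the dual of the form domain.
\<close>

definition sol_deriv :: "real \<Rightarrow> 'h \<Rightarrow> real \<Rightarrow> 'h \<Rightarrow> real" where
  "sol_deriv d x t \<psi> = (\<Sum>n. (\<psi> \<bullet> \<phi> n) * (x \<bullet> \<phi> n * mode d n t))"

lemma mode_dual_bound:
  assumes d: "d = 0 \<or> m \<le> d"
  shows "\<exists>C \<sigma>. 0 \<le> C \<and> 0 < \<sigma> \<and> (\<forall>n. \<forall>t>0. \<bar>mode d n t\<bar> \<le> sqrt (w n) * (C * rl_kernel \<sigma> t))"
  using ml_dual_bound[OF m d] l_nonneg by blast

lemma square_div_w_le: "\<bar>p\<bar> \<le> sqrt (w n) * q \<Longrightarrow> p\<^sup>2 / w n \<le> q\<^sup>2"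
proof -
  assume "\<bar>p\<bar> \<le> sqrt (w n) * q"
  then have "\<bar>p\<bar>\<^sup>2 \<le> (sqrt (w n) * q)\<^sup>2" by (intro power_mono) auto
  then show ?thesis using w_pos[of n] by (simp add: power_mult_distrib field_simps)
qed

lemma dual_weighted_summable:
  assumes x: "x \<in> H" and h: "\<And>n. \<bar>h n\<bar> \<le> sqrt (w n) * M"
  shows "summable (\<lambda>n. (x \<bullet> \<phi> n * h n)\<^sup>2 / w n)" "(\<Sum>n. (x \<bullet> \<phi> n * h n)\<^sup>2 / w n) \<le> M\<^sup>2 * (norm x)\<^sup>2"
proof -
  have le: "(x \<bullet> \<phi> n * h n)\<^sup>2 / w n \<le> M\<^sup>2 * (x \<bullet> \<phi> n)\<^sup>2" for n
    using mult_right_mono[OF square_div_w_le[OF h], of "(x \<bullet> \<phi> n)\<^sup>2" n] by (simp add: power_mult_distrib mult.commute)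
  have s: "summable (\<lambda>n. M\<^sup>2 * (x \<bullet> \<phi> n)\<^sup>2)" by (rule summable_mult[OF coeff_summable(1)[OF x]])
  show s': "summable (\<lambda>n. (x \<bullet> \<phi> n * h n)\<^sup>2 / w n)"
    by (rule summable_comparison_test'[OF s]) (use le w_pos in \<open>simp add: less_imp_le\<close>)
  have "(\<Sum>n. (x \<bullet> \<phi> n * h n)\<^sup>2 / w n) \<le> (\<Sum>n. M\<^sup>2 * (x \<bullet> \<phi> n)\<^sup>2)"
    by (rule suminf_le[OF le s' s])
  then show "(\<Sum>n. (x \<bullet> \<phi> n * h n)\<^sup>2 / w n) \<le> M\<^sup>2 * (norm x)\<^sup>2"
    using suminf_mult[OF coeff_summable(1)[OF x], of "M\<^sup>2"] coeff_summable(2)[OF x] by simp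
qed

lemma dual_multiplier:
  assumes x: "x \<in> H" and h: "\<And>n. \<bar>h n\<bar> \<le> sqrt (w n) * M"
  defines "f \<equiv> \<lambda>\<psi>. \<Sum>n. (\<psi> \<bullet> \<phi> n) * (x \<bullet> \<phi> n * h n)"
  shows "f \<in> V'" "f (\<phi> n) = x \<bullet> \<phi> n * h n" "dual_norm V E f = sqrt (\<Sum>n. (x \<bullet> \<phi> n * h n)\<^sup>2 / w n)"
    "\<psi> \<in> V \<Longrightarrow> summable (\<lambda>n. (\<psi> \<bullet> \<phi> n) * (x \<bullet> \<phi> n * h n))"
proof -
  note s = dual_weighted_summable(1)[OF x h]
  note syn = dual_synthesis[of "\<lambda>n. x \<bullet> \<phi> n * h n", OF _ s]
  show V': "f \<in> V'" unfolding f_def by (rule syn(1)) auto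
  show c: "f (\<phi> n) = x \<bullet> \<phi> n * h n" for n unfolding f_def by (rule syn(2)) auto
  show "dual_norm V E f = sqrt (\<Sum>n. (x \<bullet> \<phi> n * h n)\<^sup>2 / w n)"
    unfolding dual_norm_eq[OF V'] c ..
  show "\<psi> \<in> V \<Longrightarrow> summable (\<lambda>n. (\<psi> \<bullet> \<phi> n) * (x \<bullet> \<phi> n * h n))" by (rule syn(3)) auto
qed

lemma sol_deriv_facts:
  assumes x: "x \<in> H" and d: "d = 0 \<or> m \<le> d" and t: "0 < t"
  shows "sol_deriv d x t \<in> V'" "sol_deriv d x t (\<phi> n) = x \<bullet> \<phi> n * mode d n t"
    "dual_norm V E (sol_deriv d x t) = sqrt (\<Sum>n. (x \<bullet> \<phi> n * mode d n t)\<^sup>2 / w n)"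
proof -
  obtain C \<sigma> where C: "0 \<le> C" "0 < \<sigma>" "\<And>n t. 0 < t \<Longrightarrow> \<bar>mode d n t\<bar> \<le> sqrt (w n) * (C * rl_kernel \<sigma> t)"
    using mode_dual_bound[OF d] by blast
  have F: "sol_deriv d x t = (\<lambda>\<psi>. \<Sum>n. (\<psi> \<bullet> \<phi> n) * (x \<bullet> \<phi> n * mode d n t))" by (rule ext) (simp add: sol_deriv_def)
  note dm = dual_multiplier[OF x C(3)[OF t], folded F]
  show "sol_deriv d x t \<in> V'" by (rule dm(1))
  show "sol_deriv d x t (\<phi> n) = x \<bullet> \<phi> n * mode d n t"
    unfolding sol_deriv_def by (rule dual_multiplier(2)[OF x C(3)[OF t]])
  show "dual_norm V E (sol_deriv d x t) = sqrt (\<Sum>n. (x \<bullet> \<phi> n * mode d n t)\<^sup>2 / w n)" by (rule dm(3))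
qed

text \<open>
  By the mean value theorem the difference quotient of a mode is a value of its derivative, so
  \<open>ml_dual_bound\<close> bounds all difference quotients uniformly and the limit can be taken mode by mode.
\<close>

lemma sol_has_dual_derivative:
  assumes x: "x \<in> H" and d: "d = 0 \<or> m \<le> d" and t: "0 < t"
    and G: "\<And>s. 0 < s \<Longrightarrow> G s = inner (sol (1 + d) x s)"
  shows "has_dual_derivative V E G (sol_deriv d x t) t"
proof -
  obtain C \<sigma> where C: "0 \<le> C" "0 < \<sigma>" "\<And>n t. 0 < t \<Longrightarrow> \<bar>mode d n t\<bar> \<le> sqrt (w n) * (C * rl_kernel \<sigma> t)"
    using mode_dual_bound[OF d] by blast
  have d1: "m \<le> 1 + d" and d0: "0 \<le> d" using d m by auto
  define q where "q n s = (mode (1 + d) n s - mode (1 + d) n t) / (s - t)" for n s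
  define h where "h n s = (q n s - mode d n t) / sqrt (w n)" for n s
  have "(rl_kernel \<sigma> \<longlongrightarrow> rl_kernel \<sigma> t) (at t)" using rl_kernel_isCont[OF t] by (simp add: isCont_def)
  then have "eventually (\<lambda>s. rl_kernel \<sigma> s < rl_kernel \<sigma> t + 1) (at t)" by (rule order_tendstoD) simp
  then have "eventually (\<lambda>s. rl_kernel \<sigma> s < rl_kernel \<sigma> t + 1 \<and> 0 < s) (at t)"
    using order_tendstoD(1)[OF tendsto_ident_at t] by (rule eventually_conj)
  then obtain r where r: "0 < r" "\<And>s. s \<noteq> t \<Longrightarrow> dist s t < r \<Longrightarrow> rl_kernel \<sigma> s < rl_kernel \<sigma> t + 1 \<and> 0 < s"
    unfolding eventually_at by auto
  define M where "M = C * (rl_kernel \<sigma> t + 1)"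
  have M: "\<bar>mode d n s\<bar> \<le> sqrt (w n) * M \<and> 0 < s" if "dist s t < r" for n s
  proof -
    have s: "rl_kernel \<sigma> s \<le> rl_kernel \<sigma> t + 1" "0 < s" using r(2)[OF _ that] t by (cases "s = t"; force)+
    have "\<bar>mode d n s\<bar> \<le> sqrt (w n) * (C * rl_kernel \<sigma> s)" by (rule C(3)[OF s(2)])
    also have "\<dots> \<le> sqrt (w n) * M" unfolding M_def using s C w_pos[of n]
      by (intro mult_left_mono) auto
    finally show ?thesis using s by simp
  qed
  have der: "(mode (1 + d) n has_real_derivative mode d n s) (at s)" if "0 < s" for n s
    using ml_has_derivative[OF m(1) d0 that, of "l n"] by (simp add: add.commute)
  have q_bound: "\<bar>q n s\<bar> \<le> sqrt (w n) * M" if s: "dist s t < r" "s \<noteq> t" for n s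
  proof -
    have "\<exists>z. dist z t < r \<and> mode (1 + d) n s - mode (1 + d) n t = (s - t) * mode d n z"
    proof (cases "t < s")
      case True
      have "\<exists>z>t. z < s \<and> mode (1 + d) n s - mode (1 + d) n t = (s - t) * mode d n z"
        by (rule MVT2[OF True der]) (use t in auto)
      then obtain z where z: "t < z" "z < s" "mode (1 + d) n s - mode (1 + d) n t = (s - t) * mode d n z" by blast
      then show ?thesis using s by (intro exI[of _ z]) (auto simp: dist_real_def)
    next
      case False
      then have st: "s < t" using s by simp
      have s0: "0 < s" using M[OF s(1)] by blast
      have "\<exists>z>s. z < t \<and> mode (1 + d) n t - mode (1 + d) n s = (t - s) * mode d n z"
        by (rule MVT2[OF st der]) (use s0 in auto)
      then obtain z where z: "s < z" "z < t" "mode (1 + d) n t - mode (1 + d) n s = (t - s) * mode d n z" by blast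
      then have "mode (1 + d) n s - mode (1 + d) n t = (s - t) * mode d n z" by (simp add: algebra_simps)
      then show ?thesis using z s by (intro exI[of _ z]) (auto simp: dist_real_def)
    qed
    then obtain z where z: "dist z t < r" "mode (1 + d) n s - mode (1 + d) n t = (s - t) * mode d n z" by blast
    then show ?thesis using M[OF z(1), of n] s by (simp add: q_def)
  qed
  have near: "eventually (\<lambda>s. dist s t < r \<and> s \<noteq> t) (at t)"
    using r(1) by (auto simp: eventually_at)
  have "((\<lambda>s. sqrt (\<Sum>n. (x \<bullet> \<phi> n * h n s)\<^sup>2)) \<longlongrightarrow> 0) (at t)"
  proof (rule weighted_sqrt_suminf_tendsto_0[OF coeff_summable(1)[OF x]])
    fix n
    have "(q n \<longlongrightarrow> mode d n t) (at t)"
      using der[OF t, of n] unfolding has_field_derivative_iff q_def[abs_def] by simp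
    then have "((\<lambda>s. (q n s - mode d n t) / sqrt (w n)) \<longlongrightarrow> (mode d n t - mode d n t) / sqrt (w n)) (at t)"
      using w_pos[of n] by (intro tendsto_intros) auto
    then show "((h n) \<longlongrightarrow> 0) (at t)" by (simp add: h_def[abs_def])
  next
    show "eventually (\<lambda>s. \<forall>n. (h n s)\<^sup>2 \<le> (2 * M)\<^sup>2) (at t)"
      using near
    proof eventually_elim
      case (elim s)
      show ?case
      proof
        fix n
        have "\<bar>q n s - mode d n t\<bar> \<le> sqrt (w n) * (2 * M)"
        proof -
          have "\<bar>q n s\<bar> \<le> sqrt (w n) * M" "\<bar>mode d n t\<bar> \<le> sqrt (w n) * M"
            using q_bound[of s n] M[of t n] elim r(1) by auto
          then have "\<bar>q n s - mode d n t\<bar> \<le> sqrt (w n) * M + sqrt (w n) * M" by linarith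
          then show ?thesis by (simp add: algebra_simps)
        qed
        from square_div_w_le[OF this] show "(h n s)\<^sup>2 \<le> (2 * M)\<^sup>2"
          using w_pos[of n] by (simp add: h_def power_divide)
      qed
    qed
  qed
  then show ?thesis unfolding has_dual_derivative_def
  proof (rule Lim_transform_eventually)
    show "eventually (\<lambda>s. sqrt (\<Sum>n. (x \<bullet> \<phi> n * h n s)\<^sup>2) =
        dual_norm V E (\<lambda>\<psi>. (G s \<psi> - G t \<psi>) / (s - t) - sol_deriv d x t \<psi>)) (at t)"
      using near
    proof eventually_elim
      case (elim s)
      then have s0: "0 < s" using M by blast
      let ?Q = "\<lambda>\<psi>. (G s \<psi> - G t \<psi>) / (s - t) - sol_deriv d x t \<psi>"
      have Q: "?Q = (\<lambda>\<psi>. (1 / (s - t)) * ((sol (1 + d) x s - sol (1 + d) x t) \<bullet> \<psi>) + (- 1) * sol_deriv d x t \<psi>)"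
        by (rule ext) (simp add: G s0 t inner_diff_left)
      have QV: "?Q \<in> V'" unfolding Q
        by (rule dual_space_lincomb[OF inner_dual sol_deriv_facts(1)[OF x d t]])
      have "(?Q (\<phi> n))\<^sup>2 / w n = (x \<bullet> \<phi> n * h n s)\<^sup>2" for n
      proof -
        have "?Q (\<phi> n) = x \<bullet> \<phi> n * (q n s - mode d n t)"
          by (simp add: G s0 t sol_coeff[OF x d1] sol_deriv_facts(2)[OF x d t] q_def right_diff_distrib)
        then show ?thesis using w_pos[of n] by (simp add: h_def power_mult_distrib power_divide)
      qed
      then show ?case unfolding dual_norm_eq[OF QV] by simp
    qed
  qed
qed


text \<open>
  The time factor of the right-hand side for which \<open>sol (b + d + m) x\<close> solves the equation. It is
  \<open>t ^ j / fact j\<close> for \<open>d = real j + 1 - b\<close>.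
\<close>

definition source :: "real \<Rightarrow> real \<Rightarrow> real" where
  "source d t = (if d = 0 then 0 else rl_kernel (b + d) t)"

lemma outer_conv:
  assumes d: "d = 0 \<or> m \<le> d" and b: "0 < b" and t: "0 < t"
  shows "set_integrable lborel {0<..<t} (\<lambda>\<tau>. rl_kernel b (t - \<tau>) * mode d n \<tau>)"
    "(LINT \<tau>:{0<..<t}|lborel. rl_kernel b (t - \<tau>) * mode d n \<tau>) = source d t - l n * mode (b + d + m) n t"
proof -
  have "set_integrable lborel {0<..<t} (\<lambda>\<tau>. rl_kernel b (t - \<tau>) * mode d n \<tau>) \<and>
    (LINT \<tau>:{0<..<t}|lborel. rl_kernel b (t - \<tau>) * mode d n \<tau>) = source d t - l n * mode (b + d + m) n t"
  proof (cases "d = 0")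
    case False
    then have "0 < d" using d m by auto
    then show ?thesis
      using ml_conv[OF m(1) b _ t, of d "l n"] ml_rec[OF m(1) _ t, of "b + d" "l n"] False b by (simp add: source_def)
  next
    case True
    have "set_integrable lborel {0<..<t} (\<lambda>\<tau>. - l n * (rl_kernel b (t - \<tau>) * mode m n \<tau>))"
      by (intro set_integrable_mult_right ml_conv(1) m b t)
    moreover have "(LINT \<tau>:{0<..<t}|lborel. - l n * (rl_kernel b (t - \<tau>) * mode m n \<tau>)) = - l n * mode (b + m) n t"
      by (simp only: set_integral_mult_right ml_conv(2)[OF m(1) b m(1) t])
    moreover have eq: "- l n * (rl_kernel b (t - \<tau>) * mode m n \<tau>) = rl_kernel b (t - \<tau>) * mode d n \<tau>" if "\<tau> \<in> {0<..<t}" for \<tau>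
      using that True ml_zero[OF m(1), of \<tau> "l n"] by simp
    moreover have "set_integrable lborel {0<..<t} (\<lambda>\<tau>. - l n * (rl_kernel b (t - \<tau>) * mode m n \<tau>)) =
        set_integrable lborel {0<..<t} (\<lambda>\<tau>. rl_kernel b (t - \<tau>) * mode d n \<tau>)"
      by (rule set_integrable_cong[OF refl refl eq])
    moreover have "(LINT \<tau>:{0<..<t}|lborel. - l n * (rl_kernel b (t - \<tau>) * mode m n \<tau>)) = (LINT \<tau>:{0<..<t}|lborel. rl_kernel b (t - \<tau>) * mode d n \<tau>)"
      by (rule set_lebesgue_integral_cong) (use eq in auto)
    ultimately show ?thesis using True by (simp add: source_def)
  qed
  then show "set_integrable lborel {0<..<t} (\<lambda>\<tau>. rl_kernel b (t - \<tau>) * mode d n \<tau>)"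
    "(LINT \<tau>:{0<..<t}|lborel. rl_kernel b (t - \<tau>) * mode d n \<tau>) = source d t - l n * mode (b + d + m) n t" by auto
qed

lemma mode_measurable: "0 \<le> d \<Longrightarrow> (\<lambda>\<tau>. indicat_real {0<..<t} \<tau> * mode d n \<tau>) \<in> borel_measurable borel"
proof -
  assume d: "0 \<le> d"
  have "continuous_on {0<..<t} (mode d n)"
    by (rule continuous_on_subset[OF continuous_on_ml[OF m(1) d]]) auto
  from borel_measurable_continuous_on_indicator[OF _ this] show ?thesis by simp
qed

lemma sol_deriv_dual_frac_integrable:
  assumes x: "x \<in> H" and d: "d = 0 \<or> m \<le> d" and t: "0 < t"
  shows "dual_frac_integrable_left V E b (sol_deriv d x) t"
proof (cases "b = 0")
  case False
  then have b: "0 < b" using ab by simp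
  have d0: "0 \<le> d" using d m by auto
  obtain C \<sigma> where C: "0 \<le> C" "0 < \<sigma>" "\<And>n t. 0 < t \<Longrightarrow> \<bar>mode d n t\<bar> \<le> sqrt (w n) * (C * rl_kernel \<sigma> t)"
    using mode_dual_bound[OF d] by blast
  have G: "0 < Gamma b" using b by simp
  note [measurable] = mode_measurable[OF d0, of t]
  have rep: "indicat_real {0<..<t} \<tau> * ((t - \<tau>) powr (b - 1) * sol_deriv d x \<tau> \<psi>) =
      (t - \<tau>) powr (b - 1) * (\<Sum>n. (\<psi> \<bullet> \<phi> n) * (x \<bullet> \<phi> n * (indicat_real {0<..<t} \<tau> * mode d n \<tau>)))" for \<tau> \<psi>
    by (cases "\<tau> \<in> {0<..<t}") (auto simp: sol_deriv_def)
  have Fs: "(\<lambda>\<psi>. (t - \<tau>) powr (b - 1) * sol_deriv d x \<tau> \<psi>) \<in> V'" if "0 < \<tau>" for \<tau>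
    using dual_space_lincomb[OF sol_deriv_facts(1)[OF x d that] sol_deriv_facts(1)[OF x d that], of "(t - \<tau>) powr (b - 1)" 0] by simp
  have nrm: "dual_norm V E (\<lambda>\<psi>. (t - \<tau>) powr (b - 1) * sol_deriv d x \<tau> \<psi>) =
      sqrt (\<Sum>n. ((t - \<tau>) powr (b - 1) * (x \<bullet> \<phi> n * mode d n \<tau>))\<^sup>2 / w n)" if "0 < \<tau>" for \<tau>
    unfolding dual_norm_eq[OF Fs[OF that]] sol_deriv_facts(2)[OF x d that] ..
  have "dual_integrable V E {0<..<t} (\<lambda>\<tau> \<psi>. (t - \<tau>) powr (b - 1) * sol_deriv d x \<tau> \<psi>)"
    unfolding dual_integrable_def
  proof (intro conjI ballI)
    fix \<psi>
    show "set_borel_measurable lborel {0<..<t} (\<lambda>\<tau>. (t - \<tau>) powr (b - 1) * sol_deriv d x \<tau> \<psi>)"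
      unfolding set_borel_measurable_def real_scaleR_def rep by measurable
  next
    show "set_integrable lborel {0<..<t} (\<lambda>\<tau>. dual_norm V E (\<lambda>\<psi>. (t - \<tau>) powr (b - 1) * sol_deriv d x \<tau> \<psi>))"
    proof (rule set_integrable_bound)
      show "set_integrable lborel {0<..<t} (\<lambda>\<tau>. (Gamma b * C * norm x) * (rl_kernel b (t - \<tau>) * rl_kernel \<sigma> \<tau>))"
        using rl_kernel_conv(1)[OF b C(2) t] by simp
      have "indicat_real {0<..<t} \<tau> *\<^sub>R dual_norm V E (\<lambda>\<psi>. (t - \<tau>) powr (b - 1) * sol_deriv d x \<tau> \<psi>) =
         sqrt (\<Sum>n. ((t - \<tau>) powr (b - 1) * (x \<bullet> \<phi> n * (indicat_real {0<..<t} \<tau> * mode d n \<tau>)))\<^sup>2 / w n)" for \<tau>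
        by (cases "\<tau> \<in> {0<..<t}") (auto simp: nrm)
      then show "set_borel_measurable lborel {0<..<t} (\<lambda>\<tau>. dual_norm V E (\<lambda>\<psi>. (t - \<tau>) powr (b - 1) * sol_deriv d x \<tau> \<psi>))"
        unfolding set_borel_measurable_def by simp
      show "AE \<tau> in lborel. \<tau> \<in> {0<..<t} \<longrightarrow> norm (dual_norm V E (\<lambda>\<psi>. (t - \<tau>) powr (b - 1) * sol_deriv d x \<tau> \<psi>)) \<le>
          norm ((Gamma b * C * norm x) * (rl_kernel b (t - \<tau>) * rl_kernel \<sigma> \<tau>))"
      proof (intro AE_I2 impI)
        fix \<tau> assume "\<tau> \<in> {0<..<t}"
        then have \<tau>: "0 < \<tau>" "\<tau> < t" by auto
        let ?p = "(t - \<tau>) powr (b - 1)"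
        have "\<bar>?p * mode d n \<tau>\<bar> \<le> sqrt (w n) * (?p * (C * rl_kernel \<sigma> \<tau>))" for n
          using mult_left_mono[OF C(3)[OF \<tau>(1), of n], of ?p] by (simp add: abs_mult mult_ac)
        from dual_weighted_summable(2)[OF x this]
        have "(\<Sum>n. (?p * (x \<bullet> \<phi> n * mode d n \<tau>))\<^sup>2 / w n) \<le> (?p * (C * rl_kernel \<sigma> \<tau>))\<^sup>2 * (norm x)\<^sup>2"
          by (simp add: mult.left_commute)
        then have "dual_norm V E (\<lambda>\<psi>. ?p * sol_deriv d x \<tau> \<psi>) \<le> sqrt ((?p * (C * rl_kernel \<sigma> \<tau>) * norm x)\<^sup>2)"
          unfolding nrm[OF \<tau>(1)] power_mult_distrib by (rule real_sqrt_le_mono)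
        also have "\<dots> = ?p * (C * rl_kernel \<sigma> \<tau>) * norm x"
          using C rl_kernel_nonneg[of \<sigma> \<tau>] by simp
        also have "\<dots> = (Gamma b * C * norm x) * (rl_kernel b (t - \<tau>) * rl_kernel \<sigma> \<tau>)"
          using less_imp_neq[OF G] by (simp add: rl_kernel_def)
        finally show "norm (dual_norm V E (\<lambda>\<psi>. ?p * sol_deriv d x \<tau> \<psi>)) \<le> norm ((Gamma b * C * norm x) * (rl_kernel b (t - \<tau>) * rl_kernel \<sigma> \<tau>))"
          using dual_norm_nonneg[OF Fs[OF \<tau>(1)]] by simp
      qed
    qed
  qed
  then show ?thesis by (simp add: dual_frac_integrable_left_def)
qed (simp add: dual_frac_integrable_left_def)

lemma sol_deriv_outer:
  assumes x: "x \<in> H" and d: "d = 0 \<or> m \<le> d" and t: "0 < t" and \<psi>: "\<psi> \<in> V"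
  shows "frac_int_left b (\<lambda>\<tau>. sol_deriv d x \<tau> \<psi>) t = (\<Sum>n. (\<psi> \<bullet> \<phi> n) * (x \<bullet> \<phi> n * (source d t - l n * mode (b + d + m) n t)))"
proof (cases "b = 0")
  case True
  have "mode d n t = source d t - l n * mode (b + d + m) n t" for n
    unfolding source_def using ml_rec[OF m(1) _ t, of d "l n"] True d m by auto
  then show ?thesis using True by (simp add: frac_int_left_def sol_deriv_def)
next
  case False
  then have b: "0 < b" using ab by simp
  have G: "0 < Gamma b" using b by simp
  obtain C \<sigma> where C: "0 \<le> C" "0 < \<sigma>" "\<And>n t. 0 < t \<Longrightarrow> \<bar>mode d n t\<bar> \<le> sqrt (w n) * (C * rl_kernel \<sigma> t)"
    using mode_dual_bound[OF d] by blast
  define c where "c n = (\<psi> \<bullet> \<phi> n) * (x \<bullet> \<phi> n)" for n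
  define f where "f n \<tau> = c n * (indicat_real {0<..<t} \<tau> *\<^sub>R (rl_kernel b (t - \<tau>) * mode d n \<tau>))" for n \<tau>
  define D where "D = C * rl_kernel (b + \<sigma>) t"
  note oc = outer_conv[OF d b t, unfolded set_integrable_def set_lebesgue_integral_def]
  note pc = rl_kernel_conv[OF b C(2) t, unfolded set_integrable_def set_lebesgue_integral_def]
  have fi: "integrable lborel (f n)" and fI: "integral\<^sup>L lborel (f n) = c n * (source d t - l n * mode (b + d + m) n t)" for n
    unfolding f_def[abs_def] using oc by auto
  have cw: "summable (\<lambda>n. \<bar>(sqrt (w n) * (\<psi> \<bullet> \<phi> n)) * (x \<bullet> \<phi> n)\<bar>)"
  proof (rule Cauchy_Schwarz_suminf(1)[OF _ coeff_summable(1)[OF x]])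
    have "(sqrt (w n) * (\<psi> \<bullet> \<phi> n))\<^sup>2 = w n * (\<psi> \<bullet> \<phi> n)\<^sup>2" for n
      using w_pos[of n] by (simp add: power_mult_distrib)
    then show "summable (\<lambda>n. (sqrt (w n) * (\<psi> \<bullet> \<phi> n))\<^sup>2)"
      using form_norm_sums[OF \<psi>] by (simp add: sums_iff)
  qed
  have cw': "\<bar>c n\<bar> * sqrt (w n) = \<bar>(sqrt (w n) * (\<psi> \<bullet> \<phi> n)) * (x \<bullet> \<phi> n)\<bar>" for n
    using w_pos[of n] by (simp add: c_def abs_mult)
  have fn: "norm (f n \<tau>) \<le> (\<bar>c n\<bar> * sqrt (w n)) * (C * (indicat_real {0<..<t} \<tau> *\<^sub>R (rl_kernel b (t - \<tau>) * rl_kernel \<sigma> \<tau>)))" for n \<tau>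
  proof (cases "\<tau> \<in> {0<..<t}")
    case True
    have "\<bar>c n\<bar> * (rl_kernel b (t - \<tau>) * \<bar>mode d n \<tau>\<bar>) \<le> \<bar>c n\<bar> * (rl_kernel b (t - \<tau>) * (sqrt (w n) * (C * rl_kernel \<sigma> \<tau>)))"
      using C(3)[of \<tau> n] True rl_kernel_nonneg[of b] b by (intro mult_left_mono) auto
    then show ?thesis using True rl_kernel_nonneg[of b "t - \<tau>"] b by (simp add: f_def abs_mult mult_ac)
  qed (simp add: f_def)
  have sm: "summable (\<lambda>n. norm (f n \<tau>))" for \<tau>
    by (rule summable_comparison_test'[OF summable_mult2[OF cw[folded cw']]]) (use fn in simp)
  have nI: "(LINT \<tau>|lborel. norm (f n \<tau>)) \<le> (\<bar>c n\<bar> * sqrt (w n)) * D" for n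
  proof -
    have "(LINT \<tau>|lborel. norm (f n \<tau>)) \<le> (LINT \<tau>|lborel. (\<bar>c n\<bar> * sqrt (w n)) * (C * (indicat_real {0<..<t} \<tau> *\<^sub>R (rl_kernel b (t - \<tau>) * rl_kernel \<sigma> \<tau>))))"
      by (intro integral_mono fn integrable_norm fi integrable_mult_right pc)
    also have "\<dots> = (\<bar>c n\<bar> * sqrt (w n)) * D" using pc(2) by (simp add: D_def)
    finally show ?thesis .
  qed
  have SI: "summable (\<lambda>n. LINT \<tau>|lborel. norm (f n \<tau>))"
    by (rule summable_comparison_test'[OF summable_mult2[OF cw[folded cw'], of D]]) (use nI in simp)
  have sumf: "(\<Sum>n. f n \<tau>) = indicat_real {0<..<t} \<tau> *\<^sub>R (rl_kernel b (t - \<tau>) * sol_deriv d x \<tau> \<psi>)" for \<tau>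
  proof (cases "\<tau> \<in> {0<..<t}")
    case True
    then have \<tau>: "0 < \<tau>" by simp
    have "summable (\<lambda>n. (\<psi> \<bullet> \<phi> n) * (x \<bullet> \<phi> n * mode d n \<tau>))"
      by (rule dual_multiplier(4)[OF x C(3)[OF \<tau>] \<psi>])
    from suminf_mult[OF this, of "rl_kernel b (t - \<tau>)"] show ?thesis
      using True by (simp add: f_def c_def sol_deriv_def mult_ac)
  qed (simp add: f_def)
  have "(LINT \<tau>:{0<..<t}|lborel. rl_kernel b (t - \<tau>) * sol_deriv d x \<tau> \<psi>) = (LINT \<tau>|lborel. (\<Sum>n. f n \<tau>))"
    by (simp add: sumf set_lebesgue_integral_def)
  also have "\<dots> = (\<Sum>n. integral\<^sup>L lborel (f n))"
    by (rule integral_suminf[OF fi AE_I2[OF sm] SI])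
  finally have "(LINT \<tau>:{0<..<t}|lborel. rl_kernel b (t - \<tau>) * sol_deriv d x \<tau> \<psi>) = (\<Sum>n. c n * (source d t - l n * mode (b + d + m) n t))"
    by (simp add: fI)
  moreover have "frac_int_left b (\<lambda>\<tau>. sol_deriv d x \<tau> \<psi>) t = (LINT \<tau>:{0<..<t}|lborel. rl_kernel b (t - \<tau>) * sol_deriv d x \<tau> \<psi>)"
    using False by (simp add: frac_int_left_def rl_kernel_def set_lebesgue_integral_def mult_ac flip: Bochner_Integration.integral_mult_right_zero)
  ultimately show ?thesis by (simp add: c_def mult.assoc)
qed

lemma outer_bound:
  assumes \<beta>: "m \<le> \<beta>" and t: "0 < t"
  shows "\<bar>k - l n * mode \<beta> n t\<bar> \<le> sqrt (w n) * (\<bar>k\<bar> + sqrt (form_bound \<beta> t))"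
proof -
  have w1: "1 \<le> sqrt (w n)" using l_nonneg[of n] by simp
  have B0: "0 \<le> form_bound \<beta> t" using mode_form_bound[OF \<beta> t, of n] w_pos[of n] by (smt (verit) mult_nonneg_nonneg zero_le_power2)
  have "(l n * mode \<beta> n t)\<^sup>2 \<le> w n * (w n * (mode \<beta> n t)\<^sup>2)"
    using l_nonneg[of n] by (simp add: power_mult_distrib power2_eq_square algebra_simps)
  also have "\<dots> \<le> w n * form_bound \<beta> t" using mode_form_bound[OF \<beta> t, of n] w_pos[of n] by (intro mult_left_mono) auto
  also have "\<dots> = (sqrt (w n) * sqrt (form_bound \<beta> t))\<^sup>2" using w_pos[of n] B0 by (simp add: power_mult_distrib)
  finally have "\<bar>l n * mode \<beta> n t\<bar> \<le> \<bar>sqrt (w n) * sqrt (form_bound \<beta> t)\<bar>" by (simp only: abs_le_square_iff)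
  then have "\<bar>l n * mode \<beta> n t\<bar> \<le> sqrt (w n) * sqrt (form_bound \<beta> t)" using B0 w_pos[of n] by (simp add: abs_mult)
  moreover have "\<bar>k\<bar> \<le> sqrt (w n) * \<bar>k\<bar>" using mult_right_mono[OF w1, of "\<bar>k\<bar>"] by simp
  ultimately show ?thesis using abs_triangle_ineq4[of k "l n * mode \<beta> n t"] by (simp add: distrib_left)
qed

text \<open>
  The Hilfer derivative of \<open>sol (b + d + m) x\<close>, computed mode by mode in \<open>outer_conv\<close>.
\<close>

definition sol_hilfer :: "real \<Rightarrow> 'h \<Rightarrow> real \<Rightarrow> 'h \<Rightarrow> real" where
  "sol_hilfer d x t \<psi> = (\<Sum>n. (\<psi> \<bullet> \<phi> n) * (x \<bullet> \<phi> n * (source d t - l n * mode (b + d + m) n t)))"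

lemma sol_hilfer_facts:
  assumes x: "x \<in> H" and d: "0 \<le> d" and t: "0 < t"
  shows "sol_hilfer d x t \<in> V'" "sol_hilfer d x t (\<phi> n) = x \<bullet> \<phi> n * (source d t - l n * mode (b + d + m) n t)"
    "\<psi> \<in> V \<Longrightarrow> (\<lambda>n. (\<psi> \<bullet> \<phi> n) * (x \<bullet> \<phi> n * (source d t - l n * mode (b + d + m) n t))) sums sol_hilfer d x t \<psi>"
proof -
  have \<beta>: "m \<le> b + d + m" using ab d by simp
  have W: "sol_hilfer d x t = (\<lambda>\<psi>. \<Sum>n. (\<psi> \<bullet> \<phi> n) * (x \<bullet> \<phi> n * (source d t - l n * mode (b + d + m) n t)))"
    by (rule ext) (simp add: sol_hilfer_def)
  note dm = dual_multiplier[OF x outer_bound[OF \<beta> t, of "source d t"], folded W]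
  show "sol_hilfer d x t \<in> V'" by (rule dm(1))
  show "sol_hilfer d x t (\<phi> n) = x \<bullet> \<phi> n * (source d t - l n * mode (b + d + m) n t)"
    unfolding sol_hilfer_def by (rule dual_multiplier(2)[OF x outer_bound[OF \<beta> t, of "source d t"]])
  show "\<psi> \<in> V \<Longrightarrow> (\<lambda>n. (\<psi> \<bullet> \<phi> n) * (x \<bullet> \<phi> n * (source d t - l n * mode (b + d + m) n t))) sums sol_hilfer d x t \<psi>"
    using dm(4) by (simp add: sol_hilfer_def sums_iff)
qed

lemma sol_hilfer_continuous:
  assumes x: "x \<in> H" and d: "0 \<le> d"
  shows "norm_continuous_on (dual_norm V E) {0<..T} (sol_hilfer d x)"
  unfolding norm_continuous_on_def
proof
  let ?S = "{0<..T}"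
  fix t assume t: "t \<in> ?S"
  then have t0: "0 < t" by simp
  define \<beta> where "\<beta> = b + d + m"
  have \<beta>: "m \<le> \<beta>" "0 \<le> \<beta>" using ab d m by (auto simp: \<beta>_def)
  define k where "k n s = source d s - l n * mode \<beta> n s" for n s
  define h where "h n s = (k n s - k n t) / sqrt (w n)" for n s
  have srclim: "(source d \<longlongrightarrow> source d t) (at t within ?S)"
  proof (cases "d = 0")
    case False
    then show ?thesis using rl_kernel_isCont[OF t0, of "b + d"]
      by (simp add: source_def[abs_def] isCont_def tendsto_within_subset[OF _ subset_UNIV])
  qed (simp add: source_def[abs_def])
  have klim: "(k n \<longlongrightarrow> k n t) (at t within ?S)" for n
  proof -
    have "((\<lambda>s. mode \<beta> n s) \<longlongrightarrow> mode \<beta> n t) (at t within ?S)"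
      using mode_isCont[OF \<beta>(2) t0, of n] by (simp add: isCont_def tendsto_within_subset[OF _ subset_UNIV])
    then show ?thesis unfolding k_def by (intro tendsto_intros srclim)
  qed
  define B where "B = (\<bar>source d t\<bar> + 1) + sqrt (form_bound \<beta> t + 1)"
  have Bnd: "\<bar>k n s\<bar> \<le> sqrt (w n) * B" if "0 < s" "form_bound \<beta> s \<le> form_bound \<beta> t + 1" "\<bar>source d s\<bar> \<le> \<bar>source d t\<bar> + 1" for n s
  proof -
    have "\<bar>k n s\<bar> \<le> sqrt (w n) * (\<bar>source d s\<bar> + sqrt (form_bound \<beta> s))"
      unfolding k_def by (rule outer_bound[OF \<beta>(1) that(1)])
    also have "\<dots> \<le> sqrt (w n) * B"
      unfolding B_def using that w_pos[of n] by (intro mult_left_mono add_mono real_sqrt_le_mono) auto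
    finally show ?thesis .
  qed
  have "((\<lambda>s. sqrt (\<Sum>n. (x \<bullet> \<phi> n * h n s)\<^sup>2)) \<longlongrightarrow> 0) (at t within ?S)"
  proof (rule weighted_sqrt_suminf_tendsto_0[OF coeff_summable(1)[OF x]])
    fix n
    have "((\<lambda>s. (k n s - k n t) / sqrt (w n)) \<longlongrightarrow> (k n t - k n t) / sqrt (w n)) (at t within ?S)"
      using w_pos[of n] by (intro tendsto_intros klim) auto
    then show "(h n \<longlongrightarrow> 0) (at t within ?S)" by (simp add: h_def[abs_def])
  next
    have "eventually (\<lambda>s. \<bar>source d s\<bar> < \<bar>source d t\<bar> + 1) (at t within ?S)"
      by (rule order_tendstoD(2)[OF tendsto_rabs[OF srclim]]) simp
    then show "eventually (\<lambda>s. \<forall>n. (h n s)\<^sup>2 \<le> (2 * B)\<^sup>2) (at t within ?S)"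
      using eventually_form_bound[OF t0, of \<beta> ?S]
    proof eventually_elim
      case (elim s)
      show ?case
      proof
        fix n
        have "\<bar>k n s - k n t\<bar> \<le> sqrt (w n) * (2 * B)"
          using Bnd[of s n] Bnd[of t n] elim t0 by simp
        from square_div_w_le[OF this] show "(h n s)\<^sup>2 \<le> (2 * B)\<^sup>2"
          using w_pos[of n] by (simp add: h_def power_divide)
      qed
    qed
  qed
  then show "((\<lambda>s. dual_norm V E (sol_hilfer d x s - sol_hilfer d x t)) \<longlongrightarrow> 0) (at t within ?S)"
  proof (rule Lim_transform_eventually)
    have "eventually (\<lambda>s. s \<in> ?S) (at t within ?S)" by (simp add: eventually_at_filter)
    then show "eventually (\<lambda>s. sqrt (\<Sum>n. (x \<bullet> \<phi> n * h n s)\<^sup>2) = dual_norm V E (sol_hilfer d x s - sol_hilfer d x t)) (at t within ?S)"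
    proof eventually_elim
      case (elim s)
      then have s0: "0 < s" by simp
      have Q: "sol_hilfer d x s - sol_hilfer d x t = (\<lambda>\<psi>. 1 * sol_hilfer d x s \<psi> + (- 1) * sol_hilfer d x t \<psi>)" by (rule ext) simp
      have QV: "sol_hilfer d x s - sol_hilfer d x t \<in> V'" unfolding Q
        by (rule dual_space_lincomb[OF sol_hilfer_facts(1)[OF x d s0] sol_hilfer_facts(1)[OF x d t0]])
      have "((sol_hilfer d x s - sol_hilfer d x t) (\<phi> n))\<^sup>2 / w n = (x \<bullet> \<phi> n * h n s)\<^sup>2" for n
      proof -
        have "(sol_hilfer d x s - sol_hilfer d x t) (\<phi> n) = x \<bullet> \<phi> n * (k n s - k n t)"
          by (simp add: sol_hilfer_facts(2)[OF x d] s0 t0 k_def \<beta>_def right_diff_distrib)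
        then show ?thesis using w_pos[of n] by (simp add: h_def power_mult_distrib power_divide)
      qed
      then show ?case unfolding dual_norm_eq[OF QV] by simp
    qed
  qed
qed

text \<open>
  The case \<open>d = 0\<close> is the homogeneous problem with datum \<open>x\<close>; the case \<open>d \<ge> m\<close> is the problem with datum \<open>0\<close>
  and right-hand side \<open>source d t\<close> times \<open>x\<close>.
\<close>

theorem explicit_solution:
  assumes x: "x \<in> H" and d: "d = 0 \<or> m \<le> d" and T: "0 < T"
    and par: "m = \<mu>" "a = (1 - \<nu>) * (1 - \<mu>)" "b = \<nu> * (1 - \<mu>)"
  shows "evolution_solution V E T \<mu> \<nu> (\<lambda>t \<psi>. source d t * (x \<bullet> \<psi>)) (if d = 0 then x else 0) (sol (b + d + m) x)"
    "0 < t \<Longrightarrow> frac_int_left a (sol (b + d + m) x) t = sol (1 + d) x t"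
proof -
  let ?\<beta> = "b + d + m"
  have d0: "0 \<le> d" using d m by auto
  have \<beta>: "m \<le> ?\<beta>" using ab d0 by simp
  have a\<beta>: "a + ?\<beta> = 1 + d" using ab(3) by simp
  have fi: "frac_integrable_left a (sol ?\<beta> x) t" "frac_int_left a (sol ?\<beta> x) t = sol (1 + d) x t" if "0 < t" for t
  proof -
    have "frac_integrable_left a (sol ?\<beta> x) t \<and> frac_int_left a (sol ?\<beta> x) t = sol (1 + d) x t"
    proof (cases "a = 0")
      case True
      then have eq: "?\<beta> = 1 + d" using a\<beta> by simp
      show ?thesis unfolding eq frac_integrable_left_def frac_int_left_def using True by simp
    next
      case False
      then have "0 < a" using ab by simp
      then show ?thesis
        using sol_frac[OF x \<beta> _ that, of a] unfolding a\<beta> by (simp add: frac_integrable_left_def)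
    qed
    then show "frac_integrable_left a (sol ?\<beta> x) t" "frac_int_left a (sol ?\<beta> x) t = sol (1 + d) x t" by auto
  qed
  show "0 < t \<Longrightarrow> frac_int_left a (sol ?\<beta> x) t = sol (1 + d) x t" by (rule fi(2))
  show "evolution_solution V E T \<mu> \<nu> (\<lambda>t \<psi>. source d t * (x \<bullet> \<psi>)) (if d = 0 then x else 0) (sol (b + d + m) x)"
    unfolding evolution_solution_def has_hilfer_derivative_left_def par(2,3)[symmetric]
  proof (intro conjI)
    show "\<forall>t\<in>{0<..T}. sol ?\<beta> x t \<in> V" using sol_V[OF x \<beta>] by simp
    show "norm_continuous_on (form_norm E) {0<..T} (sol ?\<beta> x)"
      by (rule sol_continuous(1)[OF x \<beta>]) auto
    show "\<exists>g. continuous_on {0..T} g \<and> g 0 = (if d = 0 then x else 0) \<and>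
        (\<forall>t\<in>{0<..T}. frac_integrable_left a (sol ?\<beta> x) t \<and> g t = frac_int_left a (sol ?\<beta> x) t)"
      by (rule exI, rule conjI[OF sol_initial[OF x d]]) (simp add: fi)
    have "(\<forall>t\<in>{0<..T}. frac_integrable_left a (sol ?\<beta> x) t) \<and>
        (\<forall>t\<in>{0<..<T}. sol_deriv d x t \<in> V' \<and> has_dual_derivative V E (\<lambda>s. inner (frac_int_left a (sol ?\<beta> x) s)) (sol_deriv d x t) t) \<and>
        (\<forall>t\<in>{0<..T}. dual_frac_integrable_left V E b (sol_deriv d x) t \<and> (\<forall>\<psi>\<in>V. sol_hilfer d x t \<psi> = frac_int_left b (\<lambda>\<tau>. sol_deriv d x \<tau> \<psi>) t))"
      using fi(1) sol_deriv_facts(1)[OF x d] sol_deriv_dual_frac_integrable[OF x d] sol_deriv_outer[OF x d]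
      by (auto intro!: sol_has_dual_derivative[OF x d] simp: fi(2) sol_hilfer_def)
    moreover have "AE t in lborel. t \<in> {0<..<T} \<longrightarrow> sol_hilfer d x t \<psi> + E (sol ?\<beta> x t) \<psi> - source d t * (x \<bullet> \<psi>) = 0" if \<psi>: "\<psi> \<in> V" for \<psi>
    proof (rule AE_I2, rule impI)
      fix t assume "t \<in> {0<..<T}"
      then have t: "0 < t" by simp
      have "(\<lambda>n. (\<psi> \<bullet> \<phi> n) * (x \<bullet> \<phi> n * (source d t - l n * mode ?\<beta> n t)) + l n * ((x \<bullet> \<phi> n * mode ?\<beta> n t) * (\<psi> \<bullet> \<phi> n)))
          sums (sol_hilfer d x t \<psi> + E (sol ?\<beta> x t) \<psi>)"
        using E_sums[OF sol_V[OF x \<beta> t] \<psi>] sol_hilfer_facts(3)[OF x d0 t \<psi>]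
        by (intro sums_add) (simp_all add: sol_coeff[OF x \<beta> t])
      then have "(\<lambda>n. source d t * ((x \<bullet> \<phi> n) * (\<psi> \<bullet> \<phi> n))) sums (sol_hilfer d x t \<psi> + E (sol ?\<beta> x t) \<psi>)"
        by (simp add: algebra_simps)
      from sums_unique2[OF this sums_mult[OF parseval[OF x]]]
      show "sol_hilfer d x t \<psi> + E (sol ?\<beta> x t) \<psi> - source d t * (x \<bullet> \<psi>) = 0" by simp
    qed
    moreover have "\<forall>t\<in>{0<..T}. sol_hilfer d x t \<in> V'" using sol_hilfer_facts(1)[OF x d0] by simp
    ultimately show "\<exists>w. ((\<forall>t\<in>{0<..T}. frac_integrable_left a (sol ?\<beta> x) t) \<and>
         (\<exists>F. (\<forall>t\<in>{0<..<T}. F t \<in> V' \<and>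
              has_dual_derivative V E (\<lambda>s. inner (frac_int_left a (sol ?\<beta> x) s)) (F t) t) \<and>
           (\<forall>t\<in>{0<..T}. dual_frac_integrable_left V E b F t \<and> (\<forall>\<phi>\<in>V. w t \<phi> = frac_int_left b (\<lambda>\<tau>. F \<tau> \<phi>) t)))) \<and>
        (\<forall>t\<in>{0<..T}. w t \<in> V') \<and> norm_continuous_on (dual_norm V E) {0<..T} w \<and>
        (\<forall>\<phi>'\<in>V. AE t in lborel. t \<in> {0<..<T} \<longrightarrow> w t \<phi>' + E (sol ?\<beta> x t) \<phi>' - source d t * (x \<bullet> \<phi>') = 0)"
      using sol_hilfer_continuous[OF x d0, of T] by (intro exI[of _ "sol_hilfer d x"] conjI exI[of _ "sol_deriv d x"]) auto
  qed
qed

end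


section \<open>Superposition of weak solutions\<close>

lemma frac_int_left_add:
  assumes "frac_integrable_left c f t" "frac_integrable_left c g t"
  shows "frac_integrable_left c (\<lambda>s. f s + g s) t" "frac_int_left c (\<lambda>s. f s + g s) t = frac_int_left c f t + frac_int_left c g t"
proof -
  have "set_integrable lborel {0<..<t} (\<lambda>s. (t - s) powr (c - 1) *\<^sub>R (f s + g s)) \<and>
     (LINT s:{0<..<t}|lborel. (t - s) powr (c - 1) *\<^sub>R (f s + g s)) =
       (LINT s:{0<..<t}|lborel. (t - s) powr (c - 1) *\<^sub>R f s) + (LINT s:{0<..<t}|lborel. (t - s) powr (c - 1) *\<^sub>R g s)" if "c \<noteq> 0"
    unfolding scaleR_right_distrib using assms that set_integral_add[of lborel "{0<..<t}" "\<lambda>s. (t - s) powr (c - 1) *\<^sub>R f s" "\<lambda>s. (t - s) powr (c - 1) *\<^sub>R g s"]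
    by (simp add: frac_integrable_left_def)
  then show "frac_integrable_left c (\<lambda>s. f s + g s) t" "frac_int_left c (\<lambda>s. f s + g s) t = frac_int_left c f t + frac_int_left c g t"
    by (auto simp: frac_integrable_left_def frac_int_left_def scaleR_right_distrib)
qed

context diagonal_form
begin

lemma form_norm_add_le:
  assumes x: "x \<in> V" and y: "y \<in> V"
  shows "form_norm E (x + y) \<le> sqrt (2 * (form_norm E x)\<^sup>2 + 2 * (form_norm E y)\<^sup>2)"
proof -
  have "0 \<le> E (x - y) (x - y) + (x - y) \<bullet> (x - y)" using E_nonneg[OF V_diff[OF x y]] by simp
  moreover have "E (x + y) (x + y) = E x x + 2 * E y x + E y y"
    using x y V_add[OF x y] by (simp add: E_add_left E_add_right E_sym[OF x y])
  moreover have "(x + y) \<bullet> (x + y) = x \<bullet> x + 2 * (y \<bullet> x) + y \<bullet> y" "(x - y) \<bullet> (x - y) = x \<bullet> x - 2 * (y \<bullet> x) + y \<bullet> y"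
    by (simp_all add: inner_add inner_diff inner_commute)
  ultimately have "E (x + y) (x + y) + (x + y) \<bullet> (x + y) \<le> 2 * (E x x + x \<bullet> x) + 2 * (E y y + y \<bullet> y)"
    using E_diff_self[OF x y] by simp
  then show ?thesis using E_nonneg[OF x] E_nonneg[OF y]
    unfolding form_norm_def by (intro real_sqrt_le_mono) simp
qed

lemma dual_norm_add_le:
  assumes f: "f \<in> V'" and g: "g \<in> V'"
  shows "dual_norm V E (\<lambda>\<psi>. f \<psi> + g \<psi>) \<le> dual_norm V E f + dual_norm V E g"
  unfolding dual_norm_def[of V E "\<lambda>\<psi>. f \<psi> + g \<psi>"]
proof (rule cSUP_least)
  have "form_norm E 0 = 0" using E_scale_left[OF V_0 V_0, of 0] by (simp add: form_norm_def)
  then show "{\<psi> \<in> V. form_norm E \<psi> \<le> 1} \<noteq> {}" using V_0 by force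
  fix \<psi> assume "\<psi> \<in> {\<psi> \<in> V. form_norm E \<psi> \<le> 1}"
  then show "\<bar>f \<psi> + g \<psi>\<bar> \<le> dual_norm V E f + dual_norm V E g"
    using dual_norm_ge[OF f, of \<psi>] dual_norm_ge[OF g, of \<psi>] by simp
qed

lemma dual_space_add: "f \<in> V' \<Longrightarrow> g \<in> V' \<Longrightarrow> (\<lambda>\<psi>. f \<psi> + g \<psi>) \<in> V'"
  using dual_space_lincomb[of f g 1 1] by simp

lemma dual_space_diff: "f \<in> V' \<Longrightarrow> g \<in> V' \<Longrightarrow> (\<lambda>\<psi>. f \<psi> - g \<psi>) \<in> V'"
  using dual_space_lincomb[of f g 1 "-1"] by simp

lemma dual_space_scale: "f \<in> V' \<Longrightarrow> (\<lambda>\<psi>. c * f \<psi>) \<in> V'"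
  using dual_space_lincomb[of f f c 0] by simp

lemma difference_quotient_dual: "f \<in> V' \<Longrightarrow> (\<lambda>\<psi>. (x \<bullet> \<psi> - y \<bullet> \<psi>) / c - f \<psi>) \<in> V'"
  using dual_space_diff[OF dual_space_scale[OF inner_dual, of "1/c" "x - y"], of f]
  by (simp add: inner_diff_left)

lemma dual_apply_le: "f \<in> V' \<Longrightarrow> \<psi> \<in> V \<Longrightarrow> \<bar>f \<psi>\<bar> \<le> form_norm E \<psi> * dual_norm V E f"
proof -
  assume f: "f \<in> V'" and \<psi>: "\<psi> \<in> V"
  note cs = weighted_Cauchy_Schwarz[OF dual_summable[OF f] \<psi>]
  have "\<bar>f \<psi>\<bar> \<le> (\<Sum>n. \<bar>(\<psi> \<bullet> \<phi> n) * f (\<phi> n)\<bar>)"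
    using summable_rabs[OF cs(1)] dual_expansion[OF f \<psi>] by (simp add: sums_iff)
  also note cs(2)
  finally show ?thesis by (simp only: dual_norm_eq[OF f])
qed

lemma dual_integrable_add:
  assumes F: "dual_integrable V E S F" "\<And>s. s \<in> S \<Longrightarrow> F s \<in> V'" and G: "dual_integrable V E S G" "\<And>s. s \<in> S \<Longrightarrow> G s \<in> V'"
  shows "dual_integrable V E S (\<lambda>s \<psi>. F s \<psi> + G s \<psi>)"
  unfolding dual_integrable_def
proof (intro conjI ballI)
  have m: "set_borel_measurable lborel S (\<lambda>s. F s \<psi> + G s \<psi>)" if "\<psi> \<in> V" for \<psi>
    unfolding set_borel_measurable_def scaleR_right_distrib
    by (rule borel_measurable_add)
      (use F(1) G(1) that in \<open>auto simp: dual_integrable_def set_borel_measurable_def\<close>)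
  then show "\<psi> \<in> V \<Longrightarrow> set_borel_measurable lborel S (\<lambda>s. F s \<psi> + G s \<psi>)" for \<psi> .
  have sum_int: "set_integrable lborel S (\<lambda>s. dual_norm V E (F s) + dual_norm V E (G s))"
    using F(1) G(1) unfolding dual_integrable_def by (intro set_integral_add) auto
  show "set_integrable lborel S (\<lambda>s. dual_norm V E (\<lambda>\<psi>. F s \<psi> + G s \<psi>))"
  proof (rule set_integrable_bound[OF sum_int])
    have e: "indicat_real S s *\<^sub>R dual_norm V E (\<lambda>\<psi>. F s \<psi> + G s \<psi>) =
        sqrt (\<Sum>n. (indicat_real S s *\<^sub>R (F s (\<phi> n) + G s (\<phi> n)))\<^sup>2 / w n)" for s
      using dual_norm_eq[OF dual_space_add[OF F(2) G(2)], of s] by (cases "s \<in> S") auto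
    have [measurable]: "(\<lambda>s. indicat_real S s *\<^sub>R (F s (\<phi> n) + G s (\<phi> n))) \<in> borel_measurable lborel" for n
      using m[OF basis_V] by (simp add: set_borel_measurable_def)
    show "set_borel_measurable lborel S (\<lambda>s. dual_norm V E (\<lambda>\<psi>. F s \<psi> + G s \<psi>))"
      unfolding set_borel_measurable_def e by measurable
    show "AE s in lborel. s \<in> S \<longrightarrow> norm (dual_norm V E (\<lambda>\<psi>. F s \<psi> + G s \<psi>)) \<le> norm (dual_norm V E (F s) + dual_norm V E (G s))"
    proof (intro AE_I2 impI)
      fix s assume s: "s \<in> S"
      show "norm (dual_norm V E (\<lambda>\<psi>. F s \<psi> + G s \<psi>)) \<le> norm (dual_norm V E (F s) + dual_norm V E (G s))"
        using dual_norm_add_le[OF F(2)[OF s] G(2)[OF s]] dual_norm_nonneg[OF dual_space_add[OF F(2)[OF s] G(2)[OF s]]] by simp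
    qed
  qed
qed

lemma dual_norm_tendsto_add:
  assumes "((\<lambda>s. dual_norm V E (f s)) \<longlongrightarrow> 0) F" "((\<lambda>s. dual_norm V E (g s)) \<longlongrightarrow> 0) F"
    and "eventually (\<lambda>s. f s \<in> V' \<and> g s \<in> V') F"
  shows "((\<lambda>s. dual_norm V E (\<lambda>\<psi>. f s \<psi> + g s \<psi>)) \<longlongrightarrow> 0) F"
proof (rule Lim_null_comparison)
  show "eventually (\<lambda>s. norm (dual_norm V E (\<lambda>\<psi>. f s \<psi> + g s \<psi>)) \<le> dual_norm V E (f s) + dual_norm V E (g s)) F"
    using assms(3) by eventually_elim (use dual_norm_add_le dual_norm_nonneg dual_space_add in simp)
  show "((\<lambda>s. dual_norm V E (f s) + dual_norm V E (g s)) \<longlongrightarrow> 0) F"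
    using tendsto_add[OF assms(1,2)] by simp
qed

end

locale evolution_form = diagonal_form H V E \<phi> l
  for H V :: "'h::{real_inner,banach,second_countable_topology} set" and E :: "'h \<Rightarrow> 'h \<Rightarrow> real"
    and \<phi> :: "nat \<Rightarrow> 'h" and l :: "nat \<Rightarrow> real"
begin

text \<open>
  The nontrivial points are triangle inequalities for the form norm and the dual norm, and the
  measurability of the dual norm of a sum, for which \<open>dual_norm_eq\<close> is used.
\<close>

theorem evolution_solution_add:
  assumes 1: "evolution_solution V E T \<mu> \<nu> q1 x1 u1" and 2: "evolution_solution V E T \<mu> \<nu> q2 x2 u2"
  shows "evolution_solution V E T \<mu> \<nu> (\<lambda>t \<psi>. q1 t \<psi> + q2 t \<psi>) (x1 + x2) (\<lambda>t. u1 t + u2 t)"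
proof -
  let ?a = "(1 - \<nu>) * (1 - \<mu>)" and ?b = "\<nu> * (1 - \<mu>)"
  obtain g1 w1 where V1: "\<And>t. t \<in> {0<..T} \<Longrightarrow> u1 t \<in> V" and nc1: "norm_continuous_on (form_norm E) {0<..T} u1"
    and g1: "continuous_on {0..T} g1" "g1 0 = x1"
      "\<And>t. t \<in> {0<..T} \<Longrightarrow> frac_integrable_left ?a u1 t" "\<And>t. t \<in> {0<..T} \<Longrightarrow> g1 t = frac_int_left ?a u1 t"
    and w1: "has_hilfer_derivative_left V E T \<mu> \<nu> u1 w1" "\<And>t. t \<in> {0<..T} \<Longrightarrow> w1 t \<in> V'"
      "norm_continuous_on (dual_norm V E) {0<..T} w1"
      "\<And>\<psi>. \<psi> \<in> V \<Longrightarrow> AE t in lborel. t \<in> {0<..<T} \<longrightarrow> w1 t \<psi> + E (u1 t) \<psi> - q1 t \<psi> = 0"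
    using 1 unfolding evolution_solution_def by blast
  obtain g2 w2 where V2: "\<And>t. t \<in> {0<..T} \<Longrightarrow> u2 t \<in> V" and nc2: "norm_continuous_on (form_norm E) {0<..T} u2"
    and g2: "continuous_on {0..T} g2" "g2 0 = x2"
      "\<And>t. t \<in> {0<..T} \<Longrightarrow> frac_integrable_left ?a u2 t" "\<And>t. t \<in> {0<..T} \<Longrightarrow> g2 t = frac_int_left ?a u2 t"
    and w2: "has_hilfer_derivative_left V E T \<mu> \<nu> u2 w2" "\<And>t. t \<in> {0<..T} \<Longrightarrow> w2 t \<in> V'"
      "norm_continuous_on (dual_norm V E) {0<..T} w2"
      "\<And>\<psi>. \<psi> \<in> V \<Longrightarrow> AE t in lborel. t \<in> {0<..<T} \<longrightarrow> w2 t \<psi> + E (u2 t) \<psi> - q2 t \<psi> = 0"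
    using 2 unfolding evolution_solution_def by blast
  obtain F1 where F1: "\<And>t. t \<in> {0<..<T} \<Longrightarrow> F1 t \<in> V'"
      "\<And>t. t \<in> {0<..<T} \<Longrightarrow> has_dual_derivative V E (\<lambda>s. inner (frac_int_left ?a u1 s)) (F1 t) t"
    and W1: "\<And>t. t \<in> {0<..T} \<Longrightarrow> dual_frac_integrable_left V E ?b F1 t"
      "\<And>t \<psi>. t \<in> {0<..T} \<Longrightarrow> \<psi> \<in> V \<Longrightarrow> w1 t \<psi> = frac_int_left ?b (\<lambda>\<tau>. F1 \<tau> \<psi>) t"
    using w1(1) unfolding has_hilfer_derivative_left_def by blast
  obtain F2 where F2: "\<And>t. t \<in> {0<..<T} \<Longrightarrow> F2 t \<in> V'"
      "\<And>t. t \<in> {0<..<T} \<Longrightarrow> has_dual_derivative V E (\<lambda>s. inner (frac_int_left ?a u2 s)) (F2 t) t"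
    and W2: "\<And>t. t \<in> {0<..T} \<Longrightarrow> dual_frac_integrable_left V E ?b F2 t"
      "\<And>t \<psi>. t \<in> {0<..T} \<Longrightarrow> \<psi> \<in> V \<Longrightarrow> w2 t \<psi> = frac_int_left ?b (\<lambda>\<tau>. F2 \<tau> \<psi>) t"
    using w2(1) unfolding has_hilfer_derivative_left_def by blast
  have scal: "frac_integrable_left ?b (\<lambda>\<tau>. F \<tau> \<psi>) t"
    if "dual_frac_integrable_left V E ?b F t" "\<And>s. s \<in> {0<..<T} \<Longrightarrow> F s \<in> V'" "\<psi> \<in> V" "t \<in> {0<..T}" for F \<psi> t
  proof (cases "?b = 0")
    case False
    let ?G = "\<lambda>\<tau> \<psi>. (t - \<tau>) powr (?b - 1) * F \<tau> \<psi>"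
    have di: "dual_integrable V E {0<..<t} ?G"
      using that(1) False by (simp add: dual_frac_integrable_left_def)
    have GV: "?G s \<in> V'" if "s \<in> {0<..<t}" for s
      using that \<open>t \<in> {0<..T}\<close> by (intro dual_space_scale \<open>\<And>s. s \<in> {0<..<T} \<Longrightarrow> F s \<in> V'\<close>) auto
    have "set_integrable lborel {0<..<t} (\<lambda>\<tau>. ?G \<tau> \<psi>)"
    proof (rule set_integrable_bound)
      show "set_integrable lborel {0<..<t} (\<lambda>\<tau>. form_norm E \<psi> * dual_norm V E (?G \<tau>))"
        using di by (simp add: dual_integrable_def)
      show "set_borel_measurable lborel {0<..<t} (\<lambda>\<tau>. ?G \<tau> \<psi>)"
        using di \<open>\<psi> \<in> V\<close> by (simp add: dual_integrable_def)
      show "AE \<tau> in lborel. \<tau> \<in> {0<..<t} \<longrightarrow> norm (?G \<tau> \<psi>) \<le> norm (form_norm E \<psi> * dual_norm V E (?G \<tau>))"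
        using dual_apply_le[OF GV \<open>\<psi> \<in> V\<close>] by (intro AE_I2 impI) (simp add: abs_le_iff order_trans[OF _ abs_ge_self])
    qed
    then show ?thesis by (simp add: frac_integrable_left_def)
  qed (simp add: frac_integrable_left_def)
  have U: "frac_int_left ?a (\<lambda>t. u1 t + u2 t) t = frac_int_left ?a u1 t + frac_int_left ?a u2 t" if "t \<in> {0<..T}" for t
    by (rule frac_int_left_add(2)[OF g1(3)[OF that] g2(3)[OF that]])
  have hil: "has_hilfer_derivative_left V E T \<mu> \<nu> (\<lambda>t. u1 t + u2 t) (\<lambda>t \<psi>. w1 t \<psi> + w2 t \<psi>)"
    unfolding has_hilfer_derivative_left_def
  proof (intro conjI ballI exI[of _ "\<lambda>t \<psi>. F1 t \<psi> + F2 t \<psi>"])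
    fix t assume t: "t \<in> {0<..T}"
    show "frac_integrable_left ?a (\<lambda>t. u1 t + u2 t) t"
      by (rule frac_int_left_add(1)[OF g1(3)[OF t] g2(3)[OF t]])
    show "w1 t \<psi> + w2 t \<psi> = frac_int_left ?b (\<lambda>\<tau>. F1 \<tau> \<psi> + F2 \<tau> \<psi>) t" if "\<psi> \<in> V" for \<psi>
      using frac_int_left_add(2)[OF scal[OF W1(1)[OF t] F1(1) that t] scal[OF W2(1)[OF t] F2(1) that t]]
        W1(2)[OF t that] W2(2)[OF t that] by simp
    show "dual_frac_integrable_left V E ?b (\<lambda>t \<psi>. F1 t \<psi> + F2 t \<psi>) t"
    proof (cases "?b = 0")
      case False
      have "dual_integrable V E {0<..<t} (\<lambda>\<tau> \<psi>. (t - \<tau>) powr (?b - 1) * F1 \<tau> \<psi> + (t - \<tau>) powr (?b - 1) * F2 \<tau> \<psi>)"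
        using W1(1)[OF t] W2(1)[OF t] False t unfolding dual_frac_integrable_left_def
        by (intro dual_integrable_add dual_space_scale F1 F2) auto
      then show ?thesis by (simp add: dual_frac_integrable_left_def distrib_left)
    qed (simp add: dual_frac_integrable_left_def)
  next
    fix t assume t: "t \<in> {0<..<T}"
    show "(\<lambda>\<psi>. F1 t \<psi> + F2 t \<psi>) \<in> V'" by (rule dual_space_add[OF F1(1)[OF t] F2(1)[OF t]])
    let ?Q = "\<lambda>u F s \<psi>. (frac_int_left ?a u s \<bullet> \<psi> - frac_int_left ?a u t \<bullet> \<psi>) / (s - t) - F t \<psi>"
    have lim: "((\<lambda>s. dual_norm V E (\<lambda>\<psi>. ?Q u1 F1 s \<psi> + ?Q u2 F2 s \<psi>)) \<longlongrightarrow> 0) (at t)"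
      using F1(2)[OF t] F2(2)[OF t] F1(1)[OF t] F2(1)[OF t] unfolding has_dual_derivative_def
      by (intro dual_norm_tendsto_add always_eventually allI conjI difference_quotient_dual) auto
    show "has_dual_derivative V E (\<lambda>s. inner (frac_int_left ?a (\<lambda>t. u1 t + u2 t) s)) (\<lambda>\<psi>. F1 t \<psi> + F2 t \<psi>) t"
      unfolding has_dual_derivative_def
    proof (rule Lim_transform_eventually[OF lim])
      have "eventually (\<lambda>s. s \<in> {0<..<T}) (at t)"
        using t by (intro eventually_at_in_open') auto
      then show "eventually (\<lambda>s. dual_norm V E (\<lambda>\<psi>. ?Q u1 F1 s \<psi> + ?Q u2 F2 s \<psi>) =
         dual_norm V E (\<lambda>\<psi>. (frac_int_left ?a (\<lambda>t. u1 t + u2 t) s \<bullet> \<psi> - frac_int_left ?a (\<lambda>t. u1 t + u2 t) t \<bullet> \<psi>) / (s - t) - (F1 t \<psi> + F2 t \<psi>))) (at t)"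
      proof eventually_elim
        case (elim s)
        then have "s \<in> {0<..T}" "t \<in> {0<..T}" using t by auto
        then show ?case unfolding U[OF \<open>s \<in> {0<..T}\<close>] U[OF \<open>t \<in> {0<..T}\<close>] inner_add_left
          by (simp add: add_divide_distrib diff_divide_distrib algebra_simps)
      qed
    qed
  qed
  show ?thesis unfolding evolution_solution_def
  proof (intro conjI ballI exI[of _ "\<lambda>t. g1 t + g2 t"] exI[of _ "\<lambda>t \<psi>. w1 t \<psi> + w2 t \<psi>"])
    fix t assume t: "t \<in> {0<..T}"
    show "u1 t + u2 t \<in> V" by (rule V_add[OF V1[OF t] V2[OF t]])
    show "frac_integrable_left ?a (\<lambda>t. u1 t + u2 t) t"
      by (rule frac_int_left_add(1)[OF g1(3)[OF t] g2(3)[OF t]])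
    show "g1 t + g2 t = frac_int_left ?a (\<lambda>t. u1 t + u2 t) t" using g1(4)[OF t] g2(4)[OF t] U[OF t] by simp
    show "(\<lambda>\<psi>. w1 t \<psi> + w2 t \<psi>) \<in> V'" by (rule dual_space_add[OF w1(2)[OF t] w2(2)[OF t]])
  next
    show "continuous_on {0..T} (\<lambda>t. g1 t + g2 t)" by (intro continuous_intros g1 g2)
    show "g1 0 + g2 0 = x1 + x2" using g1 g2 by simp
    show "has_hilfer_derivative_left V E T \<mu> \<nu> (\<lambda>t. u1 t + u2 t) (\<lambda>t \<psi>. w1 t \<psi> + w2 t \<psi>)" by (rule hil)
    show "AE t in lborel. t \<in> {0<..<T} \<longrightarrow> w1 t \<psi> + w2 t \<psi> + E (u1 t + u2 t) \<psi> - (q1 t \<psi> + q2 t \<psi>) = 0" if "\<psi> \<in> V" for \<psi>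
      using w1(4)[OF that] w2(4)[OF that]
    proof eventually_elim
      case (elim t)
      then show ?case using V1[of t] V2[of t] that by (auto simp: E_add_left)
    qed
    show "norm_continuous_on (form_norm E) {0<..T} (\<lambda>t. u1 t + u2 t)"
      unfolding norm_continuous_on_def
    proof
      fix t assume t: "t \<in> {0<..T}"
      let ?f = "\<lambda>u s. form_norm E (u s - u t)"
      have "((\<lambda>s. sqrt (2 * (?f u1 s)\<^sup>2 + 2 * (?f u2 s)\<^sup>2)) \<longlongrightarrow> sqrt (2 * 0\<^sup>2 + 2 * 0\<^sup>2)) (at t within {0<..T})"
        using nc1 nc2 t unfolding norm_continuous_on_def by (intro tendsto_intros) auto
      then have lim: "((\<lambda>s. sqrt (2 * (?f u1 s)\<^sup>2 + 2 * (?f u2 s)\<^sup>2)) \<longlongrightarrow> 0) (at t within {0<..T})" by simp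
      show "((\<lambda>s. form_norm E (u1 s + u2 s - (u1 t + u2 t))) \<longlongrightarrow> 0) (at t within {0<..T})"
      proof (rule Lim_null_comparison[OF _ lim])
        have "eventually (\<lambda>s. s \<in> {0<..T}) (at t within {0<..T})" by (simp add: eventually_at_filter)
        then show "eventually (\<lambda>s. norm (form_norm E (u1 s + u2 s - (u1 t + u2 t))) \<le> sqrt (2 * (?f u1 s)\<^sup>2 + 2 * (?f u2 s)\<^sup>2)) (at t within {0<..T})"
        proof eventually_elim
          case (elim s)
          have v: "u1 s - u1 t \<in> V" "u2 s - u2 t \<in> V" using V1 V2 V_diff elim t by auto
          have eq: "u1 s + u2 s - (u1 t + u2 t) = (u1 s - u1 t) + (u2 s - u2 t)" by simp
          show ?case unfolding eq using form_norm_add_le[OF v] form_norm_nonneg[OF V_add[OF v]] by simp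
        qed
      qed
    qed
    show "norm_continuous_on (dual_norm V E) {0<..T} (\<lambda>t \<psi>. w1 t \<psi> + w2 t \<psi>)"
      unfolding norm_continuous_on_def
    proof
      fix t assume t: "t \<in> {0<..T}"
      have ev: "eventually (\<lambda>s. s \<in> {0<..T}) (at t within {0<..T})" by (simp add: eventually_at_filter)
      have "((\<lambda>s. dual_norm V E (\<lambda>\<psi>. (w1 s - w1 t) \<psi> + (w2 s - w2 t) \<psi>)) \<longlongrightarrow> 0) (at t within {0<..T})"
      proof (rule dual_norm_tendsto_add[where f = "\<lambda>s. w1 s - w1 t" and g = "\<lambda>s. w2 s - w2 t"])
        show "eventually (\<lambda>s. w1 s - w1 t \<in> V' \<and> w2 s - w2 t \<in> V') (at t within {0<..T})"
          using ev
        proof eventually_elim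
          case (elim s)
          then show ?case using dual_space_diff[OF w1(2) w1(2)[OF t], of s] dual_space_diff[OF w2(2) w2(2)[OF t], of s]
            by (simp add: fun_diff_def)
        qed
      qed (use w1(3) w2(3) t in \<open>auto simp: norm_continuous_on_def\<close>)
      moreover have "(\<lambda>\<psi>. (w1 s - w1 t) \<psi> + (w2 s - w2 t) \<psi>) = (\<lambda>\<psi>. w1 s \<psi> + w2 s \<psi>) - (\<lambda>\<psi>. w1 t \<psi> + w2 t \<psi>)" for s
        by (rule ext) simp
      ultimately show "((\<lambda>s. dual_norm V E ((\<lambda>\<psi>. w1 s \<psi> + w2 s \<psi>) - (\<lambda>\<psi>. w1 t \<psi> + w2 t \<psi>))) \<longlongrightarrow> 0) (at t within {0<..T})"
        by simp
    qed
  qed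
qed

end


section \<open>Convolutions and the duality of scalar fractional equations\<close>

definition conv :: "(real \<Rightarrow> real) \<Rightarrow> (real \<Rightarrow> real) \<Rightarrow> real \<Rightarrow> real" where
  "conv f g t = (LINT s|lborel. f s * g (t - s))"

lemma conv_commute: "conv f g = conv g f"
proof
  fix t
  have "conv f g t = (LINT s|lborel. f (t + (-1) * s) * g (t - (t + (-1) * s)))"
    unfolding conv_def by (subst lborel_integral_real_affine[of "-1" _ t]) simp_all
  then show "conv f g t = conv g f t" by (simp add: conv_def mult.commute)
qed

lemma conv_integrable_pair:
  fixes f g :: "real \<Rightarrow> real"
  assumes f: "integrable lborel f" and g: "integrable lborel g"
  shows "integrable (lborel \<Otimes>\<^sub>M lborel) (\<lambda>(s, t). f s * g (t - s) :: real)"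
proof (rule lborel_pair.Fubini_integrable)
  have [measurable]: "f \<in> borel_measurable borel" "g \<in> borel_measurable borel"
    using f g by (auto dest: borel_measurable_integrable)
  show "(\<lambda>(s, t). f s * g (t - s)) \<in> borel_measurable (lborel \<Otimes>\<^sub>M lborel)"
    by measurable
  have sh: "integrable lborel (\<lambda>t. g (t - s))" "(LINT t|lborel. \<bar>g (t - s)\<bar>) = (LINT t|lborel. \<bar>g t\<bar>)" for s
    using lborel_integrable_real_affine[OF g, of 1 "-s"] lborel_integral_real_affine[of 1 "\<lambda>t. \<bar>g t\<bar>" "-s"] by auto
  show "AE s in lborel. integrable lborel (\<lambda>t. case (s, t) of (s, t) \<Rightarrow> f s * g (t - s))"
    using sh by auto
  have "(\<lambda>s. LINT t|lborel. norm (case (s, t) of (s, t) \<Rightarrow> f s * g (t - s))) = (\<lambda>s. \<bar>f s\<bar> * (LINT t|lborel. \<bar>g t\<bar>))"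
    by (rule ext) (simp add: abs_mult sh)
  then show "integrable lborel (\<lambda>s. LINT t|lborel. norm (case (s, t) of (s, t) \<Rightarrow> f s * g (t - s)))"
    using f by simp
qed

lemma
  assumes f: "integrable lborel f" and g: "integrable lborel g"
  shows AE_conv_integrable: "AE t in lborel. integrable lborel (\<lambda>s. f s * g (t - s) :: real)"
    and conv_integrable: "integrable lborel (conv f g)"
proof -
  have i: "integrable (lborel \<Otimes>\<^sub>M lborel) (\<lambda>(t, s). f s * g (t - s))"
    using lborel_pair.integrable_product_swap[OF conv_integrable_pair[OF f g]] by (simp add: case_prod_unfold)
  show "AE t in lborel. integrable lborel (\<lambda>s. f s * g (t - s))"
    using lborel_pair.AE_integrable_fst'[OF i] by simp
  show "integrable lborel (conv f g)"
    using lborel_pair.integrable_fst'[OF i] by (simp add: conv_def[abs_def])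
qed

lemma AE_reflect:
  fixes P :: "real \<Rightarrow> bool"
  assumes "AE t in lborel. P t"
  shows "AE s in lborel. P (t - s)"
proof -
  obtain N where N: "N \<in> null_sets lborel" "{x. \<not> P x} \<subseteq> N"
    using assms unfolding eventually_ae_filter by auto
  have m: "Measurable.pred borel (\<lambda>x. x \<notin> N)" using N(1) by auto
  have "AE x in lborel. x \<notin> N" using N(1) by (rule AE_not_in)
  from AE_borel_affine[OF _ m this, of "-1" t] have "AE s in lborel. t - s \<notin> N" by simp
  then show ?thesis by eventually_elim (use N(2) in auto)
qed

lemma conv_assoc_AE:
  assumes f: "integrable lborel f" and g: "integrable lborel g" and h: "integrable lborel h"
  shows "AE t in lborel. conv (conv f g) h t = conv f (conv g h) t"
proof -
  have [measurable]: "f \<in> borel_measurable borel" "g \<in> borel_measurable borel" "h \<in> borel_measurable borel"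
    using f g h by (auto dest: borel_measurable_integrable)
  let ?a = "\<lambda>f s. \<bar>f s :: real\<bar>"
  have gh: "integrable lborel (conv (?a g) (?a h))" using g h by (intro conv_integrable) auto
  have i1: "AE t in lborel. integrable lborel (\<lambda>s. ?a f s * conv (?a g) (?a h) (t - s))"
    using f gh by (intro AE_conv_integrable) auto
  have i2: "AE t in lborel. integrable lborel (\<lambda>s. ?a g s * ?a h (t - s))"
    using g h by (intro AE_conv_integrable) auto
  show ?thesis
    using i1
  proof eventually_elim
    case (elim t)
    have sh: "(LINT r|lborel. g (r - s) * h (t - r)) = conv g h (t - s)"
      "(LINT r|lborel. \<bar>g (r - s)\<bar> * \<bar>h (t - r)\<bar>) = conv (?a g) (?a h) (t - s)"
      "integrable lborel (\<lambda>r. g (r - s) * h (t - r)) \<longleftrightarrow> integrable lborel (\<lambda>q. g q * h (t - s - q))" for s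
      using lborel_integral_real_affine[of 1 "\<lambda>r. g (r - s) * h (t - r)" s]
        lborel_integral_real_affine[of 1 "\<lambda>r. \<bar>g (r - s)\<bar> * \<bar>h (t - r)\<bar>" s]
        lborel_integrable_real_affine_iff[of 1 "\<lambda>r. g (r - s) * h (t - r)" s]
      by (auto simp: conv_def algebra_simps)
    have pair: "integrable (lborel \<Otimes>\<^sub>M lborel) (\<lambda>(s, r). f s * (g (r - s) * h (t - r)))"
    proof (rule lborel_pair.Fubini_integrable)
      show "AE s in lborel. integrable lborel (\<lambda>r. case (s, r) of (s, r) \<Rightarrow> f s * (g (r - s) * h (t - r)))"
        using AE_reflect[OF i2, of t]
      proof eventually_elim
        case (elim s)
        have "integrable lborel (\<lambda>q. g q * h (t - s - q))"
          by (rule Bochner_Integration.integrable_bound[OF elim]) (auto simp: abs_mult)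
        then show ?case using sh(3) by simp
      qed
      have "(\<lambda>s. LINT r|lborel. norm (case (s, r) of (s, r) \<Rightarrow> f s * (g (r - s) * h (t - r))))
          = (\<lambda>s. ?a f s * conv (?a g) (?a h) (t - s))"
        by (rule ext) (simp add: abs_mult sh(2))
      then show "integrable lborel (\<lambda>s. LINT r|lborel. norm (case (s, r) of (s, r) \<Rightarrow> f s * (g (r - s) * h (t - r))))"
        using elim by simp
    qed measurable
    have "conv (conv f g) h t = (LINT r|lborel. (LINT s|lborel. f s * (g (r - s) * h (t - r))))"
      unfolding conv_def by (simp add: mult.assoc flip: Bochner_Integration.integral_mult_left_zero)
    also have "\<dots> = (LINT s|lborel. (LINT r|lborel. f s * (g (r - s) * h (t - r))))"
      by (rule lborel_pair.Fubini_integral[OF pair])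
    also have "\<dots> = conv f (conv g h) t"
      by (simp add: sh(1) conv_def[of f])
    finally show ?case .
  qed
qed

text \<open>
  Weak solutions are controlled only between \<open>0\<close> and \<open>T\<close>. After cutting off, convolutions are taken on the
  whole line, where they are associative and commutative; at times before \<open>T\<close> they only see values before \<open>T\<close>.
\<close>

definition cutoff :: "real \<Rightarrow> (real \<Rightarrow> real) \<Rightarrow> real \<Rightarrow> real" where
  "cutoff T f t = indicat_real {0<..<T} t * f t"

lemma cutoff_integrable: "integrable lborel (cutoff T f) \<longleftrightarrow> set_integrable lborel {0<..<T} f"
  by (simp add: cutoff_def[abs_def] set_integrable_def)

lemma cutoff_zero: "t \<le> 0 \<Longrightarrow> cutoff T f t = 0" "T \<le> t \<Longrightarrow> cutoff T f t = 0"
  by (auto simp: cutoff_def)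

lemma cutoff_in: "0 < t \<Longrightarrow> t < T \<Longrightarrow> cutoff T f t = f t"
  by (auto simp: cutoff_def)

lemma conv_cutoff:
  assumes "t < T"
  shows "conv (cutoff T f) (cutoff T g) t = (LINT s:{0<..<t}|lborel. f s * g (t - s))"
  unfolding conv_def set_lebesgue_integral_def
  by (rule Bochner_Integration.integral_cong) (use assms in \<open>auto simp: cutoff_def indicator_def\<close>)

lemma conv_causal:
  assumes ae: "AE s in lborel. s < T \<longrightarrow> f s = f' s" and t: "t < T"
    and int: "integrable lborel f" "integrable lborel f'" "integrable lborel (cutoff T g)"
  shows "conv f (cutoff T g) t = conv f' (cutoff T g) t"
  unfolding conv_def
proof (rule integral_cong_AE)
  have [measurable]: "f \<in> borel_measurable borel" "f' \<in> borel_measurable borel" "cutoff T g \<in> borel_measurable borel"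
    using int by (auto dest: borel_measurable_integrable)
  show "(\<lambda>s. f s * cutoff T g (t - s)) \<in> borel_measurable lborel" "(\<lambda>s. f' s * cutoff T g (t - s)) \<in> borel_measurable lborel"
    by measurable
  show "AE s in lborel. f s * cutoff T g (t - s) = f' s * cutoff T g (t - s)"
    using ae
  proof eventually_elim
    case (elim s)
    show ?case
    proof (cases "s < T")
      case False
      then show ?thesis using t cutoff_zero(1)[of "t - s" T g] by simp
    qed (use elim in simp)
  qed
qed

lemma conv_diff_scale_AE:
  assumes f: "integrable lborel f" and g: "integrable lborel g" and h: "integrable lborel h"
  shows "AE t in lborel. conv (\<lambda>s. c * f s + d * g s) h t = c * conv f h t + d * conv g h t"
  using AE_conv_integrable[OF f h] AE_conv_integrable[OF g h]
proof eventually_elim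
  case (elim t)
  have "conv (\<lambda>s. c * f s + d * g s) h t = (LINT s|lborel. c * (f s * h (t - s)) + d * (g s * h (t - s)))"
    unfolding conv_def by (simp add: algebra_simps)
  also have "\<dots> = c * conv f h t + d * conv g h t"
    unfolding conv_def using elim by (subst Bochner_Integration.integral_add) auto
  finally show ?case .
qed

text \<open>
  The fractional integral as a convolution operator; order \<open>0\<close> is a separate case because \<open>rl_kernel 0\<close> is
  not the unit mass.
\<close>

definition frac_int_op :: "real \<Rightarrow> real \<Rightarrow> (real \<Rightarrow> real) \<Rightarrow> real \<Rightarrow> real" where
  "frac_int_op T c f = (if c = 0 then f else conv (cutoff T (rl_kernel c)) f)"

lemma rl_kernel_integrable:
  assumes c: "0 < c"
  shows "integrable lborel (cutoff T (rl_kernel c))"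
proof (cases "0 < T")
  case True
  have "((\<lambda>s. s powr (c - 1)) has_integral T powr (c - 1 + 1) / (c - 1 + 1)) {0..T}"
    using c True by (intro has_integral_powr_from_0) auto
  then have "(\<lambda>s. s powr (c - 1)) absolutely_integrable_on {0..T}"
    by (intro nonnegative_absolutely_integrable_1) (auto simp: has_integral_iff)
  then have "set_integrable lebesgue {0<..<T} (\<lambda>s. s powr (c - 1))"
    by (rule set_integrable_subset) auto
  then have "set_integrable lborel {0<..<T} (\<lambda>s. s powr (c - 1))"
    unfolding set_integrable_def by (subst (asm) integrable_completion) auto
  then show ?thesis unfolding cutoff_integrable rl_kernel_def[abs_def] by (rule set_integrable_divide)
next
  case False
  then have "cutoff T (rl_kernel c) = (\<lambda>s. 0)" by (auto simp: cutoff_def fun_eq_iff)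
  then show ?thesis by simp
qed

lemma frac_int_op_integrable: "0 \<le> c \<Longrightarrow> integrable lborel f \<Longrightarrow> integrable lborel (frac_int_op T c f)"
  by (auto simp: frac_int_op_def intro!: conv_integrable rl_kernel_integrable)

lemma frac_int_op_eq:
  assumes "0 < t" "t < T"
  shows "frac_int_op T c (cutoff T f) t = frac_int_left c f t"
proof (cases "c = 0")
  case True
  then show ?thesis using assms by (simp add: frac_int_op_def frac_int_left_def cutoff_in)
next
  case False
  then have "frac_int_op T c (cutoff T f) t = conv (cutoff T f) (cutoff T (rl_kernel c)) t"
    by (simp add: frac_int_op_def conv_commute)
  also have "\<dots> = (LINT s:{0<..<t}|lborel. f s * rl_kernel c (t - s))"
    using assms by (intro conv_cutoff)
  also have "\<dots> = (LINT s:{0<..<t}|lborel. 1 / Gamma c * ((t - s) powr (c - 1) * f s))"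
    by (rule set_lebesgue_integral_cong) (auto simp: rl_kernel_def)
  also have "\<dots> = frac_int_left c f t"
    using False by (simp add: frac_int_left_def)
  finally show ?thesis .
qed

lemma frac_int_op_neg: "t \<le> 0 \<Longrightarrow> frac_int_op T c (cutoff T f) t = 0"
proof -
  assume t: "t \<le> 0"
  have "cutoff T (rl_kernel c) s * cutoff T f (t - s) = 0" for s
    using t by (cases "0 < s") (auto simp: cutoff_zero)
  then have "conv (cutoff T (rl_kernel c)) (cutoff T f) t = 0"
    unfolding conv_def by (simp only: Bochner_Integration.integral_zero)
  then show ?thesis using t by (simp add: frac_int_op_def cutoff_zero)
qed

lemma frac_int_op_assoc:
  assumes "0 \<le> c" "integrable lborel f" "integrable lborel g"
  shows "AE t in lborel. conv f (frac_int_op T c g) t = conv (frac_int_op T c f) g t"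
proof (cases "c = 0")
  case False
  let ?p = "cutoff T (rl_kernel c)"
  have p: "integrable lborel ?p" using assms False by (intro rl_kernel_integrable) auto
  have "AE t in lborel. conv (conv f ?p) g t = conv f (conv ?p g) t"
    by (rule conv_assoc_AE[OF assms(2) p assms(3)])
  then have "AE t in lborel. conv f (conv ?p g) t = conv (conv ?p f) g t"
    by eventually_elim (simp add: conv_commute[of f ?p])
  then show ?thesis using False by (simp add: frac_int_op_def)
qed (simp add: frac_int_op_def)

text \<open>
  Convolve \<open>I^b F + l u = f\<close> with \<open>y\<close> and \<open>I^a G + l y = 0\<close> with \<open>u\<close>, and subtract. The terms with \<open>l\<close> cancel, and
  moving the fractional integrals to the other factor leaves
  \<open>f conv y = F conv (I^b y) - G conv (I^a u)\<close>. Inserting \<open>I^b y = w0 + 1 conv G\<close> and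
  \<open>I^a u = 1 conv F\<close>, everything cancels except \<open>w0 * (1 conv F) = w0 * U\<close>.
\<close>

lemma fractional_duality:
  fixes u F f y G U W :: "real \<Rightarrow> real"
  assumes ab: "0 \<le> a" "0 \<le> b"
    and int: "set_integrable lborel {0<..<T} u" "set_integrable lborel {0<..<T} F" "set_integrable lborel {0<..<T} f"
      "set_integrable lborel {0<..<T} y" "set_integrable lborel {0<..<T} G"
    and U: "\<And>t. 0 < t \<Longrightarrow> t < T \<Longrightarrow> U t = frac_int_left a u t \<and> U t = (LINT s:{0<..<t}|lborel. F s)"
    and W: "\<And>t. 0 < t \<Longrightarrow> t < T \<Longrightarrow> W t = frac_int_left b y t \<and> W t = w0 + (LINT s:{0<..<t}|lborel. G s)"
    and eq: "AE t in lborel. t \<in> {0<..<T} \<longrightarrow> frac_int_left b F t + l * u t = f t"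
      "AE t in lborel. t \<in> {0<..<T} \<longrightarrow> frac_int_left a G t + l * y t = 0"
  shows "AE t in lborel. t \<in> {0<..<T} \<longrightarrow> U t * w0 = (LINT s:{0<..<t}|lborel. f s * y (t - s))"
proof -
  let ?u = "cutoff T u" and ?F = "cutoff T F" and ?f = "cutoff T f" and ?y = "cutoff T y" and ?G = "cutoff T G"
    and ?J = "cutoff T (\<lambda>_. 1)"
  let ?I = "frac_int_op T"
  have i: "integrable lborel ?u" "integrable lborel ?F" "integrable lborel ?f" "integrable lborel ?y" "integrable lborel ?G"
    using int by (simp_all add: cutoff_integrable)
  have iJ: "integrable lborel ?J" unfolding cutoff_integrable set_integrable_def by (cases "0 \<le> T") auto
  note ci = conv_integrable and pi = frac_int_op_integrable
  \<comment> \<open>both equations and both primitives, as identities between convolutions before time \<open>T\<close>\<close>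
  have e1: "AE t in lborel. t < T \<longrightarrow> ?I b ?F t = 1 * ?f t + (- l) * ?u t"
    using eq(1)
  proof eventually_elim
    case (elim t)
    show ?case
    proof (cases "0 < t")
      case True
      then show ?thesis using elim frac_int_op_eq[of t T b F] by (auto simp: cutoff_in)
    qed (simp add: frac_int_op_neg cutoff_zero)
  qed
  have e2: "AE t in lborel. t < T \<longrightarrow> ?I a ?G t = 0 * ?y t + (- l) * ?y t"
    using eq(2)
  proof eventually_elim
    case (elim t)
    show ?case
    proof (cases "0 < t")
      case True
      then show ?thesis using elim frac_int_op_eq[of t T a G] by (auto simp: cutoff_in)
    qed (simp add: frac_int_op_neg cutoff_zero)
  qed
  have conv_J: "conv ?J (cutoff T h) t = (LINT s:{0<..<t}|lborel. h s)" if "t < T" for h t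
    using conv_cutoff[OF that, of h "\<lambda>_. 1"] by (simp add: conv_commute)
  have e3: "AE t in lborel. t < T \<longrightarrow> ?I a ?u t = 1 * conv ?J ?F t + 0 * ?J t"
  proof (rule AE_I2, rule impI)
    fix t assume t: "t < T"
    show "?I a ?u t = 1 * conv ?J ?F t + 0 * ?J t"
    proof (cases "0 < t")
      case True
      then show ?thesis using U[OF True t] frac_int_op_eq[OF True t, of a u] conv_J[OF t, of F] by simp
    next
      case False
      then have "{0<..<t} = {}" by auto
      then show ?thesis using False conv_J[OF t, of F] frac_int_op_neg[of t T a u] by (simp add: set_lebesgue_integral_def)
    qed
  qed
  have e4: "AE t in lborel. t < T \<longrightarrow> ?I b ?y t = 1 * conv ?J ?G t + w0 * ?J t"
  proof (rule AE_I2, rule impI)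
    fix t assume t: "t < T"
    show "?I b ?y t = 1 * conv ?J ?G t + w0 * ?J t"
    proof (cases "0 < t")
      case True
      then show ?thesis using W[OF True t] frac_int_op_eq[OF True t, of b y] conv_J[OF t, of G] t by (simp add: cutoff_in)
    next
      case False
      then have "{0<..<t} = {}" by auto
      then show ?thesis using False conv_J[OF t, of G] frac_int_op_neg[of t T b y] by (simp add: cutoff_zero set_lebesgue_integral_def)
    qed
  qed
  have lin: "AE t in lborel. t < T \<longrightarrow> conv k (cutoff T h) t = c * conv p (cutoff T h) t + d * conv q (cutoff T h) t"
    if ae: "AE t in lborel. t < T \<longrightarrow> k t = c * p t + d * q t"
      and ik: "integrable lborel k" "integrable lborel p" "integrable lborel q" "integrable lborel (cutoff T h)" for k p q h c d
    using conv_diff_scale_AE[OF ik(2,3,4), of c d]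
  proof eventually_elim
    case (elim t)
    have "conv k (cutoff T h) t = conv (\<lambda>s. c * p s + d * q s) (cutoff T h) t" if "t < T"
      by (rule conv_causal[OF ae that ik(1) _ ik(4)]) (use ik in auto)
    then show ?case using elim by simp
  qed
  note l1 = lin[OF e1 pi[OF ab(2) i(2)] i(3,1) i(4)]
    and l2 = lin[OF e2 pi[OF ab(1) i(5)] i(4,4) i(1)]
    and l3 = lin[OF e3 pi[OF ab(1) i(1)] ci[OF iJ i(2)] iJ i(5)]
    and l4 = lin[OF e4 pi[OF ab(2) i(4)] ci[OF iJ i(5)] iJ i(2)]
  show ?thesis
    using l1 l2 l3 l4 frac_int_op_assoc[OF ab(2) i(4,2), of T] frac_int_op_assoc[OF ab(1) i(1,5), of T]
      conv_assoc_AE[OF iJ i(5,2)] conv_assoc_AE[OF iJ i(2,5)]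
  proof eventually_elim
    case (elim t)
    show ?case
    proof
      assume t: "t \<in> {0<..<T}"
      then have tT: "t < T" by simp
      have A: "conv ?f ?y t - l * conv ?u ?y t = conv ?J (conv ?G ?F) t + w0 * conv ?J ?F t"
        using elim(1,4,5,7) tT by (simp add: conv_commute[of ?y "?I b ?F"])
      have B: "- l * conv ?u ?y t = conv ?J (conv ?F ?G) t"
        using elim(2,3,6,8) tT by (simp add: conv_commute[of ?u "?I a ?G"] conv_commute[of ?y ?u])
      have "conv ?f ?y t = w0 * conv ?J ?F t"
        using A B by (simp add: conv_commute[of ?F ?G])
      then show "U t * w0 = (LINT s:{0<..<t}|lborel. f s * y (t - s))"
        using U[of t] t conv_J[OF tT, of F] conv_cutoff[OF tT, of f y] by simp
    qed
  qed
qed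


section \<open>Time reversal\<close>

lemma set_reflect:
  fixes f :: "real \<Rightarrow> 'b::{banach, second_countable_topology}"
  shows "set_integrable lborel {t<..<T} f \<longleftrightarrow> set_integrable lborel {0<..<T - t} (\<lambda>s. f (T - s))"
    "(LINT s:{t<..<T}|lborel. f s) = (LINT s:{0<..<T - t}|lborel. f (T - s))"
proof -
  have e: "indicat_real {0<..<T - t} s *\<^sub>R f (T - s) = indicat_real {t<..<T} (T + (-1) * s) *\<^sub>R f (T + (-1) * s)" for s
    by (auto simp: indicator_def)
  show "set_integrable lborel {t<..<T} f \<longleftrightarrow> set_integrable lborel {0<..<T - t} (\<lambda>s. f (T - s))"
    unfolding set_integrable_def e
    using lborel_integrable_real_affine_iff[of "-1" "\<lambda>s. indicat_real {t<..<T} s *\<^sub>R f s" T] by simp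
  show "(LINT s:{t<..<T}|lborel. f s) = (LINT s:{0<..<T - t}|lborel. f (T - s))"
    unfolding set_lebesgue_integral_def e
    using lborel_integral_real_affine[of "-1" "\<lambda>s. indicat_real {t<..<T} s *\<^sub>R f s" T] by simp
qed

lemma set_borel_measurable_reflect:
  fixes f :: "real \<Rightarrow> real"
  shows "set_borel_measurable lborel {t<..<T} f \<longleftrightarrow> set_borel_measurable lborel {0<..<T - t} (\<lambda>s. f (T - s))"
proof -
  define h where "h s = indicat_real {t<..<T} s *\<^sub>R f s" for s
  have e: "indicat_real {0<..<T - t} s *\<^sub>R f (T - s) = h (T - s)" for s
    by (auto simp: indicator_def h_def)
  have "h \<in> borel_measurable borel \<longleftrightarrow> (\<lambda>s. h (T - s)) \<in> borel_measurable borel"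
  proof
    assume [measurable]: "h \<in> borel_measurable borel"
    show "(\<lambda>s. h (T - s)) \<in> borel_measurable borel" by measurable
  next
    assume [measurable]: "(\<lambda>s. h (T - s)) \<in> borel_measurable borel"
    have "(\<lambda>s. (\<lambda>s. h (T - s)) (T - s)) \<in> borel_measurable borel"
      by (rule measurable_compose[of "\<lambda>s. T - s" borel borel "\<lambda>s. h (T - s)"]) measurable
    then show "h \<in> borel_measurable borel" by simp
  qed
  then show ?thesis unfolding set_borel_measurable_def e h_def[symmetric] by simp
qed

lemma frac_right_eq_left:
  "frac_int_right T c v t = frac_int_left c (\<lambda>s. v (T - s)) (T - t)"
  "frac_integrable_right T c v t \<longleftrightarrow> frac_integrable_left c (\<lambda>s. v (T - s)) (T - t)"
  unfolding frac_int_right_def frac_int_left_def frac_integrable_right_def frac_integrable_left_def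
    set_reflect[of t T] by (simp_all add: algebra_simps)

lemma dual_norm_minus: "dual_norm V E (\<lambda>\<phi>. - f \<phi>) = dual_norm V E f"
  by (simp add: dual_norm_def)

lemma dual_frac_right_eq_left:
  "dual_frac_integrable_right V E T c F t \<longleftrightarrow> dual_frac_integrable_left V E c (\<lambda>s \<phi>. - F (T - s) \<phi>) (T - t)"
proof -
  have "dual_norm V E (\<lambda>\<phi>. - (x * f \<phi>)) = dual_norm V E (\<lambda>\<phi>. x * f \<phi>)" for x :: real and f
    by (rule dual_norm_minus)
  moreover have "set_borel_measurable lborel S (\<lambda>s. - f s) \<longleftrightarrow> set_borel_measurable lborel S f" for S and f :: "real \<Rightarrow> real"
    by (simp add: set_borel_measurable_def)
  moreover have e: "T - s - t = T - t - s" for s by simp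
  ultimately show ?thesis
    unfolding dual_frac_integrable_right_def dual_frac_integrable_left_def dual_integrable_def
      set_reflect[of t T] set_borel_measurable_reflect[of t T] e
    by (simp only: mult_minus_right)
qed

lemma filterlim_reflect:
  fixes T t :: real
  shows "filterlim (\<lambda>s. T - s) (at (T - t) within (\<lambda>s. T - s) ` S) (at t within S)"
  unfolding filterlim_at
proof
  show "\<forall>\<^sub>F s in at t within S. T - s \<in> (\<lambda>s. T - s) ` S \<and> T - s \<noteq> T - t"
    by (auto simp: eventually_at_filter)
  show "((\<lambda>s. T - s) \<longlongrightarrow> T - t) (at t within S)" by (intro tendsto_intros)
qed

lemma reflect_images:
  fixes T :: real
  shows "(\<lambda>s. T - s) ` {0<..T} = {0..<T}" "(\<lambda>s. T - s) ` {0..<T} = {0<..T}" "(\<lambda>s. T - s) ` UNIV = UNIV"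
  by (auto simp: image_iff intro!: bexI[where x = "T - _"] exI[where x = "T - _"])

lemma norm_continuous_reflect:
  assumes "norm_continuous_on nrm ((\<lambda>s. T - s) ` S) u"
  shows "norm_continuous_on nrm S (\<lambda>s. u (T - s))"
  unfolding norm_continuous_on_def
proof
  fix t assume t: "t \<in> S"
  then have "((\<lambda>s. nrm (u s - u (T - t))) \<longlongrightarrow> 0) (at (T - t) within (\<lambda>s. T - s) ` S)"
    using assms unfolding norm_continuous_on_def by blast
  from filterlim_compose[OF this filterlim_reflect]
  show "((\<lambda>s. nrm (u (T - s) - u (T - t))) \<longlongrightarrow> 0) (at t within S)" .
qed

lemma has_dual_derivative_reflect:
  assumes "has_dual_derivative V E G G' (T - t)"
  shows "has_dual_derivative V E (\<lambda>s. G (T - s)) (\<lambda>\<phi>. - G' \<phi>) t"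
proof -
  have f: "filterlim (\<lambda>s. T - s) (at (T - t)) (at t)"
    using filterlim_reflect[of T t UNIV] reflect_images(3)[of T] by simp
  have "((\<lambda>s. dual_norm V E (\<lambda>\<phi>. (G (T - s) \<phi> - G (T - t) \<phi>) / ((T - s) - (T - t)) - G' \<phi>)) \<longlongrightarrow> 0) (at t)"
    using filterlim_compose[OF assms[unfolded has_dual_derivative_def] f] .
  moreover have "(\<lambda>\<phi>. (G (T - s) \<phi> - G (T - t) \<phi>) / ((T - s) - (T - t)) - G' \<phi>) =
      (\<lambda>\<phi>. - ((G (T - s) \<phi> - G (T - t) \<phi>) / (s - t) - (- G' \<phi>)))" for s
  proof
    fix \<phi>
    have "(T - s) - (T - t) = - (s - t)" by simp
    then show "(G (T - s) \<phi> - G (T - t) \<phi>) / ((T - s) - (T - t)) - G' \<phi> =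
       - ((G (T - s) \<phi> - G (T - t) \<phi>) / (s - t) - (- G' \<phi>))" by (simp only: divide_minus_right)
  qed
  ultimately show ?thesis unfolding has_dual_derivative_def by (simp only: dual_norm_minus)
qed

lemma dual_space_minus: "f \<in> dual_space V E \<Longrightarrow> (\<lambda>\<phi>. - f \<phi>) \<in> dual_space V E"
  by (auto simp: dual_space_def linear_on_set_def)

lemma hilfer_reflect:
  assumes "has_hilfer_derivative_right V E T \<mu> \<nu> v w"
  shows "has_hilfer_derivative_left V E T \<mu> \<nu> (\<lambda>s. v (T - s)) (\<lambda>s. w (T - s))"
proof -
  let ?a = "(1 - \<nu>) * (1 - \<mu>)" and ?b = "\<nu> * (1 - \<mu>)"
  from assms obtain F where 1: "\<And>t. t \<in> {0..<T} \<Longrightarrow> frac_integrable_right T ?a v t"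
    and F: "\<And>t. t \<in> {0<..<T} \<Longrightarrow> F t \<in> dual_space V E \<and> has_dual_derivative V E (\<lambda>s. inner (frac_int_right T ?a v s)) (F t) t"
    and w: "\<And>t. t \<in> {0..<T} \<Longrightarrow> dual_frac_integrable_right V E T ?b F t \<and> (\<forall>\<phi>\<in>V. w t \<phi> = - frac_int_right T ?b (\<lambda>\<tau>. F \<tau> \<phi>) t)"
    unfolding has_hilfer_derivative_right_def by blast
  have neg: "frac_int_left c (\<lambda>s. - h s) t = - frac_int_left c h t" for c t and h :: "real \<Rightarrow> real"
    by (simp add: frac_int_left_def set_lebesgue_integral_def)
  show ?thesis unfolding has_hilfer_derivative_left_def
  proof (intro conjI exI[of _ "\<lambda>s \<phi>. - F (T - s) \<phi>"] ballI)
    fix t assume t: "t \<in> {0<..T}"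
    then have t': "T - t \<in> {0..<T}" by auto
    show "frac_integrable_left ?a (\<lambda>s. v (T - s)) t" using 1[OF t'] by (simp add: frac_right_eq_left)
    show "dual_frac_integrable_left V E ?b (\<lambda>s \<phi>. - F (T - s) \<phi>) t"
      using w[OF t'] by (simp add: dual_frac_right_eq_left)
    show "w (T - t) \<phi> = frac_int_left ?b (\<lambda>\<tau>. - F (T - \<tau>) \<phi>) t" if "\<phi> \<in> V" for \<phi>
      using w[OF t'] that by (simp add: frac_right_eq_left neg)
  next
    fix t assume "t \<in> {0<..<T}"
    then have t': "T - t \<in> {0<..<T}" by auto
    show "(\<lambda>\<phi>. - F (T - t) \<phi>) \<in> dual_space V E" using F[OF t'] by (simp add: dual_space_minus)
    show "has_dual_derivative V E (\<lambda>s. inner (frac_int_left ?a (\<lambda>s. v (T - s)) s)) (\<lambda>\<phi>. - F (T - t) \<phi>) t"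
      using has_dual_derivative_reflect[OF conjunct2[OF F[OF t']]] by (simp add: frac_right_eq_left)
  qed
qed

lemma hilfer_reflect':
  assumes "has_hilfer_derivative_left V E T \<mu> \<nu> u w"
  shows "has_hilfer_derivative_right V E T \<mu> \<nu> (\<lambda>s. u (T - s)) (\<lambda>s. w (T - s))"
proof -
  let ?a = "(1 - \<nu>) * (1 - \<mu>)" and ?b = "\<nu> * (1 - \<mu>)"
  from assms obtain F where 1: "\<And>t. t \<in> {0<..T} \<Longrightarrow> frac_integrable_left ?a u t"
    and F: "\<And>t. t \<in> {0<..<T} \<Longrightarrow> F t \<in> dual_space V E \<and> has_dual_derivative V E (\<lambda>s. inner (frac_int_left ?a u s)) (F t) t"
    and w: "\<And>t. t \<in> {0<..T} \<Longrightarrow> dual_frac_integrable_left V E ?b F t \<and> (\<forall>\<phi>\<in>V. w t \<phi> = frac_int_left ?b (\<lambda>\<tau>. F \<tau> \<phi>) t)"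
    unfolding has_hilfer_derivative_left_def by blast
  have neg: "frac_int_left c (\<lambda>s. - h s) t = - frac_int_left c h t" for c t and h :: "real \<Rightarrow> real"
    by (simp add: frac_int_left_def set_lebesgue_integral_def)
  show ?thesis unfolding has_hilfer_derivative_right_def
  proof (intro conjI exI[of _ "\<lambda>s \<phi>. - F (T - s) \<phi>"] ballI)
    fix t assume t: "t \<in> {0..<T}"
    then have t': "T - t \<in> {0<..T}" by auto
    show "frac_integrable_right T ?a (\<lambda>s. u (T - s)) t" using 1[OF t'] by (simp add: frac_right_eq_left)
    show "dual_frac_integrable_right V E T ?b (\<lambda>s \<phi>. - F (T - s) \<phi>) t"
      using w[OF t'] by (simp add: dual_frac_right_eq_left)
    show "w (T - t) \<phi> = - frac_int_right T ?b (\<lambda>\<tau>. - F (T - \<tau>) \<phi>) t" if "\<phi> \<in> V" for \<phi>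
      using w[OF t'] that by (simp add: frac_right_eq_left neg)
  next
    fix t assume "t \<in> {0<..<T}"
    then have t': "T - t \<in> {0<..<T}" by auto
    show "(\<lambda>\<phi>. - F (T - t) \<phi>) \<in> dual_space V E" using F[OF t'] by (simp add: dual_space_minus)
    show "has_dual_derivative V E (\<lambda>s. inner (frac_int_right T ?a (\<lambda>s. u (T - s)) s)) (\<lambda>\<phi>. - F (T - t) \<phi>) t"
      using has_dual_derivative_reflect[OF conjunct2[OF F[OF t']]] by (simp add: frac_right_eq_left)
  qed
qed

text \<open>
  Reflection exchanges right and left fractional integrals, and the sign of the time derivative accounts for the
  minus sign in the right Hilfer derivative.
\<close>

theorem adjoint_iff_reflected_evolution:
  "adjoint_weak_solution V E T \<mu> \<nu> v0 v \<longleftrightarrow> evolution_solution V E T \<mu> (1 - \<nu>) (\<lambda>_ _. 0) v0 (\<lambda>s. v (T - s))"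
proof
  assume a: "adjoint_weak_solution V E T \<mu> \<nu> v0 v"
  then obtain g w where V: "\<And>t. t \<in> {0..<T} \<Longrightarrow> v t \<in> V" and nc: "norm_continuous_on (form_norm E) {0..<T} v"
    and g: "continuous_on {0..T} g" "g T = v0"
      "\<And>t. t \<in> {0..<T} \<Longrightarrow> frac_integrable_right T (\<nu> * (1 - \<mu>)) v t \<and> g t = frac_int_right T (\<nu> * (1 - \<mu>)) v t"
    and w: "has_hilfer_derivative_right V E T \<mu> (1 - \<nu>) v w" "\<And>t. t \<in> {0..<T} \<Longrightarrow> w t \<in> dual_space V E"
      "norm_continuous_on (dual_norm V E) {0..<T} w"
      "\<And>\<phi>. \<phi> \<in> V \<Longrightarrow> AE t in lborel. t \<in> {0<..<T} \<longrightarrow> w t \<phi> + E (v t) \<phi> = 0"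
    unfolding adjoint_weak_solution_def by blast
  show "evolution_solution V E T \<mu> (1 - \<nu>) (\<lambda>_ _. 0) v0 (\<lambda>s. v (T - s))"
    unfolding evolution_solution_def
  proof (intro conjI exI[of _ "\<lambda>s. g (T - s)"] exI[of _ "\<lambda>s. w (T - s)"] ballI)
    fix t assume "t \<in> {0<..T}"
    then have t': "T - t \<in> {0..<T}" by auto
    show "v (T - t) \<in> V" by (rule V[OF t'])
    show "w (T - t) \<in> dual_space V E" by (rule w(2)[OF t'])
    show "frac_integrable_left ((1 - (1 - \<nu>)) * (1 - \<mu>)) (\<lambda>s. v (T - s)) t"
      "g (T - t) = frac_int_left ((1 - (1 - \<nu>)) * (1 - \<mu>)) (\<lambda>s. v (T - s)) t"
      using g(3)[OF t'] by (simp_all add: frac_right_eq_left)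
  next
    show "norm_continuous_on (form_norm E) {0<..T} (\<lambda>s. v (T - s))"
      "norm_continuous_on (dual_norm V E) {0<..T} (\<lambda>s. w (T - s))"
      using nc w(3) by (auto intro!: norm_continuous_reflect simp: reflect_images)
    show "continuous_on {0..T} (\<lambda>s. g (T - s))"
      by (rule continuous_on_compose2[OF g(1)]) (auto intro!: continuous_intros)
    show "g (T - 0) = v0" using g by simp
    show "has_hilfer_derivative_left V E T \<mu> (1 - \<nu>) (\<lambda>s. v (T - s)) (\<lambda>s. w (T - s))"
      by (rule hilfer_reflect[OF w(1)])
    fix \<phi> assume "\<phi> \<in> V"
    from AE_reflect[OF w(4)[OF this], of T]
    show "AE t in lborel. t \<in> {0<..<T} \<longrightarrow> w (T - t) \<phi> + E (v (T - t)) \<phi> - 0 = 0"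
      by eventually_elim auto
  qed
next
  assume "evolution_solution V E T \<mu> (1 - \<nu>) (\<lambda>_ _. 0) v0 (\<lambda>s. v (T - s))"
  then obtain g w where V: "\<And>t. t \<in> {0<..T} \<Longrightarrow> v (T - t) \<in> V" and nc: "norm_continuous_on (form_norm E) {0<..T} (\<lambda>s. v (T - s))"
    and g: "continuous_on {0..T} g" "g 0 = v0"
      "\<And>t. t \<in> {0<..T} \<Longrightarrow> frac_integrable_left ((1 - (1 - \<nu>)) * (1 - \<mu>)) (\<lambda>s. v (T - s)) t \<and>
         g t = frac_int_left ((1 - (1 - \<nu>)) * (1 - \<mu>)) (\<lambda>s. v (T - s)) t"
    and w: "has_hilfer_derivative_left V E T \<mu> (1 - \<nu>) (\<lambda>s. v (T - s)) w" "\<And>t. t \<in> {0<..T} \<Longrightarrow> w t \<in> dual_space V E"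
      "norm_continuous_on (dual_norm V E) {0<..T} w"
      "\<And>\<phi>. \<phi> \<in> V \<Longrightarrow> AE t in lborel. t \<in> {0<..<T} \<longrightarrow> w t \<phi> + E (v (T - t)) \<phi> - 0 = 0"
    unfolding evolution_solution_def by blast
  show "adjoint_weak_solution V E T \<mu> \<nu> v0 v"
    unfolding adjoint_weak_solution_def
  proof (intro conjI exI[of _ "\<lambda>s. g (T - s)"] exI[of _ "\<lambda>s. w (T - s)"] ballI)
    fix t assume "t \<in> {0..<T}"
    then have t': "T - t \<in> {0<..T}" by auto
    show "v t \<in> V" using V[OF t'] by simp
    show "w (T - t) \<in> dual_space V E" by (rule w(2)[OF t'])
    show "frac_integrable_right T (\<nu> * (1 - \<mu>)) v t"
      "g (T - t) = frac_int_right T (\<nu> * (1 - \<mu>)) v t"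
      using g(3)[OF t'] by (simp_all add: frac_right_eq_left)
  next
    show "norm_continuous_on (form_norm E) {0..<T} v"
      using norm_continuous_reflect[of "form_norm E" T "{0..<T}" "\<lambda>s. v (T - s)"] nc by (simp add: reflect_images)
    show "norm_continuous_on (dual_norm V E) {0..<T} (\<lambda>s. w (T - s))"
      using w(3) by (auto intro!: norm_continuous_reflect simp: reflect_images)
    show "continuous_on {0..T} (\<lambda>s. g (T - s))"
      by (rule continuous_on_compose2[OF g(1)]) (auto intro!: continuous_intros)
    show "g (T - T) = v0" using g by simp
    show "has_hilfer_derivative_right V E T \<mu> (1 - \<nu>) v (\<lambda>s. w (T - s))"
      using hilfer_reflect'[OF w(1)] by simp
    fix \<phi> assume "\<phi> \<in> V"
    from AE_reflect[OF w(4)[OF this], of T]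
    show "AE t in lborel. t \<in> {0<..<T} \<longrightarrow> w (T - t) \<phi> + E (v t) \<phi> = 0"
      by eventually_elim auto
  qed
qed


section \<open>Duality between state and adjoint state\<close>

text \<open>
  For \<open>c \<le> 1\<close> the weight is bounded below on the interval, so it can be divided out.
\<close>

lemma set_integrable_unweight:
  fixes f :: "real \<Rightarrow> 'b::{banach, second_countable_topology}"
  assumes c: "c \<le> 1" and f: "set_integrable lborel {0<..<T} (\<lambda>s. (T - s) powr (c - 1) *\<^sub>R f s)"
  shows "set_integrable lborel {0<..<T} f"
proof -
  let ?h = "\<lambda>s. indicat_real {0<..<T} s *\<^sub>R (T - s) powr (c - 1) *\<^sub>R f s"
  have h: "integrable lborel ?h" using f by (simp add: set_integrable_def)
  then have [measurable]: "?h \<in> borel_measurable lborel" by (rule borel_measurable_integrable)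
  have e: "indicat_real {0<..<T} s *\<^sub>R f s = (T - s) powr (1 - c) *\<^sub>R ?h s" for s
    by (cases "s \<in> {0<..<T}") (auto simp flip: powr_add)
  show ?thesis unfolding set_integrable_def
  proof (rule Bochner_Integration.integrable_bound)
    show "integrable lborel (\<lambda>s. T powr (1 - c) *\<^sub>R ?h s)" by (intro integrable_scaleR_right h)
    show "(\<lambda>s. indicat_real {0<..<T} s *\<^sub>R f s) \<in> borel_measurable lborel" unfolding e by measurable
    show "AE s in lborel. norm (indicat_real {0<..<T} s *\<^sub>R f s) \<le> norm (T powr (1 - c) *\<^sub>R ?h s)"
    proof (rule AE_I2)
      fix s
      show "norm (indicat_real {0<..<T} s *\<^sub>R f s) \<le> norm (T powr (1 - c) *\<^sub>R ?h s)"
      proof (cases "s \<in> {0<..<T}")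
        case True
        then have "(T - s) powr (1 - c) \<le> T powr (1 - c)" using c by (intro powr_mono2) auto
        then show ?thesis unfolding e norm_scaleR by (intro mult_right_mono) auto
      qed simp
    qed
  qed
qed

lemma AE_interval_ex:
  fixes P :: "real \<Rightarrow> bool"
  assumes "AE t in lborel. P t" "a < b"
  shows "\<exists>t\<in>{a<..<b}. P t"
proof (rule ccontr)
  assume n: "\<not> (\<exists>t\<in>{a<..<b}. P t)"
  obtain N where N: "N \<in> null_sets lborel" "{x. \<not> P x} \<subseteq> N"
    using assms(1) unfolding eventually_ae_filter by auto
  then have "{a<..<b} \<subseteq> N" using n by auto
  then have "emeasure lborel {a<..<b} \<le> emeasure lborel N" using N(1) by (intro emeasure_mono) auto
  then show False using N(1) assms(2) by (auto simp: null_sets_def)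
qed

context evolution_form
begin

lemma dual_derivative_coeff:
  assumes "has_dual_derivative V E (\<lambda>s. inner (G s)) f t" "f \<in> V'"
  shows "((\<lambda>s. G s \<bullet> \<phi> n) has_real_derivative f (\<phi> n)) (at t)"
proof -
  let ?Q = "\<lambda>s \<psi>. (G s \<bullet> \<psi> - G t \<bullet> \<psi>) / (s - t) - f \<psi>"
  have "((\<lambda>s. ?Q s (\<phi> n)) \<longlongrightarrow> 0) (at t)"
  proof (rule Lim_null_comparison)
    show "eventually (\<lambda>s. norm (?Q s (\<phi> n)) \<le> sqrt (w n) * dual_norm V E (?Q s)) (at t)"
      using dual_norm_coeff_le[OF difference_quotient_dual[OF assms(2)]] by (intro always_eventually allI) simp
    show "((\<lambda>s. sqrt (w n) * dual_norm V E (?Q s)) \<longlongrightarrow> 0) (at t)"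
      using tendsto_mult_left[OF assms(1)[unfolded has_dual_derivative_def], of "sqrt (w n)"] by simp
  qed
  then show ?thesis unfolding has_field_derivative_iff by (rule LIM_zero_cancel)
qed

text \<open>
  What a weak solution satisfies in coordinates, with the integrability needed for convolutions: \<open>g\<close> is the
  continuous fractional integral of order \<open>a\<close> of the solution and \<open>F\<close> its derivative in the dual space.
\<close>

definition mode_system :: "real \<Rightarrow> real \<Rightarrow> real \<Rightarrow> (real \<Rightarrow> 'h \<Rightarrow> real) \<Rightarrow> 'h \<Rightarrow> (real \<Rightarrow> 'h) \<Rightarrow> (real \<Rightarrow> 'h) \<Rightarrow> (real \<Rightarrow> 'h \<Rightarrow> real) \<Rightarrow> bool" where
  "mode_system T a b q u0 u g F \<longleftrightarrow>
     continuous_on {0..T} g \<and> (\<forall>t\<in>{0<..T}. g t = frac_int_left a u t) \<and> set_integrable lborel {0<..<T} u \<and>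
     (\<forall>n. set_integrable lborel {0<..<T} (\<lambda>t. F t (\<phi> n))) \<and>
     (\<forall>n t. 0 < t \<longrightarrow> t < T \<longrightarrow> g t \<bullet> \<phi> n = frac_int_left a (\<lambda>t. u t \<bullet> \<phi> n) t) \<and>
     (\<forall>n t. 0 < t \<longrightarrow> t < T \<longrightarrow> g t \<bullet> \<phi> n = u0 \<bullet> \<phi> n + (LINT s:{0<..<t}|lborel. F s (\<phi> n))) \<and>
     (\<forall>n. AE t in lborel. t \<in> {0<..<T} \<longrightarrow> frac_int_left b (\<lambda>\<tau>. F \<tau> (\<phi> n)) t + l n * (u t \<bullet> \<phi> n) = q t (\<phi> n))"

lemma mode_systemD:
  assumes "mode_system T a b q u0 u g F"
  shows "continuous_on {0..T} g" "t \<in> {0<..T} \<Longrightarrow> g t = frac_int_left a u t" "set_integrable lborel {0<..<T} u"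
    "set_integrable lborel {0<..<T} (\<lambda>t. F t (\<phi> n))"
    "0 < t \<Longrightarrow> t < T \<Longrightarrow> g t \<bullet> \<phi> n = frac_int_left a (\<lambda>t. u t \<bullet> \<phi> n) t"
    "0 < t \<Longrightarrow> t < T \<Longrightarrow> g t \<bullet> \<phi> n = u0 \<bullet> \<phi> n + (LINT s:{0<..<t}|lborel. F s (\<phi> n))"
    "AE t in lborel. t \<in> {0<..<T} \<longrightarrow> frac_int_left b (\<lambda>\<tau>. F \<tau> (\<phi> n)) t + l n * (u t \<bullet> \<phi> n) = q t (\<phi> n)"
  using assms unfolding mode_system_def by auto

text \<open>
  The derivative \<open>F\<close> is only known pointwise. For \<open>b > 0\<close> it is integrable because the outer fractional
  integral exists at time \<open>T\<close>; for \<open>b = 0\<close> it equals the Hilfer derivative, whose coordinates are continuous,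
  and the equation itself bounds it. The fundamental theorem of calculus then recovers \<open>g\<close> from \<open>F\<close>.
\<close>

lemma evolution_modes:
  assumes sol: "evolution_solution V E T \<mu> \<nu> q u0 u"
    and ab: "a = (1 - \<nu>) * (1 - \<mu>)" "b = \<nu> * (1 - \<mu>)" "0 \<le> a" "a \<le> 1" "0 \<le> b" "b \<le> 1" and T: "0 < T"
    and q: "\<And>n. set_integrable lborel {0<..<T} (\<lambda>t. q t (\<phi> n))"
  shows "\<exists>g F. mode_system T a b q u0 u g F"
proof -
  obtain g W where V: "\<And>t. t \<in> {0<..T} \<Longrightarrow> u t \<in> V"
    and g: "continuous_on {0..T} g" "g 0 = u0"
      "\<And>t. t \<in> {0<..T} \<Longrightarrow> frac_integrable_left a u t" "\<And>t. t \<in> {0<..T} \<Longrightarrow> g t = frac_int_left a u t"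
    and W: "has_hilfer_derivative_left V E T \<mu> \<nu> u W" "\<And>t. t \<in> {0<..T} \<Longrightarrow> W t \<in> V'"
      "norm_continuous_on (dual_norm V E) {0<..T} W"
      "\<And>\<psi>. \<psi> \<in> V \<Longrightarrow> AE t in lborel. t \<in> {0<..<T} \<longrightarrow> W t \<psi> + E (u t) \<psi> - q t \<psi> = 0"
    using sol unfolding evolution_solution_def ab(1,2)[symmetric] by blast
  obtain F where F: "\<And>t. t \<in> {0<..<T} \<Longrightarrow> F t \<in> V'"
      "\<And>t. t \<in> {0<..<T} \<Longrightarrow> has_dual_derivative V E (\<lambda>s. inner (frac_int_left a u s)) (F t) t"
    and WF: "\<And>t. t \<in> {0<..T} \<Longrightarrow> dual_frac_integrable_left V E b F t"
      "\<And>t \<psi>. t \<in> {0<..T} \<Longrightarrow> \<psi> \<in> V \<Longrightarrow> W t \<psi> = frac_int_left b (\<lambda>\<tau>. F \<tau> \<psi>) t"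
    using W(1) unfolding has_hilfer_derivative_left_def ab(1,2)[symmetric] by blast
  have u_int: "set_integrable lborel {0<..<T} u"
  proof (cases "a = 0")
    case True
    then have "g t = u t" if "t \<in> {0<..<T}" for t using g(4)[of t] that by (simp add: frac_int_left_def)
    then have "set_integrable lborel {0<..<T} g = set_integrable lborel {0<..<T} u" by (intro set_integrable_cong) auto
    moreover have "set_integrable lborel {0..T} g"
      unfolding set_integrable_def by (rule borel_integrable_compact[OF compact_Icc g(1)])
    then have "set_integrable lborel {0<..<T} g" by (rule set_integrable_subset) auto
    ultimately show ?thesis by simp
  next
    case False
    have "frac_integrable_left a u T" using T by (intro g(3)) simp
    then have "set_integrable lborel {0<..<T} (\<lambda>s. (T - s) powr (a - 1) *\<^sub>R u s)"
      using False unfolding frac_integrable_left_def by blast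
    then show ?thesis by (rule set_integrable_unweight[OF ab(4)])
  qed
  have AEq: "AE t in lborel. t \<in> {0<..<T} \<longrightarrow> frac_int_left b (\<lambda>\<tau>. F \<tau> (\<phi> n)) t + l n * (u t \<bullet> \<phi> n) = q t (\<phi> n)" for n
    using W(4)[OF basis_V[of n]]
  proof eventually_elim
    case (elim t)
    show ?case
    proof
      assume t: "t \<in> {0<..<T}"
      then have t': "t \<in> {0<..T}" by simp
      have "E (u t) (\<phi> n) = l n * (u t \<bullet> \<phi> n)"
        unfolding E_sym[OF V[OF t'] basis_V] E_basis[OF V[OF t']] by (simp add: inner_commute)
      then show "frac_int_left b (\<lambda>\<tau>. F \<tau> (\<phi> n)) t + l n * (u t \<bullet> \<phi> n) = q t (\<phi> n)"
        using elim t WF(2)[OF t' basis_V] by simp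
    qed
  qed
  have un_int: "set_integrable lborel {0<..<T} (\<lambda>t. u t \<bullet> \<phi> n)" for n
  proof -
    have "integrable lborel (\<lambda>t. (indicat_real {0<..<T} t *\<^sub>R u t) \<bullet> \<phi> n)"
      using u_int unfolding set_integrable_def by (intro integrable_inner_left) simp
    then show ?thesis by (simp add: set_integrable_def)
  qed
  have F_int: "set_integrable lborel {0<..<T} (\<lambda>t. F t (\<phi> n))" for n
  proof (cases "b = 0")
    case False
    let ?G = "\<lambda>\<tau> \<psi>. (T - \<tau>) powr (b - 1) * F \<tau> \<psi>"
    have di: "dual_integrable V E {0<..<T} ?G"
      using WF(1)[of T] False T by (simp add: dual_frac_integrable_left_def)
    have "set_integrable lborel {0<..<T} (\<lambda>\<tau>. ?G \<tau> (\<phi> n))"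
    proof (rule set_integrable_bound)
      show "set_integrable lborel {0<..<T} (\<lambda>\<tau>. sqrt (w n) * dual_norm V E (?G \<tau>))"
        using di by (simp add: dual_integrable_def)
      show "set_borel_measurable lborel {0<..<T} (\<lambda>\<tau>. ?G \<tau> (\<phi> n))"
        using di basis_V by (simp add: dual_integrable_def)
      show "AE \<tau> in lborel. \<tau> \<in> {0<..<T} \<longrightarrow> norm (?G \<tau> (\<phi> n)) \<le> norm (sqrt (w n) * dual_norm V E (?G \<tau>))"
      proof (intro AE_I2 impI)
        fix \<tau> assume "\<tau> \<in> {0<..<T}"
        from dual_norm_coeff_le[OF dual_space_scale[OF F(1)[OF this], of "(T - \<tau>) powr (b - 1)"], of n]
        show "norm (?G \<tau> (\<phi> n)) \<le> norm (sqrt (w n) * dual_norm V E (?G \<tau>))" unfolding real_norm_def by linarith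
      qed
    qed
    then have "set_integrable lborel {0<..<T} (\<lambda>s. (T - s) powr (b - 1) *\<^sub>R F s (\<phi> n))"
      by (simp only: real_scaleR_def)
    then show ?thesis by (rule set_integrable_unweight[OF ab(6)])
  next
    case True
    have Wc: "continuous_on {0<..T} (\<lambda>t. W t (\<phi> n))"
      unfolding continuous_on_def
    proof
      fix t assume t: "t \<in> {0<..T}"
      show "((\<lambda>t. W t (\<phi> n)) \<longlongrightarrow> W t (\<phi> n)) (at t within {0<..T})"
      proof (rule LIM_zero_cancel, rule Lim_null_comparison)
        have "eventually (\<lambda>s. s \<in> {0<..T}) (at t within {0<..T})" by (simp add: eventually_at_filter)
        then show "eventually (\<lambda>s. norm (W s (\<phi> n) - W t (\<phi> n)) \<le> sqrt (w n) * dual_norm V E (W s - W t)) (at t within {0<..T})"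
        proof eventually_elim
          case (elim s)
          have "W s - W t \<in> V'" using dual_space_diff[OF W(2)[OF elim] W(2)[OF t]] by (simp add: fun_diff_def)
          from dual_norm_coeff_le[OF this, of n] show ?case by simp
        qed
        show "((\<lambda>s. sqrt (w n) * dual_norm V E (W s - W t)) \<longlongrightarrow> 0) (at t within {0<..T})"
          using W(3) t tendsto_mult_left[of "\<lambda>s. dual_norm V E (W s - W t)" 0 _ "sqrt (w n)"]
          unfolding norm_continuous_on_def by simp
      qed
    qed
    have WFn: "W t (\<phi> n) = F t (\<phi> n)" if "t \<in> {0<..<T}" for t
      using WF(2)[of t "\<phi> n"] that True basis_V by (simp add: frac_int_left_def)
    have "set_integrable lborel {0<..<T} (\<lambda>t. W t (\<phi> n))"
    proof (rule set_integrable_bound)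
      show "set_integrable lborel {0<..<T} (\<lambda>t. q t (\<phi> n) - l n * (u t \<bullet> \<phi> n))"
        by (intro set_integral_diff q set_integrable_mult_right un_int)
      have "continuous_on {0<..<T} (\<lambda>t. W t (\<phi> n))" by (rule continuous_on_subset[OF Wc]) auto
      from borel_measurable_continuous_on_indicator[OF _ this]
      show "set_borel_measurable lborel {0<..<T} (\<lambda>t. W t (\<phi> n))" by (simp add: set_borel_measurable_def)
      show "AE t in lborel. t \<in> {0<..<T} \<longrightarrow> norm (W t (\<phi> n)) \<le> norm (q t (\<phi> n) - l n * (u t \<bullet> \<phi> n))"
        using AEq[of n] by eventually_elim (auto simp: WFn True frac_int_left_def)
    qed
    moreover have "set_integrable lborel {0<..<T} (\<lambda>t. W t (\<phi> n)) = set_integrable lborel {0<..<T} (\<lambda>t. F t (\<phi> n))"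
      using WFn by (intro set_integrable_cong) auto
    ultimately show ?thesis by simp
  qed
  have gn: "g t \<bullet> \<phi> n = frac_int_left a (\<lambda>t. u t \<bullet> \<phi> n) t" if t: "0 < t" "t < T" for n t
  proof (cases "a = 0")
    case True
    then show ?thesis using g(4)[of t] t by (simp add: frac_int_left_def)
  next
    case False
    let ?h = "\<lambda>s. indicat_real {0<..<t} s *\<^sub>R (t - s) powr (a - 1) *\<^sub>R u s"
    have "integrable lborel ?h"
      using g(3)[of t] t False by (simp add: frac_integrable_left_def set_integrable_def)
    then have "(LINT s|lborel. ?h s) \<bullet> \<phi> n = (LINT s|lborel. ?h s \<bullet> \<phi> n)"
      by (intro integral_inner_left[symmetric])
    then show ?thesis using g(4)[of t] t False by (simp add: frac_int_left_def set_lebesgue_integral_def mult.assoc)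
  qed
  have gF: "g t \<bullet> \<phi> n = u0 \<bullet> \<phi> n + (LINT s:{0<..<t}|lborel. F s (\<phi> n))" if t: "0 < t" "t < T" for n t
  proof -
    have "((\<lambda>s. F s (\<phi> n)) has_integral (g t \<bullet> \<phi> n - g 0 \<bullet> \<phi> n)) {0..t}"
    proof (rule fundamental_theorem_of_calculus_interior)
      show "continuous_on {0..t} (\<lambda>s. g s \<bullet> \<phi> n)"
        by (intro continuous_intros continuous_on_subset[OF g(1)]) (use t in auto)
      fix s assume s: "s \<in> {0<..<t}"
      then have sT: "s \<in> {0<..<T}" using t by auto
      have "((\<lambda>s. frac_int_left a u s \<bullet> \<phi> n) has_real_derivative F s (\<phi> n)) (at s)"
        by (rule dual_derivative_coeff[OF F(2)[OF sT] F(1)[OF sT]])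
      then have "((\<lambda>s. g s \<bullet> \<phi> n) has_real_derivative F s (\<phi> n)) (at s)"
        by (rule has_field_derivative_transform_within_open[where S = "{0<..<T}"]) (use sT g(4) in auto)
      then show "((\<lambda>s. g s \<bullet> \<phi> n) has_vector_derivative F s (\<phi> n)) (at s)"
        by (simp add: has_real_derivative_iff_has_vector_derivative)
    qed (use t in simp)
    then have 1: "((\<lambda>s. F s (\<phi> n)) has_integral (g t \<bullet> \<phi> n - g 0 \<bullet> \<phi> n)) {0<..<t}"
      by (rule has_integral_Icc_iff_Ioo[THEN iffD1])
    have "set_integrable lborel {0<..<t} (\<lambda>s. F s (\<phi> n))"
      by (rule set_integrable_subset[OF F_int]) (use t in auto)
    from set_borel_integral_eq_integral(2)[OF this] integral_unique[OF 1]
    show ?thesis using g(2) by simp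
  qed
  show ?thesis unfolding mode_system_def
    using g(1) g(4) u_int F_int gn gF AEq by (intro exI[of _ g] exI[of _ F] conjI allI impI ballI) auto
qed

text \<open>
  By Parseval the scalar convolutions \<open>q s (\<phi> n) * (y (t - s) \<bullet> \<phi> n)\<close> sum to \<open>z s \<bullet> y (t - s) = 0\<close>. Cauchy-Schwarz
  bounds the partial sums by \<open>N s * norm (y (t - s))\<close>, which is integrable in \<open>s\<close> for almost every \<open>t\<close>, so
  that sum and integral can be interchanged. The resulting orthogonality for almost every \<open>t\<close> extends to
  \<open>t = T\<close> by continuity of the fractional integral of \<open>u\<close>.
\<close>

theorem evolution_duality:
  assumes u: "evolution_solution V E T \<mu> \<nu> q 0 u" and y: "evolution_solution V E T \<mu> (1 - \<nu>) (\<lambda>_ _. 0) v0 y"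
    and par: "0 \<le> \<nu>" "\<nu> \<le> 1" "0 < \<mu>" "\<mu> \<le> 1" and T: "0 < T" and v0: "v0 \<in> H"
    and q: "\<And>n. set_integrable lborel {0<..<T} (\<lambda>t. q t (\<phi> n))"
    and N: "set_integrable lborel {0<..<T} N"
    and z: "AE t in lborel. t \<in> {0<..<T} \<longrightarrow> z t \<in> H \<and> (\<forall>n. q t (\<phi> n) = z t \<bullet> \<phi> n) \<and> norm (z t) \<le> N t \<and>
        (\<forall>s\<in>{0<..<T}. z t \<bullet> y s = 0)"
  shows "frac_int_left ((1 - \<nu>) * (1 - \<mu>)) u T \<bullet> v0 = 0"
proof -
  define a where "a = (1 - \<nu>) * (1 - \<mu>)"
  define b where "b = \<nu> * (1 - \<mu>)"
  have ab: "0 \<le> a" "a \<le> 1" "0 \<le> b" "b \<le> 1"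
    using par by (auto simp: a_def b_def intro!: mult_le_one)
  have ab': "b = (1 - (1 - \<nu>)) * (1 - \<mu>)" by (simp add: b_def)
  obtain g F where 1: "mode_system T a b q 0 u g F"
    using evolution_modes[OF u a_def b_def ab T q] by blast
  note g = mode_systemD(1,2)[OF 1] and ui = mode_systemD(3)[OF 1] and Fi = mode_systemD(4)[OF 1]
    and gn = mode_systemD(5,6)[OF 1] and Fe = mode_systemD(7)[OF 1]
  have zq: "set_integrable lborel {0<..<T} (\<lambda>t. 0)" by (simp add: set_integrable_def)
  obtain k G where 2: "mode_system T b a (\<lambda>_ _. 0) v0 y k G"
    using evolution_modes[OF y ab' a_def ab(3,4,1,2) T zq] by blast
  note yi = mode_systemD(3)[OF 2] and Gi = mode_systemD(4)[OF 2] and kn = mode_systemD(5,6)[OF 2] and Ge = mode_systemD(7)[OF 2]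
  have yV: "y t \<in> V" if "t \<in> {0<..T}" for t using y that unfolding evolution_solution_def by blast
  have inner_int: "set_integrable lborel {0<..<T} (\<lambda>t. h t \<bullet> \<phi> n)" if "set_integrable lborel {0<..<T} h" for h and n
  proof -
    have "integrable lborel (\<lambda>t. (indicat_real {0<..<T} t *\<^sub>R h t) \<bullet> \<phi> n)"
      using that unfolding set_integrable_def by (intro integrable_inner_left) simp
    then show ?thesis by (simp add: set_integrable_def)
  qed
  have dual: "AE t in lborel. t \<in> {0<..<T} \<longrightarrow>
      (g t \<bullet> \<phi> n) * (v0 \<bullet> \<phi> n) = (LINT s:{0<..<t}|lborel. q s (\<phi> n) * (y (t - s) \<bullet> \<phi> n))" for n
  proof (rule fractional_duality[where a = a and b = b and T = T and u = "\<lambda>t. u t \<bullet> \<phi> n" and F = "\<lambda>t. F t (\<phi> n)"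
        and f = "\<lambda>t. q t (\<phi> n)" and y = "\<lambda>t. y t \<bullet> \<phi> n" and G = "\<lambda>t. G t (\<phi> n)" and l = "l n"
        and U = "\<lambda>t. g t \<bullet> \<phi> n" and W = "\<lambda>t. k t \<bullet> \<phi> n" and ?w0.0 = "v0 \<bullet> \<phi> n"])
    show "0 \<le> a" "0 \<le> b" by (rule ab)+
    show "set_integrable lborel {0<..<T} (\<lambda>t. u t \<bullet> \<phi> n)" "set_integrable lborel {0<..<T} (\<lambda>t. y t \<bullet> \<phi> n)"
      by (rule inner_int[OF ui], rule inner_int[OF yi])
    show "set_integrable lborel {0<..<T} (\<lambda>t. F t (\<phi> n))" by (rule Fi)
    show "set_integrable lborel {0<..<T} (\<lambda>t. G t (\<phi> n))" by (rule Gi)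
    show "set_integrable lborel {0<..<T} (\<lambda>t. q t (\<phi> n))" by (rule q)
    show "AE t in lborel. t \<in> {0<..<T} \<longrightarrow> frac_int_left b (\<lambda>t. F t (\<phi> n)) t + l n * (u t \<bullet> \<phi> n) = q t (\<phi> n)" by (rule Fe)
    show "AE t in lborel. t \<in> {0<..<T} \<longrightarrow> frac_int_left a (\<lambda>t. G t (\<phi> n)) t + l n * (y t \<bullet> \<phi> n) = 0" by (rule Ge)
    fix t assume t: "0 < t" "t < T"
    have "g t \<bullet> \<phi> n = (LINT s:{0<..<t}|lborel. F s (\<phi> n))"
      unfolding gn(2)[OF t, of n] by simp
    then show "g t \<bullet> \<phi> n = frac_int_left a (\<lambda>t. u t \<bullet> \<phi> n) t \<and> g t \<bullet> \<phi> n = (LINT s:{0<..<t}|lborel. F s (\<phi> n))"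
      using gn(1)[OF t, of n] by (rule conjI[rotated])
    show "k t \<bullet> \<phi> n = frac_int_left b (\<lambda>t. y t \<bullet> \<phi> n) t \<and> k t \<bullet> \<phi> n = v0 \<bullet> \<phi> n + (LINT s:{0<..<t}|lborel. G s (\<phi> n))"
      by (rule conjI[OF kn(1)[OF t] kn(2)[OF t]])
  qed
  have cN: "integrable lborel (cutoff T N)" using N by (simp add: cutoff_integrable)
  have cy: "integrable lborel (cutoff T (\<lambda>t. norm (y t)))"
    unfolding cutoff_integrable using set_integrable_norm[OF yi] by simp
  have dual_all: "AE t in lborel. \<forall>n. t \<in> {0<..<T} \<longrightarrow>
      (g t \<bullet> \<phi> n) * (v0 \<bullet> \<phi> n) = (LINT s:{0<..<t}|lborel. q s (\<phi> n) * (y (t - s) \<bullet> \<phi> n))"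
    unfolding AE_all_countable by (rule allI) (rule dual)
  have zero: "AE t in lborel. t \<in> {0<..<T} \<longrightarrow> g t \<bullet> v0 = 0"
    using AE_conv_integrable[OF cN cy] dual_all
  proof eventually_elim
    case (elim t)
    show ?case
    proof
      assume t: "t \<in> {0<..<T}"
      have tT: "t < T" "t \<in> {0<..T}" using t by auto
      let ?q = "\<lambda>n. cutoff T (\<lambda>s. q s (\<phi> n))" and ?y = "\<lambda>n. cutoff T (\<lambda>s. y s \<bullet> \<phi> n)"
      have mq [measurable]: "?q n \<in> borel_measurable borel" "?y n \<in> borel_measurable borel" for n
        using q[of n] inner_int[OF yi, of n] unfolding cutoff_integrable[symmetric] by (auto dest: borel_measurable_integrable)
      have bound: "norm (\<Sum>n<j. ?q n s * ?y n (t - s)) \<le> cutoff T N s * cutoff T (\<lambda>t. norm (y t)) (t - s)"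
        and lim: "(\<lambda>j. \<Sum>n<j. ?q n s * ?y n (t - s)) \<longlonglongrightarrow> 0"
        if zs: "s \<in> {0<..<T} \<longrightarrow> z s \<in> H \<and> (\<forall>n. q s (\<phi> n) = z s \<bullet> \<phi> n) \<and> norm (z s) \<le> N s \<and> (\<forall>r\<in>{0<..<T}. z s \<bullet> y r = 0)" for s j
      proof -
        have "norm (\<Sum>n<j. ?q n s * ?y n (t - s)) \<le> cutoff T N s * cutoff T (\<lambda>t. norm (y t)) (t - s) \<and>
          (\<lambda>j. \<Sum>n<j. ?q n s * ?y n (t - s)) \<longlonglongrightarrow> 0"
        proof (cases "s \<in> {0<..<T} \<and> t - s \<in> {0<..<T}")
          case True
          then have zH: "z s \<in> H" and zn: "\<And>n. q s (\<phi> n) = z s \<bullet> \<phi> n" and zN: "norm (z s) \<le> N s" and z0: "z s \<bullet> y (t - s) = 0"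
            using zs by auto
          have yH: "y (t - s) \<in> H" using yV[of "t - s"] True V_H by auto
          have e: "?q n s * ?y n (t - s) = (z s \<bullet> \<phi> n) * (y (t - s) \<bullet> \<phi> n)" for n
            using True by (simp add: cutoff_def zn)
          have sq: "summable (\<lambda>n. (x \<bullet> \<phi> n)\<^sup>2)" "sqrt (\<Sum>n. (x \<bullet> \<phi> n)\<^sup>2) = norm x" if "x \<in> H" for x
            using parseval_norm[OF that] by (auto simp: sums_iff)
          note cs = Cauchy_Schwarz_suminf[OF sq(1)[OF zH] sq(1)[OF yH]]
          have "norm (\<Sum>n<j. ?q n s * ?y n (t - s)) \<le> (\<Sum>n<j. \<bar>(z s \<bullet> \<phi> n) * (y (t - s) \<bullet> \<phi> n)\<bar>)"
            unfolding e real_norm_def by (rule sum_abs)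
          also have "\<dots> \<le> (\<Sum>n. \<bar>(z s \<bullet> \<phi> n) * (y (t - s) \<bullet> \<phi> n)\<bar>)"
            by (intro sum_le_suminf cs) auto
          also have "\<dots> \<le> norm (z s) * norm (y (t - s))" using cs(2) sq(2)[OF zH] sq(2)[OF yH] by simp
          also have "\<dots> \<le> N s * norm (y (t - s))" using zN by (intro mult_right_mono) auto
          finally have "norm (\<Sum>n<j. ?q n s * ?y n (t - s)) \<le> cutoff T N s * cutoff T (\<lambda>t. norm (y t)) (t - s)"
            using True by (simp add: cutoff_def)
          moreover have "(\<lambda>j. \<Sum>n<j. ?q n s * ?y n (t - s)) \<longlonglongrightarrow> 0"
            using parseval[OF zH, of "y (t - s)"] unfolding e sums_def z0 .
          ultimately show ?thesis by simp
        next
          case False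
          then have z: "cutoff T h s * cutoff T h' (t - s) = 0" for h h' by (auto simp: cutoff_def)
          show ?thesis unfolding z by simp
        qed
        then show "norm (\<Sum>n<j. ?q n s * ?y n (t - s)) \<le> cutoff T N s * cutoff T (\<lambda>t. norm (y t)) (t - s)"
          "(\<lambda>j. \<Sum>n<j. ?q n s * ?y n (t - s)) \<longlonglongrightarrow> 0" by auto
      qed
      have qy: "integrable lborel (\<lambda>s. \<Sum>n<j. ?q n s * ?y n (t - s))" for j
        using elim(1)
      proof (rule Bochner_Integration.integrable_bound)
        show "AE s in lborel. norm (\<Sum>n<j. ?q n s * ?y n (t - s)) \<le> norm (cutoff T N s * cutoff T (\<lambda>t. norm (y t)) (t - s))"
          using z
        proof eventually_elim
          case (elim s)
          from bound[OF elim, of j] show ?case unfolding real_norm_def by linarith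
        qed
      qed measurable
      have qy1: "integrable lborel (\<lambda>s. ?q n s * ?y n (t - s))" for n
        using Bochner_Integration.integrable_diff[OF qy[of "Suc n"] qy[of n]] by simp
      have "(\<lambda>j. LINT s|lborel. (\<Sum>n<j. ?q n s * ?y n (t - s))) \<longlonglongrightarrow> (LINT s|(lborel :: real measure). 0)"
      proof (rule integral_dominated_convergence[OF _ _ elim(1)])
        show "AE s in lborel. (\<lambda>j. \<Sum>n<j. ?q n s * ?y n (t - s)) \<longlonglongrightarrow> 0"
          using z by (rule eventually_mono) (rule lim)
        show "AE s in lborel. norm (\<Sum>n<j. ?q n s * ?y n (t - s)) \<le> cutoff T N s * cutoff T (\<lambda>t. norm (y t)) (t - s)" for j
          using z by (rule eventually_mono) (rule bound)
      qed measurable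
      moreover have "(LINT s|lborel. (\<Sum>n<j. ?q n s * ?y n (t - s))) = (\<Sum>n<j. (g t \<bullet> \<phi> n) * (v0 \<bullet> \<phi> n))" for j
      proof -
        have "(LINT s|lborel. (\<Sum>n<j. ?q n s * ?y n (t - s))) = (\<Sum>n<j. conv (?q n) (?y n) t)"
          unfolding conv_def by (rule Bochner_Integration.integral_sum) (rule qy1)
        also have "\<dots> = (\<Sum>n<j. (g t \<bullet> \<phi> n) * (v0 \<bullet> \<phi> n))"
          using elim(2) t by (intro sum.cong) (auto simp: conv_cutoff[OF tT(1)])
        finally show ?thesis .
      qed
      ultimately have "(\<lambda>j. \<Sum>n<j. (g t \<bullet> \<phi> n) * (v0 \<bullet> \<phi> n)) \<longlonglongrightarrow> 0" by simp
      moreover have "(\<lambda>j. \<Sum>n<j. (g t \<bullet> \<phi> n) * (v0 \<bullet> \<phi> n)) \<longlonglongrightarrow> v0 \<bullet> g t"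
        using parseval[OF v0, of "g t"] by (simp add: sums_def mult.commute)
      ultimately show "g t \<bullet> v0 = 0" using LIMSEQ_unique[of _ 0 "v0 \<bullet> g t"] by (simp add: inner_commute)
    qed
  qed
  have "g T \<bullet> v0 = 0"
  proof (rule ccontr)
    assume "g T \<bullet> v0 \<noteq> 0"
    have "continuous_on {0..T} (\<lambda>t. g t \<bullet> v0)" by (intro continuous_intros g)
    then have "((\<lambda>t. g t \<bullet> v0) \<longlongrightarrow> g T \<bullet> v0) (at T within {0..T})" using T by (simp add: continuous_on_def)
    from tendsto_imp_eventually_ne[OF this \<open>g T \<bullet> v0 \<noteq> 0\<close>]
    obtain d where d: "0 < d" "\<And>t. t \<in> {0..T} \<Longrightarrow> t \<noteq> T \<Longrightarrow> dist t T < d \<Longrightarrow> g t \<bullet> v0 \<noteq> 0"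
      unfolding eventually_at by auto
    obtain t where t: "t \<in> {max 0 (T - d)<..<T}" "t \<in> {0<..<T} \<longrightarrow> g t \<bullet> v0 = 0"
      using AE_interval_ex[OF zero, of "max 0 (T - d)" T] T d(1) by auto
    then show False using d(2)[of t] by (auto simp: dist_real_def)
  qed
  then show ?thesis using g(2)[of T] T by (simp add: a_def)
qed

end


section \<open>Moments, and square-integrable functions of space and time\<close>

text \<open>
  By Weierstrass approximation the integral against every continuous function vanishes; a bump with the
  sign of \<open>k r0\<close> supported near \<open>r0\<close> gives a contradiction if \<open>k r0 \<noteq> 0\<close>.
\<close>

lemma moments_zero_imp_zero:
  fixes k :: "real \<Rightarrow> real"
  assumes int: "set_integrable lborel {0<..<T} k" and cont: "continuous_on {0<..<T} k"
    and mom: "\<And>j::nat. (LINT r:{0<..<T}|lborel. r ^ j * k r) = 0" and r0: "r0 \<in> {0<..<T}"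
  shows "k r0 = 0"
proof (rule ccontr)
  assume k0: "k r0 \<noteq> 0"
  have ki: "integrable lborel (\<lambda>r. indicat_real {0<..<T} r * k r)" using int by (simp add: set_integrable_def)
  then have km [measurable]: "(\<lambda>r. indicat_real {0<..<T} r * k r) \<in> borel_measurable borel"
    by (auto dest: borel_measurable_integrable)
  have mult_int: "integrable lborel (\<lambda>r. c r * (indicat_real {0<..<T} r * k r))"
    if c: "continuous_on {0..T} c" for c :: "real \<Rightarrow> real"
  proof -
    obtain B where "\<forall>x\<in>c ` {0..T}. norm x \<le> B"
      using compact_imp_bounded[OF compact_continuous_image[OF c compact_Icc]] unfolding bounded_iff by blast
    then have B: "\<bar>c r\<bar> \<le> B" if "r \<in> {0..T}" for r using that by auto
    have cm [measurable]: "(\<lambda>r. indicat_real {0..T} r * c r) \<in> borel_measurable borel"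
      using borel_measurable_continuous_on_indicator[OF _ c] by simp
    have e: "c r * (indicat_real {0<..<T} r * k r) = (indicat_real {0..T} r * c r) * (indicat_real {0<..<T} r * k r)" for r
      by (auto simp: indicator_def)
    show ?thesis
    proof (rule Bochner_Integration.integrable_bound)
      show "integrable lborel (\<lambda>r. B * (indicat_real {0<..<T} r * k r))" using ki by simp
      show "(\<lambda>r. c r * (indicat_real {0<..<T} r * k r)) \<in> borel_measurable lborel" unfolding e by measurable
      show "AE r in lborel. norm (c r * (indicat_real {0<..<T} r * k r)) \<le> norm (B * (indicat_real {0<..<T} r * k r))"
      proof (rule AE_I2)
        fix r
        show "norm (c r * (indicat_real {0<..<T} r * k r)) \<le> norm (B * (indicat_real {0<..<T} r * k r))"
          using B[of r] by (cases "r \<in> {0<..<T}") (auto simp: abs_mult intro!: mult_right_mono)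
      qed
    qed
  qed
  have poly0: "(LINT r|lborel. p r * (indicat_real {0<..<T} r * k r)) = 0" if "real_polynomial_function p" for p
  proof -
    from that[unfolded real_polynomial_function_iff_sum]
    obtain a n where p: "p = (\<lambda>x. \<Sum>i\<le>n. a i * x ^ i)" by (elim exE)
    have i: "integrable lborel (\<lambda>r. r ^ j * (indicat_real {0<..<T} r * k r))" for j :: nat
      by (intro mult_int continuous_intros)
    have "(LINT r|lborel. p r * (indicat_real {0<..<T} r * k r)) = (LINT r|lborel. (\<Sum>i\<le>n. a i * (r ^ i * (indicat_real {0<..<T} r * k r))))"
      by (simp add: p sum_distrib_right mult.assoc)
    also have "\<dots> = (\<Sum>i\<le>n. a i * (LINT r|lborel. r ^ i * (indicat_real {0<..<T} r * k r)))"
      using i by (subst Bochner_Integration.integral_sum) auto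
    also have "\<dots> = 0"
    proof (rule sum.neutral, rule ballI)
      fix i
      have "(LINT r|lborel. r ^ i * (indicat_real {0<..<T} r * k r)) = (LINT r:{0<..<T}|lborel. r ^ i * k r)"
        unfolding set_lebesgue_integral_def by (simp add: mult.left_commute)
      then show "a i * (LINT r|lborel. r ^ i * (indicat_real {0<..<T} r * k r)) = 0" using mom[of i] by simp
    qed
    finally show ?thesis .
  qed
  have cont0: "(LINT r|lborel. c r * (indicat_real {0<..<T} r * k r)) = 0" if c: "continuous_on {0..T} c" for c :: "real \<Rightarrow> real"
  proof -
    define L where "L = (LINT r|lborel. \<bar>indicat_real {0<..<T} r * k r\<bar>)"
    have L: "0 \<le> L" unfolding L_def by (intro Bochner_Integration.integral_nonneg) auto
    have le: "\<bar>LINT r|lborel. c r * (indicat_real {0<..<T} r * k r)\<bar> \<le> e * L" if e: "0 < e" for e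
    proof -
      obtain p where p: "real_polynomial_function p" "\<And>x. x \<in> {0..T} \<Longrightarrow> \<bar>c x - p x\<bar> < e"
        using Stone_Weierstrass_real_polynomial_function[OF compact_Icc c e] by blast
      have pc: "continuous_on {0..T} p" using continuous_on_polymonial_function[of p] p(1)
        by (simp add: real_polynomial_function_eq)
      have "(LINT r|lborel. c r * (indicat_real {0<..<T} r * k r)) = (LINT r|lborel. (c r - p r) * (indicat_real {0<..<T} r * k r))"
        using poly0[OF p(1)] mult_int[OF c] mult_int[OF pc] by (simp add: left_diff_distrib)
      also have "\<bar>\<dots>\<bar> \<le> (LINT r|lborel. \<bar>(c r - p r) * (indicat_real {0<..<T} r * k r)\<bar>)"
        by (rule integral_abs_bound)
      also have "\<dots> \<le> (LINT r|lborel. e * \<bar>indicat_real {0<..<T} r * k r\<bar>)"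
      proof (rule integral_mono)
        show "integrable lborel (\<lambda>r. \<bar>(c r - p r) * (indicat_real {0<..<T} r * k r)\<bar>)"
          using mult_int[OF continuous_on_diff[OF c pc]] by simp
        show "integrable lborel (\<lambda>r. e * \<bar>indicat_real {0<..<T} r * k r\<bar>)" using ki by simp
        fix r
        show "\<bar>(c r - p r) * (indicat_real {0<..<T} r * k r)\<bar> \<le> e * \<bar>indicat_real {0<..<T} r * k r\<bar>"
          using p(2)[of r] by (cases "r \<in> {0<..<T}") (auto simp: abs_mult intro!: mult_right_mono)
      qed
      also have "\<dots> = e * L" by (simp add: L_def)
      finally show ?thesis .
    qed
    show ?thesis
    proof (rule ccontr)
      assume ne: "(LINT r|lborel. c r * (indicat_real {0<..<T} r * k r)) \<noteq> 0"
      let ?I = "\<bar>LINT r|lborel. c r * (indicat_real {0<..<T} r * k r)\<bar>"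
      have "?I \<le> ?I / (2 * (L + 1)) * L" by (rule le) (use ne L in auto)
      also have "\<dots> \<le> ?I / (2 * (L + 1)) * (L + 1)" using L by (intro mult_left_mono) auto
      also have "\<dots> = ?I / 2" using L by (simp add: field_simps)
      finally show False using ne by simp
    qed
  qed
  have "isCont k r0" using cont r0 by (simp add: continuous_on_eq_continuous_at)
  then have lim: "(k \<longlongrightarrow> k r0) (at r0)" by (simp add: isCont_def)
  have "((\<lambda>r. k r * k r0) \<longlongrightarrow> k r0 * k r0) (at r0)" by (intro tendsto_intros lim)
  moreover have "0 < k r0 * k r0" using k0 not_real_square_gt_zero[of "k r0"] by blast
  ultimately have "eventually (\<lambda>r. 0 < k r * k r0) (at r0)" by (rule order_tendstoD(1))
  then obtain d where d: "0 < d" "\<And>r. r \<noteq> r0 \<Longrightarrow> dist r r0 < d \<Longrightarrow> 0 < k r * k r0"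
    unfolding eventually_at by auto
  then have d': "0 < k r * k r0" if "\<bar>r - r0\<bar> < d" for r
    using that \<open>0 < k r0 * k r0\<close> by (cases "r = r0") (auto simp: dist_real_def)
  \<comment> \<open>a tent around \<open>r0\<close>, inside the neighbourhood where \<open>k\<close> keeps its sign\<close>
  define c where "c r = max 0 (d - \<bar>r - r0\<bar>) * k r0" for r
  have cc: "continuous_on {0..T} c" unfolding c_def by (intro continuous_intros)
  have nn: "0 \<le> c r * (indicat_real {0<..<T} r * k r)" for r
  proof (cases "\<bar>r - r0\<bar> < d")
    case True
    have "c r * (indicat_real {0<..<T} r * k r) = (max 0 (d - \<bar>r - r0\<bar>) * indicat_real {0<..<T} r) * (k r * k r0)"
      by (simp add: c_def)
    moreover have "0 \<le> (max 0 (d - \<bar>r - r0\<bar>) * indicat_real {0<..<T} r) * (k r * k r0)"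
      by (rule mult_nonneg_nonneg) (simp, rule less_imp_le[OF d'[OF True]])
    ultimately show ?thesis by (simp only:)
  qed (simp add: c_def)
  have "AE r in lborel. c r * (indicat_real {0<..<T} r * k r) = 0"
    using integral_nonneg_eq_0_iff_AE[OF mult_int[OF cc] AE_I2[OF nn]] cont0[OF cc] by simp
  from AE_interval_ex[OF this, of "max 0 (r0 - d)" r0] r0 d(1)
  obtain r where r: "r \<in> {max 0 (r0 - d)<..<r0}" "c r * (indicat_real {0<..<T} r * k r) = 0" by auto
  have rr: "\<bar>r - r0\<bar> < d" "r \<in> {0<..<T}" using r(1) r0 by auto
  then show False using r(2) d'[OF rr(1)] by (auto simp: c_def max_def split: if_splits)
qed

lemma inner_L2_eq: "f \<bullet> g = (LINT x|lborel. rep_L2 f x * rep_L2 g x)"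
proof -
  have "abs_L2 (rep_L2 f) \<bullet> abs_L2 (rep_L2 g) = (LINT x|lborel. rep_L2 f x * rep_L2 g x)"
    by (rule inner_L2.abs_eq) auto
  then show ?thesis by simp
qed

lemma inner_abs_L2: "square_integrable f \<Longrightarrow> abs_L2 f \<bullet> g = (LINT x|lborel. f x * rep_L2 g x)"
proof -
  assume f: "square_integrable f"
  have "abs_L2 f \<bullet> abs_L2 (rep_L2 g) = (LINT x|lborel. f x * rep_L2 g x)"
    by (rule inner_L2.abs_eq) (use f in auto)
  then show ?thesis by simp
qed

lemma rep_add_AE: "AE x in lborel. rep_L2 (f + g) x = rep_L2 f x + rep_L2 g x"
proof -
  have "f + g = abs_L2 (\<lambda>x. rep_L2 f x + rep_L2 g x)"
    using abs_L2_add[of "rep_L2 f" "rep_L2 g"] by simp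
  then show ?thesis using rep_abs_L2[OF square_integrable_add[of "rep_L2 f" "rep_L2 g"]] by simp
qed

lemma rep_scaleR_AE: "AE x in lborel. rep_L2 (c *\<^sub>R f) x = c * rep_L2 f x"
proof -
  have "c *\<^sub>R f = abs_L2 (\<lambda>x. c * rep_L2 f x)"
    using abs_L2_scaleR[of "rep_L2 f" c] by simp
  then show ?thesis using rep_abs_L2[OF square_integrable_cmult[of "rep_L2 f" c]] by simp
qed

lemma rep_zero_AE: "AE x in lborel. rep_L2 0 x = 0"
  using rep_scaleR_AE[of 0 0] by simp

lemma subspace_L2_on: "subspace (L2_on S)"
  unfolding subspace_def L2_on_def mem_Collect_eq
proof (intro conjI ballI allI)
  show "AE x in lborel. x \<notin> S \<longrightarrow> rep_L2 0 x = 0" using rep_zero_AE by eventually_elim simp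
next
  fix f g :: "'a L2"
  assume "f \<in> {f. AE x in lborel. x \<notin> S \<longrightarrow> rep_L2 f x = 0}" "g \<in> {f. AE x in lborel. x \<notin> S \<longrightarrow> rep_L2 f x = 0}"
  then have fg: "AE x in lborel. x \<notin> S \<longrightarrow> rep_L2 f x = 0" "AE x in lborel. x \<notin> S \<longrightarrow> rep_L2 g x = 0" by auto
  show "AE x in lborel. x \<notin> S \<longrightarrow> rep_L2 (f + g) x = 0"
    using rep_add_AE[of f g] fg by eventually_elim simp
next
  fix c and f :: "'a L2"
  assume "f \<in> {f. AE x in lborel. x \<notin> S \<longrightarrow> rep_L2 f x = 0}"
  then have f: "AE x in lborel. x \<notin> S \<longrightarrow> rep_L2 f x = 0" by auto
  show "AE x in lborel. x \<notin> S \<longrightarrow> rep_L2 (c *\<^sub>R f) x = 0"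
    using rep_scaleR_AE[of c f] f by eventually_elim simp
qed

lemma square_integrable_indicator_mult:
  assumes "S \<in> sets borel"
  shows "square_integrable (\<lambda>x. indicat_real S x * rep_L2 f x)"
  unfolding square_integrable_def
proof
  have [measurable]: "S \<in> sets borel" by fact
  show "(\<lambda>x. indicat_real S x * rep_L2 f x) \<in> borel_measurable lborel" by measurable
  show "integrable lborel (\<lambda>x. (indicat_real S x * rep_L2 f x)\<^sup>2)"
  proof (rule Bochner_Integration.integrable_bound)
    show "integrable lborel (\<lambda>x. (rep_L2 f x)\<^sup>2)" using square_integrable_rep[of f] by (simp add: square_integrable_def)
    show "AE x in lborel. norm ((indicat_real S x * rep_L2 f x)\<^sup>2) \<le> norm ((rep_L2 f x)\<^sup>2)"
      by (auto simp: indicator_def)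
  qed measurable
qed

lemma indicator_inner_zero_AE:
  assumes S: "S \<in> sets borel" and z: "abs_L2 (\<lambda>x. indicat_real S x * rep_L2 f x) \<bullet> f = 0"
  shows "AE x in lborel. x \<in> S \<longrightarrow> rep_L2 f x = 0"
proof -
  note si = square_integrable_indicator_mult[OF S, of f]
  have i: "integrable lborel (\<lambda>x. indicat_real S x * rep_L2 f x * rep_L2 f x)"
    by (rule square_integrable_mult[OF si square_integrable_rep])
  have "(LINT x|lborel. indicat_real S x * rep_L2 f x * rep_L2 f x) = 0"
    using z inner_abs_L2[OF si, of f] by simp
  moreover have "AE x in lborel. 0 \<le> indicat_real S x * rep_L2 f x * rep_L2 f x"
    by (auto simp: indicator_def)
  ultimately have "AE x in lborel. indicat_real S x * rep_L2 f x * rep_L2 f x = 0"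
    using integral_nonneg_eq_0_iff_AE[OF i] by simp
  then show ?thesis by eventually_elim (auto simp: indicator_def split: if_splits)
qed

lemma abs_L2_on:
  assumes "square_integrable f" "AE x in lborel. x \<notin> S \<longrightarrow> f x = 0"
  shows "abs_L2 f \<in> L2_on S"
  unfolding L2_on_def mem_Collect_eq using rep_abs_L2[OF assms(1)] assms(2) by eventually_elim simp

lemma L2_on_inner_zero:
  assumes "f \<in> L2_on S" "AE x in lborel. x \<in> S \<longrightarrow> rep_L2 g x = 0"
  shows "f \<bullet> g = 0"
proof -
  have "AE x in lborel. rep_L2 f x * rep_L2 g x = 0"
    using assms(1)[unfolded L2_on_def mem_Collect_eq] assms(2) by eventually_elim auto
  then show ?thesis unfolding inner_L2_eq using integral_cong_AE[of "\<lambda>x. rep_L2 f x * rep_L2 g x" lborel "\<lambda>x. 0"] by simp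
qed

text \<open>
  Membership in \<open>L2_on S\<close> is orthogonality to the part of the function outside \<open>S\<close>, which is a closed
  condition.
\<close>

lemma closed_L2_on:
  assumes S: "S \<in> sets borel"
  shows "closed (L2_on S)"
  unfolding closed_sequential_limits
proof (intro allI impI)
  fix X :: "nat \<Rightarrow> 'a L2" and f
  assume X: "(\<forall>n. X n \<in> L2_on S) \<and> X \<longlonglongrightarrow> f"
  have S': "- S \<in> sets borel" using S by auto
  let ?h = "abs_L2 (\<lambda>x. indicat_real (- S) x * rep_L2 f x)"
  have h: "AE x in lborel. x \<in> S \<longrightarrow> rep_L2 ?h x = 0"
    using rep_abs_L2[OF square_integrable_indicator_mult[OF S', of f]] by eventually_elim simp
  have "X n \<bullet> ?h = 0" for n using X h by (intro L2_on_inner_zero[of _ S]) auto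
  moreover have "(\<lambda>n. X n \<bullet> ?h) \<longlonglongrightarrow> f \<bullet> ?h" using X by (intro tendsto_intros) auto
  ultimately have "f \<bullet> ?h = 0" by (simp add: LIMSEQ_const_iff)
  then have "AE x in lborel. x \<in> - S \<longrightarrow> rep_L2 f x = 0"
    by (intro indicator_inner_zero_AE[OF S']) (simp add: inner_commute)
  then show "f \<in> L2_on S" by (simp add: L2_on_def)
qed

lemma L2_on_mono: "S \<subseteq> S' \<Longrightarrow> L2_on S \<subseteq> L2_on S'"
  unfolding L2_on_def by (auto elim: eventually_mono)

lemma AE_slices:
  fixes P :: "'a::euclidean_space \<Rightarrow> real \<Rightarrow> bool"
  assumes "AE z in lborel. P (fst z) (snd z)"
  shows "AE t in lborel. AE x in lborel. P x t"
proof -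
  obtain N where N: "N \<in> null_sets (lborel :: ('a \<times> real) measure)" "{z. \<not> P (fst z) (snd z)} \<subseteq> N"
    using assms unfolding eventually_ae_filter by auto
  have Ns [measurable]: "N \<in> sets (lborel \<Otimes>\<^sub>M lborel)" using N(1) unfolding lborel_prod by auto
  have "AE z in lborel \<Otimes>\<^sub>M lborel. z \<notin> N" unfolding lborel_prod by (rule AE_not_in[OF N(1)])
  then have "AE x in lborel. AE t in lborel. (x, t) \<notin> N"
    by (rule lborel_pair.AE_pair)
  moreover have "{z \<in> space (lborel \<Otimes>\<^sub>M lborel). (fst z, snd z) \<notin> N} \<in> sets (lborel \<Otimes>\<^sub>M lborel)"
    using sets.compl_sets[OF Ns] by (simp add: set_diff_eq)
  ultimately have "AE t in lborel. AE x in lborel. (x, t) \<notin> N"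
    using lborel_pair.AE_commute[of "\<lambda>x t. (x, t) \<notin> N"] by blast
  then show ?thesis
    by eventually_elim (auto elim!: eventually_mono dest!: subsetD[OF N(2)] intro: subsetD[OF N(2)])
qed

lemma L2_slices:
  fixes f :: "('a::euclidean_space \<times> real) L2"
  shows "AE t in lborel. square_integrable (\<lambda>x. rep_L2 f (x, t))"
    "integrable lborel (\<lambda>t. LINT x|lborel. (rep_L2 f (x, t))\<^sup>2)"
proof -
  have m [measurable]: "rep_L2 f \<in> borel_measurable (lborel \<Otimes>\<^sub>M lborel)"
    using square_integrable_measurable[OF square_integrable_rep[of f]] by (simp add: lborel_prod)
  have "integrable (lborel \<Otimes>\<^sub>M lborel) (\<lambda>z. (rep_L2 f z)\<^sup>2)"
    using square_integrable_rep[of f] by (simp add: square_integrable_def lborel_prod)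
  then have i: "integrable (lborel \<Otimes>\<^sub>M lborel) (\<lambda>(t, x). (rep_L2 f (x, t))\<^sup>2)"
    using lborel_pair.integrable_product_swap[of "\<lambda>z. (rep_L2 f z)\<^sup>2"] by (simp add: case_prod_unfold)
  have mt: "(\<lambda>x. rep_L2 f (x, t)) \<in> borel_measurable lborel" for t by measurable
  show "AE t in lborel. square_integrable (\<lambda>x. rep_L2 f (x, t))"
    using lborel_pair.AE_integrable_fst'[OF i] by eventually_elim (use mt in \<open>simp add: square_integrable_def\<close>)
  show "integrable lborel (\<lambda>t. LINT x|lborel. (rep_L2 f (x, t))\<^sup>2)"
    using lborel_pair.integrable_fst'[OF i] by simp
qed

text \<open>
  Controls that are a function of time times a function of space, with their effect in the weak formulation.
\<close>

lemma L2_on_tensor: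
  fixes \<psi> :: "'a::euclidean_space L2" and \<eta> :: "real \<Rightarrow> real"
  assumes \<eta>: "\<eta> \<in> borel_measurable borel" "integrable lborel (\<lambda>t. (\<eta> t)\<^sup>2)"
    and supp: "\<And>t. t \<notin> J \<Longrightarrow> \<eta> t = 0" and \<psi>: "\<psi> \<in> L2_on S"
  shows "\<exists>f\<in>L2_on (S \<times> J). AE t in lborel. \<forall>\<phi>. (LINT x|lborel. rep_L2 f (x, t) * rep_L2 \<phi> x) = \<eta> t * (\<psi> \<bullet> \<phi>)"
proof -
  note [measurable] = \<eta>(1)
  let ?F = "\<lambda>z. rep_L2 \<psi> (fst z) * \<eta> (snd z)"
  have si: "square_integrable ?F" unfolding square_integrable_def
  proof
    have m: "?F \<in> borel_measurable (lborel \<Otimes>\<^sub>M lborel)" by measurable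
    then show "?F \<in> borel_measurable lborel" by (simp add: lborel_prod)
    have "integrable (lborel \<Otimes>\<^sub>M lborel) (\<lambda>(x, t). (rep_L2 \<psi> x * \<eta> t)\<^sup>2)"
    proof (rule lborel_pair.Fubini_integrable)
      show "(\<lambda>(x, t). (rep_L2 \<psi> x * \<eta> t)\<^sup>2) \<in> borel_measurable (lborel \<Otimes>\<^sub>M lborel)" by measurable
      show "AE x in lborel. integrable lborel (\<lambda>t. case (x, t) of (x, t) \<Rightarrow> (rep_L2 \<psi> x * \<eta> t)\<^sup>2)"
        using \<eta>(2) by (simp add: power_mult_distrib)
      show "integrable lborel (\<lambda>x. LINT t|lborel. norm (case (x, t) of (x, t) \<Rightarrow> (rep_L2 \<psi> x * \<eta> t)\<^sup>2))"
        using square_integrable_rep[of \<psi>] by (simp add: power_mult_distrib square_integrable_def)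
    qed
    then show "integrable lborel (\<lambda>z. (?F z)\<^sup>2)" by (simp add: lborel_prod case_prod_unfold)
  qed
  define f where "f = abs_L2 ?F"
  have rep: "AE z in lborel. rep_L2 f z = ?F z" unfolding f_def by (rule rep_abs_L2[OF si])
  show ?thesis
  proof
    have "AE x in lborel. x \<notin> S \<longrightarrow> rep_L2 \<psi> x = 0" using \<psi> by (simp add: L2_on_def)
    then obtain N where N: "N \<in> null_sets (lborel :: 'a measure)" "{x. \<not> (x \<notin> S \<longrightarrow> rep_L2 \<psi> x = 0)} \<subseteq> N"
      unfolding eventually_ae_filter by auto
    have "N \<times> UNIV \<in> null_sets (lborel \<Otimes>\<^sub>M (lborel :: real measure))"
      using N(1) by (intro lborel.times_in_null_sets1) auto
    then have "AE z in lborel \<Otimes>\<^sub>M (lborel :: real measure). z \<notin> N \<times> UNIV" by (rule AE_not_in)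
    then have "AE z in lborel. z \<notin> S \<times> J \<longrightarrow> ?F z = 0"
      unfolding lborel_prod by eventually_elim (use N(2) supp in \<open>auto simp: mem_Times_iff\<close>)
    then show "f \<in> L2_on (S \<times> J)" unfolding f_def by (intro abs_L2_on si)
    have "AE z in lborel. rep_L2 f (fst z, snd z) = rep_L2 \<psi> (fst z) * \<eta> (snd z)" using rep by simp
    then have "AE t in lborel. AE x in lborel. rep_L2 f (x, t) = rep_L2 \<psi> x * \<eta> t" by (rule AE_slices)
    then show "AE t in lborel. \<forall>\<phi>. (LINT x|lborel. rep_L2 f (x, t) * rep_L2 \<phi> x) = \<eta> t * (\<psi> \<bullet> \<phi>)"
    proof eventually_elim
      case (elim t)
      show ?case
      proof
        fix \<phi> :: "'a L2"
        have mf: "(\<lambda>x. rep_L2 f (x, t)) \<in> borel_measurable borel"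
        proof -
          have "rep_L2 f \<in> borel_measurable (lborel \<Otimes>\<^sub>M lborel)"
            using square_integrable_measurable[OF square_integrable_rep[of f]] by (simp add: lborel_prod)
          then show ?thesis by measurable
        qed
        have "(LINT x|lborel. rep_L2 f (x, t) * rep_L2 \<phi> x) = (LINT x|lborel. \<eta> t * (rep_L2 \<psi> x * rep_L2 \<phi> x))"
          by (rule integral_cong_AE) (use elim mf in \<open>auto elim!: eventually_mono\<close>)
        then show "(LINT x|lborel. rep_L2 f (x, t) * rep_L2 \<phi> x) = \<eta> t * (\<psi> \<bullet> \<phi>)"
          by (simp add: inner_L2_eq)
      qed
    qed
  qed
qed


section \<open>Controllability and unique continuation\<close>

lemma weak_solution_iff_evolution_solution:
  "weak_solution V E T \<mu> \<nu> f u0 u \<longleftrightarrow>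
    evolution_solution V E T \<mu> \<nu> (\<lambda>t \<phi>. LINT x|lborel. rep_L2 f (x, t) * rep_L2 \<phi> x) u0 u"
  by (simp only: weak_solution_def evolution_solution_def)

lemma evolution_solution_cong:
  assumes sol: "evolution_solution V E T \<mu> \<nu> q u0 u"
    and q: "AE t in lborel. t \<in> {0<..<T} \<longrightarrow> (\<forall>\<phi>\<in>V. q t \<phi> = q' t \<phi>)"
  shows "evolution_solution V E T \<mu> \<nu> q' u0 u"
proof -
  have "AE t in lborel. t \<in> {0<..<T} \<longrightarrow> w t \<phi> + E (u t) \<phi> - q' t \<phi> = 0"
    if "AE t in lborel. t \<in> {0<..<T} \<longrightarrow> w t \<phi> + E (u t) \<phi> - q t \<phi> = 0" "\<phi> \<in> V" for w \<phi>
    using that(1) q by eventually_elim (use that(2) in auto)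
  then show ?thesis using sol unfolding evolution_solution_def by blast
qed

lemma form_operator_diagonal:
  assumes "form_operator \<Omega> D A V E ev"
  shows "\<exists>\<phi> l. evolution_form (L2_on \<Omega>) V E \<phi> l"
proof -
  interpret form_operator \<Omega> D A V E ev by fact
  have cl: "closed (L2_on \<Omega>)" using open_domain by (intro closed_L2_on) auto
  interpret cs: compact_selfadjoint "L2_on \<Omega>" D A
    by (rule compact_selfadjoint.intro[OF cl selfadjoint nonneg compact_embedding])
  obtain \<phi> l where \<phi>: "orthonormal_or_zero \<phi>" "\<And>n. \<phi> n \<in> D" "\<And>n. A (\<phi> n) = l n *\<^sub>R \<phi> n" "\<And>n. 0 \<le> (l n :: real)"
    "\<And>x. x \<in> L2_on \<Omega> \<Longrightarrow> (\<lambda>n. (x \<bullet> \<phi> n) *\<^sub>R \<phi> n) sums x"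
    by (rule cs.eigenvector_expansion) blast
  have form_eq: "\<phi> n \<in> V \<and> (\<forall>\<psi>\<in>V. E (\<phi> n) \<psi> = A (\<phi> n) \<bullet> \<psi>)" for n
    using associated \<phi>(2)[of n] unfolding associated_with_form_def by blast
  then have V: "\<phi> n \<in> V" and E: "\<psi> \<in> V \<Longrightarrow> E (\<phi> n) \<psi> = l n * (\<phi> n \<bullet> \<psi>)" for n \<psi>
    using \<phi>(3)[of n] form_eq[of n] by simp_all
  have "diagonal_form (L2_on \<Omega>) V E \<phi> l"
    by (rule diagonal_form.intro[OF form cl subspace_L2_on \<phi>(1) V \<phi>(4) E \<phi>(5)])
  then show ?thesis unfolding evolution_form_def by blast
qed

text \<open>
  A control enters the equation only through its time slices, which are square integrable for almost every
  time.
\<close>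

lemma control_slices:
  fixes f :: "('a::euclidean_space \<times> real) L2"
  assumes f: "f \<in> L2_on (S \<times> J)"
  defines "z \<equiv> \<lambda>t. abs_L2 (\<lambda>x. rep_L2 f (x, t))" and "N \<equiv> \<lambda>t. sqrt (LINT x|lborel. (rep_L2 f (x, t))\<^sup>2)"
  shows "AE t in lborel. z t \<in> L2_on S \<and> norm (z t) = N t \<and> (\<forall>\<psi>. (LINT x|lborel. rep_L2 f (x, t) * rep_L2 \<psi> x) = z t \<bullet> \<psi>)"
    "set_integrable lborel {0<..<T} N" "set_integrable lborel {0<..<T} (\<lambda>t. LINT x|lborel. rep_L2 f (x, t) * rep_L2 \<psi> x)"
proof -
  have m [measurable]: "rep_L2 f \<in> borel_measurable (lborel \<Otimes>\<^sub>M lborel)"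
    using square_integrable_measurable[OF square_integrable_rep[of f]] by (simp add: lborel_prod)
  have "AE z in lborel. (fst z, snd z) \<notin> S \<times> J \<longrightarrow> rep_L2 f (fst z, snd z) = 0"
    using f by (simp add: L2_on_def)
  then have supp: "AE t in lborel. AE x in lborel. (x, t) \<notin> S \<times> J \<longrightarrow> rep_L2 f (x, t) = 0"
    by (rule AE_slices)
  show 1: "AE t in lborel. z t \<in> L2_on S \<and> norm (z t) = N t \<and> (\<forall>\<psi>. (LINT x|lborel. rep_L2 f (x, t) * rep_L2 \<psi> x) = z t \<bullet> \<psi>)"
    using L2_slices(1)[of f] supp
  proof eventually_elim
    case (elim t)
    have "z t \<in> L2_on S" unfolding z_def
      by (rule abs_L2_on[OF elim(1)]) (use elim(2) in \<open>auto elim: eventually_mono\<close>)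
    then show ?case unfolding z_def N_def by (simp add: norm_abs_L2[OF elim(1)] inner_abs_L2[OF elim(1)])
  qed
  have N2: "integrable lborel (\<lambda>t. (N t)\<^sup>2)"
    unfolding N_def using L2_slices(2)[of f] by simp
  have "(\<lambda>t. sqrt (LINT x|lborel. (rep_L2 f (x, t))\<^sup>2)) \<in> borel_measurable borel"
    using borel_measurable_integrable[OF L2_slices(2)[of f]] by simp
  then have mN [measurable]: "N \<in> borel_measurable borel" by (simp add: N_def)
  show N: "set_integrable lborel {0<..<T} N"
  proof (rule set_integrable_bound)
    have "set_integrable lborel {0<..<T} (\<lambda>t. 1 :: real)" by (cases "0 \<le> T") (auto simp: set_integrable_def)
    moreover have "set_integrable lborel {0<..<T} (\<lambda>t. (N t)\<^sup>2)"
      unfolding set_integrable_def by (rule integrable_mult_indicator[OF _ N2]) simp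
    ultimately show "set_integrable lborel {0<..<T} (\<lambda>t. 1 + (N t)\<^sup>2)" by (rule set_integral_add)
    show "set_borel_measurable lborel {0<..<T} N" unfolding set_borel_measurable_def by measurable
    have "\<bar>a\<bar> \<le> \<bar>1 + a\<^sup>2\<bar>" for a :: real
    proof -
      have "0 \<le> (\<bar>a\<bar> - 1)\<^sup>2 + \<bar>a\<bar>\<^sup>2 + 1" by simp
      then have "2 * \<bar>a\<bar> \<le> 2 * (1 + a\<^sup>2)" by (simp add: power2_diff)
      then show ?thesis by simp
    qed
    then show "AE t in lborel. t \<in> {0<..<T} \<longrightarrow> norm (N t) \<le> norm (1 + (N t)\<^sup>2)" by simp
  qed
  show "set_integrable lborel {0<..<T} (\<lambda>t. LINT x|lborel. rep_L2 f (x, t) * rep_L2 \<psi> x)"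
  proof (rule set_integrable_bound)
    show "set_integrable lborel {0<..<T} (\<lambda>t. norm \<psi> * N t)" using N by simp
    have "(\<lambda>t. LINT x|lborel. rep_L2 f (x, t) * rep_L2 \<psi> x) \<in> borel_measurable lborel"
      by (rule lborel.borel_measurable_lebesgue_integral) measurable
    then show "set_borel_measurable lborel {0<..<T} (\<lambda>t. LINT x|lborel. rep_L2 f (x, t) * rep_L2 \<psi> x)"
      unfolding set_borel_measurable_def by measurable
    show "AE t in lborel. t \<in> {0<..<T} \<longrightarrow> norm (LINT x|lborel. rep_L2 f (x, t) * rep_L2 \<psi> x) \<le> norm (norm \<psi> * N t)"
      using 1
    proof eventually_elim
      case (elim t)
      have "\<bar>z t \<bullet> \<psi>\<bar> \<le> norm (z t) * norm \<psi>" by (rule Cauchy_Schwarz_ineq2)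
      then show ?case using elim by (auto simp: mult.commute)
    qed
  qed
qed

text \<open>
  Steer from \<open>0\<close> towards \<open>v0\<close> itself: the reached state is orthogonal to \<open>v0\<close> and within \<open>e\<close> of it, so
  \<open>norm v0 \<le> e\<close>.
\<close>

lemma controllable_imp_unique_continuation:
  assumes ef: "evolution_form (L2_on \<Omega>) V E \<phi> l" and \<omega>: "\<omega> \<subseteq> \<Omega>"
    and par: "0 \<le> \<nu>" "\<nu> \<le> 1" "0 < \<mu>" "\<mu> \<le> 1" and T: "0 < T"
    and contr: "mean_approx_controllable \<Omega> \<omega> V E T \<mu> \<nu>"
  shows "adjoint_unique_continuation \<Omega> \<omega> V E T \<mu> \<nu>"
  unfolding adjoint_unique_continuation_def
proof (intro ballI allI impI, elim conjE)
  interpret evolution_form "L2_on \<Omega>" V E \<phi> l by fact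
  fix v0 v
  assume v0: "v0 \<in> L2_on \<Omega>" and v: "adjoint_weak_solution V E T \<mu> \<nu> v0 v"
    and van: "\<forall>t\<in>{0<..<T}. AE x in lborel. x \<in> \<omega> \<longrightarrow> rep_L2 (v t) x = 0"
  let ?a = "(1 - \<nu>) * (1 - \<mu>)"
  have y: "evolution_solution V E T \<mu> (1 - \<nu>) (\<lambda>_ _. 0) v0 (\<lambda>s. v (T - s))"
    using v by (simp add: adjoint_iff_reflected_evolution)
  have small: "norm v0 \<le> e" if e: "0 < e" for e
  proof -
    have "0 \<in> L2_on \<Omega>" by (rule subspace_0[OF subspaceH])
    then obtain f u where f: "f \<in> L2_on (\<omega> \<times> {0<..<T})" and u: "weak_solution V E T \<mu> \<nu> f 0 u"
      and close: "norm (frac_int_left ?a u T - v0) \<le> e"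
      using contr v0 e unfolding mean_approx_controllable_def by blast
    have "AE t in lborel. t \<in> {0<..<T} \<longrightarrow> abs_L2 (\<lambda>x. rep_L2 f (x, t)) \<in> L2_on \<Omega> \<and>
        (\<forall>n. (LINT x|lborel. rep_L2 f (x, t) * rep_L2 (\<phi> n) x) = abs_L2 (\<lambda>x. rep_L2 f (x, t)) \<bullet> \<phi> n) \<and>
        norm (abs_L2 (\<lambda>x. rep_L2 f (x, t))) \<le> sqrt (LINT x|lborel. (rep_L2 f (x, t))\<^sup>2) \<and>
        (\<forall>s\<in>{0<..<T}. abs_L2 (\<lambda>x. rep_L2 f (x, t)) \<bullet> v (T - s) = 0)"
      using control_slices(1)[OF f]
    proof eventually_elim
      case (elim t)
      have "abs_L2 (\<lambda>x. rep_L2 f (x, t)) \<bullet> v (T - s) = 0" if s: "s \<in> {0<..<T}" for s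
      proof (rule L2_on_inner_zero)
        show "abs_L2 (\<lambda>x. rep_L2 f (x, t)) \<in> L2_on \<omega>" using elim by blast
        have "T - s \<in> {0<..<T}" using s by auto
        then show "AE x in lborel. x \<in> \<omega> \<longrightarrow> rep_L2 (v (T - s)) x = 0" using van by blast
      qed
      then show ?case using elim L2_on_mono[OF \<omega>] by auto
    qed
    from evolution_duality[OF u[unfolded weak_solution_iff_evolution_solution] y par T v0 control_slices(3)[OF f] control_slices(2)[OF f] this]
    have "frac_int_left ?a u T \<bullet> v0 = 0" .
    then have "(norm v0)\<^sup>2 = (v0 - frac_int_left ?a u T) \<bullet> v0"
      by (simp add: inner_diff_left power2_norm_eq_inner)
    also have "\<dots> \<le> norm (v0 - frac_int_left ?a u T) * norm v0" by (rule norm_cauchy_schwarz)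
    also have "\<dots> \<le> e * norm v0" using close by (intro mult_right_mono) (simp_all add: norm_minus_commute)
    finally have le: "norm v0 * norm v0 \<le> e * norm v0" by (simp only: power2_eq_square)
    show ?thesis
    proof (cases "norm v0 = 0")
      case False
      then have "0 < norm v0" by simp
      then show ?thesis by (rule mult_right_le_imp_le[OF le])
    qed (use e in simp)
  qed
  have "norm v0 \<le> 0" by (rule field_le_epsilon) (use small in simp)
  then show "v0 = 0" by simp
qed

text \<open>
  The states reached from \<open>0\<close> by the controls \<open>t ^ j / fact j\<close> times \<open>\<psi>\<close> span a dense subspace. Adding the
  explicit free evolution of \<open>u0\<close> to a solution with datum \<open>0\<close> treats an arbitrary initial datum.
\<close>

lemma unique_continuation_imp_controllable:
  assumes ef: "evolution_form (L2_on \<Omega>) V E \<phi> l" and \<omega>: "\<omega> \<subseteq> \<Omega>" "open \<omega>"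
    and par: "0 \<le> \<nu>" "\<nu> \<le> 1" "0 < \<mu>" "\<mu> \<le> 1" and T: "0 < T"
    and uc: "adjoint_unique_continuation \<Omega> \<omega> V E T \<mu> \<nu>"
  shows "mean_approx_controllable \<Omega> \<omega> V E T \<mu> \<nu>"
proof -
  define a where "a = (1 - \<nu>) * (1 - \<mu>)"
  define b where "b = \<nu> * (1 - \<mu>)"
  have ab: "0 \<le> a" "0 \<le> b" using par unfolding a_def b_def by (intro mult_nonneg_nonneg; simp)+
  have abm: "a + b + \<mu> = 1" by (simp add: a_def b_def algebra_simps)
  interpret evolution_form "L2_on \<Omega>" V E \<phi> l by fact
  interpret F: fractional_form "L2_on \<Omega>" V E \<phi> l \<mu> a b
    by unfold_locales (use par ab abm in auto)
  interpret B: fractional_form "L2_on \<Omega>" V E \<phi> l \<mu> b a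
    by unfold_locales (use par ab abm in auto)
  have \<omega>s: "\<omega> \<in> sets borel" using \<omega>(2) by auto
  have \<omega>H: "\<psi> \<in> L2_on \<omega> \<Longrightarrow> \<psi> \<in> L2_on \<Omega>" for \<psi> using L2_on_mono[OF \<omega>(1)] by blast
  \<comment> \<open>with this choice \<open>source (d j)\<close> is the monomial \<open>t ^ j / fact j\<close>\<close>
  define d where "d j = real j + 1 - b" for j :: nat
  have d: "\<mu> \<le> d j" "0 < d j" for j using ab abm par by (auto simp: d_def)
  define reach where "reach z \<longleftrightarrow> (\<exists>f\<in>L2_on (\<omega> \<times> {0<..<T}). \<exists>u. weak_solution V E T \<mu> \<nu> f 0 u \<and> frac_int_left a u T = z)" for z
  define R where "R = {F.sol (1 + d j) \<psi> T |j \<psi>. \<psi> \<in> L2_on \<omega>}"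
  have gen: "reach (F.sol (1 + d j) \<psi> T)" if \<psi>: "\<psi> \<in> L2_on \<omega>" for j \<psi>
  proof -
    define \<eta> where "\<eta> t = indicat_real {0<..<T} t * rl_kernel (real j + 1) t" for t
    have \<eta>m: "\<eta> \<in> borel_measurable borel" unfolding \<eta>_def[abs_def] by measurable
    have "integrable lborel (\<lambda>t. (\<eta> t)\<^sup>2)"
    proof (rule Bochner_Integration.integrable_bound)
      have "set_integrable lborel {0<..<T} (\<lambda>t. (rl_kernel (real j + 1) T)\<^sup>2)" using T by (auto simp: set_integrable_def)
      then show "integrable lborel (\<lambda>t. indicat_real {0<..<T} t *\<^sub>R (rl_kernel (real j + 1) T)\<^sup>2)" by (simp add: set_integrable_def)
      have "\<bar>rl_kernel (real j + 1) t\<bar> \<le> \<bar>rl_kernel (real j + 1) T\<bar>" if "0 < t" "t < T" for t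
      proof -
        have "rl_kernel (real j + 1) t \<le> rl_kernel (real j + 1) T"
          unfolding rl_kernel_def using that Gamma_real_pos[of "real j + 1"] by (intro divide_right_mono powr_mono2) auto
        then show ?thesis using rl_kernel_nonneg[of "real j + 1" t] by simp
      qed
      then have "(rl_kernel (real j + 1) t)\<^sup>2 \<le> (rl_kernel (real j + 1) T)\<^sup>2" if "0 < t" "t < T" for t
        using that by (simp only: abs_le_square_iff)
      then show "AE t in lborel. norm ((\<eta> t)\<^sup>2) \<le> norm (indicat_real {0<..<T} t *\<^sub>R (rl_kernel (real j + 1) T)\<^sup>2)"
        by (auto simp: \<eta>_def indicator_def)
      show "(\<lambda>t. (\<eta> t)\<^sup>2) \<in> borel_measurable lborel" using \<eta>m by simp
    qed
    then obtain f where f: "f \<in> L2_on (\<omega> \<times> {0<..<T})"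
      "AE t in lborel. \<forall>\<phi>. (LINT x|lborel. rep_L2 f (x, t) * rep_L2 \<phi> x) = \<eta> t * (\<psi> \<bullet> \<phi>)"
      using L2_on_tensor[OF \<eta>m _ _ \<psi>, of "{0<..<T}"] by (auto simp: \<eta>_def)
    note ex = F.explicit_solution[OF \<omega>H[OF \<psi>] disjI2[OF d(1)[of j]] T refl a_def b_def]
    have "evolution_solution V E T \<mu> \<nu> (\<lambda>t \<phi>. LINT x|lborel. rep_L2 f (x, t) * rep_L2 \<phi> x) (if d j = 0 then \<psi> else 0) (F.sol (b + d j + \<mu>) \<psi>)"
    proof (rule evolution_solution_cong[OF ex(1)])
      have "F.source (d j) t = \<eta> t" if "t \<in> {0<..<T}" for t
        using that d(2)[of j] by (simp add: F.source_def \<eta>_def d_def)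
      then show "AE t in lborel. t \<in> {0<..<T} \<longrightarrow> (\<forall>\<phi>\<in>V. F.source (d j) t * (\<psi> \<bullet> \<phi>) = (LINT x|lborel. rep_L2 f (x, t) * rep_L2 \<phi> x))"
        using f(2) by (auto elim: eventually_mono)
    qed
    then have "weak_solution V E T \<mu> \<nu> f 0 (F.sol (b + d j + \<mu>) \<psi>)"
      using d(2)[of j] by (simp add: weak_solution_iff_evolution_solution)
    then show ?thesis unfolding reach_def using f(1) ex(2)[OF T] by blast
  qed
  have add: "\<exists>f\<in>L2_on (\<omega> \<times> {0<..<T}). \<exists>u. weak_solution V E T \<mu> \<nu> f (x1 + x2) u \<and> frac_int_left a u T = frac_int_left a u1 T + frac_int_left a u2 T"
    if f1: "f1 \<in> L2_on (\<omega> \<times> {0<..<T})" "weak_solution V E T \<mu> \<nu> f1 x1 u1"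
      and f2: "f2 \<in> L2_on (\<omega> \<times> {0<..<T})" "weak_solution V E T \<mu> \<nu> f2 x2 u2" for f1 f2 x1 x2 u1 u2
  proof (intro bexI exI conjI)
    show fs: "f1 + f2 \<in> L2_on (\<omega> \<times> {0<..<T})" by (rule subspace_add[OF subspace_L2_on f1(1) f2(1)])
    have "AE z in lborel. rep_L2 (f1 + f2) (fst z, snd z) = rep_L2 f1 (fst z, snd z) + rep_L2 f2 (fst z, snd z)"
      using rep_add_AE[of f1 f2] by simp
    then have sum: "AE t in lborel. AE x in lborel. rep_L2 (f1 + f2) (x, t) = rep_L2 f1 (x, t) + rep_L2 f2 (x, t)"
      by (rule AE_slices)
    have "AE t in lborel. t \<in> {0<..<T} \<longrightarrow> (\<forall>\<phi>\<in>V. (LINT x|lborel. rep_L2 f1 (x, t) * rep_L2 \<phi> x) + (LINT x|lborel. rep_L2 f2 (x, t) * rep_L2 \<phi> x)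
        = (LINT x|lborel. rep_L2 (f1 + f2) (x, t) * rep_L2 \<phi> x))"
      using sum L2_slices(1)[of f1] L2_slices(1)[of f2] L2_slices(1)[of "f1 + f2"]
    proof eventually_elim
      case (elim t)
      show ?case
      proof (intro impI ballI)
        fix \<phi>' :: "'a L2"
        have "(LINT x|lborel. rep_L2 (f1 + f2) (x, t) * rep_L2 \<phi>' x) = (LINT x|lborel. rep_L2 f1 (x, t) * rep_L2 \<phi>' x + rep_L2 f2 (x, t) * rep_L2 \<phi>' x)"
        proof (rule integral_cong_AE)
          show "AE x in lborel. rep_L2 (f1 + f2) (x, t) * rep_L2 \<phi>' x = rep_L2 f1 (x, t) * rep_L2 \<phi>' x + rep_L2 f2 (x, t) * rep_L2 \<phi>' x"
            using elim(1) by eventually_elim (simp add: distrib_right)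
        qed (use elim(2-4)[THEN square_integrable_measurable] in auto)
        also have "\<dots> = (LINT x|lborel. rep_L2 f1 (x, t) * rep_L2 \<phi>' x) + (LINT x|lborel. rep_L2 f2 (x, t) * rep_L2 \<phi>' x)"
          by (intro Bochner_Integration.integral_add square_integrable_mult elim square_integrable_rep)
        finally show "(LINT x|lborel. rep_L2 f1 (x, t) * rep_L2 \<phi>' x) + (LINT x|lborel. rep_L2 f2 (x, t) * rep_L2 \<phi>' x)
            = (LINT x|lborel. rep_L2 (f1 + f2) (x, t) * rep_L2 \<phi>' x)" by simp
      qed
    qed
    from evolution_solution_cong[OF evolution_solution_add[OF f1(2)[unfolded weak_solution_iff_evolution_solution] f2(2)[unfolded weak_solution_iff_evolution_solution]] this]
    show "weak_solution V E T \<mu> \<nu> (f1 + f2) (x1 + x2) (\<lambda>t. u1 t + u2 t)"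
      by (simp add: weak_solution_iff_evolution_solution)
    have "frac_integrable_left a u T" if "weak_solution V E T \<mu> \<nu> f x u" for f x u
      using that T unfolding weak_solution_def a_def by auto
    then show "frac_int_left a (\<lambda>t. u1 t + u2 t) T = frac_int_left a u1 T + frac_int_left a u2 T"
      using f1(2) f2(2) by (intro frac_int_left_add(2)) blast+
  qed
  have reach_span: "reach z" if "z \<in> span R" for z
    using that
  proof (induction rule: span_induct_alt)
    case base
    have "reach (F.sol (1 + d 0) 0 T)" by (rule gen) (rule subspace_0[OF subspace_L2_on])
    then show ?case by (simp add: F.sol_def)
  next
    case (step c x y)
    then obtain j \<psi> where x: "x = F.sol (1 + d j) \<psi> T" and \<psi>: "\<psi> \<in> L2_on \<omega>" by (auto simp: R_def)
    have c\<psi>: "c *\<^sub>R \<psi> \<in> L2_on \<omega>" by (rule subspace_scale[OF subspace_L2_on \<psi>])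
    have m1: "\<mu> \<le> 1 + d j" using d(1)[of j] by simp
    have "c *\<^sub>R x = F.sol (1 + d j) (c *\<^sub>R \<psi>) T"
    proof (rule H_eqI)
      show "c *\<^sub>R x \<in> L2_on \<Omega>" unfolding x by (intro subspace_scale subspaceH F.sol_H \<omega>H \<psi> m1 T)
      show "F.sol (1 + d j) (c *\<^sub>R \<psi>) T \<in> L2_on \<Omega>" by (intro F.sol_H \<omega>H c\<psi> m1 T)
      show "c *\<^sub>R x \<bullet> \<phi> n = F.sol (1 + d j) (c *\<^sub>R \<psi>) T \<bullet> \<phi> n" for n
        unfolding x by (simp add: F.sol_coeff[OF \<omega>H[OF \<psi>] m1 T] F.sol_coeff[OF \<omega>H[OF c\<psi>] m1 T])
    qed
    then have "reach (c *\<^sub>R x)" using gen[OF c\<psi>] by simp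
    then show ?case using step(2) add[of _ 0 _ _ 0] unfolding reach_def by (metis add.right_neutral)
  qed
  have dense: "L2_on \<Omega> \<subseteq> closure (span R)"
  proof (rule ccontr)
    assume "\<not> L2_on \<Omega> \<subseteq> closure (span R)"
    then obtain x where x: "x \<in> L2_on \<Omega>" "x \<notin> closure (span R)" by blast
    have "subspace (closure (span R))"
      unfolding subspace_def using closure_span_closed(1)[of R] closure_span_closed(2,3)[of _ R] by blast
    then obtain p v0 where p: "p \<in> closure (span R)" "x = p + v0" "v0 \<noteq> 0" "\<And>z. z \<in> closure (span R) \<Longrightarrow> v0 \<bullet> z = 0"
      using closed_subspace_orthogonal_vector[OF _ closed_closure x(2)] by blast
    have RH: "R \<subseteq> L2_on \<Omega>"
    proof
      fix z assume "z \<in> R"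
      then obtain j \<psi> where z: "z = F.sol (1 + d j) \<psi> T" and \<psi>: "\<psi> \<in> L2_on \<omega>" by (auto simp: R_def)
      have "\<mu> \<le> 1 + d j" using d(1)[of j] by simp
      then show "z \<in> L2_on \<Omega>" unfolding z by (rule F.sol_H[OF \<omega>H[OF \<psi>] _ T])
    qed
    have "closure (span R) \<subseteq> L2_on \<Omega>"
      by (rule closure_minimal[OF span_minimal[OF RH subspaceH] closedH])
    then have v0: "v0 \<in> L2_on \<Omega>" using p(1,2) x(1) subspace_diff[OF subspaceH x(1), of p] by auto
    define y where "y = B.sol (a + 0 + \<mu>) v0"
    have am: "\<mu> \<le> a + 0 + \<mu>" using ab by simp
    have "evolution_solution V E T \<mu> (1 - \<nu>) (\<lambda>t \<psi>. B.source 0 t * (v0 \<bullet> \<psi>)) (if (0::real) = 0 then v0 else 0) (B.sol (a + 0 + \<mu>) v0)"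
      by (rule B.explicit_solution(1)[OF v0 _ T refl]) (auto simp: a_def b_def)
    then have "evolution_solution V E T \<mu> (1 - \<nu>) (\<lambda>_ _. 0) v0 y"
      by (simp add: B.source_def y_def)
    then have adj: "adjoint_weak_solution V E T \<mu> \<nu> v0 (\<lambda>t. y (T - t))"
      by (simp add: adjoint_iff_reflected_evolution)
    have perp: "\<psi> \<bullet> y s = 0" if \<psi>: "\<psi> \<in> L2_on \<omega>" and s: "s \<in> {0<..<T}" for \<psi> s
    proof -
      define k where "k r = \<psi> \<bullet> y (T - r)" for r
      have yc: "continuous_on {0<..} y" unfolding y_def by (rule B.sol_continuous(2)[OF v0 am]) auto
      have kc: "continuous_on {0<..<T} k" unfolding k_def
        by (intro continuous_intros continuous_on_compose2[OF yc]) auto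
      have mom: "set_integrable lborel {0<..<T} (\<lambda>r. r ^ j * k r) \<and> (LINT r:{0<..<T}|lborel. r ^ j * k r) = 0" for j
      proof -
        have c: "0 < real j + 1" by simp
        note sf = B.sol_frac[OF v0 am c T, folded y_def]
        \<comment> \<open>the fractional integral of order \<open>j + 1\<close> of \<open>y\<close> at \<open>T\<close> is, up to a factor, a moment of \<open>y\<close>\<close>
        have e1: "real j + 1 + (a + 0 + \<mu>) = 1 + d j" using abm by (simp add: d_def)
        have m1: "\<mu> \<le> 1 + d j" using d(1)[of j] by simp
        \<comment> \<open>the solution operators are symmetric, so the kernel moves from the control to the adjoint datum\<close>
        have "\<psi> \<bullet> B.sol (1 + d j) v0 T = v0 \<bullet> F.sol (1 + d j) \<psi> T"
        proof -
          have "(\<lambda>n. (\<psi> \<bullet> \<phi> n) * (B.sol (1 + d j) v0 T \<bullet> \<phi> n)) = (\<lambda>n. (v0 \<bullet> \<phi> n) * (F.sol (1 + d j) \<psi> T \<bullet> \<phi> n))"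
            by (simp add: F.sol_coeff[OF \<omega>H[OF \<psi>] m1 T] B.sol_coeff[OF v0 m1 T] mult_ac)
          then show ?thesis
            using parseval[OF \<omega>H[OF \<psi>], of "B.sol (1 + d j) v0 T"] parseval[OF v0, of "F.sol (1 + d j) \<psi> T"]
            by (simp add: sums_unique2)
        qed
        also have "\<dots> = 0"
        proof (rule p(4))
          have "F.sol (1 + d j) \<psi> T \<in> R" using \<psi> by (auto simp: R_def)
          then show "F.sol (1 + d j) \<psi> T \<in> closure (span R)"
            using closure_subset span_base by blast
        qed
        finally have z: "\<psi> \<bullet> frac_int_left (real j + 1) y T = 0" by (simp only: sf(2) e1)
        let ?h = "\<lambda>\<tau>. (T - \<tau>) powr (real j + 1 - 1) *\<^sub>R y \<tau>"
        have i1: "integrable lborel (\<lambda>\<tau>. indicat_real {0<..<T} \<tau> *\<^sub>R ?h \<tau>)"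
          using sf(1) by (simp add: set_integrable_def)
        have e2: "\<psi> \<bullet> (indicat_real {0<..<T} \<tau> *\<^sub>R ?h \<tau>) = indicat_real {0<..<T} \<tau> *\<^sub>R ((T - \<tau>) ^ j * (\<psi> \<bullet> y \<tau>))" for \<tau>
          by (cases "\<tau> \<in> {0<..<T}") (auto simp: powr_realpow)
        have i2: "set_integrable lborel {0<..<T} (\<lambda>\<tau>. (T - \<tau>) ^ j * (\<psi> \<bullet> y \<tau>))"
          unfolding set_integrable_def e2[symmetric] by (rule integrable_inner_right) (rule i1)
        have "(LINT \<tau>:{0<..<T}|lborel. (T - \<tau>) ^ j * (\<psi> \<bullet> y \<tau>)) = \<psi> \<bullet> (LINT \<tau>|lborel. indicat_real {0<..<T} \<tau> *\<^sub>R ?h \<tau>)"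
          unfolding set_lebesgue_integral_def e2[symmetric] by (rule integral_inner_right) (rule i1)
        also have "\<dots> = 0"
        proof -
          have "Gamma (real j + 1) \<noteq> 0" using Gamma_real_pos[of "real j + 1"] by linarith
          then show ?thesis using z by (simp add: frac_int_left_def set_lebesgue_integral_def)
        qed
        finally have i3: "(LINT \<tau>:{0<..<T}|lborel. (T - \<tau>) ^ j * (\<psi> \<bullet> y \<tau>)) = 0" .
        show ?thesis
          using i2 i3 set_reflect[of 0 T "\<lambda>r. r ^ j * k r"] by (simp add: k_def)
      qed
      have ki: "set_integrable lborel {0<..<T} k" using mom[of 0] by simp
      have "k (T - s) = 0"
        by (rule moments_zero_imp_zero[OF ki kc]) (use mom s in auto)
      then show ?thesis by (simp add: k_def)
    qed
    have van: "AE x in lborel. x \<in> \<omega> \<longrightarrow> rep_L2 (y (T - t)) x = 0" if t: "t \<in> {0<..<T}" for t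
    proof (rule indicator_inner_zero_AE[OF \<omega>s])
      have "abs_L2 (\<lambda>x. indicat_real \<omega> x * rep_L2 (y (T - t)) x) \<in> L2_on \<omega>"
        by (intro abs_L2_on square_integrable_indicator_mult \<omega>s) simp
      then show "abs_L2 (\<lambda>x. indicat_real \<omega> x * rep_L2 (y (T - t)) x) \<bullet> y (T - t) = 0"
        using t by (intro perp) auto
    qed
    have "v0 = 0" using uc v0 adj van unfolding adjoint_unique_continuation_def by blast
    then show False using p(3) by simp
  qed
  show ?thesis unfolding mean_approx_controllable_def a_def[symmetric]
  proof (intro ballI allI impI)
    fix u0 u1 :: "'a L2" and e :: real
    assume u0: "u0 \<in> L2_on \<Omega>" and u1: "u1 \<in> L2_on \<Omega>" and e: "0 < e"
    have "evolution_solution V E T \<mu> \<nu> (\<lambda>t \<psi>. F.source 0 t * (u0 \<bullet> \<psi>)) (if (0::real) = 0 then u0 else 0) (F.sol (b + 0 + \<mu>) u0)"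
      and hT: "frac_int_left a (F.sol (b + 0 + \<mu>) u0) T = F.sol (1 + 0) u0 T"
      using F.explicit_solution[OF u0 disjI1[OF refl] T refl a_def b_def] T by auto
    then have h: "evolution_solution V E T \<mu> \<nu> (\<lambda>t \<psi>. 0) u0 (F.sol (b + 0 + \<mu>) u0)"
      by (simp add: F.source_def)
    have "AE z in lborel. rep_L2 (0 :: ('a \<times> real) L2) (fst z, snd z) = 0"
      using rep_zero_AE by simp
    then have "AE t in lborel. AE x in lborel. rep_L2 (0 :: ('a \<times> real) L2) (x, t) = 0" by (rule AE_slices)
    then have "AE t in lborel. t \<in> {0<..<T} \<longrightarrow> (\<forall>\<phi>\<in>V. 0 = (LINT x|lborel. rep_L2 (0 :: ('a \<times> real) L2) (x, t) * rep_L2 \<phi> x))"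
    proof eventually_elim
      case (elim t)
      have "(LINT x|lborel. rep_L2 (0 :: ('a \<times> real) L2) (x, t) * rep_L2 \<phi>' x) = 0" for \<phi>' :: "'a L2"
        by (rule integral_eq_zero_AE) (use elim(1) in \<open>auto elim: eventually_mono\<close>)
      then show ?case by simp
    qed
    from evolution_solution_cong[OF h this]
    have hw: "weak_solution V E T \<mu> \<nu> 0 u0 (F.sol (b + 0 + \<mu>) u0)"
      by (simp add: weak_solution_iff_evolution_solution)
    let ?t = "u1 - F.sol (1 + 0) u0 T"
    have "?t \<in> L2_on \<Omega>" by (intro subspace_diff subspaceH u1 F.sol_H u0 T) (use par in simp)
    then obtain z where z: "z \<in> span R" "dist z ?t < e"
      using dense e unfolding subset_iff closure_approachable by meson
    obtain f u where f: "f \<in> L2_on (\<omega> \<times> {0<..<T})" "weak_solution V E T \<mu> \<nu> f 0 u" "frac_int_left a u T = z"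
      using reach_span[OF z(1)] unfolding reach_def by blast
    have "0 \<in> L2_on (\<omega> \<times> {0<..<T})" by (rule subspace_0[OF subspace_L2_on])
    from add[OF f(1,2) this hw] obtain g v where g: "g \<in> L2_on (\<omega> \<times> {0<..<T})" "weak_solution V E T \<mu> \<nu> g u0 v"
      "frac_int_left a v T = z + F.sol (1 + 0) u0 T"
      unfolding f(3) hT by auto
    have "norm (frac_int_left a v T - u1) = dist z ?t" by (simp add: g(3) dist_norm algebra_simps)
    then show "\<exists>f\<in>L2_on (\<omega> \<times> {0<..<T}). \<exists>u. weak_solution V E T \<mu> \<nu> f u0 u \<and> norm (frac_int_left a u T - u1) \<le> e"
      using g(1,2) z(2) by (intro bexI[OF _ g(1)] exI[of _ v]) simp
  qed
qed

theorem mainTheorem3: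
  fixes \<Omega> \<omega> :: "(real ^ 'n) set"
    and D V :: "(real ^ 'n) L2 set"
    and A :: "(real ^ 'n) L2 \<Rightarrow> (real ^ 'n) L2"
    and E :: "(real ^ 'n) L2 \<Rightarrow> (real ^ 'n) L2 \<Rightarrow> real"
    and ev :: "nat \<Rightarrow> real" and \<mu> \<nu> T :: real
  assumes "form_operator \<Omega> D A V E ev"
    and "0 \<le> \<nu>" and "\<nu> \<le> 1" and "0 < \<mu>" and "\<mu> \<le> 1"
    and "(1 - \<nu>) * (1 - \<mu>) \<noteq> 0"
    and "0 < T"
    and "open \<omega>" and "\<omega> \<noteq> {}" and "\<omega> \<subseteq> \<Omega>"
  shows "mean_approx_controllable \<Omega> \<omega> V E T \<mu> \<nu> \<longleftrightarrow> adjoint_unique_continuation \<Omega> \<omega> V E T \<mu> \<nu>"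
proof -
  obtain \<phi> l where ef: "evolution_form (L2_on \<Omega>) V E \<phi> l"
    using form_operator_diagonal[OF assms(1)] by blast
  show ?thesis
    using controllable_imp_unique_continuation[OF ef assms(10,2-5,7)]
      unique_continuation_imp_controllable[OF ef assms(10,8,2-5,7)] by blast
qed

end
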